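(* Let $k$ be a field. If $\Lambda$ is a Frobenius $k$-algebra with a Nakayama automorphism $\nu$ such that $\nu^2=1$, then there is an isomorphism of vector spaces $$\widehat{\mathrm{HH}}^n(\Lambda,\Lambda) \cong \widehat{\mathrm{HH}}^{-(n+1)}(\Lambda,\Lambda)$$ for all $n\in\mathbb{Z}$.
   Context: $D(-)=\mathrm{Hom}_k(-,k)$. A finite dimensional $k$-algebra $\Lambda$ is Frobenius if there is an isomorphism $\phi\colon\Lambda\to D(\Lambda)$ of left $\Lambda$-modules; the corresponding Nakayama automorphism $\nu$ is the $k$-algebra automorphism defined by $\phi(1)(\lambda x)=\phi(1)(\nu(x)\lambda)$ for all $\lambda,x\in\Lambda$. $\Lambda^e=\Lambda\otimes_k\Lambda^{op}$ is the enveloping algebra, which is again Frobenius, in particular selfinjective; $\Lambda$ is a left $\Lambda^e$-module via $(\lambda\otimes\lambda')b=\lambda b\lambda'$. A complete resolution of $\Lambda$ over $\Lambda^e$ is an acyclic complex $\mathbb{T}$ of finitely generated projective left $\Lambda^e$-modules, indexed by $\mathbb{Z}$, such that $\mathrm{Hom}_{\Lambda^e}(\mathbb{T},\Lambda^e)$ is acyclic and such that there are a projective resolution $\mathbb{P}$ of $\Lambda$ and a chain map $f\colon\mathbb{T}\to\mathbb{P}$ with $f_n$ bijective for $n\ge 0$. Tate-Hochschild cohomology is $\widehat{\mathrm{HH}}^n(\Lambda,B)=\widehat{\mathrm{Ext}}^n_{\Lambda^e}(\Lambda,B)=H^n(\mathrm{Hom}_{\Lambda^e}(\mathbb{T},B))$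 for $n\in\mathbb{Z}$ and a bimodule $B$. *)

theory Defs
  imports "HOL-Algebra.Module" "HOL-Algebra.QuotRing"
begin

section \<open>Left modules over a (not necessarily commutative) ring\<close>

text \<open>
  The library locale \<^locale>\<open>module\<close> requires a commutative base ring. As there, modules are
  represented by the record type \<^type>\<open>module\<close>, whose fields \<^const>\<open>mult\<close> and \<^const>\<open>one\<close>
  carry no meaning unless the module is an algebra; where there is no multiplication they are
  set to \<^const>\<open>undefined\<close>.
\<close>

locale left_module = R?: ring R + M?: abelian_group M for R and M (structure) +
  assumes smult_closed:
      "\<lbrakk>a \<in> carrier R; x \<in> carrier M\<rbrakk> \<Longrightarrow> a \<odot>\<^bsub>M\<^esub> x \<in> carrier M"
    and smult_l_distr:
      "\<lbrakk>a \<in> carrier R; b \<in> carrier R; x \<in> carrier M\<rbrakk> \<Longrightarrow>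
        (a \<oplus>\<^bsub>R\<^esub> b) \<odot>\<^bsub>M\<^esub> x = a \<odot>\<^bsub>M\<^esub> x \<oplus>\<^bsub>M\<^esub> b \<odot>\<^bsub>M\<^esub> x"
    and smult_r_distr:
      "\<lbrakk>a \<in> carrier R; x \<in> carrier M; y \<in> carrier M\<rbrakk> \<Longrightarrow>
        a \<odot>\<^bsub>M\<^esub> (x \<oplus>\<^bsub>M\<^esub> y) = a \<odot>\<^bsub>M\<^esub> x \<oplus>\<^bsub>M\<^esub> a \<odot>\<^bsub>M\<^esub> y"
    and smult_assoc:
      "\<lbrakk>a \<in> carrier R; b \<in> carrier R; x \<in> carrier M\<rbrakk> \<Longrightarrow>
        (a \<otimes>\<^bsub>R\<^esub> b) \<odot>\<^bsub>M\<^esub> x = a \<odot>\<^bsub>M\<^esub> (b \<odot>\<^bsub>M\<^esub> x)"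
    and smult_one: "x \<in> carrier M \<Longrightarrow> \<one>\<^bsub>R\<^esub> \<odot>\<^bsub>M\<^esub> x = x"

text \<open>
  Homomorphisms are extensional functions, so that \<open>mod_hom R M N\<close> is the set
  $\mathrm{Hom}_R(M,N)$ and equality of homomorphisms is equality on the carrier.
\<close>

definition mod_hom ::
    "('r, 'x) ring_scheme \<Rightarrow> ('r, 'm, 'y) module_scheme \<Rightarrow> ('r, 'n, 'z) module_scheme \<Rightarrow> ('m \<Rightarrow> 'n) set"
  where "mod_hom R M N =
    {h \<in> carrier M \<rightarrow>\<^sub>E carrier N.
       (\<forall>x\<in>carrier M. \<forall>y\<in>carrier M. h (x \<oplus>\<^bsub>M\<^esub> y) = h x \<oplus>\<^bsub>N\<^esub> h y) \<and>
       (\<forall>r\<in>carrier R. \<forall>x\<in>carrier M. h (r \<odot>\<^bsub>M\<^esub> x) = r \<odot>\<^bsub>N\<^esub> h x)}"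

definition mod_iso ::
    "('r, 'x) ring_scheme \<Rightarrow> ('r, 'm, 'y) module_scheme \<Rightarrow> ('r, 'n, 'z) module_scheme \<Rightarrow> ('m \<Rightarrow> 'n) set"
  where "mod_iso R M N = {h \<in> mod_hom R M N. bij_betw h (carrier M) (carrier N)}"

definition regular_module :: "('r, 'x) ring_scheme \<Rightarrow> ('r, 'r) module"
  where "regular_module R =
    \<lparr>carrier = carrier R, mult = mult R, one = \<one>\<^bsub>R\<^esub>, zero = \<zero>\<^bsub>R\<^esub>, add = add R, smult = mult R\<rparr>"

text \<open>The free module $R^{(I)}$: finitely supported functions, extended by zero outside \<open>I\<close>.\<close>

definition free_module :: "('r, 'x) ring_scheme \<Rightarrow> 'i set \<Rightarrow> ('r, 'i \<Rightarrow> 'r) module"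
  where "free_module R I =
    \<lparr>carrier = {f. (\<forall>i\<in>I. f i \<in> carrier R) \<and> (\<forall>i. i \<notin> I \<longrightarrow> f i = \<zero>\<^bsub>R\<^esub>) \<and> finite {i. f i \<noteq> \<zero>\<^bsub>R\<^esub>}},
     mult = undefined, one = undefined,
     zero = (\<lambda>i. \<zero>\<^bsub>R\<^esub>), add = (\<lambda>f g i. f i \<oplus>\<^bsub>R\<^esub> g i), smult = (\<lambda>r f i. r \<otimes>\<^bsub>R\<^esub> f i)\<rparr>"

definition basis_vector :: "('r, 'x) ring_scheme \<Rightarrow> 'i \<Rightarrow> 'i \<Rightarrow> 'r"
  where "basis_vector R i = (\<lambda>j. if j = i then \<one>\<^bsub>R\<^esub> else \<zero>\<^bsub>R\<^esub>)"

definition fin_gen :: "('r, 'x) ring_scheme \<Rightarrow> ('r, 'm, 'y) module_scheme \<Rightarrow> bool"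
  where "fin_gen R M \<longleftrightarrow>
    (\<exists>S. finite S \<and> S \<subseteq> carrier M \<and>
      (\<forall>x\<in>carrier M. \<exists>c\<in>S \<rightarrow> carrier R. x = finsum M (\<lambda>s. c s \<odot>\<^bsub>M\<^esub> s) S))"

text \<open>
  A projective module is a direct summand of a free module. Index sets contained in the type of
  the elements of \<open>P\<close> suffice, since \<open>P\<close> is a quotient of the free module on its own carrier.
\<close>

definition projective_module :: "('r, 'x) ring_scheme \<Rightarrow> ('r, 'm) module \<Rightarrow> bool"
  where "projective_module R P \<longleftrightarrow> left_module R P \<and>
    (\<exists>(I :: 'm set) \<iota> \<pi>. \<iota> \<in> mod_hom R P (free_module R I) \<and> \<pi> \<in> mod_hom R (free_module R I) P \<and>
      (\<forall>x\<in>carrier P. \<pi> (\<iota> x) = x))"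

text \<open>
  The quotient by a submodule (or, for algebras, by an ideal): \<^const>\<open>FactRing\<close> with the induced
  scalar multiplication.
\<close>

definition quot_module :: "('r, 'm) module \<Rightarrow> 'm set \<Rightarrow> ('r, 'm set) module"
  where "quot_module M N =
    \<lparr>carrier = carrier (M Quot N), mult = mult (M Quot N), one = one (M Quot N),
     zero = zero (M Quot N), add = add (M Quot N),
     smult = (\<lambda>r X. \<Union>x\<in>X. N +>\<^bsub>M\<^esub> (r \<odot>\<^bsub>M\<^esub> x))\<rparr>"


section \<open>Frobenius algebras\<close>

text \<open>The library locale \<^locale>\<open>algebra\<close> covers commutative algebras only.\<close>

definition k_algebra :: "('k, 'x) ring_scheme \<Rightarrow> ('k, 'a) module \<Rightarrow> bool"
  where "k_algebra K A \<longleftrightarrow> field K \<and> ring A \<and> module K A \<and>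
    (\<forall>c\<in>carrier K. \<forall>x\<in>carrier A. \<forall>y\<in>carrier A.
       (c \<odot>\<^bsub>A\<^esub> x) \<otimes>\<^bsub>A\<^esub> y = c \<odot>\<^bsub>A\<^esub> (x \<otimes>\<^bsub>A\<^esub> y) \<and>
       x \<otimes>\<^bsub>A\<^esub> (c \<odot>\<^bsub>A\<^esub> y) = c \<odot>\<^bsub>A\<^esub> (x \<otimes>\<^bsub>A\<^esub> y))"

text \<open>$D(A) = \mathrm{Hom}_k(A,k)$ with the left action $(a f)(x) = f(xa)$.\<close>

definition dual_module :: "('k, 'x) ring_scheme \<Rightarrow> ('k, 'a) module \<Rightarrow> ('a, 'a \<Rightarrow> 'k) module"
  where "dual_module K A =
    \<lparr>carrier = mod_hom K A (regular_module K), mult = undefined, one = undefined,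
     zero = (\<lambda>x\<in>carrier A. \<zero>\<^bsub>K\<^esub>),
     add = (\<lambda>f g. \<lambda>x\<in>carrier A. f x \<oplus>\<^bsub>K\<^esub> g x),
     smult = (\<lambda>a f. \<lambda>x\<in>carrier A. f (x \<otimes>\<^bsub>A\<^esub> a))\<rparr>"

definition frobenius_algebra :: "('k, 'x) ring_scheme \<Rightarrow> ('k, 'a) module \<Rightarrow> bool"
  where "frobenius_algebra K A \<longleftrightarrow> k_algebra K A \<and> fin_gen K A \<and>
    (\<exists>\<phi>. \<phi> \<in> mod_iso A (regular_module A) (dual_module K A))"

definition nakayama_automorphism :: "('k, 'x) ring_scheme \<Rightarrow> ('k, 'a) module \<Rightarrow> ('a \<Rightarrow> 'a) \<Rightarrow> bool"
  where "nakayama_automorphism K A \<nu> \<longleftrightarrow>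
    \<nu> \<in> ring_iso A A \<and>
    (\<forall>c\<in>carrier K. \<forall>x\<in>carrier A. \<nu> (c \<odot>\<^bsub>A\<^esub> x) = c \<odot>\<^bsub>A\<^esub> \<nu> x) \<and>
    (\<exists>\<phi>\<in>mod_iso A (regular_module A) (dual_module K A).
       \<forall>l\<in>carrier A. \<forall>x\<in>carrier A. \<phi> \<one>\<^bsub>A\<^esub> (l \<otimes>\<^bsub>A\<^esub> x) = \<phi> \<one>\<^bsub>A\<^esub> (\<nu> x \<otimes>\<^bsub>A\<^esub> l))"


section \<open>The enveloping algebra\<close>

definition opposite_algebra :: "('k, 'a) module \<Rightarrow> ('k, 'a) module"
  where "opposite_algebra A = A\<lparr>mult := (\<lambda>x y. y \<otimes>\<^bsub>A\<^esub> x)\<rparr>"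

text \<open>
  The free vector space on $A \times B$, with multiplication extending
  $(a,b)(a',b') = (aa',bb')$ bilinearly.
\<close>

definition free_product_algebra ::
    "('k, 'x) ring_scheme \<Rightarrow> ('k, 'a) module \<Rightarrow> ('k, 'b) module \<Rightarrow> ('k, 'a \<times> 'b \<Rightarrow> 'k) module"
  where "free_product_algebra K A B =
    (free_module K (carrier A \<times> carrier B))
      \<lparr>mult := (\<lambda>f g r. finsum K (\<lambda>(p, q). f p \<otimes>\<^bsub>K\<^esub> g q)
          {(p, q). f p \<noteq> \<zero>\<^bsub>K\<^esub> \<and> g q \<noteq> \<zero>\<^bsub>K\<^esub> \<and>
             r = (fst p \<otimes>\<^bsub>A\<^esub> fst q, snd p \<otimes>\<^bsub>B\<^esub> snd q)}),
       one := basis_vector K (\<one>\<^bsub>A\<^esub>, \<one>\<^bsub>B\<^esub>)\<rparr>"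

definition bilinear_relations ::
    "('k, 'x) ring_scheme \<Rightarrow> ('k, 'a) module \<Rightarrow> ('k, 'b) module \<Rightarrow> ('a \<times> 'b \<Rightarrow> 'k) set"
  where "bilinear_relations K A B = (let F = free_product_algebra K A B; e = basis_vector K in
    {e (a \<oplus>\<^bsub>A\<^esub> a', b) \<ominus>\<^bsub>F\<^esub> (e (a, b) \<oplus>\<^bsub>F\<^esub> e (a', b)) | a a' b.
       a \<in> carrier A \<and> a' \<in> carrier A \<and> b \<in> carrier B} \<union>
    {e (a, b \<oplus>\<^bsub>B\<^esub> b') \<ominus>\<^bsub>F\<^esub> (e (a, b) \<oplus>\<^bsub>F\<^esub> e (a, b')) | a b b'.
       a \<in> carrier A \<and> b \<in> carrier B \<and> b' \<in> carrier B} \<union>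
    {e (c \<odot>\<^bsub>A\<^esub> a, b) \<ominus>\<^bsub>F\<^esub> c \<odot>\<^bsub>F\<^esub> e (a, b) | c a b.
       c \<in> carrier K \<and> a \<in> carrier A \<and> b \<in> carrier B} \<union>
    {e (a, c \<odot>\<^bsub>B\<^esub> b) \<ominus>\<^bsub>F\<^esub> c \<odot>\<^bsub>F\<^esub> e (a, b) | c a b.
       c \<in> carrier K \<and> a \<in> carrier A \<and> b \<in> carrier B})"

text \<open>
  $A \otimes_k B$. The product of a relation with a basis vector is again a relation, so the ideal
  generated by the relations is their linear span and the quotient is the usual tensor product,
  with $(a \otimes b)(a' \otimes b') = aa' \otimes bb'$.
\<close>

definition tensor_algebra_of ::
    "('k, 'x) ring_scheme \<Rightarrow> ('k, 'a) module \<Rightarrow> ('k, 'b) module \<Rightarrow> ('k, ('a \<times> 'b \<Rightarrow> 'k) set) module"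
  where "tensor_algebra_of K A B = (let F = free_product_algebra K A B in
    quot_module F (Idl\<^bsub>F\<^esub> (bilinear_relations K A B)))"

definition enveloping_algebra ::
    "('k, 'x) ring_scheme \<Rightarrow> ('k, 'a) module \<Rightarrow> ('k, ('a \<times> 'a \<Rightarrow> 'k) set) module"
  where "enveloping_algebra K A = tensor_algebra_of K A (opposite_algebra A)"

text \<open>
  $A$ as a left $A^e$-module. An element of $A^e$ is a coset \<open>X\<close>, and the class of
  $\sum_p f(p)\,(a_p, a'_p)$ sends $b$ to $\sum_p f(p)\, a_p b a'_p$, independently of the
  representative \<open>f\<close>.
\<close>

definition enveloping_self ::
    "('k, 'x) ring_scheme \<Rightarrow> ('k, 'a) module \<Rightarrow> (('a \<times> 'a \<Rightarrow> 'k) set, 'a) module"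
  where "enveloping_self K A =
    \<lparr>carrier = carrier A, mult = mult A, one = \<one>\<^bsub>A\<^esub>, zero = \<zero>\<^bsub>A\<^esub>, add = add A,
     smult = (\<lambda>X b. the_elem
       ((\<lambda>f. finsum A (\<lambda>p. f p \<odot>\<^bsub>A\<^esub> (fst p \<otimes>\<^bsub>A\<^esub> b \<otimes>\<^bsub>A\<^esub> snd p)) {p. f p \<noteq> \<zero>\<^bsub>K\<^esub>}) ` X))\<rparr>"


section \<open>Complexes and complete resolutions\<close>

text \<open>Complexes are indexed by the integers, with differentials \<open>d n\<close> from degree \<open>n\<close> to \<open>n - 1\<close>.\<close>

definition chain_complex ::
    "('r, 'x) ring_scheme \<Rightarrow> (int \<Rightarrow> ('r, 'm) module) \<Rightarrow> (int \<Rightarrow> 'm \<Rightarrow> 'm) \<Rightarrow> bool"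
  where "chain_complex R T d \<longleftrightarrow>
    (\<forall>n. left_module R (T n)) \<and> (\<forall>n. d n \<in> mod_hom R (T n) (T (n - 1))) \<and>
    (\<forall>n. \<forall>x\<in>carrier (T n). d (n - 1) (d n x) = \<zero>\<^bsub>T (n - 2)\<^esub>)"

definition exact_at :: "(int \<Rightarrow> ('r, 'm) module) \<Rightarrow> (int \<Rightarrow> 'm \<Rightarrow> 'm) \<Rightarrow> int \<Rightarrow> bool"
  where "exact_at T d n \<longleftrightarrow>
    {x \<in> carrier (T n). d n x = \<zero>\<^bsub>T (n - 1)\<^esub>} = d (n + 1) ` carrier (T (n + 1))"

definition chain_map ::
    "('r, 'x) ring_scheme \<Rightarrow> (int \<Rightarrow> ('r, 'm) module) \<Rightarrow> (int \<Rightarrow> 'm \<Rightarrow> 'm) \<Rightarrow>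
      (int \<Rightarrow> ('r, 'p) module) \<Rightarrow> (int \<Rightarrow> 'p \<Rightarrow> 'p) \<Rightarrow> (int \<Rightarrow> 'm \<Rightarrow> 'p) \<Rightarrow> bool"
  where "chain_map R T d P \<delta> f \<longleftrightarrow>
    (\<forall>n. f n \<in> mod_hom R (T n) (P n)) \<and>
    (\<forall>n. \<forall>x\<in>carrier (T n). \<delta> n (f n x) = f (n - 1) (d n x))"

definition projective_resolution ::
    "('r, 'x) ring_scheme \<Rightarrow> ('r, 'b) module \<Rightarrow> (int \<Rightarrow> ('r, 'p) module) \<Rightarrow> (int \<Rightarrow> 'p \<Rightarrow> 'p) \<Rightarrow> bool"
  where "projective_resolution R M P \<delta> \<longleftrightarrow>
    chain_complex R P \<delta> \<and> (\<forall>n. projective_module R (P n)) \<and>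
    (\<forall>n<0. carrier (P n) = {\<zero>\<^bsub>P n\<^esub>}) \<and> (\<forall>n>0. exact_at P \<delta> n) \<and>
    (\<exists>\<epsilon>\<in>mod_hom R (P 0) M. \<epsilon> ` carrier (P 0) = carrier M \<and>
       {x \<in> carrier (P 0). \<epsilon> x = \<zero>\<^bsub>M\<^esub>} = \<delta> 1 ` carrier (P 1))"

text \<open>
  The complex $\mathrm{Hom}_R(T,B)$ has $\mathrm{Hom}_R(T_n,B)$ in degree \<open>n\<close>, with differential
  $g \mapsto g \circ d_{n+1}$ into degree $n+1$.
\<close>

definition hom_cocycles ::
    "('r, 'x) ring_scheme \<Rightarrow> (int \<Rightarrow> ('r, 'm) module) \<Rightarrow> (int \<Rightarrow> 'm \<Rightarrow> 'm) \<Rightarrow> ('r, 'b) module \<Rightarrow>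
      int \<Rightarrow> ('m \<Rightarrow> 'b) set"
  where "hom_cocycles R T d B n =
    {g \<in> mod_hom R (T n) B. \<forall>x\<in>carrier (T (n + 1)). g (d (n + 1) x) = \<zero>\<^bsub>B\<^esub>}"

definition hom_coboundaries ::
    "('r, 'x) ring_scheme \<Rightarrow> (int \<Rightarrow> ('r, 'm) module) \<Rightarrow> (int \<Rightarrow> 'm \<Rightarrow> 'm) \<Rightarrow> ('r, 'b) module \<Rightarrow>
      int \<Rightarrow> ('m \<Rightarrow> 'b) set"
  where "hom_coboundaries R T d B n =
    (\<lambda>g. compose (carrier (T n)) g (d n)) ` mod_hom R (T (n - 1)) B"

text \<open>
  The projective resolution may be taken with elements in the same type as \<open>T\<close>: its terms are
  isomorphic to those of \<open>T\<close> in degrees \<open>n \<ge> 0\<close> and zero in negative degrees.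
\<close>

definition complete_resolution ::
    "('r, 'x) ring_scheme \<Rightarrow> ('r, 'b) module \<Rightarrow> (int \<Rightarrow> ('r, 'm) module) \<Rightarrow> (int \<Rightarrow> 'm \<Rightarrow> 'm) \<Rightarrow> bool"
  where "complete_resolution R M T d \<longleftrightarrow>
    chain_complex R T d \<and> (\<forall>n. exact_at T d n) \<and>
    (\<forall>n. fin_gen R (T n) \<and> projective_module R (T n)) \<and>
    (\<forall>n. hom_cocycles R T d (regular_module R) n = hom_coboundaries R T d (regular_module R) n) \<and>
    (\<exists>(P :: int \<Rightarrow> ('r, 'm) module) \<delta> f. projective_resolution R M P \<delta> \<and> chain_map R T d P \<delta> f \<and>
       (\<forall>n\<ge>0. bij_betw (f n) (carrier (T n)) (carrier (P n))))"


section \<open>Tate-Hochschild cohomology\<close>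

text \<open>
  For a $k$-algebra \<open>E\<close>, every left \<open>E\<close>-module is a vector space by restriction of scalars along
  $c \mapsto c \cdot 1_E$; this gives the $k$-linear structure on $\mathrm{Hom}_E(M,N)$.
\<close>

definition hom_space ::
    "('k, 'e) module \<Rightarrow> ('e, 'm) module \<Rightarrow> ('e, 'n) module \<Rightarrow> ('k, 'm \<Rightarrow> 'n) module"
  where "hom_space E M N =
    \<lparr>carrier = mod_hom E M N, mult = undefined, one = undefined,
     zero = (\<lambda>x\<in>carrier M. \<zero>\<^bsub>N\<^esub>),
     add = (\<lambda>f g. \<lambda>x\<in>carrier M. f x \<oplus>\<^bsub>N\<^esub> g x),
     smult = (\<lambda>c f. \<lambda>x\<in>carrier M. (c \<odot>\<^bsub>E\<^esub> \<one>\<^bsub>E\<^esub>) \<odot>\<^bsub>N\<^esub> f x)\<rparr>"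

definition hom_cohomology ::
    "('k, 'e) module \<Rightarrow> (int \<Rightarrow> ('e, 'm) module) \<Rightarrow> (int \<Rightarrow> 'm \<Rightarrow> 'm) \<Rightarrow> ('e, 'b) module \<Rightarrow>
      int \<Rightarrow> ('k, ('m \<Rightarrow> 'b) set) module"
  where "hom_cohomology E T d B n =
    quot_module ((hom_space E (T n) B)\<lparr>carrier := hom_cocycles E T d B n\<rparr>) (hom_coboundaries E T d B n)"

text \<open>
  The Tate-Hochschild cohomology of \<open>A\<close> with coefficients in the \<open>A\<close>-bimodule (left module over the
  enveloping algebra) \<open>B\<close>, computed from a complete resolution \<open>(T, d)\<close> of \<open>A\<close>.
\<close>

definition tate_hochschild ::
    "('k, 'x) ring_scheme \<Rightarrow> ('k, 'a) module \<Rightarrow>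
      (int \<Rightarrow> (('a \<times> 'a \<Rightarrow> 'k) set, 'm) module) \<Rightarrow> (int \<Rightarrow> 'm \<Rightarrow> 'm) \<Rightarrow>
      (('a \<times> 'a \<Rightarrow> 'k) set, 'b) module \<Rightarrow> int \<Rightarrow> ('k, ('m \<Rightarrow> 'b) set) module"
  where "tate_hochschild K A T d B n = hom_cohomology (enveloping_algebra K A) T d B n"

end

theory Submission
  imports Defs
begin

text \<open>
  Write $E = \Lambda^e$, let $t = \phi(1)$, and let $(e_i)$, $(e_i')$ be dual bases for $t$. The
  Casimir element $\omega = \sum_i e_i \otimes e_i'$ satisfies
  $(a \otimes 1)\omega = (1 \otimes a)\omega$ and
  $\omega(a \otimes 1) = \omega(1 \otimes \nu(a))$. For a projective bimodule $P$,
  multiplication by $\omega$ maps $P$ onto its centralizer $P^\Lambda = \mathrm{Hom}_E(\Lambda, P)$,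
  with kernel spanned by the twisted commutators $ap - p\nu(a)$. On the other hand $g \mapsto t \circ g$
  identifies $\mathrm{Hom}_E(P, \Lambda)$ with the linear forms on $P$ that vanish on all
  $pa - \nu(a)p$, and since $\nu^2 = 1$ these are the same commutators. Hence
  $\mathrm{Hom}_E(P, \Lambda)$ is dual to $P^\Lambda$, naturally in $P$, and
  $\widehat{\mathrm{HH}}^n(\Lambda, \Lambda)$ is dual to $H_n(\mathrm{Hom}_E(\Lambda, \mathbb{T}))$.
  The latter has the dimension of $\widehat{\mathrm{HH}}^{-(n+1)}(\Lambda, \Lambda)$, because both
  are groups of stable homomorphisms between syzygies of $\mathbb{T}$, and these do not change when
  both syzygies are shifted.
\<close>

section \<open>Finite-dimensional linear algebra\<close>

text \<open>The isomorphism comes from an equality of dimensions and is not canonical: duality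
  exhibits one side as a dual space, which is compared with the space itself by counting. Dimensions
  are carried by \<open>has_codim\<close>, which can be transported along linear relations that are
  not maps, such as the pairs linking a homomorphism to its shift. The index -(n+1) results from the
  degrees of syzygies. The algebra is the syzygy in degree -1. Cohomology in degree m consists of
  stable maps from the syzygy in degree m-1 to the one in degree -1, or after a shift by one from
  degree m to degree 0. Homology of invariants in degree n consists of stable maps from degree -1 to
  degree n, or after a shift by -n from degree -(n+1) to degree 0. A shift rests on two moves: maps
  out of a term lift because the term is projective, and maps killing boundaries extend to the next
  term because the dual complex is acyclic. Until the last section the enveloping algebra is seen
  only through the two embeddings of the algebra, the contraction of one factor with t, and additive
  generation by pure tensors.\<close>

definition functional_on ::
    "('k, 'x) ring_scheme \<Rightarrow> ('k, 'v, 'y) module_scheme \<Rightarrow> 'v set \<Rightarrow> ('v \<Rightarrow> 'k) \<Rightarrow> bool"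
  where "functional_on K V Z f \<longleftrightarrow> f \<in> Z \<rightarrow> carrier K \<and>
    (\<forall>x\<in>Z. \<forall>y\<in>Z. f (x \<oplus>\<^bsub>V\<^esub> y) = f x \<oplus>\<^bsub>K\<^esub> f y) \<and>
    (\<forall>c\<in>carrier K. \<forall>x\<in>Z. f (c \<odot>\<^bsub>V\<^esub> x) = c \<otimes>\<^bsub>K\<^esub> f x)"

text \<open>The functions \<open>\<chi> i\<close> with \<open>i < r\<close> are coordinates on \<open>Z/N\<close>, so \<open>has_codim\<close> says $\dim Z/N = r$.\<close>

definition coordinates ::
    "('k, 'x) ring_scheme \<Rightarrow> ('k, 'v, 'y) module_scheme \<Rightarrow> 'v set \<Rightarrow> 'v set \<Rightarrow> nat \<Rightarrow> (nat \<Rightarrow> 'v \<Rightarrow> 'k) \<Rightarrow> bool"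
  where "coordinates K V Z N r \<chi> \<longleftrightarrow>
    (\<forall>i<r. functional_on K V Z (\<chi> i)) \<and>
    (\<forall>c. (\<forall>i<r. c i \<in> carrier K) \<longrightarrow> (\<exists>z\<in>Z. \<forall>i<r. \<chi> i z = c i)) \<and>
    (\<forall>z\<in>Z. z \<in> N \<longleftrightarrow> (\<forall>i<r. \<chi> i z = \<zero>\<^bsub>K\<^esub>))"

definition has_codim ::
    "('k, 'x) ring_scheme \<Rightarrow> ('k, 'v, 'y) module_scheme \<Rightarrow> 'v set \<Rightarrow> 'v set \<Rightarrow> nat \<Rightarrow> bool"
  where "has_codim K V Z N r \<longleftrightarrow> (\<exists>\<chi>. coordinates K V Z N r \<chi>)"

text \<open>Chains of such one-vector extensions take the place of bases: arguments about dimension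
  climb from a subspace to a larger one by adjoining a vector outside it.\<close>

definition adjoin :: "('k, 'x) ring_scheme \<Rightarrow> ('k, 'v, 'y) module_scheme \<Rightarrow> 'v set \<Rightarrow> 'v \<Rightarrow> 'v set"
  where "adjoin K V M z = {m \<oplus>\<^bsub>V\<^esub> c \<odot>\<^bsub>V\<^esub> z | m c. m \<in> M \<and> c \<in> carrier K}"

text \<open>Finite dimension, phrased through subspaces: no linear combination has to be written,
  and a chain of extensions is known to have exhausted the space as soon as it contains
  \<open>S\<close>.\<close>

definition fin_spanned :: "('k, 'x) ring_scheme \<Rightarrow> ('k, 'v, 'y) module_scheme \<Rightarrow> bool"
  where "fin_spanned K V \<longleftrightarrow>
    (\<exists>S. finite S \<and> S \<subseteq> carrier V \<and> (\<forall>U. submodule U K V \<and> S \<subseteq> U \<longrightarrow> U = carrier V))"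

lemma coordinatesD:
  assumes "coordinates K V Z N r \<chi>"
  shows "\<And>i. i < r \<Longrightarrow> functional_on K V Z (\<chi> i)"
    "\<And>c. (\<forall>i<r. c i \<in> carrier K) \<Longrightarrow> \<exists>z\<in>Z. \<forall>i<r. \<chi> i z = c i"
    "\<And>z. z \<in> Z \<Longrightarrow> z \<in> N \<longleftrightarrow> (\<forall>i<r. \<chi> i z = \<zero>\<^bsub>K\<^esub>)"
  using assms unfolding coordinates_def by simp_all

lemma functional_onD:
  assumes "functional_on K V Z f"
  shows "\<And>x. x \<in> Z \<Longrightarrow> f x \<in> carrier K"
    and "\<And>x y. x \<in> Z \<Longrightarrow> y \<in> Z \<Longrightarrow> f (x \<oplus>\<^bsub>V\<^esub> y) = f x \<oplus>\<^bsub>K\<^esub> f y"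
    and "\<And>c x. c \<in> carrier K \<Longrightarrow> x \<in> Z \<Longrightarrow> f (c \<odot>\<^bsub>V\<^esub> x) = c \<otimes>\<^bsub>K\<^esub> f x"
  using assms by (auto simp: functional_on_def)

lemma functional_on_subset: "functional_on K V Z f \<Longrightarrow> Y \<subseteq> Z \<Longrightarrow> functional_on K V Y f"
  unfolding functional_on_def by blast

lemma (in abelian_group) add_diff_cancel_right:
  assumes "a \<in> carrier G" "b \<in> carrier G" "c \<in> carrier G"
  shows "(a \<oplus> c) \<ominus> (b \<oplus> c) = a \<ominus> b"
proof -
  have "(a \<oplus> c) \<ominus> (b \<oplus> c) = a \<oplus> (c \<oplus> \<ominus> c) \<oplus> \<ominus> b"
    using assms by (simp add: minus_eq minus_add a_ac)
  then show ?thesis using assms by (simp add: r_neg minus_eq)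
qed

context module
begin

lemma minus_smult: "x \<in> carrier M \<Longrightarrow> (\<ominus> \<one>) \<odot>\<^bsub>M\<^esub> x = \<ominus>\<^bsub>M\<^esub> x"
  by (simp add: smult_l_minus)

lemma submodule_zero: "submodule H R M \<Longrightarrow> \<zero>\<^bsub>M\<^esub> \<in> H"
  using submodule.axioms(1) subgroup.one_closed by fastforce

lemma submodule_minus: "submodule H R M \<Longrightarrow> x \<in> H \<Longrightarrow> y \<in> H \<Longrightarrow> x \<ominus>\<^bsub>M\<^esub> y \<in> H"
  by (simp add: a_minus_def submoduleE)

lemma submoduleI':
  assumes "H \<subseteq> carrier M" "\<zero>\<^bsub>M\<^esub> \<in> H"
    and "\<And>a b. \<lbrakk>a \<in> H ; b \<in> H\<rbrakk> \<Longrightarrow> a \<oplus>\<^bsub>M\<^esub> b \<in> H"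
    and "\<And>a x. \<lbrakk>a \<in> carrier R; x \<in> H\<rbrakk> \<Longrightarrow> a \<odot>\<^bsub>M\<^esub> x \<in> H"
  shows "submodule H R M"
proof (rule submoduleI)
  fix a assume "a \<in> H"
  then show "\<ominus>\<^bsub>M\<^esub> a \<in> H"
    using assms(1) assms(4)[of "\<ominus> \<one>" a] minus_smult[of a] by auto
qed (use assms in auto)

lemma functional_zero:
  assumes "functional_on R M Z f" "submodule Z R M"
  shows "f \<zero>\<^bsub>M\<^esub> = \<zero>"
proof -
  have z: "\<zero>\<^bsub>M\<^esub> \<in> Z" using assms(2) by (rule submodule_zero)
  have "f (\<zero> \<odot>\<^bsub>M\<^esub> \<zero>\<^bsub>M\<^esub>) = \<zero> \<otimes> f \<zero>\<^bsub>M\<^esub>"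
    by (rule functional_onD(3)[OF assms(1)]) (use z in auto)
  then show ?thesis using functional_onD(1)[OF assms(1) z] by simp
qed

lemma functional_minus:
  assumes "functional_on R M Z f" "submodule Z R M" "x \<in> Z" "y \<in> Z"
  shows "f (x \<ominus>\<^bsub>M\<^esub> y) = f x \<ominus> f y"
proof -
  have c: "x \<in> carrier M" "y \<in> carrier M" using assms submoduleE(1) by blast+
  have m: "(\<ominus> \<one>) \<odot>\<^bsub>M\<^esub> y \<in> Z" using assms submoduleE(4) by blast
  have "x \<ominus>\<^bsub>M\<^esub> y = x \<oplus>\<^bsub>M\<^esub> (\<ominus> \<one>) \<odot>\<^bsub>M\<^esub> y"
    using c by (simp add: a_minus_def minus_smult)
  then have "f (x \<ominus>\<^bsub>M\<^esub> y) = f x \<oplus> (\<ominus> \<one>) \<otimes> f y"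
    using assms m functional_onD[OF assms(1)] by simp
  then show ?thesis
    using functional_onD(1)[OF assms(1)] assms(4) by (simp add: a_minus_def R.l_minus)
qed

lemma adjoin_submodule:
  assumes U: "submodule U R M" and z: "z \<in> carrier M"
  shows "submodule (adjoin R M U z) R M" and "U \<subseteq> adjoin R M U z" and "z \<in> adjoin R M U z"
proof -
  have sub: "U \<subseteq> carrier M" using U submoduleE(1) by blast
  show "submodule (adjoin R M U z) R M"
  proof (rule submoduleI')
    show "adjoin R M U z \<subseteq> carrier M" using sub z by (auto simp: adjoin_def)
    show "\<zero>\<^bsub>M\<^esub> \<in> adjoin R M U z"
      unfolding adjoin_def using submodule_zero[OF U] z by (force intro!: exI[of _ "\<zero>"] exI[of _ "\<zero>\<^bsub>M\<^esub>"])
  next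
    fix a b assume "a \<in> adjoin R M U z" "b \<in> adjoin R M U z"
    then obtain m c m' c' where h: "a = m \<oplus>\<^bsub>M\<^esub> c \<odot>\<^bsub>M\<^esub> z" "m \<in> U" "c \<in> carrier R"
      "b = m' \<oplus>\<^bsub>M\<^esub> c' \<odot>\<^bsub>M\<^esub> z" "m' \<in> U" "c' \<in> carrier R" by (auto simp: adjoin_def)
    then have "m \<in> carrier M" "m' \<in> carrier M" using sub by auto
    then have "a \<oplus>\<^bsub>M\<^esub> b = (m \<oplus>\<^bsub>M\<^esub> m') \<oplus>\<^bsub>M\<^esub> (c \<oplus> c') \<odot>\<^bsub>M\<^esub> z"
      using h z by (simp add: smult_l_distr M.a_ac)
    moreover have "m \<oplus>\<^bsub>M\<^esub> m' \<in> U" using U h submoduleE(5) by blast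
    ultimately show "a \<oplus>\<^bsub>M\<^esub> b \<in> adjoin R M U z"
      unfolding adjoin_def using h by blast
  next
    fix k a assume k: "k \<in> carrier R" and "a \<in> adjoin R M U z"
    then obtain m c where h: "a = m \<oplus>\<^bsub>M\<^esub> c \<odot>\<^bsub>M\<^esub> z" "m \<in> U" "c \<in> carrier R"
      by (auto simp: adjoin_def)
    then have "m \<in> carrier M" using sub by auto
    then have "k \<odot>\<^bsub>M\<^esub> a = k \<odot>\<^bsub>M\<^esub> m \<oplus>\<^bsub>M\<^esub> (k \<otimes> c) \<odot>\<^bsub>M\<^esub> z"
      using h z k by (simp add: smult_r_distr smult_assoc1)
    moreover have "k \<odot>\<^bsub>M\<^esub> m \<in> U" using U h k submoduleE(4) by blast
    ultimately show "k \<odot>\<^bsub>M\<^esub> a \<in> adjoin R M U z"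
      unfolding adjoin_def using h k by blast
  qed
  show "U \<subseteq> adjoin R M U z"
  proof
    fix u assume u: "u \<in> U"
    then have "u = u \<oplus>\<^bsub>M\<^esub> \<zero> \<odot>\<^bsub>M\<^esub> z" using sub z by auto
    then show "u \<in> adjoin R M U z" unfolding adjoin_def using u by blast
  qed
  have "z = \<zero>\<^bsub>M\<^esub> \<oplus>\<^bsub>M\<^esub> \<one> \<odot>\<^bsub>M\<^esub> z" using z by simp
  then show "z \<in> adjoin R M U z" unfolding adjoin_def using submodule_zero[OF U] by blast
qed

end

locale vspace = module K V + field K for K (structure) and V
begin

text \<open>If the coefficients differed, dividing by their difference would place \<open>z\<close>
  in \<open>U\<close>. This uniqueness is what allows a functional on \<open>adjoin K V U z\<close>
  to be defined by prescribing its value at \<open>z\<close>.\<close>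

lemma adjoin_unique:
  assumes U: "submodule U K V" and z: "z \<in> carrier V" "z \<notin> U"
    and "m \<in> U" "m' \<in> U" "c \<in> carrier K" "c' \<in> carrier K"
    and eq: "m \<oplus>\<^bsub>V\<^esub> c \<odot>\<^bsub>V\<^esub> z = m' \<oplus>\<^bsub>V\<^esub> c' \<odot>\<^bsub>V\<^esub> z"
  shows "m = m' \<and> c = c'"
proof -
  have C: "m \<in> carrier V" "m' \<in> carrier V" using assms submoduleE(1) by blast+
  have "c = c'"
  proof (rule ccontr)
    assume "c \<noteq> c'"
    then have nz: "c \<ominus> c' \<in> carrier K - {\<zero>}" using assms R.add.inv_equality[of c "\<ominus> c'"] by (auto simp: R.minus_eq)
    have "(c \<ominus> c') \<odot>\<^bsub>V\<^esub> z = m' \<ominus>\<^bsub>V\<^esub> m"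
    proof -
      have "(c \<ominus> c') \<odot>\<^bsub>V\<^esub> z = c \<odot>\<^bsub>V\<^esub> z \<ominus>\<^bsub>V\<^esub> c' \<odot>\<^bsub>V\<^esub> z"
        using assms by (simp add: R.minus_eq M.minus_eq smult_l_distr smult_l_minus)
      also have "\<dots> = \<ominus>\<^bsub>V\<^esub> m \<oplus>\<^bsub>V\<^esub> (m \<oplus>\<^bsub>V\<^esub> c \<odot>\<^bsub>V\<^esub> z) \<ominus>\<^bsub>V\<^esub> c' \<odot>\<^bsub>V\<^esub> z"
        using assms(2-7) C by (simp add: M.r_neg1 M.minus_eq)
      also have "\<dots> = \<ominus>\<^bsub>V\<^esub> m \<oplus>\<^bsub>V\<^esub> (m' \<oplus>\<^bsub>V\<^esub> c' \<odot>\<^bsub>V\<^esub> z) \<ominus>\<^bsub>V\<^esub> c' \<odot>\<^bsub>V\<^esub> z" by (simp only: eq)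
      also have "\<dots> = m' \<ominus>\<^bsub>V\<^esub> m" using assms(2-7) C M.a_comm[of m' "\<ominus>\<^bsub>V\<^esub> m"] by (simp add: M.minus_eq M.a_assoc M.r_neg)
      finally show ?thesis .
    qed
    then have "(c \<ominus> c') \<odot>\<^bsub>V\<^esub> z \<in> U" using submodule_minus[OF U] assms by simp
    then have "inv (c \<ominus> c') \<odot>\<^bsub>V\<^esub> ((c \<ominus> c') \<odot>\<^bsub>V\<^esub> z) \<in> U"
      using submoduleE(4)[OF U] nz field_Units by simp
    moreover have "inv (c \<ominus> c') \<odot>\<^bsub>V\<^esub> ((c \<ominus> c') \<odot>\<^bsub>V\<^esub> z) = z"
      using nz z field_Units by (simp flip: smult_assoc1)
    ultimately show False using z by simp
  qed
  then show ?thesis using eq assms(2,7) C by simp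
qed

text \<open>The coefficient of \<open>s\<close> in any element \<open>z\<close> of \<open>Z\<close>
  outside \<open>U\<close> is invertible, so a multiple of \<open>z\<close> removes the
  \<open>s\<close>-part of every other element of \<open>Z\<close>. Intersecting a chain of
  one-vector extensions with \<open>Z\<close> thus gives again such a chain, up to
  repetitions.\<close>

lemma submodule_step:
  assumes U: "submodule U K V" and s: "s \<in> carrier V" and Z: "submodule Z K V"
    and sub: "Z \<subseteq> adjoin K V U s" and nsub: "\<not> Z \<subseteq> U"
  shows "\<exists>z\<in>Z - U. Z = adjoin K V (Z \<inter> U) z"
proof -
  obtain z where z: "z \<in> Z" "z \<notin> U" using nsub by blast
  have ZC: "Z \<subseteq> carrier V" and UC: "U \<subseteq> carrier V" using Z U submoduleE(1) by blast+
  obtain u c where u: "u \<in> U" "c \<in> carrier K" "z = u \<oplus>\<^bsub>V\<^esub> c \<odot>\<^bsub>V\<^esub> s"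
    using z sub by (auto simp: adjoin_def)
  have "c \<noteq> \<zero>" using u z s UC by auto
  then have ic: "inv c \<in> carrier K" "inv c \<otimes> c = \<one>" using u field_Units by auto
  have "adjoin K V (Z \<inter> U) z \<subseteq> Z"
    using z submoduleE(4,5)[OF Z] by (auto simp: adjoin_def)
  moreover have "w \<in> adjoin K V (Z \<inter> U) z" if w: "w \<in> Z" for w
  proof -
    obtain u' c' where u': "u' \<in> U" "c' \<in> carrier K" "w = u' \<oplus>\<^bsub>V\<^esub> c' \<odot>\<^bsub>V\<^esub> s"
      using w sub by (auto simp: adjoin_def)
    \<comment> \<open>The factor for which \<open>w\<close> minus \<open>k\<close> times
      \<open>z\<close> has no \<open>s\<close>-component, so that the difference lies in
      \<open>U\<close> as well as in \<open>Z\<close>.\<close>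
    define k where "k = c' \<otimes> inv c"
    have k: "k \<in> carrier K" "k \<otimes> c = c'" using u' ic u by (auto simp: k_def m_assoc)
    have C: "u \<in> carrier V" "u' \<in> carrier V" "z \<in> carrier V" "w \<in> carrier V" using u u' UC ZC z w by auto
    have "k \<odot>\<^bsub>V\<^esub> z = k \<odot>\<^bsub>V\<^esub> u \<oplus>\<^bsub>V\<^esub> c' \<odot>\<^bsub>V\<^esub> s"
      using C u k s by (simp add: smult_r_distr flip: smult_assoc1)
    then have "w \<ominus>\<^bsub>V\<^esub> k \<odot>\<^bsub>V\<^esub> z = u' \<ominus>\<^bsub>V\<^esub> k \<odot>\<^bsub>V\<^esub> u"
      using C u u' k s by (simp add: M.add_diff_cancel_right)
    then have "w \<ominus>\<^bsub>V\<^esub> k \<odot>\<^bsub>V\<^esub> z \<in> Z \<inter> U"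
      using submodule_minus[OF U] submodule_minus[OF Z] submoduleE(4)[OF U] submoduleE(4)[OF Z] u u' k w z
      by (metis IntI)
    moreover have "w = (w \<ominus>\<^bsub>V\<^esub> k \<odot>\<^bsub>V\<^esub> z) \<oplus>\<^bsub>V\<^esub> k \<odot>\<^bsub>V\<^esub> z"
      using C k by (simp add: M.minus_eq M.a_assoc M.l_neg)
    ultimately show ?thesis unfolding adjoin_def using k by blast
  qed
  ultimately show ?thesis using z by blast
qed

text \<open>Finite chains of one-vector extensions starting at \<open>N\<close>; rule induction on
  them serves as induction on dimension.\<close>

inductive reachable :: "'c set \<Rightarrow> 'c set \<Rightarrow> bool" for N where
  base: "reachable N N"
| step: "reachable N U \<Longrightarrow> s \<in> carrier V \<Longrightarrow> reachable N (adjoin K V U s)"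

lemma reachable_submodule: "reachable N U \<Longrightarrow> submodule N K V \<Longrightarrow> submodule U K V"
  by (induction rule: reachable.induct) (auto intro: adjoin_submodule)

text \<open>Adjoining the vectors of a finite spanning set one by one produces a subspace that
  contains the set, hence everything.\<close>

lemma reachable_carrier:
  assumes N: "submodule N K V" and V: "fin_spanned K V"
  shows "reachable N (carrier V)"
proof -
  obtain S where S: "finite S" "S \<subseteq> carrier V" "\<forall>U. submodule U K V \<and> S \<subseteq> U \<longrightarrow> U = carrier V"
    using V by (auto simp: fin_spanned_def)
  have "\<exists>U. reachable N U \<and> S \<subseteq> U" using S(1,2)
  proof (induction S)
    case empty
    then show ?case using base by blast
  next
    case (insert s S)
    then obtain U where U: "reachable N U" "S \<subseteq> U" by auto
    have "submodule U K V" using U N reachable_submodule by blast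
    then have "insert s S \<subseteq> adjoin K V U s" using U(2) insert.prems adjoin_submodule(2,3)[of U s] by simp
    moreover have "reachable N (adjoin K V U s)" using U(1) insert.prems step by simp
    ultimately show ?case by blast
  qed
  then show ?thesis using S reachable_submodule N by blast
qed

text \<open>Induction on the dimension of \<open>Z/N\<close> inside a finite-dimensional space, with
  each new vector taken from \<open>Z\<close>. It contains the fact that subspaces of a
  finite-dimensional space are finite-dimensional.\<close>

lemma submodule_induct:
  assumes V: "fin_spanned K V" and N: "submodule N K V"
    and Z: "submodule Z K V" "N \<subseteq> Z"
    and base: "P N"
    and step: "\<And>M z. submodule M K V \<Longrightarrow> N \<subseteq> M \<Longrightarrow> M \<subseteq> Z \<Longrightarrow> z \<in> Z - M \<Longrightarrow> P M \<Longrightarrow> P (adjoin K V M z)"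
  shows "P Z"
proof -
  \<comment> \<open>The claim ranges over all \<open>Y\<close> between \<open>N\<close> and
    \<open>Z\<close> because the step passes from \<open>Y\<close> to its intersection with the
    previous link \<open>U\<close>, and not to \<open>U\<close>, which need not lie in
    \<open>Z\<close>.\<close>
  have "\<And>Y. submodule Y K V \<Longrightarrow> N \<subseteq> Y \<Longrightarrow> Y \<subseteq> Z \<Longrightarrow> Y \<subseteq> U \<Longrightarrow> P Y" if "reachable N U" for U
    using that
  proof (induction rule: reachable.induct)
    case base
    then show ?case using assms by (metis subset_antisym)
  next
    case (step U s Y)
    have U: "submodule U K V" using step reachable_submodule N by blast
    show ?case
    proof (cases "Y \<subseteq> U")
      case True then show ?thesis using step by blast
    next
      case False
      then obtain z where z: "z \<in> Y - U" "Y = adjoin K V (Y \<inter> U) z"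
        using submodule_step[OF U \<open>s \<in> carrier V\<close>] step by blast
      have M: "submodule (Y \<inter> U) K V"
        by (rule submoduleI') (use U step.prems in \<open>auto dest: submoduleE submodule_zero submoduleE(4,5)\<close>)
      have NU: "N \<subseteq> U" using step.hyps(1) N
        by (induction rule: reachable.induct) (use adjoin_submodule reachable_submodule in blast)+
      have "P (Y \<inter> U)" by (rule step.IH) (use M NU step.prems in auto)
      then have "P (adjoin K V (Y \<inter> U) z)"
        by (intro assms(6)) (use M NU z step.prems in auto)
      then show ?thesis using z by simp
    qed
  qed
  from this[OF reachable_carrier[OF N V]] show ?thesis
    using Z submoduleE(1)[of Z] by blast
qed

text \<open>The value \<open>k\<close> at the new vector is free. The value 0 is used to prolong
  given functionals, while prolonging the zero functional with value 1 creates the coordinate that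
  detects \<open>z\<close>.\<close>

lemma adjoin_extend:
  assumes M: "submodule M K V" and z: "z \<in> carrier V" "z \<notin> M"
    and f: "functional_on K V M f" and k: "k \<in> carrier K"
  shows "\<exists>g. functional_on K V (adjoin K V M z) g \<and> (\<forall>m\<in>M. \<forall>c\<in>carrier K. g (m \<oplus>\<^bsub>V\<^esub> c \<odot>\<^bsub>V\<^esub> z) = f m \<oplus> c \<otimes> k)"
proof -
  define g where "g x = (THE y. \<exists>m\<in>M. \<exists>c\<in>carrier K. x = m \<oplus>\<^bsub>V\<^esub> c \<odot>\<^bsub>V\<^esub> z \<and> y = f m \<oplus> c \<otimes> k)" for x
  have g: "g (m \<oplus>\<^bsub>V\<^esub> c \<odot>\<^bsub>V\<^esub> z) = f m \<oplus> c \<otimes> k" if "m \<in> M" "c \<in> carrier K" for m c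
    unfolding g_def
  proof (rule the_equality)
    show "\<exists>m'\<in>M. \<exists>c'\<in>carrier K. m \<oplus>\<^bsub>V\<^esub> c \<odot>\<^bsub>V\<^esub> z = m' \<oplus>\<^bsub>V\<^esub> c' \<odot>\<^bsub>V\<^esub> z \<and> f m \<oplus> c \<otimes> k = f m' \<oplus> c' \<otimes> k"
      using that by blast
  qed (use adjoin_unique[OF M z] that in metis)
  have MC: "M \<subseteq> carrier V" using M submoduleE(1) by blast
  note fD = functional_onD[OF f]
  have "functional_on K V (adjoin K V M z) g"
    unfolding functional_on_def
  proof (intro conjI ballI)
    show "g \<in> adjoin K V M z \<rightarrow> carrier K" using g fD(1) k by (auto simp: adjoin_def)
  next
    fix x y assume "x \<in> adjoin K V M z" "y \<in> adjoin K V M z"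
    then obtain m c m' c' where h: "x = m \<oplus>\<^bsub>V\<^esub> c \<odot>\<^bsub>V\<^esub> z" "m \<in> M" "c \<in> carrier K"
      "y = m' \<oplus>\<^bsub>V\<^esub> c' \<odot>\<^bsub>V\<^esub> z" "m' \<in> M" "c' \<in> carrier K" by (auto simp: adjoin_def)
    then have C: "m \<in> carrier V" "m' \<in> carrier V" using MC by auto
    have "x \<oplus>\<^bsub>V\<^esub> y = (m \<oplus>\<^bsub>V\<^esub> m') \<oplus>\<^bsub>V\<^esub> (c \<oplus> c') \<odot>\<^bsub>V\<^esub> z"
      using h z C by (simp add: smult_l_distr M.a_ac)
    then have "g (x \<oplus>\<^bsub>V\<^esub> y) = f (m \<oplus>\<^bsub>V\<^esub> m') \<oplus> (c \<oplus> c') \<otimes> k"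
      using g[of "m \<oplus>\<^bsub>V\<^esub> m'" "c \<oplus> c'"] h submoduleE(5)[OF M] by simp
    also have "\<dots> = g x \<oplus> g y" using h k fD by (simp add: g l_distr R.a_ac)
    finally show "g (x \<oplus>\<^bsub>V\<^esub> y) = g x \<oplus> g y" .
  next
    fix b x assume b: "b \<in> carrier K" and "x \<in> adjoin K V M z"
    then obtain m c where h: "x = m \<oplus>\<^bsub>V\<^esub> c \<odot>\<^bsub>V\<^esub> z" "m \<in> M" "c \<in> carrier K" by (auto simp: adjoin_def)
    then have C: "m \<in> carrier V" using MC by auto
    have "b \<odot>\<^bsub>V\<^esub> x = b \<odot>\<^bsub>V\<^esub> m \<oplus>\<^bsub>V\<^esub> (b \<otimes> c) \<odot>\<^bsub>V\<^esub> z"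
      using h z C b by (simp add: smult_r_distr smult_assoc1)
    then have "g (b \<odot>\<^bsub>V\<^esub> x) = f (b \<odot>\<^bsub>V\<^esub> m) \<oplus> (b \<otimes> c) \<otimes> k"
      using g[of "b \<odot>\<^bsub>V\<^esub> m" "b \<otimes> c"] h b submoduleE(4)[OF M] by simp
    also have "\<dots> = b \<otimes> g x" using h k fD b by (simp add: g r_distr m_assoc)
    finally show "g (b \<odot>\<^bsub>V\<^esub> x) = b \<otimes> g x" .
  qed
  then show ?thesis using g by blast
qed

text \<open>A finite-dimensional Hahn-Banach statement: along a chain from \<open>N\<close> to
  \<open>V\<close> each adjoined vector gets the value 0. It is the source of exactness under
  dualization.\<close>

lemma functional_extend:
  assumes V: "fin_spanned K V" and N: "submodule N K V" and f: "functional_on K V N f"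
  shows "\<exists>g. functional_on K V (carrier V) g \<and> (\<forall>x\<in>N. g x = f x)"
proof -
  show ?thesis
  proof (rule submodule_induct[OF V N carrier_is_submodule, where P = "\<lambda>Z. \<exists>g. functional_on K V Z g \<and> (\<forall>x\<in>N. g x = f x)"])
    show "N \<subseteq> carrier V" using N submoduleE(1) by blast
    show "\<exists>g. functional_on K V N g \<and> (\<forall>x\<in>N. g x = f x)" using f by blast
  next
    fix M z assume M: "submodule M K V" "N \<subseteq> M" "M \<subseteq> carrier V" "z \<in> carrier V - M"
      and "\<exists>g. functional_on K V M g \<and> (\<forall>x\<in>N. g x = f x)"
    then obtain g where g: "functional_on K V M g" "\<forall>x\<in>N. g x = f x" by blast
    obtain h where h: "functional_on K V (adjoin K V M z) h"
      "\<forall>m\<in>M. \<forall>c\<in>carrier K. h (m \<oplus>\<^bsub>V\<^esub> c \<odot>\<^bsub>V\<^esub> z) = g m \<oplus> c \<otimes> \<zero>"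
      using adjoin_extend[OF M(1) _ _ g(1) R.zero_closed] M(4) by blast
    have "h x = f x" if x: "x \<in> N" for x
    proof -
      have "h (x \<oplus>\<^bsub>V\<^esub> \<zero> \<odot>\<^bsub>V\<^esub> z) = g x \<oplus> \<zero> \<otimes> \<zero>" using h x M by blast
      moreover have "x \<oplus>\<^bsub>V\<^esub> \<zero> \<odot>\<^bsub>V\<^esub> z = x" using x M by auto
      moreover have "g x \<in> carrier K" using functional_onD(1)[OF g(1)] x M by blast
      ultimately show ?thesis using g(2) x by simp
    qed
    then show "\<exists>g. functional_on K V (adjoin K V M z) g \<and> (\<forall>x\<in>N. g x = f x)" using h by blast
  qed
qed

text \<open>Each adjoined vector contributes one coordinate, so the codimension counts the links of
  a chain from \<open>N\<close> to \<open>Z\<close>.\<close>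

lemma has_codim_exists:
  assumes V: "fin_spanned K V" and N: "submodule N K V" and Z: "submodule Z K V" "N \<subseteq> Z"
  shows "\<exists>r. has_codim K V Z N r"
proof (rule submodule_induct[OF V N Z, where P = "\<lambda>Z. \<exists>r. has_codim K V Z N r"])
  show "\<exists>r. has_codim K V N N r"
    by (rule exI[of _ 0]) (use submodule_zero[OF N] in \<open>auto simp: has_codim_def coordinates_def\<close>)
next
  fix M z assume M: "submodule M K V" "N \<subseteq> M" "M \<subseteq> Z" "z \<in> Z - M" and "\<exists>r. has_codim K V M N r"
  then obtain r where r: "has_codim K V M N r" by blast
  obtain \<chi> where \<chi>c: "coordinates K V M N r \<chi>" using r by (auto simp: has_codim_def)
  note \<chi> = coordinatesD[OF \<chi>c]
  have zc: "z \<in> carrier V" "z \<notin> M" using M Z submoduleE(1) by blast+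
  have MC: "M \<subseteq> carrier V" using M submoduleE(1) by blast
  \<comment> \<open>For \<open>i < r\<close> the old coordinate, prolonged by 0 at \<open>z\<close>;
    for \<open>i = r\<close> the new one, which is 0 on \<open>M\<close> and 1 at
    \<open>z\<close>.\<close>
  define \<chi>' where "\<chi>' i = (SOME g. functional_on K V (adjoin K V M z) g \<and>
     (\<forall>m\<in>M. \<forall>c\<in>carrier K. g (m \<oplus>\<^bsub>V\<^esub> c \<odot>\<^bsub>V\<^esub> z) =
        (if i < r then \<chi> i m else \<zero>) \<oplus> c \<otimes> (if i < r then \<zero> else \<one>)))" for i
  have zf: "functional_on K V M (\<lambda>_. \<zero>)" by (auto simp: functional_on_def)
  have "\<exists>g. functional_on K V (adjoin K V M z) g \<and>
     (\<forall>m\<in>M. \<forall>c\<in>carrier K. g (m \<oplus>\<^bsub>V\<^esub> c \<odot>\<^bsub>V\<^esub> z) =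
        (if i < r then \<chi> i m else \<zero>) \<oplus> c \<otimes> (if i < r then \<zero> else \<one>))" for i
    using adjoin_extend[OF M(1) zc \<chi>(1)[of i] R.zero_closed] adjoin_extend[OF M(1) zc zf R.one_closed]
    by (cases "i < r") simp_all
  then have \<chi>': "functional_on K V (adjoin K V M z) (\<chi>' i) \<and>
     (\<forall>m\<in>M. \<forall>c\<in>carrier K. \<chi>' i (m \<oplus>\<^bsub>V\<^esub> c \<odot>\<^bsub>V\<^esub> z) =
        (if i < r then \<chi> i m else \<zero>) \<oplus> c \<otimes> (if i < r then \<zero> else \<one>))" for i
    unfolding \<chi>'_def by (rule someI_ex)
  have lo: "\<chi>' i (m \<oplus>\<^bsub>V\<^esub> c \<odot>\<^bsub>V\<^esub> z) = \<chi> i m" if "i < r" "m \<in> M" "c \<in> carrier K" for i m c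
    using \<chi>'[of i] that functional_onD(1)[OF \<chi>(1)] by simp
  have hi: "\<chi>' r (m \<oplus>\<^bsub>V\<^esub> c \<odot>\<^bsub>V\<^esub> z) = c" if "m \<in> M" "c \<in> carrier K" for m c
    using \<chi>'[of r] that by simp
  have "has_codim K V (adjoin K V M z) N (Suc r)"
    unfolding has_codim_def coordinates_def
  proof (rule exI[of _ \<chi>'], intro conjI allI impI ballI)
    fix i show "functional_on K V (adjoin K V M z) (\<chi>' i)" using \<chi>' by blast
  next
    fix c assume c: "\<forall>i<Suc r. c i \<in> carrier K"
    then obtain m where m: "m \<in> M" "\<forall>i<r. \<chi> i m = c i" using \<chi>(2)[of c] by auto
    have "\<forall>i<Suc r. \<chi>' i (m \<oplus>\<^bsub>V\<^esub> c r \<odot>\<^bsub>V\<^esub> z) = c i"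
      using lo hi m c by (auto simp: less_Suc_eq)
    then show "\<exists>x\<in>adjoin K V M z. \<forall>i<Suc r. \<chi>' i x = c i"
      using m(1) c by (intro bexI[of _ "m \<oplus>\<^bsub>V\<^esub> c r \<odot>\<^bsub>V\<^esub> z"]) (auto simp: adjoin_def)
  next
    fix x assume "x \<in> adjoin K V M z"
    then obtain m c where h: "x = m \<oplus>\<^bsub>V\<^esub> c \<odot>\<^bsub>V\<^esub> z" "m \<in> M" "c \<in> carrier K" by (auto simp: adjoin_def)
    have "x \<in> N \<longleftrightarrow> c = \<zero> \<and> m \<in> N"
    proof
      assume x: "x \<in> N"
      have "x \<in> carrier V" using x M MC by auto
      then have "m \<oplus>\<^bsub>V\<^esub> c \<odot>\<^bsub>V\<^esub> z = x \<oplus>\<^bsub>V\<^esub> \<zero> \<odot>\<^bsub>V\<^esub> z" using h zc by simp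
      then show "c = \<zero> \<and> m \<in> N" using adjoin_unique[OF M(1) zc] h x M by (metis R.zero_closed subsetD)
    qed (use h zc MC in auto)
    also have "\<dots> \<longleftrightarrow> (\<forall>i<Suc r. \<chi>' i x = \<zero>)"
      using h lo hi \<chi>(3)[of m] by (auto simp: less_Suc_eq)
    finally show "x \<in> N \<longleftrightarrow> (\<forall>i<Suc r. \<chi>' i x = \<zero>)" .
  qed
  then show "\<exists>r. has_codim K V (adjoin K V M z) N r" by blast
qed

end

text \<open>The linear relation \<open>\<rho>\<close> induces an isomorphism from \<open>Z/N\<close> to \<open>Z'/N'\<close>.\<close>

lemma has_codim_transfer:
  fixes K :: "('k, 'x) ring_scheme" and V :: "('k, 'v, 'y) module_scheme" and W :: "('k, 'w, 'z) module_scheme"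
  assumes "module K V" "module K W"
    and Z: "submodule Z K V" and Z': "submodule Z' K W" and N': "\<zero>\<^bsub>W\<^esub> \<in> N'"
    and add: "\<And>x y x' y'. \<lbrakk>x \<in> Z; y \<in> Z; x' \<in> Z'; y' \<in> Z'; \<rho> x x'; \<rho> y y'\<rbrakk> \<Longrightarrow> \<rho> (x \<oplus>\<^bsub>V\<^esub> y) (x' \<oplus>\<^bsub>W\<^esub> y')"
    and smult: "\<And>c x x'. \<lbrakk>c \<in> carrier K; x \<in> Z; x' \<in> Z'; \<rho> x x'\<rbrakk> \<Longrightarrow> \<rho> (c \<odot>\<^bsub>V\<^esub> x) (c \<odot>\<^bsub>W\<^esub> x')"
    and total: "\<And>x. x \<in> Z \<Longrightarrow> \<exists>x'\<in>Z'. \<rho> x x'"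
    and onto: "\<And>x'. x' \<in> Z' \<Longrightarrow> \<exists>x\<in>Z. \<rho> x x'"
    and iff: "\<And>x x'. \<lbrakk>x \<in> Z; x' \<in> Z'; \<rho> x x'\<rbrakk> \<Longrightarrow> x \<in> N \<longleftrightarrow> x' \<in> N'"
    and codim: "has_codim K V Z N r"
  shows "has_codim K W Z' N' r"
proof -
  interpret V: module K V by fact
  interpret W: module K W by fact
  obtain \<chi> where \<chi>c: "coordinates K V Z N r \<chi>" using codim by (auto simp: has_codim_def)
  note \<chi> = coordinatesD[OF \<chi>c]
  have ZC: "Z \<subseteq> carrier V" and ZC': "Z' \<subseteq> carrier W" using Z Z' V.submoduleE(1) W.submoduleE(1) by auto
  define s where "s x' = (SOME x. x \<in> Z \<and> \<rho> x x')" for x'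
  have s: "s x' \<in> Z" "\<rho> (s x') x'" if "x' \<in> Z'" for x'
    using someI_ex[of "\<lambda>x. x \<in> Z \<and> \<rho> x x'"] onto[OF that] by (auto simp: s_def)
  \<comment> \<open>Coordinates on \<open>Z'\<close> are read off at any partner in
    \<open>Z\<close>. Two partners of one \<open>x'\<close> differ by a partner of zero, which
    \<open>iff\<close> places in \<open>N\<close>, where every coordinate vanishes.\<close>
  have uniq: "\<chi> i x = \<chi> i y" if "x \<in> Z" "y \<in> Z" "x' \<in> Z'" "\<rho> x x'" "\<rho> y x'" "i < r" for x y x' i
  proof -
    let ?m = "\<ominus>\<^bsub>K\<^esub> \<one>\<^bsub>K\<^esub>"
    have m: "?m \<odot>\<^bsub>V\<^esub> y \<in> Z" "?m \<odot>\<^bsub>W\<^esub> x' \<in> Z'"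
      using that V.submoduleE(4)[OF Z] W.submoduleE(4)[OF Z'] by simp_all
    have "\<rho> (x \<oplus>\<^bsub>V\<^esub> ?m \<odot>\<^bsub>V\<^esub> y) (x' \<oplus>\<^bsub>W\<^esub> ?m \<odot>\<^bsub>W\<^esub> x')"
      using that m by (intro add smult) auto
    moreover have "x' \<oplus>\<^bsub>W\<^esub> ?m \<odot>\<^bsub>W\<^esub> x' = \<zero>\<^bsub>W\<^esub>"
      using that ZC' W.minus_smult[of x'] W.M.r_neg by auto
    ultimately have "\<rho> (x \<ominus>\<^bsub>V\<^esub> y) \<zero>\<^bsub>W\<^esub>"
      using that ZC V.minus_smult[of y] by (auto simp: V.M.minus_eq)
    then have "x \<ominus>\<^bsub>V\<^esub> y \<in> N"
      using iff N' V.submodule_minus[OF Z] W.submodule_zero[OF Z'] that by blast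
    then have "\<chi> i (x \<ominus>\<^bsub>V\<^esub> y) = \<zero>\<^bsub>K\<^esub>" using \<chi>(3) V.submodule_minus[OF Z] that by blast
    then have "\<chi> i x \<ominus>\<^bsub>K\<^esub> \<chi> i y = \<zero>\<^bsub>K\<^esub>"
      using V.functional_minus[OF \<chi>(1) Z] that by simp
    then show ?thesis
      using functional_onD(1)[OF \<chi>(1)] that V.R.add.inv_equality[of "\<chi> i x" "\<ominus>\<^bsub>K\<^esub> \<chi> i y"]
      by (auto simp: V.R.minus_eq)
  qed
  show ?thesis
    unfolding has_codim_def coordinates_def
  proof (rule exI[of _ "\<lambda>i x'. \<chi> i (s x')"], intro conjI allI impI ballI)
    fix i assume i: "i < r"
    note fD = functional_onD[OF \<chi>(1)[OF i]]
    show "functional_on K W Z' (\<lambda>x'. \<chi> i (s x'))"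
      unfolding functional_on_def
    proof (intro conjI ballI)
      show "(\<lambda>x'. \<chi> i (s x')) \<in> Z' \<rightarrow> carrier K" using s fD by auto
    next
      fix x y assume xy: "x \<in> Z'" "y \<in> Z'"
      have "\<chi> i (s (x \<oplus>\<^bsub>W\<^esub> y)) = \<chi> i (s x \<oplus>\<^bsub>V\<^esub> s y)"
      proof (rule uniq[OF _ _ _ _ _ i])
        show "x \<oplus>\<^bsub>W\<^esub> y \<in> Z'" using W.submoduleE(5)[OF Z'] xy by simp
        then show "s (x \<oplus>\<^bsub>W\<^esub> y) \<in> Z" "\<rho> (s (x \<oplus>\<^bsub>W\<^esub> y)) (x \<oplus>\<^bsub>W\<^esub> y)" using s by auto
        show "s x \<oplus>\<^bsub>V\<^esub> s y \<in> Z" using V.submoduleE(5)[OF Z] s xy by simp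
        show "\<rho> (s x \<oplus>\<^bsub>V\<^esub> s y) (x \<oplus>\<^bsub>W\<^esub> y)" using add s xy by simp
      qed
      then show "\<chi> i (s (x \<oplus>\<^bsub>W\<^esub> y)) = \<chi> i (s x) \<oplus>\<^bsub>K\<^esub> \<chi> i (s y)" using fD s xy by simp
    next
      fix c x assume xy: "c \<in> carrier K" "x \<in> Z'"
      have "\<chi> i (s (c \<odot>\<^bsub>W\<^esub> x)) = \<chi> i (c \<odot>\<^bsub>V\<^esub> s x)"
      proof (rule uniq[OF _ _ _ _ _ i])
        show "c \<odot>\<^bsub>W\<^esub> x \<in> Z'" using W.submoduleE(4)[OF Z'] xy by simp
        then show "s (c \<odot>\<^bsub>W\<^esub> x) \<in> Z" "\<rho> (s (c \<odot>\<^bsub>W\<^esub> x)) (c \<odot>\<^bsub>W\<^esub> x)" using s by auto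
        show "c \<odot>\<^bsub>V\<^esub> s x \<in> Z" using V.submoduleE(4)[OF Z] s xy by simp
        show "\<rho> (c \<odot>\<^bsub>V\<^esub> s x) (c \<odot>\<^bsub>W\<^esub> x)" using smult s xy by simp
      qed
      then show "\<chi> i (s (c \<odot>\<^bsub>W\<^esub> x)) = c \<otimes>\<^bsub>K\<^esub> \<chi> i (s x)" using fD s xy by simp
    qed
  next
    fix c assume c: "\<forall>i<r. c i \<in> carrier K"
    then obtain z where z: "z \<in> Z" "\<forall>i<r. \<chi> i z = c i" using \<chi>(2)[of c] by blast
    obtain z' where z': "z' \<in> Z'" "\<rho> z z'" using total[OF z(1)] by blast
    have "\<forall>i<r. \<chi> i (s z') = c i" using uniq[OF s(1) z(1) z'(1) s(2) z'(2)] z' z(2) by simp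
    then show "\<exists>z\<in>Z'. \<forall>i<r. \<chi> i (s z) = c i" using z' by blast
  next
    fix z assume "z \<in> Z'"
    then show "(z \<in> N') = (\<forall>i<r. \<chi> i (s z) = \<zero>\<^bsub>K\<^esub>)" using s \<chi>(3) iff by blast
  qed
qed

text \<open>These will be the cosets of \<open>N\<close> in \<open>Z\<close>, indexed by coordinate
  vectors instead of representatives. Entries of \<open>c\<close> from index \<open>r\<close> on are
  ignored.\<close>

definition fibre :: "'v set \<Rightarrow> nat \<Rightarrow> (nat \<Rightarrow> 'v \<Rightarrow> 'k) \<Rightarrow> (nat \<Rightarrow> 'k) \<Rightarrow> 'v set"
  where "fibre Z r \<chi> c = {z \<in> Z. \<forall>i<r. \<chi> i z = c i}"

text \<open>Passing to fibres turns \<open>Q\<close> into the space of coordinate vectors of length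
  \<open>r\<close>. Non-emptiness is recorded because scalar multiplication in the quotient is a
  union over the elements of a coset.\<close>

lemma quot_module_fibres:
  fixes K :: "('k, 'x) ring_scheme" and V :: "('k, 'v) module"
  assumes "module K V" and Z: "submodule Z K V" and N: "N \<subseteq> Z"
    and coord: "coordinates K V Z N r \<chi>"
  defines "fib \<equiv> fibre Z r \<chi>"
    and "Q \<equiv> quot_module (V\<lparr>carrier := Z\<rparr>) N"
    and "KR \<equiv> {c. \<forall>i<r. c i \<in> carrier K}"
  shows "carrier Q = fib ` KR"
    and "\<And>c c'. c \<in> KR \<Longrightarrow> c' \<in> KR \<Longrightarrow> fib c = fib c' \<longleftrightarrow> (\<forall>i<r. c i = c' i)"
    and "\<And>c c'. c \<in> KR \<Longrightarrow> c' \<in> KR \<Longrightarrow> fib c \<oplus>\<^bsub>Q\<^esub> fib c' = fib (\<lambda>i. c i \<oplus>\<^bsub>K\<^esub> c' i)"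
    and "\<And>k c. k \<in> carrier K \<Longrightarrow> c \<in> KR \<Longrightarrow> k \<odot>\<^bsub>Q\<^esub> fib c = fib (\<lambda>i. k \<otimes>\<^bsub>K\<^esub> c i)"
    and "\<And>c. c \<in> KR \<Longrightarrow> fib c \<noteq> {}"
proof -
  interpret V: module K V by fact
  have ZC: "Z \<subseteq> carrier V" using Z V.submoduleE(1) by auto
  note \<chi> = coordinatesD[OF coord]
  note fD = functional_onD[OF \<chi>(1)]
  note sub = V.submoduleE(4,5)[OF Z] V.submodule_minus[OF Z]
  have fdiff: "\<chi> i (x \<ominus>\<^bsub>V\<^esub> y) = \<chi> i x \<ominus>\<^bsub>K\<^esub> \<chi> i y" if "i < r" "x \<in> Z" "y \<in> Z" for i x y
    using V.functional_minus[OF \<chi>(1) Z] that by simp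
  have diff_add: "y = (y \<ominus>\<^bsub>V\<^esub> x) \<oplus>\<^bsub>V\<^esub> x" "y = x \<oplus>\<^bsub>V\<^esub> (y \<ominus>\<^bsub>V\<^esub> x)" if "x \<in> Z" "y \<in> Z" for x y
  proof -
    have "x \<in> carrier V" "y \<in> carrier V" using that ZC by auto
    then show "y = (y \<ominus>\<^bsub>V\<^esub> x) \<oplus>\<^bsub>V\<^esub> x" by (simp add: V.M.minus_eq V.M.a_assoc V.M.l_neg)
    then show "y = x \<oplus>\<^bsub>V\<^esub> (y \<ominus>\<^bsub>V\<^esub> x)" using \<open>x \<in> carrier V\<close> \<open>y \<in> carrier V\<close> by (simp add: V.M.a_comm)
  qed
  \<comment> \<open>One inclusion says that adding elements of \<open>N\<close> does not change
    coordinates, the other that elements with equal coordinates differ by an element of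
    \<open>N\<close>.\<close>
  have coset: "N +>\<^bsub>V\<lparr>carrier := Z\<rparr>\<^esub> z = fib (\<lambda>i. \<chi> i z)" if z: "z \<in> Z" for z
  proof
    show "N +>\<^bsub>V\<lparr>carrier := Z\<rparr>\<^esub> z \<subseteq> fib (\<lambda>i. \<chi> i z)"
      using z N sub fD \<chi>(3) by (auto simp: a_r_coset_def r_coset_def fib_def fibre_def)
    show "fib (\<lambda>i. \<chi> i z) \<subseteq> N +>\<^bsub>V\<lparr>carrier := Z\<rparr>\<^esub> z"
    proof
      fix w assume "w \<in> fib (\<lambda>i. \<chi> i z)"
      then have w: "w \<in> Z" "\<forall>i<r. \<chi> i w = \<chi> i z" by (auto simp: fib_def fibre_def)
      have "w \<ominus>\<^bsub>V\<^esub> z \<in> N" using \<chi>(3)[OF sub(3)[OF w(1) z]] w z fD(1) fdiff V.R.r_neg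
        by (simp add: V.R.minus_eq)
      then show "w \<in> N +>\<^bsub>V\<lparr>carrier := Z\<rparr>\<^esub> z"
        using diff_add(1)[OF z w(1)] by (auto simp: a_r_coset_def r_coset_def)
    qed
  qed
  have KRz: "(\<lambda>i. \<chi> i z) \<in> KR" if "z \<in> Z" for z using fD that by (auto simp: KR_def)
  have ex: "\<exists>z\<in>Z. fib c = fib (\<lambda>i. \<chi> i z)" if "c \<in> KR" for c
  proof -
    obtain z where "z \<in> Z" "\<forall>i<r. \<chi> i z = c i" using \<chi>(2)[of c] \<open>c \<in> KR\<close> by (auto simp: KR_def)
    then show ?thesis by (intro bexI[of _ z]) (simp_all add: fib_def fibre_def)
  qed
  show ne: "fib c \<noteq> {}" if "c \<in> KR" for c using \<chi>(2)[of c] that by (auto simp: KR_def fib_def fibre_def)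
  show "carrier Q = fib ` KR"
  proof -
    have "carrier Q = (\<lambda>z. N +>\<^bsub>V\<lparr>carrier := Z\<rparr>\<^esub> z) ` Z"
      by (auto simp: Q_def quot_module_def FactRing_def A_RCOSETS_def RCOSETS_def a_r_coset_def)
    also have "\<dots> = fib ` KR" using coset ex KRz by force
    finally show ?thesis .
  qed
  show "fib c = fib c' \<longleftrightarrow> (\<forall>i<r. c i = c' i)" if "c \<in> KR" "c' \<in> KR" for c c'
  proof
    assume eq: "fib c = fib c'"
    obtain z where "z \<in> fib c" using ne[OF \<open>c \<in> KR\<close>] by (meson ex_in_conv)
    then show "\<forall>i<r. c i = c' i" using eq unfolding fib_def fibre_def by force
  qed (simp add: fib_def fibre_def)
  show "fib c \<oplus>\<^bsub>Q\<^esub> fib c' = fib (\<lambda>i. c i \<oplus>\<^bsub>K\<^esub> c' i)" if "c \<in> KR" "c' \<in> KR" for c c'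
  proof -
    have "fib c \<oplus>\<^bsub>Q\<^esub> fib c' = {x \<oplus>\<^bsub>V\<^esub> y | x y. x \<in> fib c \<and> y \<in> fib c'}"
      by (auto simp: Q_def quot_module_def FactRing_def set_add_def set_mult_def)
    also have "\<dots> = fib (\<lambda>i. c i \<oplus>\<^bsub>K\<^esub> c' i)"
    proof
      show "{x \<oplus>\<^bsub>V\<^esub> y | x y. x \<in> fib c \<and> y \<in> fib c'} \<subseteq> fib (\<lambda>i. c i \<oplus>\<^bsub>K\<^esub> c' i)"
        using sub fD by (auto simp: fib_def fibre_def)
      show "fib (\<lambda>i. c i \<oplus>\<^bsub>K\<^esub> c' i) \<subseteq> {x \<oplus>\<^bsub>V\<^esub> y | x y. x \<in> fib c \<and> y \<in> fib c'}"
      proof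
        fix w assume "w \<in> fib (\<lambda>i. c i \<oplus>\<^bsub>K\<^esub> c' i)"
        then have w: "w \<in> Z" "\<And>i. i < r \<Longrightarrow> \<chi> i w = c i \<oplus>\<^bsub>K\<^esub> c' i" by (auto simp: fib_def fibre_def)
        obtain x where "x \<in> fib c" using ne[OF \<open>c \<in> KR\<close>] by (meson ex_in_conv)
        then have x: "x \<in> Z" "\<And>i. i < r \<Longrightarrow> \<chi> i x = c i" by (auto simp: fib_def fibre_def)
        have "\<chi> i (w \<ominus>\<^bsub>V\<^esub> x) = c' i" if "i < r" for i
        proof -
          have "c i \<in> carrier K" "c' i \<in> carrier K" using that \<open>c \<in> KR\<close> \<open>c' \<in> KR\<close> by (auto simp: KR_def)
          then show ?thesis using w x that fdiff
            by (simp add: V.R.minus_eq V.R.a_comm[of "c i" "c' i"] V.R.a_assoc V.R.r_neg)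
        qed
        then have "w \<ominus>\<^bsub>V\<^esub> x \<in> fib c'" using sub w x by (auto simp: fib_def fibre_def)
        then show "w \<in> {x \<oplus>\<^bsub>V\<^esub> y | x y. x \<in> fib c \<and> y \<in> fib c'}"
          using diff_add(2)[OF x(1) w(1)] \<open>x \<in> fib c\<close> by blast
      qed
    qed
    finally show ?thesis .
  qed
  show "k \<odot>\<^bsub>Q\<^esub> fib c = fib (\<lambda>i. k \<otimes>\<^bsub>K\<^esub> c i)" if k: "k \<in> carrier K" and c: "c \<in> KR" for k c
  proof -
    have "k \<odot>\<^bsub>Q\<^esub> fib c = (\<Union>x\<in>fib c. N +>\<^bsub>V\<lparr>carrier := Z\<rparr>\<^esub> (k \<odot>\<^bsub>V\<^esub> x))"
      by (simp add: Q_def quot_module_def)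
    \<comment> \<open>All members of the union are one and the same fibre, and the union equals it
      because the index set is not empty.\<close>
    also have "\<dots> = (\<Union>x\<in>fib c. fib (\<lambda>i. k \<otimes>\<^bsub>K\<^esub> c i))"
    proof (rule SUP_cong[OF refl])
      fix x assume "x \<in> fib c"
      then have x: "x \<in> Z" "\<And>i. i < r \<Longrightarrow> \<chi> i x = c i" by (auto simp: fib_def fibre_def)
      have "fib (\<lambda>i. \<chi> i (k \<odot>\<^bsub>V\<^esub> x)) = fib (\<lambda>i. k \<otimes>\<^bsub>K\<^esub> c i)"
        using x k fD by (auto simp: fib_def fibre_def)
      then show "N +>\<^bsub>V\<lparr>carrier := Z\<rparr>\<^esub> (k \<odot>\<^bsub>V\<^esub> x) = fib (\<lambda>i. k \<otimes>\<^bsub>K\<^esub> c i)"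
        using coset[OF sub(1)[OF k x(1)]] by simp
    qed
    finally show ?thesis using ne[OF c] by simp
  qed
qed

text \<open>Equal dimension suffices: the fibre over a coordinate vector is sent to the fibre over
  the same vector. The map depends on the chosen coordinates, and so does the isomorphism finally
  obtained.\<close>

lemma mod_iso_quot_module:
  fixes K :: "('k, 'x) ring_scheme" and V :: "('k, 'v) module" and W :: "('k, 'w) module"
  assumes "module K V" "module K W"
    and "submodule Z K V" "N \<subseteq> Z" "has_codim K V Z N r"
    and "submodule Z' K W" "N' \<subseteq> Z'" "has_codim K W Z' N' r"
  shows "\<exists>h. h \<in> mod_iso K (quot_module (V\<lparr>carrier := Z\<rparr>) N) (quot_module (W\<lparr>carrier := Z'\<rparr>) N')"
proof -
  interpret V: module K V by fact
  let ?Q = "quot_module (V\<lparr>carrier := Z\<rparr>) N" and ?Q' = "quot_module (W\<lparr>carrier := Z'\<rparr>) N'"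
  let ?KR = "{c. \<forall>i<r. c i \<in> carrier K}"
  obtain \<chi> where \<chi>c: "coordinates K V Z N r \<chi>" using assms(5) by (auto simp: has_codim_def)
  note \<chi> = coordinatesD[OF \<chi>c]
  obtain \<chi>' where \<chi>'c: "coordinates K W Z' N' r \<chi>'" using assms(8) by (auto simp: has_codim_def)
  note \<chi>' = coordinatesD[OF \<chi>'c]
  define fib where "fib = fibre Z r \<chi>"
  define fib' where "fib' = fibre Z' r \<chi>'"
  note A = quot_module_fibres[OF assms(1,3,4) \<chi>c, folded fib_def]
  note B = quot_module_fibres[OF assms(2,6,7) \<chi>'c, folded fib'_def]
  \<comment> \<open>A coordinate vector of \<open>X\<close> is fixed only in its entries below
    \<open>r\<close>, so \<open>s (fib c)\<close> may differ from \<open>c\<close>; the fact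
    \<open>sf\<close> shows that the target fibre is the same.\<close>
  define s where "s X = (SOME c. c \<in> ?KR \<and> X = fib c)" for X
  have s: "s X \<in> ?KR" "X = fib (s X)" if "X \<in> carrier ?Q" for X
  proof -
    have "X \<in> fib ` ?KR" using that by (simp only: A(1))
    then obtain c where "X = fib c" "c \<in> ?KR" by (rule imageE)
    then have "\<exists>c. c \<in> ?KR \<and> X = fib c" by (intro exI conjI)
    then have "s X \<in> ?KR \<and> X = fib (s X)" unfolding s_def by (rule someI_ex)
    then show "s X \<in> ?KR" "X = fib (s X)" by simp_all
  qed
  have sf: "fib' (s (fib c)) = fib' c" if "c \<in> ?KR" for c
  proof -
    have "fib c \<in> carrier ?Q" using that A(1) by blast
    then have "s (fib c) \<in> ?KR" "fib (s (fib c)) = fib c" using s by auto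
    then have "\<forall>i<r. s (fib c) i = c i" using A(2)[of "s (fib c)" c] that by (simp only: )
    then show ?thesis by (simp add: fib'_def fibre_def)
  qed
  define h where "h = (\<lambda>X\<in>carrier ?Q. fib' (s X))"
  have h: "h (fib c) = fib' c" if "c \<in> ?KR" for c using sf that A(1) by (simp add: h_def)
  have "h \<in> mod_hom K ?Q ?Q'"
    unfolding mod_hom_def
  proof (intro CollectI conjI ballI)
    show "h \<in> carrier ?Q \<rightarrow>\<^sub>E carrier ?Q'"
      using s B(1) by (auto simp: h_def)
  next
    fix X Y assume "X \<in> carrier ?Q" "Y \<in> carrier ?Q"
    then obtain c c' where c: "c \<in> ?KR" "X = fib c" "c' \<in> ?KR" "Y = fib c'" using A(1) by auto
    then have "(\<lambda>i. c i \<oplus>\<^bsub>K\<^esub> c' i) \<in> ?KR" by simp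
    from h[OF this] show "h (X \<oplus>\<^bsub>?Q\<^esub> Y) = h X \<oplus>\<^bsub>?Q'\<^esub> h Y" using c h[OF c(1)] h[OF c(3)] A(3) B(3) by simp
  next
    fix k X assume k: "k \<in> carrier K" and "X \<in> carrier ?Q"
    then obtain c where c: "c \<in> ?KR" "X = fib c" using A(1) by auto
    then have "(\<lambda>i. k \<otimes>\<^bsub>K\<^esub> c i) \<in> ?KR" using k by simp
    from h[OF this] show "h (k \<odot>\<^bsub>?Q\<^esub> X) = k \<odot>\<^bsub>?Q'\<^esub> h X" using c k h[OF c(1)] A(4) B(4) by simp
  qed
  moreover have "bij_betw h (carrier ?Q) (carrier ?Q')"
    unfolding bij_betw_def
  proof
    show "inj_on h (carrier ?Q)"
    proof (rule inj_onI)
      fix X Y assume "X \<in> carrier ?Q" "Y \<in> carrier ?Q" "h X = h Y"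
      then obtain c c' where c: "c \<in> ?KR" "X = fib c" "c' \<in> ?KR" "Y = fib c'" "fib' c = fib' c'"
        using A(1) h by (auto; metis)
      then show "X = Y" using A(2)[of c c'] B(2)[of c c'] by simp
    qed
    show "h ` carrier ?Q = carrier ?Q'" unfolding A(1) B(1) image_image using h by (rule image_cong[OF refl])
  qed
  ultimately show ?thesis unfolding mod_iso_def by blast
qed

text \<open>The vectors \<open>v\<close> lift the basis of \<open>Z/N\<close> dual to
  \<open>\<chi>\<close>, and the last clause expands an element in it modulo \<open>N\<close>. With
  \<open>N\<close> zero this gives a basis of the algebra, with \<open>N\<close> the boundaries it
  gives representatives of homology classes.\<close>

lemma (in vspace) has_codim_basis:
  assumes Z: "submodule Z K V" and N: "N \<subseteq> Z" and codim: "has_codim K V Z N r"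
  shows "\<exists>v \<chi>. v \<in> {..<r} \<rightarrow> Z \<and> (\<forall>i<r. functional_on K V Z (\<chi> i)) \<and>
    (\<forall>i<r. \<forall>j<r. \<chi> i (v j) = (if i = j then \<one> else \<zero>)) \<and>
    (\<forall>i<r. \<forall>z\<in>N. \<chi> i z = \<zero>) \<and>
    (\<forall>z\<in>Z. \<exists>n\<in>N. z = n \<oplus>\<^bsub>V\<^esub> finsum V (\<lambda>i. \<chi> i z \<odot>\<^bsub>V\<^esub> v i) {..<r})"
proof -
  obtain \<chi> where \<chi>c: "coordinates K V Z N r \<chi>" using codim by (auto simp: has_codim_def)
  note \<chi> = coordinatesD[OF \<chi>c]
  have "\<exists>v\<in>Z. \<forall>i<r. \<chi> i v = (if i = j then \<one> else \<zero>)" for j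
    using \<chi>(2)[of "\<lambda>i. if i = j then \<one> else \<zero>"] by simp
  then obtain v where v: "\<And>j. v j \<in> Z" "\<And>i j. i < r \<Longrightarrow> \<chi> i (v j) = (if i = j then \<one> else \<zero>)" by metis
  have ZC: "Z \<subseteq> carrier V" using Z submoduleE(1) by blast
  have vC: "v j \<in> carrier V" for j using v ZC by blast
  note fD = functional_onD[OF \<chi>(1)]
  \<comment> \<open>Partial sums are followed so that induction on \<open>m\<close> applies; a
    coordinate of index \<open>m\<close> or more has not been reached yet and is still zero.\<close>
  have part: "finsum V (\<lambda>i. c i \<odot>\<^bsub>V\<^esub> v i) {..<m} \<in> Z \<and>
      (\<forall>i<r. \<chi> i (finsum V (\<lambda>i. c i \<odot>\<^bsub>V\<^esub> v i) {..<m}) = (if i < m then c i else \<zero>))"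
    if c: "\<And>i. i < m \<Longrightarrow> c i \<in> carrier K" and "m \<le> r" for c m
    using that
  proof (induction m)
    case 0
    then show ?case using submodule_zero[OF Z] functional_zero[OF \<chi>(1) Z] by simp
  next
    case (Suc m)
    let ?S = "finsum V (\<lambda>i. c i \<odot>\<^bsub>V\<^esub> v i) {..<m}"
    have IH: "?S \<in> Z" "\<And>i. i < r \<Longrightarrow> \<chi> i ?S = (if i < m then c i else \<zero>)" using Suc by auto
    have eq: "finsum V (\<lambda>i. c i \<odot>\<^bsub>V\<^esub> v i) {..<Suc m} = c m \<odot>\<^bsub>V\<^esub> v m \<oplus>\<^bsub>V\<^esub> ?S"
      unfolding lessThan_Suc by (rule M.finsum_insert) (use Suc.prems vC in auto)
    have cm: "c m \<odot>\<^bsub>V\<^esub> v m \<in> Z" "c m \<in> carrier K" using v submoduleE(4)[OF Z] Suc.prems by auto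
    show ?case unfolding eq
      using IH cm v submoduleE(5)[OF Z] fD(2)[OF _ cm(1) IH(1)] fD(3)[OF _ cm(2) v(1)] Suc.prems
      by (auto simp: less_Suc_eq)
  qed
  have "\<exists>n\<in>N. z = n \<oplus>\<^bsub>V\<^esub> finsum V (\<lambda>i. \<chi> i z \<odot>\<^bsub>V\<^esub> v i) {..<r}" if z: "z \<in> Z" for z
  proof -
    let ?S = "finsum V (\<lambda>i. \<chi> i z \<odot>\<^bsub>V\<^esub> v i) {..<r}"
    have S: "?S \<in> Z" "\<And>i. i < r \<Longrightarrow> \<chi> i ?S = \<chi> i z"
      using part[of r "\<lambda>i. \<chi> i z"] fD(1) z by auto
    have "z \<ominus>\<^bsub>V\<^esub> ?S \<in> N"
      using \<chi>(3)[OF submodule_minus[OF Z z S(1)]] functional_minus[OF \<chi>(1) Z z S(1)] S(2) fD(1) z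
      by (simp add: R.minus_eq R.r_neg)
    moreover have "z = (z \<ominus>\<^bsub>V\<^esub> ?S) \<oplus>\<^bsub>V\<^esub> ?S"
    proof -
      have "z \<in> carrier V" "?S \<in> carrier V" using z S ZC by auto
      then show ?thesis by (simp add: M.minus_eq M.a_assoc M.l_neg)
    qed
    ultimately show ?thesis by blast
  qed
  then show ?thesis using v \<chi> N by (intro exI[of _ v] exI[of _ \<chi>]) auto
qed

section \<open>Modules and projectivity\<close>

lemma (in abelian_monoid) finsum_induct:
  assumes "finite S" "f \<in> S \<rightarrow> carrier G" "P \<zero>"
    and "\<And>x y. \<lbrakk>x \<in> carrier G; y \<in> carrier G; P x; P y\<rbrakk> \<Longrightarrow> P (x \<oplus> y)"
    and "\<And>s. s \<in> S \<Longrightarrow> P (f s)"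
  shows "P (finsum G f S)"
  using assms(1,2,5)
proof (induction S)
  case empty then show ?case using assms(3) by simp
next
  case (insert s S)
  then have "f s \<in> carrier G" "f \<in> S \<rightarrow> carrier G" by auto
  then show ?case using insert assms(4) by simp
qed

lemma mod_homD:
  assumes "h \<in> mod_hom R M N"
  shows "\<And>x. x \<in> carrier M \<Longrightarrow> h x \<in> carrier N"
    and "\<And>x y. x \<in> carrier M \<Longrightarrow> y \<in> carrier M \<Longrightarrow> h (x \<oplus>\<^bsub>M\<^esub> y) = h x \<oplus>\<^bsub>N\<^esub> h y"
    and "\<And>r x. r \<in> carrier R \<Longrightarrow> x \<in> carrier M \<Longrightarrow> h (r \<odot>\<^bsub>M\<^esub> x) = r \<odot>\<^bsub>N\<^esub> h x"
    and "h \<in> extensional (carrier M)"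
  using assms by (auto simp: mod_hom_def PiE_def)

lemma mod_homI:
  assumes "\<And>x. x \<in> carrier M \<Longrightarrow> h x \<in> carrier N"
    and "\<And>x y. x \<in> carrier M \<Longrightarrow> y \<in> carrier M \<Longrightarrow> h (x \<oplus>\<^bsub>M\<^esub> y) = h x \<oplus>\<^bsub>N\<^esub> h y"
    and "\<And>r x. r \<in> carrier R \<Longrightarrow> x \<in> carrier M \<Longrightarrow> h (r \<odot>\<^bsub>M\<^esub> x) = r \<odot>\<^bsub>N\<^esub> h x"
    and "h \<in> extensional (carrier M)"
  shows "h \<in> mod_hom R M N"
  using assms by (auto simp: mod_hom_def PiE_def)

lemma mod_hom_eqI:
  assumes "h \<in> mod_hom R M N" "h' \<in> mod_hom R M N" "\<And>x. x \<in> carrier M \<Longrightarrow> h x = h' x"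
  shows "h = h'"
  by (rule extensionalityI[OF mod_homD(4)[OF assms(1)] mod_homD(4)[OF assms(2)]]) (rule assms(3))

lemma left_module_restrict_homI:
  fixes R (structure)
  assumes M: "left_module R M"
    and "\<And>x. x \<in> carrier M \<Longrightarrow> h x \<in> carrier N"
    and "\<And>x y. x \<in> carrier M \<Longrightarrow> y \<in> carrier M \<Longrightarrow> h (x \<oplus>\<^bsub>M\<^esub> y) = h x \<oplus>\<^bsub>N\<^esub> h y"
    and "\<And>r x. r \<in> carrier R \<Longrightarrow> x \<in> carrier M \<Longrightarrow> h (r \<odot>\<^bsub>M\<^esub> x) = r \<odot>\<^bsub>N\<^esub> h x"
  shows "(\<lambda>x\<in>carrier M. h x) \<in> mod_hom R M N"
proof -
  interpret left_module R M by fact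
  show ?thesis using assms smult_closed by (intro mod_homI) auto
qed

lemma mod_hom_compose:
  assumes "f \<in> mod_hom R L M" "g \<in> mod_hom R M N" "left_module R L"
  shows "compose (carrier L) g f \<in> mod_hom R L N"
proof -
  interpret left_module R L by fact
  show ?thesis
    using mod_homD[OF assms(1)] mod_homD[OF assms(2)]
    by (intro mod_homI) (auto simp: compose_def smult_closed)
qed

context left_module
begin

lemma smult_r_zero: "a \<in> carrier R \<Longrightarrow> a \<odot>\<^bsub>M\<^esub> \<zero>\<^bsub>M\<^esub> = \<zero>\<^bsub>M\<^esub>"
  using smult_r_distr[of a "\<zero>\<^bsub>M\<^esub>" "\<zero>\<^bsub>M\<^esub>"] smult_closed[of a "\<zero>\<^bsub>M\<^esub>"]
  by (metis M.add.r_cancel_one' M.r_zero M.zero_closed)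

lemma smult_l_zero: "x \<in> carrier M \<Longrightarrow> \<zero>\<^bsub>R\<^esub> \<odot>\<^bsub>M\<^esub> x = \<zero>\<^bsub>M\<^esub>"
  using smult_l_distr[of "\<zero>\<^bsub>R\<^esub>" "\<zero>\<^bsub>R\<^esub>" x] smult_closed[of "\<zero>\<^bsub>R\<^esub>" x]
  by (metis M.add.r_cancel_one' R.r_zero R.zero_closed)

lemma smult_r_neg: "\<lbrakk>a \<in> carrier R; x \<in> carrier M\<rbrakk> \<Longrightarrow> a \<odot>\<^bsub>M\<^esub> (\<ominus>\<^bsub>M\<^esub> x) = \<ominus>\<^bsub>M\<^esub> (a \<odot>\<^bsub>M\<^esub> x)"
  using smult_r_distr[of a "\<ominus>\<^bsub>M\<^esub> x" x] smult_closed smult_r_zero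
  by (metis M.a_inv_closed M.l_neg M.minus_equality)

lemma smult_l_neg: "\<lbrakk>a \<in> carrier R; x \<in> carrier M\<rbrakk> \<Longrightarrow> (\<ominus>\<^bsub>R\<^esub> a) \<odot>\<^bsub>M\<^esub> x = \<ominus>\<^bsub>M\<^esub> (a \<odot>\<^bsub>M\<^esub> x)"
  using smult_l_distr[of "\<ominus>\<^bsub>R\<^esub> a" a x] smult_closed smult_l_zero
  by (metis R.a_inv_closed R.l_neg M.minus_equality)

lemma smult_l_diff: "\<lbrakk>a \<in> carrier R; b \<in> carrier R; x \<in> carrier M\<rbrakk> \<Longrightarrow>
    (a \<ominus>\<^bsub>R\<^esub> b) \<odot>\<^bsub>M\<^esub> x = a \<odot>\<^bsub>M\<^esub> x \<ominus>\<^bsub>M\<^esub> b \<odot>\<^bsub>M\<^esub> x"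
  by (simp add: R.minus_eq M.minus_eq smult_l_distr smult_l_neg)

lemma finsum_smult_l:
  assumes "finite S" "f \<in> S \<rightarrow> carrier R" "x \<in> carrier M"
  shows "finsum R f S \<odot>\<^bsub>M\<^esub> x = finsum M (\<lambda>s. f s \<odot>\<^bsub>M\<^esub> x) S"
  using assms(1,2)
proof (induction S)
  case empty then show ?case using smult_l_zero assms by simp
next
  case (insert s S)
  then have "f s \<in> carrier R" "f \<in> S \<rightarrow> carrier R" by auto
  moreover then have "(\<lambda>s. f s \<odot>\<^bsub>M\<^esub> x) \<in> S \<rightarrow> carrier M" using smult_closed assms(3) by auto
  ultimately show ?case using insert assms(3) smult_closed smult_l_distr by simp
qed

lemma finsum_smult_r:
  assumes "finite S" "f \<in> S \<rightarrow> carrier M" "a \<in> carrier R"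
  shows "a \<odot>\<^bsub>M\<^esub> finsum M f S = finsum M (\<lambda>s. a \<odot>\<^bsub>M\<^esub> f s) S"
  using assms(1,2)
proof (induction S)
  case empty then show ?case using smult_r_zero assms by simp
next
  case (insert s S)
  then have "f s \<in> carrier M" "f \<in> S \<rightarrow> carrier M" by auto
  moreover then have "(\<lambda>s. a \<odot>\<^bsub>M\<^esub> f s) \<in> S \<rightarrow> carrier M" using smult_closed assms(3) by auto
  ultimately show ?case using insert assms(3) smult_closed smult_r_distr by simp
qed

end

lemma mod_hom_zero:
  assumes "h \<in> mod_hom R M N" "left_module R M" "left_module R N"
  shows "h \<zero>\<^bsub>M\<^esub> = \<zero>\<^bsub>N\<^esub>"
proof -
  interpret M: left_module R M by fact
  interpret N: left_module R N by fact
  have "h \<zero>\<^bsub>M\<^esub> = h \<zero>\<^bsub>M\<^esub> \<oplus>\<^bsub>N\<^esub> h \<zero>\<^bsub>M\<^esub>" using mod_homD(2)[OF assms(1), of "\<zero>\<^bsub>M\<^esub>" "\<zero>\<^bsub>M\<^esub>"] by simp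
  then show ?thesis using mod_homD(1)[OF assms(1), of "\<zero>\<^bsub>M\<^esub>"] by (metis M.M.zero_closed N.M.add.r_cancel_one')
qed

lemma mod_hom_neg:
  assumes "h \<in> mod_hom R M N" "left_module R M" "left_module R N" "x \<in> carrier M"
  shows "h (\<ominus>\<^bsub>M\<^esub> x) = \<ominus>\<^bsub>N\<^esub> h x"
proof -
  interpret M: left_module R M by fact
  interpret N: left_module R N by fact
  have "h (\<ominus>\<^bsub>M\<^esub> x) \<oplus>\<^bsub>N\<^esub> h x = \<zero>\<^bsub>N\<^esub>"
    using mod_homD(2)[OF assms(1), of "\<ominus>\<^bsub>M\<^esub> x" x] mod_hom_zero[OF assms(1-3)] assms(4) by (simp add: M.M.l_neg)
  then show ?thesis using mod_homD(1)[OF assms(1)] assms(4) by (simp add: N.M.minus_equality)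
qed

lemma mod_hom_diff:
  assumes "h \<in> mod_hom R M N" "left_module R M" "left_module R N" "x \<in> carrier M" "y \<in> carrier M"
  shows "h (x \<ominus>\<^bsub>M\<^esub> y) = h x \<ominus>\<^bsub>N\<^esub> h y"
proof -
  interpret M: left_module R M by fact
  show ?thesis
    using mod_homD(2)[OF assms(1)] mod_hom_neg[OF assms(1-3)] assms(4,5) by (simp add: a_minus_def)
qed

lemma mod_hom_finsum:
  assumes "h \<in> mod_hom R M N" "left_module R M" "left_module R N" "finite S" "f \<in> S \<rightarrow> carrier M"
  shows "h (finsum M f S) = finsum N (\<lambda>s. h (f s)) S"
  using assms(4,5)
proof (induction S)
  interpret M: left_module R M by fact
  interpret N: left_module R N by fact
  case empty
  then show ?case using mod_hom_zero[OF assms(1-3)] by simp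
next
  interpret M: left_module R M by fact
  interpret N: left_module R N by fact
  case (insert s S)
  then have "f s \<in> carrier M" "f \<in> S \<rightarrow> carrier M" by auto
  moreover then have "(\<lambda>s. h (f s)) \<in> S \<rightarrow> carrier N" using mod_homD(1)[OF assms(1)] by auto
  ultimately show ?case using insert mod_homD(1,2)[OF assms(1)] by simp
qed

lemma mod_hom_add:
  assumes "f \<in> mod_hom R M N" "g \<in> mod_hom R M N" "left_module R M" "left_module R N"
  shows "(\<lambda>x\<in>carrier M. f x \<oplus>\<^bsub>N\<^esub> g x) \<in> mod_hom R M N"
proof (rule left_module_restrict_homI[OF assms(3)])
  interpret M: left_module R M by fact
  interpret N: left_module R N by fact
  note D = mod_homD[OF assms(1)] mod_homD[OF assms(2)]
  show "f x \<oplus>\<^bsub>N\<^esub> g x \<in> carrier N" if "x \<in> carrier M" for x using D that by simp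
  show "f (x \<oplus>\<^bsub>M\<^esub> y) \<oplus>\<^bsub>N\<^esub> g (x \<oplus>\<^bsub>M\<^esub> y) = f x \<oplus>\<^bsub>N\<^esub> g x \<oplus>\<^bsub>N\<^esub> (f y \<oplus>\<^bsub>N\<^esub> g y)"
    if "x \<in> carrier M" "y \<in> carrier M" for x y using D that by (simp add: N.M.a_ac)
  show "f (r \<odot>\<^bsub>M\<^esub> x) \<oplus>\<^bsub>N\<^esub> g (r \<odot>\<^bsub>M\<^esub> x) = r \<odot>\<^bsub>N\<^esub> (f x \<oplus>\<^bsub>N\<^esub> g x)"
    if "r \<in> carrier R" "x \<in> carrier M" for r x using D that by (simp add: N.smult_r_distr)
qed

lemma mod_hom_minus:
  assumes "f \<in> mod_hom R M N" "g \<in> mod_hom R M N" "left_module R M" "left_module R N"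
  shows "(\<lambda>x\<in>carrier M. f x \<ominus>\<^bsub>N\<^esub> g x) \<in> mod_hom R M N"
proof (rule left_module_restrict_homI[OF assms(3)])
  interpret M: left_module R M by fact
  interpret N: left_module R N by fact
  note D = mod_homD[OF assms(1)] mod_homD[OF assms(2)]
  show "f x \<ominus>\<^bsub>N\<^esub> g x \<in> carrier N" if "x \<in> carrier M" for x using D that by simp
  show "f (x \<oplus>\<^bsub>M\<^esub> y) \<ominus>\<^bsub>N\<^esub> g (x \<oplus>\<^bsub>M\<^esub> y) = f x \<ominus>\<^bsub>N\<^esub> g x \<oplus>\<^bsub>N\<^esub> (f y \<ominus>\<^bsub>N\<^esub> g y)"
    if "x \<in> carrier M" "y \<in> carrier M" for x y
    using D that by (simp add: N.M.a_ac N.M.minus_eq N.M.minus_add)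
  show "f (r \<odot>\<^bsub>M\<^esub> x) \<ominus>\<^bsub>N\<^esub> g (r \<odot>\<^bsub>M\<^esub> x) = r \<odot>\<^bsub>N\<^esub> (f x \<ominus>\<^bsub>N\<^esub> g x)"
    if "r \<in> carrier R" "x \<in> carrier M" for r x
    using D that by (simp add: N.smult_r_distr N.M.minus_eq N.smult_r_neg)
qed

lemma regular_left_module:
  assumes "ring R"
  shows "left_module R (regular_module R)"
proof -
  interpret ring R by fact
  have "abelian_group (regular_module R)"
    by (rule abelian_groupI) (auto simp: regular_module_def a_ac intro: add.l_inv_ex)
  then show ?thesis
    by (intro left_module.intro left_module_axioms.intro)
      (auto simp: regular_module_def l_distr r_distr m_assoc ring_axioms)
qed

lemma regular_module_simps [simp]:
  "carrier (regular_module R) = carrier R" "zero (regular_module R) = \<zero>\<^bsub>R\<^esub>"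
  "x \<oplus>\<^bsub>regular_module R\<^esub> y = x \<oplus>\<^bsub>R\<^esub> y" "x \<odot>\<^bsub>regular_module R\<^esub> y = x \<otimes>\<^bsub>R\<^esub> y"
  by (simp_all add: regular_module_def)

lemma free_module_simps:
  "carrier (free_module R I) = {f. (\<forall>i\<in>I. f i \<in> carrier R) \<and> (\<forall>i. i \<notin> I \<longrightarrow> f i = \<zero>\<^bsub>R\<^esub>) \<and> finite {i. f i \<noteq> \<zero>\<^bsub>R\<^esub>}}"
  "zero (free_module R I) = (\<lambda>i. \<zero>\<^bsub>R\<^esub>)"
  "f \<oplus>\<^bsub>free_module R I\<^esub> g = (\<lambda>i. f i \<oplus>\<^bsub>R\<^esub> g i)" "r \<odot>\<^bsub>free_module R I\<^esub> f = (\<lambda>i. r \<otimes>\<^bsub>R\<^esub> f i)"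
  by (simp_all add: free_module_def)

lemma (in ring) free_module_carrierD: "f \<in> carrier (free_module R I) \<Longrightarrow> f i \<in> carrier R"
  by (cases "i \<in> I") (auto simp: free_module_simps)

lemma free_left_module:
  fixes R (structure)
  assumes "ring R"
  shows "left_module R (free_module R I)"
proof -
  interpret ring R by fact
  let ?F = "free_module R I"
  note cD = free_module_carrierD
  have fin: "finite {i. h (f i) (g i) \<noteq> \<zero>}"
    if "f \<in> carrier ?F" "g \<in> carrier ?F" "h \<zero> \<zero> = \<zero>" for f g h
  proof (rule finite_subset)
    show "{i. h (f i) (g i) \<noteq> \<zero>} \<subseteq> {i. f i \<noteq> \<zero>} \<union> {i. g i \<noteq> \<zero>}" using that(3) by auto
  qed (use that in \<open>auto simp: free_module_simps\<close>)
  have ad: "(\<lambda>i. f i \<oplus> g i) \<in> carrier ?F" if "f \<in> carrier ?F" "g \<in> carrier ?F" for f g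
    using that fin[OF that, of "(\<oplus>)"] by (auto simp: free_module_simps)
  have sm: "(\<lambda>i. r \<otimes> f i) \<in> carrier ?F" if "f \<in> carrier ?F" "r \<in> carrier R" for f r
    using that fin[OF that(1) that(1), of "\<lambda>x y. r \<otimes> x"] by (auto simp: free_module_simps)
  have "abelian_group ?F"
  proof (rule abelian_groupI)
    show "\<zero>\<^bsub>?F\<^esub> \<in> carrier ?F" by (simp add: free_module_simps)
  next
    fix f assume f: "f \<in> carrier ?F"
    show "\<exists>g\<in>carrier ?F. g \<oplus>\<^bsub>?F\<^esub> f = \<zero>\<^bsub>?F\<^esub>"
      by (rule bexI[OF _ sm[OF f, of "\<ominus> \<one>"]]) (use cD[OF f] in \<open>auto simp: free_module_simps l_minus l_neg\<close>)
  qed (use ad cD[of _ I] in \<open>auto simp: free_module_simps(2-) a_ac\<close>)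
  then show ?thesis
    by (intro left_module.intro left_module_axioms.intro)
      (use sm cD[of _ I] in \<open>auto simp: free_module_simps(2-) l_distr r_distr m_assoc ring_axioms\<close>)
qed

lemma basis_vector_closed:
  fixes R (structure)
  assumes "ring R" "i \<in> I"
  shows "basis_vector R i \<in> carrier (free_module R I)"
proof -
  interpret ring R by fact
  have "{j. basis_vector R i j \<noteq> \<zero>} \<subseteq> {i}" by (auto simp: basis_vector_def)
  then show ?thesis using assms(2) finite_subset by (auto simp: free_module_simps basis_vector_def)
qed

text \<open>Induction on a finite set containing the support, splitting off one coordinate at a
  time.\<close>

lemma free_module_induct:
  fixes R (structure)
  assumes R: "ring R" and f: "f \<in> carrier (free_module R I)"
    and zero: "P (\<lambda>i. \<zero>\<^bsub>R\<^esub>)"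
    and step: "\<And>i c g. \<lbrakk>i \<in> I; c \<in> carrier R; g \<in> carrier (free_module R I); P g\<rbrakk> \<Longrightarrow>
      P (c \<odot>\<^bsub>free_module R I\<^esub> basis_vector R i \<oplus>\<^bsub>free_module R I\<^esub> g)"
  shows "P f"
proof -
  interpret ring R by fact
  let ?F = "free_module R I"
  note cD = free_module_carrierD
  have "P f" if "finite J" "{i. f i \<noteq> \<zero>} \<subseteq> J" "f \<in> carrier ?F" for J f
    using that
  proof (induction J arbitrary: f)
    case empty
    then have "f = (\<lambda>i. \<zero>)" by auto
    then show ?case using zero by simp
  next
    case (insert i J)
    show ?case
    proof (cases "f i = \<zero>")
      case True
      then show ?thesis using insert by (metis (mono_tags, lifting) mem_Collect_eq subset_insert)
    next
      case False
      let ?g = "f(i := \<zero>)"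
      have "{j. ?g j \<noteq> \<zero>} \<subseteq> {j. f j \<noteq> \<zero>}" by auto
      moreover have "finite {j. f j \<noteq> \<zero>}" using insert.prems(2) by (simp add: free_module_simps)
      ultimately have "finite {j. ?g j \<noteq> \<zero>}" by (rule finite_subset)
      then have g: "?g \<in> carrier ?F" using insert.prems(2) by (simp add: free_module_simps)
      have i: "i \<in> I" using False insert.prems by (auto simp: free_module_simps)
      have "P ?g" by (rule insert.IH[OF _ g]) (use insert.prems in auto)
      then have "P (f i \<odot>\<^bsub>?F\<^esub> basis_vector R i \<oplus>\<^bsub>?F\<^esub> ?g)"
        by (intro step i g cD[OF insert.prems(2)])
      moreover have "f i \<odot>\<^bsub>?F\<^esub> basis_vector R i \<oplus>\<^bsub>?F\<^esub> ?g = f"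
        using cD[OF insert.prems(2)] by (auto simp: free_module_simps basis_vector_def)
      ultimately show ?thesis by simp
    qed
  qed
  from this[of "{i. f i \<noteq> \<zero>}"] show ?thesis using f by (auto simp: free_module_simps)
qed

lemma free_module_hom_eq:
  assumes R: "ring R" and N: "left_module R N"
    and h: "h \<in> mod_hom R (free_module R I) N" and h': "h' \<in> mod_hom R (free_module R I) N"
    and eq: "\<And>i. i \<in> I \<Longrightarrow> h (basis_vector R i) = h' (basis_vector R i)"
  shows "h = h'"
proof (rule mod_hom_eqI[OF h h'])
  let ?F = "free_module R I"
  note F = free_left_module[OF R, of I]
  interpret F: left_module R ?F by (rule F)
  fix f assume "f \<in> carrier ?F"
  with R show "h f = h' f"
  proof (rule free_module_induct)
    show "h (\<lambda>i. \<zero>\<^bsub>R\<^esub>) = h' (\<lambda>i. \<zero>\<^bsub>R\<^esub>)"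
      using mod_hom_zero[OF h F N] mod_hom_zero[OF h' F N] by (simp add: free_module_simps)
  next
    fix i c g assume *: "i \<in> I" "c \<in> carrier R" "g \<in> carrier ?F" "h g = h' g"
    have b: "basis_vector R i \<in> carrier ?F" by (rule basis_vector_closed[OF R *(1)])
    then have "c \<odot>\<^bsub>?F\<^esub> basis_vector R i \<in> carrier ?F" using * F.smult_closed by blast
    then show "h (c \<odot>\<^bsub>?F\<^esub> basis_vector R i \<oplus>\<^bsub>?F\<^esub> g) = h' (c \<odot>\<^bsub>?F\<^esub> basis_vector R i \<oplus>\<^bsub>?F\<^esub> g)"
      using * b eq mod_homD(2,3)[OF h] mod_homD(2,3)[OF h'] by simp
  qed
qed

text \<open>The universal property of a free module. The explicit sum is kept in the conclusion
  because the action on \<open>enveloping_self\<close> is defined by a sum of this shape.\<close>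

lemma free_module_hom_exists:
  assumes R: "ring R" and M: "left_module R M" and m: "\<And>i. i \<in> I \<Longrightarrow> m i \<in> carrier M"
  shows "\<exists>h\<in>mod_hom R (free_module R I) M. (\<forall>i\<in>I. h (basis_vector R i) = m i) \<and>
    (\<forall>f\<in>carrier (free_module R I). h f = finsum M (\<lambda>i. f i \<odot>\<^bsub>M\<^esub> m i) {i. f i \<noteq> \<zero>\<^bsub>R\<^esub>})"
proof -
  interpret M: left_module R M by fact
  let ?F = "free_module R I"
  note cD = M.R.free_module_carrierD
  interpret F: left_module R ?F by (rule free_left_module[OF R])
  define \<Phi> where "\<Phi> f = finsum M (\<lambda>i. f i \<odot>\<^bsub>M\<^esub> m i) {i. f i \<noteq> \<zero>\<^bsub>R\<^esub>}" for f
  \<comment> \<open>Zero coefficients contribute nothing, so \<open>f\<close>, \<open>g\<close> and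
    their sum can be evaluated over one common index set.\<close>
  have \<Phi>: "\<Phi> f = finsum M (\<lambda>i. f i \<odot>\<^bsub>M\<^esub> m i) J"
    if "f \<in> carrier ?F" "finite J" "J \<subseteq> I" "{i. f i \<noteq> \<zero>\<^bsub>R\<^esub>} \<subseteq> J" for f J
    unfolding \<Phi>_def
    by (rule M.M.add.finprod_mono_neutral_cong_left)
      (use that cD[OF that(1)] m M.smult_closed M.smult_l_zero in auto)
  have supp: "finite {i. f i \<noteq> \<zero>\<^bsub>R\<^esub>}" "{i. f i \<noteq> \<zero>\<^bsub>R\<^esub>} \<subseteq> I" if "f \<in> carrier ?F" for f
    using that by (auto simp: free_module_simps)
  have clos: "(\<lambda>i. f i \<odot>\<^bsub>M\<^esub> m i) \<in> J \<rightarrow> carrier M" if "f \<in> carrier ?F" "J \<subseteq> I" for f J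
    using that cD[OF that(1)] m M.smult_closed by auto
  have "(\<lambda>f\<in>carrier ?F. \<Phi> f) \<in> mod_hom R ?F M"
  proof (rule left_module_restrict_homI[OF F.left_module_axioms])
    fix f assume f: "f \<in> carrier ?F"
    show "\<Phi> f \<in> carrier M" unfolding \<Phi>_def by (rule M.M.finsum_closed[OF clos[OF f supp(2)[OF f]]])
  next
    fix f g assume fg: "f \<in> carrier ?F" "g \<in> carrier ?F"
    let ?J = "{i. f i \<noteq> \<zero>\<^bsub>R\<^esub>} \<union> {i. g i \<noteq> \<zero>\<^bsub>R\<^esub>}"
    have J: "finite ?J" "?J \<subseteq> I" using supp fg by auto
    have fg': "f \<oplus>\<^bsub>?F\<^esub> g \<in> carrier ?F" using fg by simp
    have "\<Phi> (f \<oplus>\<^bsub>?F\<^esub> g) = finsum M (\<lambda>i. (f \<oplus>\<^bsub>?F\<^esub> g) i \<odot>\<^bsub>M\<^esub> m i) ?J"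
      by (rule \<Phi>[OF fg' J]) (auto simp: free_module_simps)
    also have "\<dots> = finsum M (\<lambda>i. f i \<odot>\<^bsub>M\<^esub> m i \<oplus>\<^bsub>M\<^esub> g i \<odot>\<^bsub>M\<^esub> m i) ?J"
      by (rule M.M.finsum_cong')
        (use J clos[OF fg(1) J(2)] clos[OF fg(2) J(2)] cD[OF fg(1)] cD[OF fg(2)] m in
          \<open>auto simp: free_module_simps(2-) M.smult_l_distr\<close>)
    also have "\<dots> = \<Phi> f \<oplus>\<^bsub>M\<^esub> \<Phi> g"
      using M.M.finsum_addf[OF clos[OF fg(1) J(2)] clos[OF fg(2) J(2)]] \<Phi>[OF fg(1) J] \<Phi>[OF fg(2) J] by simp
    finally show "\<Phi> (f \<oplus>\<^bsub>?F\<^esub> g) = \<Phi> f \<oplus>\<^bsub>M\<^esub> \<Phi> g" .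
  next
    fix r f assume rf: "r \<in> carrier R" "f \<in> carrier ?F"
    let ?J = "{i. f i \<noteq> \<zero>\<^bsub>R\<^esub>}"
    note J = supp[OF rf(2)]
    have rf': "r \<odot>\<^bsub>?F\<^esub> f \<in> carrier ?F" using rf F.smult_closed by blast
    have "\<Phi> (r \<odot>\<^bsub>?F\<^esub> f) = finsum M (\<lambda>i. (r \<odot>\<^bsub>?F\<^esub> f) i \<odot>\<^bsub>M\<^esub> m i) ?J"
      by (rule \<Phi>[OF rf' J]) (use rf in \<open>auto simp: free_module_simps\<close>)
    also have "\<dots> = finsum M (\<lambda>i. r \<odot>\<^bsub>M\<^esub> (f i \<odot>\<^bsub>M\<^esub> m i)) ?J"
      by (rule M.M.finsum_cong')
        (use J clos[OF rf(2) J(2)] cD[OF rf(2)] rf(1) m M.smult_closed in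
          \<open>auto simp: free_module_simps(2-) M.smult_assoc\<close>)
    also have "\<dots> = r \<odot>\<^bsub>M\<^esub> \<Phi> f"
      using M.finsum_smult_r[OF J(1) clos[OF rf(2) J(2)] rf(1)] by (simp add: \<Phi>_def)
    finally show "\<Phi> (r \<odot>\<^bsub>?F\<^esub> f) = r \<odot>\<^bsub>M\<^esub> \<Phi> f" .
  qed
  moreover have "\<Phi> (basis_vector R i) = m i" if i: "i \<in> I" for i
  proof -
    have "\<Phi> (basis_vector R i) = finsum M (\<lambda>j. basis_vector R i j \<odot>\<^bsub>M\<^esub> m j) {i}"
      by (rule \<Phi>) (use i basis_vector_closed[OF R i] in \<open>auto simp: basis_vector_def\<close>)
    also have "\<dots> = m i" using m[OF i] M.smult_one by (simp add: basis_vector_def)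
    finally show ?thesis .
  qed
  ultimately show ?thesis using basis_vector_closed[OF R, of _ I] by (intro bexI[of _ "\<lambda>f\<in>carrier ?F. \<Phi> f"]) (auto simp: \<Phi>_def)
qed

text \<open>The image condition stands in for surjectivity of \<open>q\<close>, since
  \<open>q\<close> may be a differential, whose image is only a syzygy. Preimages are chosen for the
  basis of a free module and carried to \<open>P\<close> through the splitting
  \<open>\<iota>\<close>.\<close>

lemma projective_lift:
  fixes P :: "('r, 'm) module"
  assumes P: "projective_module R P" and M: "left_module R M" and N: "left_module R N"
    and q: "q \<in> mod_hom R M N" and u: "u \<in> mod_hom R P N"
    and im: "\<And>x. x \<in> carrier P \<Longrightarrow> u x \<in> q ` carrier M"
  shows "\<exists>F\<in>mod_hom R P M. \<forall>x\<in>carrier P. q (F x) = u x"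
proof -
  obtain I :: "'m set" and \<iota> \<pi> where *: "left_module R P" "\<iota> \<in> mod_hom R P (free_module R I)" "\<pi> \<in> mod_hom R (free_module R I) P"
      "\<And>x. x \<in> carrier P \<Longrightarrow> \<pi> (\<iota> x) = x"
    using P by (auto simp: projective_module_def)
  interpret M: left_module R M by fact
  note R = M.R.ring_axioms
  let ?F = "free_module R I"
  note F = free_left_module[OF R, of I]
  have "\<exists>y\<in>carrier M. q y = u (\<pi> (basis_vector R i))" if "i \<in> I" for i
    using im[of "\<pi> (basis_vector R i)"] mod_homD(1)[OF *(3)] basis_vector_closed[OF R that] by (metis imageE)
  then obtain m where m: "\<And>i. i \<in> I \<Longrightarrow> m i \<in> carrier M \<and> q (m i) = u (\<pi> (basis_vector R i))" by metis
  obtain h where h: "h \<in> mod_hom R ?F M" "\<forall>i\<in>I. h (basis_vector R i) = m i"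
    using free_module_hom_exists[OF R M, of I m] m by auto
  have "compose (carrier ?F) q h = compose (carrier ?F) u \<pi>"
    by (rule free_module_hom_eq[OF R N mod_hom_compose[OF h(1) q F] mod_hom_compose[OF *(3) u F]])
      (use m h(2) basis_vector_closed[OF R] in \<open>auto simp: compose_def\<close>)
  then have eq: "q (h f) = u (\<pi> f)" if "f \<in> carrier ?F" for f
    using that by (metis compose_eq)
  show ?thesis
    by (rule bexI[OF _ mod_hom_compose[OF *(2) h(1) *(1)]])
      (use eq mod_homD(1)[OF *(2)] *(4) in \<open>auto simp: compose_def\<close>)
qed

text \<open>The acyclicity hypothesis extends cocycles with values in \<open>R\<close>. A cocycle
  into \<open>P\<close> is embedded by \<open>\<iota>\<close> into a free module and extended
  coordinate by coordinate; finite generation of \<open>T n\<close> leaves only finitely many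
  coordinates to treat, so the extensions fit into one map, which \<open>\<pi>\<close> brings back
  to \<open>P\<close>.\<close>

lemma projective_cocycle_extend:
  fixes P :: "('r, 'm) module"
  assumes T: "chain_complex R T d" and fg: "fin_gen R (T n)" and P: "projective_module R P"
    and acyclic: "hom_cocycles R T d (regular_module R) n = hom_coboundaries R T d (regular_module R) n"
    and u: "u \<in> hom_cocycles R T d P n"
  shows "\<exists>w\<in>mod_hom R (T (n - 1)) P. \<forall>x\<in>carrier (T n). u x = w (d n x)"
proof -
  obtain I :: "'m set" and \<iota> \<pi> where *: "left_module R P" "\<iota> \<in> mod_hom R P (free_module R I)" "\<pi> \<in> mod_hom R (free_module R I) P"
      "\<And>x. x \<in> carrier P \<Longrightarrow> \<pi> (\<iota> x) = x"
    using P by (auto simp: projective_module_def)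
  have Tn: "left_module R (T n)" "left_module R (T (n - 1))" and dn: "d (n + 1) \<in> mod_hom R (T (n + 1)) (T n)"
      "d n \<in> mod_hom R (T n) (T (n - 1))"
    using T by (auto simp: chain_complex_def) (metis add_diff_cancel_right')
  interpret T: left_module R "T n" by (rule Tn)
  interpret P: left_module R P by (rule *)
  note R = T.R.ring_axioms
  let ?F = "free_module R I"
  note cD = T.R.free_module_carrierD
  note F = free_left_module[OF R, of I]
  interpret F: left_module R ?F by (rule F)
  have uh: "u \<in> mod_hom R (T n) P" "\<And>x. x \<in> carrier (T (n + 1)) \<Longrightarrow> u (d (n + 1) x) = \<zero>\<^bsub>P\<^esub>"
    using u by (auto simp: hom_cocycles_def)
  have \<iota>u: "\<iota> (u x) \<in> carrier ?F" if "x \<in> carrier (T n)" for x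
    using mod_homD(1)[OF *(2)] mod_homD(1)[OF uh(1)] that by blast
  define c where "c i = (\<lambda>x\<in>carrier (T n). \<iota> (u x) i)" for i
  have c_hom: "c i \<in> mod_hom R (T n) (regular_module R)" for i
    unfolding c_def
    by (rule left_module_restrict_homI[OF Tn(1)])
      (use cD[OF \<iota>u] mod_homD(1,2,3)[OF *(2)] mod_homD(1,2,3)[OF uh(1)] in \<open>auto simp: free_module_simps(2-)\<close>)
  have c_coc: "c i \<in> hom_cocycles R T d (regular_module R) n" for i
    using c_hom mod_homD(1)[OF dn(1)] mod_hom_zero[OF *(2,1) F] uh(2)
    by (auto simp: hom_cocycles_def c_def free_module_simps(2))
  \<comment> \<open>The coordinates on which \<open>u\<close> is not identically zero. Each is
    already non-zero at some member of a finite generating set, and the images of these members have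
    finite support.\<close>
  define J where "J = {i \<in> I. \<exists>x\<in>carrier (T n). \<iota> (u x) i \<noteq> \<zero>\<^bsub>R\<^esub>}"
  have "finite J"
  proof -
    obtain S where S: "finite S" "S \<subseteq> carrier (T n)"
      "\<forall>x\<in>carrier (T n). \<exists>c\<in>S \<rightarrow> carrier R. x = finsum (T n) (\<lambda>s. c s \<odot>\<^bsub>T n\<^esub> s) S"
      using fg by (auto simp: fin_gen_def)
    have "J \<subseteq> (\<Union>s\<in>S. {i. \<iota> (u s) i \<noteq> \<zero>\<^bsub>R\<^esub>})"
    proof (rule ccontr)
      assume "\<not> ?thesis"
      then obtain i where i: "i \<in> J" "\<And>s. s \<in> S \<Longrightarrow> \<iota> (u s) i = \<zero>\<^bsub>R\<^esub>" by blast
      then obtain x where x: "x \<in> carrier (T n)" "\<iota> (u x) i \<noteq> \<zero>\<^bsub>R\<^esub>" by (auto simp: J_def)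
      then obtain a where a: "a \<in> S \<rightarrow> carrier R" "x = finsum (T n) (\<lambda>s. a s \<odot>\<^bsub>T n\<^esub> s) S" using S(3) by blast
      have "c i x = \<zero>\<^bsub>R\<^esub>" unfolding a(2)
      proof (rule T.M.finsum_induct[OF S(1)])
        show "(\<lambda>s. a s \<odot>\<^bsub>T n\<^esub> s) \<in> S \<rightarrow> carrier (T n)" using a(1) S(2) T.smult_closed by blast
        show "c i \<zero>\<^bsub>T n\<^esub> = \<zero>\<^bsub>R\<^esub>" using mod_hom_zero[OF c_hom Tn(1) regular_left_module[OF R]] by simp
      next
        fix s assume s: "s \<in> S"
        then have "a s \<in> carrier R" "s \<in> carrier (T n)" "c i s = \<zero>\<^bsub>R\<^esub>" using a(1) S(2) i(2) by (auto simp: c_def)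
        then show "c i (a s \<odot>\<^bsub>T n\<^esub> s) = \<zero>\<^bsub>R\<^esub>" using mod_homD(3)[OF c_hom, of "a s" s i] by simp
      qed (use mod_homD(2)[OF c_hom, of _ _ i] in simp)
      then show False using x by (simp add: c_def)
    qed
    moreover have "finite (\<Union>s\<in>S. {i. \<iota> (u s) i \<noteq> \<zero>\<^bsub>R\<^esub>})"
      using S \<iota>u by (auto simp: free_module_simps)
    ultimately show ?thesis by (rule finite_subset)
  qed
  have "\<exists>w\<in>mod_hom R (T (n - 1)) (regular_module R). c i = compose (carrier (T n)) w (d n)" for i
    using c_coc acyclic unfolding hom_coboundaries_def by blast
  then obtain w where w: "\<And>i. w i \<in> mod_hom R (T (n - 1)) (regular_module R)"
    "\<And>i. c i = compose (carrier (T n)) (w i) (d n)" by metis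
  note wD = mod_homD[OF w(1)]
  \<comment> \<open>Outside \<open>J\<close> the extension \<open>w i\<close> is replaced by zero.
    It has to vanish only on the image of \<open>d n\<close>, and infinitely many non-zero
    coordinates elsewhere would leave the free module.\<close>
  define W where "W = (\<lambda>y\<in>carrier (T (n - 1)). (\<lambda>i. if i \<in> J then w i y else \<zero>\<^bsub>R\<^esub>))"
  have W: "W \<in> mod_hom R (T (n - 1)) ?F"
    unfolding W_def
  proof (rule left_module_restrict_homI[OF Tn(2)])
    fix y assume y: "y \<in> carrier (T (n - 1))"
    have "{i. (if i \<in> J then w i y else \<zero>\<^bsub>R\<^esub>) \<noteq> \<zero>\<^bsub>R\<^esub>} \<subseteq> J" by auto
    then have "finite {i. (if i \<in> J then w i y else \<zero>\<^bsub>R\<^esub>) \<noteq> \<zero>\<^bsub>R\<^esub>}" using \<open>finite J\<close> by (rule finite_subset)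
    then show "(\<lambda>i. if i \<in> J then w i y else \<zero>\<^bsub>R\<^esub>) \<in> carrier ?F"
      using wD(1) y by (auto simp: free_module_simps J_def)
  qed (use wD in \<open>auto simp: free_module_simps(2-)\<close>)
  have "W (d n x) = \<iota> (u x)" if x: "x \<in> carrier (T n)" for x
  proof
    fix i
    have dx: "d n x \<in> carrier (T (n - 1))" using mod_homD(1)[OF dn(2)] x by blast
    show "W (d n x) i = \<iota> (u x) i"
    proof (cases "i \<in> J")
      case True
      have "w i (d n x) = c i x" using x by (simp add: w(2) compose_eq)
      then show ?thesis using True dx x by (simp add: W_def c_def)
    next
      case False
      then have "\<iota> (u x) i = \<zero>\<^bsub>R\<^esub>" using x \<iota>u[OF x] by (cases "i \<in> I") (auto simp: J_def free_module_simps)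
      then show ?thesis using False dx by (simp add: W_def)
    qed
  qed
  then have "\<forall>x\<in>carrier (T n). u x = compose (carrier (T (n - 1))) \<pi> W (d n x)"
    using mod_homD(1)[OF dn(2)] *(4) mod_homD(1)[OF uh(1)] by (simp add: compose_eq)
  then show ?thesis using mod_hom_compose[OF W *(3) Tn(2)] by blast
qed

section \<open>Shifting stable homomorphisms along an acyclic complex\<close>

text \<open>The conditions on the relation are symmetric once both zero vectors are known to lie in
  the subspaces divided out, so dimension is transferred in either direction.\<close>

lemma has_codim_transfer_iff:
  fixes K :: "('k, 'x) ring_scheme" and V :: "('k, 'v, 'y) module_scheme" and W :: "('k, 'w, 'z) module_scheme"
  assumes "module K V" "module K W"
    and "submodule Z K V" "submodule Z' K W" "\<zero>\<^bsub>V\<^esub> \<in> N" "\<zero>\<^bsub>W\<^esub> \<in> N'"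
    and "\<And>x y x' y'. \<lbrakk>x \<in> Z; y \<in> Z; x' \<in> Z'; y' \<in> Z'; \<rho> x x'; \<rho> y y'\<rbrakk> \<Longrightarrow> \<rho> (x \<oplus>\<^bsub>V\<^esub> y) (x' \<oplus>\<^bsub>W\<^esub> y')"
    and "\<And>c x x'. \<lbrakk>c \<in> carrier K; x \<in> Z; x' \<in> Z'; \<rho> x x'\<rbrakk> \<Longrightarrow> \<rho> (c \<odot>\<^bsub>V\<^esub> x) (c \<odot>\<^bsub>W\<^esub> x')"
    and "\<And>x. x \<in> Z \<Longrightarrow> \<exists>x'\<in>Z'. \<rho> x x'"
    and "\<And>x'. x' \<in> Z' \<Longrightarrow> \<exists>x\<in>Z. \<rho> x x'"
    and "\<And>x x'. \<lbrakk>x \<in> Z; x' \<in> Z'; \<rho> x x'\<rbrakk> \<Longrightarrow> x \<in> N \<longleftrightarrow> x' \<in> N'"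
  shows "has_codim K V Z N r \<longleftrightarrow> has_codim K W Z' N' r"
proof
  assume "has_codim K V Z N r"
  then show "has_codim K W Z' N' r"
    by (intro has_codim_transfer[where \<rho> = \<rho>, OF assms(1-4,6,7,8,9,10,11)])
next
  assume "has_codim K W Z' N' r"
  then show "has_codim K V Z N r"
    by (intro has_codim_transfer[where \<rho> = "\<lambda>y x. \<rho> x y", OF assms(2,1,4,3,5,7,8,10,9)]) (simp_all add: assms(11))
qed

definition restrict_scalars :: "('k, 'e) module \<Rightarrow> ('e, 'm) module \<Rightarrow> ('k, 'm) module"
  where "restrict_scalars E M =
    \<lparr>carrier = carrier M, mult = undefined, one = undefined, zero = \<zero>\<^bsub>M\<^esub>, add = add M,
     smult = (\<lambda>c x. (c \<odot>\<^bsub>E\<^esub> \<one>\<^bsub>E\<^esub>) \<odot>\<^bsub>M\<^esub> x)\<rparr>"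

lemma restrict_scalars_simps [simp]:
  "carrier (restrict_scalars E M) = carrier M" "zero (restrict_scalars E M) = \<zero>\<^bsub>M\<^esub>"
  "x \<oplus>\<^bsub>restrict_scalars E M\<^esub> y = x \<oplus>\<^bsub>M\<^esub> y" "c \<odot>\<^bsub>restrict_scalars E M\<^esub> x = (c \<odot>\<^bsub>E\<^esub> \<one>\<^bsub>E\<^esub>) \<odot>\<^bsub>M\<^esub> x"
  by (simp_all add: restrict_scalars_def)

lemma hom_space_simps [simp]:
  "carrier (hom_space E M N) = mod_hom E M N" "zero (hom_space E M N) = (\<lambda>x\<in>carrier M. \<zero>\<^bsub>N\<^esub>)"
  "f \<oplus>\<^bsub>hom_space E M N\<^esub> g = (\<lambda>x\<in>carrier M. f x \<oplus>\<^bsub>N\<^esub> g x)"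
  "c \<odot>\<^bsub>hom_space E M N\<^esub> f = (\<lambda>x\<in>carrier M. (c \<odot>\<^bsub>E\<^esub> \<one>\<^bsub>E\<^esub>) \<odot>\<^bsub>N\<^esub> f x)"
  by (simp_all add: hom_space_def)

locale k_alg = fixes K :: "('k, 'x) ring_scheme" and E :: "('k, 'e) module"
  assumes k_algebra: "k_algebra K E"
begin

sublocale K: field K using k_algebra by (simp add: k_algebra_def)
sublocale E: ring E using k_algebra by (simp add: k_algebra_def)
sublocale EM: module K E using k_algebra by (simp add: k_algebra_def)

abbreviation sc where "sc c \<equiv> c \<odot>\<^bsub>E\<^esub> \<one>\<^bsub>E\<^esub>"

lemma smult_mult:
  "\<lbrakk>c \<in> carrier K; x \<in> carrier E; y \<in> carrier E\<rbrakk> \<Longrightarrow> (c \<odot>\<^bsub>E\<^esub> x) \<otimes>\<^bsub>E\<^esub> y = c \<odot>\<^bsub>E\<^esub> (x \<otimes>\<^bsub>E\<^esub> y)"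
  "\<lbrakk>c \<in> carrier K; x \<in> carrier E; y \<in> carrier E\<rbrakk> \<Longrightarrow> x \<otimes>\<^bsub>E\<^esub> (c \<odot>\<^bsub>E\<^esub> y) = c \<odot>\<^bsub>E\<^esub> (x \<otimes>\<^bsub>E\<^esub> y)"
  using k_algebra by (auto simp: k_algebra_def)

lemma sc_closed: "c \<in> carrier K \<Longrightarrow> sc c \<in> carrier E" by simp

lemma sc_add: "\<lbrakk>c \<in> carrier K; c' \<in> carrier K\<rbrakk> \<Longrightarrow> sc (c \<oplus>\<^bsub>K\<^esub> c') = sc c \<oplus>\<^bsub>E\<^esub> sc c'"
  by (simp add: EM.smult_l_distr)

lemma sc_mult: "\<lbrakk>c \<in> carrier K; c' \<in> carrier K\<rbrakk> \<Longrightarrow> sc (c \<otimes>\<^bsub>K\<^esub> c') = sc c \<otimes>\<^bsub>E\<^esub> sc c'"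
  using smult_mult(1)[of c "\<one>\<^bsub>E\<^esub>" "sc c'"] by (simp add: EM.smult_assoc1)

lemma sc_smult: "\<lbrakk>c \<in> carrier K; x \<in> carrier E\<rbrakk> \<Longrightarrow> sc c \<otimes>\<^bsub>E\<^esub> x = c \<odot>\<^bsub>E\<^esub> x"
  by (simp add: smult_mult)

lemma sc_central: "\<lbrakk>c \<in> carrier K; x \<in> carrier E\<rbrakk> \<Longrightarrow> sc c \<otimes>\<^bsub>E\<^esub> x = x \<otimes>\<^bsub>E\<^esub> sc c"
  by (simp add: smult_mult)

lemma restrict_scalars_module:
  assumes "left_module E M"
  shows "module K (restrict_scalars E M)"
proof -
  interpret M: left_module E M by fact
  have ag: "abelian_group (restrict_scalars E M)"
    by (rule abelian_groupI) (auto simp: M.M.a_ac intro: M.M.add.l_inv_ex)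
  show ?thesis
    by (rule moduleI[OF K.is_cring ag])
      (auto simp: M.smult_closed sc_add sc_mult M.smult_one M.smult_l_distr M.smult_r_distr M.smult_assoc)
qed

lemma hom_space_module:
  assumes M: "left_module E M" and N: "left_module E N"
  shows "module K (hom_space E M N)"
proof -
  interpret M: left_module E M by fact
  interpret N: left_module E N by fact
  let ?H = "hom_space E M N"
  have zero: "(\<lambda>x\<in>carrier M. \<zero>\<^bsub>N\<^esub>) \<in> mod_hom E M N"
    by (rule left_module_restrict_homI[OF M]) (auto simp: N.smult_r_zero)
  \<comment> \<open>Linearity over \<open>E\<close> holds because the scalars \<open>sc c\<close>
    are central.\<close>
  have sm: "(\<lambda>x\<in>carrier M. sc c \<odot>\<^bsub>N\<^esub> f x) \<in> mod_hom E M N" if "c \<in> carrier K" "f \<in> mod_hom E M N" for c f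
    by (rule left_module_restrict_homI[OF M])
      (use that mod_homD[OF that(2)] sc_central[OF that(1)] in
        \<open>auto simp: N.smult_closed N.smult_r_distr simp flip: N.smult_assoc\<close>)
  note ext = mod_homD(4)
  note D = mod_homD(1-3)
  have ag: "abelian_group ?H"
  proof (rule abelian_groupI)
    fix f g assume "f \<in> carrier ?H" "g \<in> carrier ?H"
    then show "f \<oplus>\<^bsub>?H\<^esub> g \<in> carrier ?H" using mod_hom_add[OF _ _ M N] by simp
    show "f \<oplus>\<^bsub>?H\<^esub> g = g \<oplus>\<^bsub>?H\<^esub> f"
      using D(1)[of f E M N] D(1)[of g E M N] \<open>f \<in> carrier ?H\<close> \<open>g \<in> carrier ?H\<close> by (auto intro!: restrict_ext simp: N.M.a_comm)
  next
    fix f g h assume "f \<in> carrier ?H" "g \<in> carrier ?H" "h \<in> carrier ?H"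
    then show "f \<oplus>\<^bsub>?H\<^esub> g \<oplus>\<^bsub>?H\<^esub> h = f \<oplus>\<^bsub>?H\<^esub> (g \<oplus>\<^bsub>?H\<^esub> h)"
      using D(1)[of f E M N] D(1)[of g E M N] D(1)[of h E M N] by (auto intro!: restrict_ext simp: N.M.a_assoc)
  next
    fix f assume f: "f \<in> carrier ?H"
    then show "\<zero>\<^bsub>?H\<^esub> \<oplus>\<^bsub>?H\<^esub> f = f"
      using D(1)[of f E M N] ext[of f E M N] by (simp add: extensional_restrict cong: restrict_cong)
    have "(\<lambda>x\<in>carrier M. \<zero>\<^bsub>N\<^esub> \<ominus>\<^bsub>N\<^esub> f x) \<in> mod_hom E M N"
      using mod_hom_minus[OF zero _ M N, of f] f by (simp cong: restrict_cong)
    then show "\<exists>g\<in>carrier ?H. g \<oplus>\<^bsub>?H\<^esub> f = \<zero>\<^bsub>?H\<^esub>"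
      by (rule_tac bexI) (use D(1)[of f E M N] f in \<open>auto intro!: restrict_ext simp: N.M.minus_eq N.M.l_neg\<close>)
  qed (simp add: zero)
  show ?thesis
  proof (rule moduleI[OF K.is_cring ag])
    fix a f assume "a \<in> carrier K" "f \<in> carrier ?H"
    then show "a \<odot>\<^bsub>?H\<^esub> f \<in> carrier ?H" using sm by simp
  next
    fix a b f assume *: "a \<in> carrier K" "b \<in> carrier K" "f \<in> carrier ?H"
    then show "(a \<oplus>\<^bsub>K\<^esub> b) \<odot>\<^bsub>?H\<^esub> f = a \<odot>\<^bsub>?H\<^esub> f \<oplus>\<^bsub>?H\<^esub> b \<odot>\<^bsub>?H\<^esub> f"
      using D(1)[of f E M N] by (auto intro!: restrict_ext simp: sc_add N.smult_l_distr)
    show "(a \<otimes>\<^bsub>K\<^esub> b) \<odot>\<^bsub>?H\<^esub> f = a \<odot>\<^bsub>?H\<^esub> (b \<odot>\<^bsub>?H\<^esub> f)"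
      using D(1)[of f E M N] * by (auto intro!: restrict_ext simp: sc_mult N.smult_assoc)
  next
    fix a f g assume "a \<in> carrier K" "f \<in> carrier ?H" "g \<in> carrier ?H"
    then show "a \<odot>\<^bsub>?H\<^esub> (f \<oplus>\<^bsub>?H\<^esub> g) = a \<odot>\<^bsub>?H\<^esub> f \<oplus>\<^bsub>?H\<^esub> a \<odot>\<^bsub>?H\<^esub> g"
      using D(1)[of f E M N] D(1)[of g E M N] by (auto intro!: restrict_ext simp: N.smult_r_distr)
  next
    fix f assume "f \<in> carrier ?H"
    then show "\<one>\<^bsub>K\<^esub> \<odot>\<^bsub>?H\<^esub> f = f"
      using D(1)[of f E M N] ext[of f E M N] by (simp add: extensional_restrict N.smult_one cong: restrict_cong)
  qed
qed

end

text \<open>What a complete resolution provides before it is compared with a projective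
  resolution.\<close>

locale acyclic_complex = k_alg K E for K :: "('k, 'x) ring_scheme" and E :: "('k, 'e) module" +
  fixes T :: "int \<Rightarrow> ('e, 'm) module" and d
  assumes complex: "chain_complex E T d"
    and exact: "\<And>n. exact_at T d n"
    and fg: "\<And>n. fin_gen E (T n)"
    and proj: "\<And>n. projective_module E (T n)"
    and hom_acyclic: "\<And>n. hom_cocycles E T d (regular_module E) n = hom_coboundaries E T d (regular_module E) n"
begin

text \<open>The third form is the second at \<open>n + 1\<close> with the target written
  \<open>T n\<close>, because \<open>T (n + 1 - 1)\<close> does not match \<open>T n\<close>
  syntactically. The separate \<open>extend_succ\<close> has the same reason.\<close>

lemma T: "left_module E (T n)" and d: "d n \<in> mod_hom E (T n) (T (n - 1))"
  and d_succ: "d (n + 1) \<in> mod_hom E (T (n + 1)) (T n)"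
  using complex unfolding chain_complex_def by (auto, metis add_diff_cancel_right')

lemma dd: "x \<in> carrier (T (n + 1)) \<Longrightarrow> d n (d (n + 1) x) = \<zero>\<^bsub>T (n - 1)\<^esub>"
proof -
  assume "x \<in> carrier (T (n + 1))"
  then have "d (n + 1 - 1) (d (n + 1) x) = \<zero>\<^bsub>T (n + 1 - 2)\<^esub>" using complex unfolding chain_complex_def by blast
  then show ?thesis by simp
qed

lemma d_zero: "d n \<zero>\<^bsub>T n\<^esub> = \<zero>\<^bsub>T (n - 1)\<^esub>"
  using mod_hom_zero[OF d T T] .

lemma exactD: "\<lbrakk>x \<in> carrier (T n); d n x = \<zero>\<^bsub>T (n - 1)\<^esub>\<rbrakk> \<Longrightarrow> \<exists>y\<in>carrier (T (n + 1)). x = d (n + 1) y"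
  using exact[of n] unfolding exact_at_def by blast

lemma extend:
  assumes "u \<in> mod_hom E (T n) (T b)" "\<And>x. x \<in> carrier (T (n + 1)) \<Longrightarrow> u (d (n + 1) x) = \<zero>\<^bsub>T b\<^esub>"
  shows "\<exists>w\<in>mod_hom E (T (n - 1)) (T b). \<forall>x\<in>carrier (T n). u x = w (d n x)"
  by (rule projective_cocycle_extend[OF complex fg proj hom_acyclic])
    (use assms in \<open>auto simp: hom_cocycles_def\<close>)

lemma extend_succ:
  assumes "u \<in> mod_hom E (T (n + 1)) (T b)" "\<And>x. x \<in> carrier (T (n + 1 + 1)) \<Longrightarrow> u (d (n + 1 + 1) x) = \<zero>\<^bsub>T b\<^esub>"
  shows "\<exists>w\<in>mod_hom E (T n) (T b). \<forall>x\<in>carrier (T (n + 1)). u x = w (d (n + 1) x)"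
  using extend[OF assms] by simp

text \<open>
  With $Z_n = \ker d_n$, a map in \<open>stable_maps p b\<close> is a homomorphism
  $Z_{p-1} \cong T_p / \mathrm{im}\, d_{p+1} \to Z_b$, and those in \<open>null_maps p b\<close> factor through a projective.
\<close>

definition stable_maps :: "int \<Rightarrow> int \<Rightarrow> ('m \<Rightarrow> 'm) set"
  where "stable_maps p b = {u \<in> mod_hom E (T p) (T b).
    (\<forall>x\<in>carrier (T (p + 1)). u (d (p + 1) x) = \<zero>\<^bsub>T b\<^esub>) \<and> (\<forall>x\<in>carrier (T p). d b (u x) = \<zero>\<^bsub>T (b - 1)\<^esub>)}"

definition null_maps :: "int \<Rightarrow> int \<Rightarrow> ('m \<Rightarrow> 'm) set"
  where "null_maps p b = {u \<in> mod_hom E (T p) (T b).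
    \<exists>w\<in>mod_hom E (T (p - 1)) (T (b + 1)). \<forall>x\<in>carrier (T p). u x = d (b + 1) (w (d p x))}"

definition stable_codim :: "int \<Rightarrow> int \<Rightarrow> nat \<Rightarrow> bool"
  where "stable_codim p b r \<longleftrightarrow> has_codim K (hom_space E (T p) (T b)) (stable_maps p b) (null_maps p b) r"

lemma stable_maps_submodule: "submodule (stable_maps p b) K (hom_space E (T p) (T b))"
proof -
  interpret H: module K "hom_space E (T p) (T b)" by (rule hom_space_module[OF T T])
  interpret Tb: left_module E "T b" by (rule T)
  interpret Tb1: left_module E "T (b - 1)" by (rule T)
  note dD = mod_homD[OF d] and dsD = mod_homD[OF d_succ]
  show ?thesis
  proof (rule H.submoduleI')
    show "stable_maps p b \<subseteq> carrier (hom_space E (T p) (T b))" by (auto simp: stable_maps_def)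
    show "\<zero>\<^bsub>hom_space E (T p) (T b)\<^esub> \<in> stable_maps p b"
      using H.M.zero_closed dsD(1) by (simp add: stable_maps_def d_zero)
  next
    fix f g assume "f \<in> stable_maps p b" "g \<in> stable_maps p b"
    then show "f \<oplus>\<^bsub>hom_space E (T p) (T b)\<^esub> g \<in> stable_maps p b"
      using H.M.a_closed[of f g] dsD(1) dD(2)[of _ b] mod_homD(1)[of f E "T p" "T b"] mod_homD(1)[of g E "T p" "T b"] by (simp add: stable_maps_def)
  next
    fix c f assume "c \<in> carrier K" "f \<in> stable_maps p b"
    then show "c \<odot>\<^bsub>hom_space E (T p) (T b)\<^esub> f \<in> stable_maps p b"
      using H.smult_closed[of c f] dsD(1) dD(3) mod_homD(1)[of f E "T p" "T b"] Tb.smult_r_zero Tb1.smult_r_zero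
      by (simp add: stable_maps_def)
  qed
qed

lemma null_maps_zero: "\<zero>\<^bsub>hom_space E (T p) (T b)\<^esub> \<in> null_maps p b"
proof -
  interpret H: module K "hom_space E (T p) (T b)" by (rule hom_space_module[OF T T])
  interpret H': module K "hom_space E (T (p - 1)) (T (b + 1))" by (rule hom_space_module[OF T T])
  show ?thesis
    using H.M.zero_closed H'.M.zero_closed mod_homD(1)[OF d, of _ p] mod_hom_zero[OF d_succ T T, of b]
    by (auto simp: null_maps_def intro!: bexI[of _ "\<lambda>x\<in>carrier (T (p - 1)). \<zero>\<^bsub>T (b + 1)\<^esub>"])
qed

text \<open>The relation linking the two sides consists of the pairs $(q F, F d)$ with $F : T_p \to T_c$ and $q F d = 0$.\<close>

lemma shift:
  assumes N: "left_module E N" and q: "q \<in> mod_hom E (T c) N"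
    and ker: "\<And>x. x \<in> carrier (T c) \<Longrightarrow> q x = \<zero>\<^bsub>N\<^esub> \<longleftrightarrow> x \<in> d (c + 1) ` carrier (T (c + 1))"
  shows "has_codim K (hom_space E (T p) N)
      {u \<in> mod_hom E (T p) N. (\<forall>x\<in>carrier (T (p + 1)). u (d (p + 1) x) = \<zero>\<^bsub>N\<^esub>) \<and> u ` carrier (T p) \<subseteq> q ` carrier (T c)}
      {u \<in> mod_hom E (T p) N. \<exists>w\<in>mod_hom E (T (p - 1)) (T c). \<forall>x\<in>carrier (T p). u x = q (w (d p x))} r
    \<longleftrightarrow> stable_codim (p + 1) c r"
    (is "has_codim K ?H ?Z ?N r \<longleftrightarrow> _")
proof -
  interpret H: module K ?H by (rule hom_space_module[OF T N])
  interpret N: left_module E N by (rule N)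
  interpret Tp: left_module E "T p" by (rule T)
  interpret Tc: left_module E "T c" by (rule T)
  let ?H' = "hom_space E (T (p + 1)) (T c)"
  interpret H': module K ?H' by (rule hom_space_module[OF T T])
  let ?Z' = "stable_maps (p + 1) c" and ?N' = "null_maps (p + 1) c"
  note qD = mod_homD[OF q] and dD = mod_homD[OF d] and dsD = mod_homD[OF d_succ]
  have q0: "q \<zero>\<^bsub>T c\<^esub> = \<zero>\<^bsub>N\<^esub>" by (rule mod_hom_zero[OF q T N])
  have qd: "q (d (c + 1) x) = \<zero>\<^bsub>N\<^esub>" if "x \<in> carrier (T (c + 1))" for x
    using ker[of "d (c + 1) x"] that dsD(1) by blast
  have q_iff: "d c x = \<zero>\<^bsub>T (c - 1)\<^esub> \<longleftrightarrow> q x = \<zero>\<^bsub>N\<^esub>" if "x \<in> carrier (T c)" for x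
    using that ker exactD[of x c] dd by blast
  define \<rho> where "\<rho> u u' \<longleftrightarrow> (\<exists>F\<in>mod_hom E (T p) (T c). (\<forall>x\<in>carrier (T p). u x = q (F x)) \<and>
      (\<forall>x\<in>carrier (T (p + 1)). u' x = F (d (p + 1) x)))" for u u'
  have Z: "submodule ?Z K ?H"
  proof (rule H.submoduleI')
    show "?Z \<subseteq> carrier ?H" by auto
    show "\<zero>\<^bsub>?H\<^esub> \<in> ?Z"
      using H.M.zero_closed dsD(1) by (auto intro!: image_eqI[of _ q "\<zero>\<^bsub>T c\<^esub>"] simp: q0)
  next
    fix f g assume fg: "f \<in> ?Z" "g \<in> ?Z"
    have "f x \<oplus>\<^bsub>N\<^esub> g x \<in> q ` carrier (T c)" if "x \<in> carrier (T p)" for x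
    proof -
      have "f x \<in> q ` carrier (T c)" "g x \<in> q ` carrier (T c)" using fg that by auto
      then obtain y z where "y \<in> carrier (T c)" "z \<in> carrier (T c)" "f x = q y" "g x = q z" by auto
      then have "f x \<oplus>\<^bsub>N\<^esub> g x = q (y \<oplus>\<^bsub>T c\<^esub> z)" "y \<oplus>\<^bsub>T c\<^esub> z \<in> carrier (T c)" using qD(2) by auto
      then show ?thesis by blast
    qed
    then show "f \<oplus>\<^bsub>?H\<^esub> g \<in> ?Z"
      using H.M.a_closed[of f g] dsD(1) fg by auto
  next
    fix k f assume kf: "k \<in> carrier K" "f \<in> ?Z"
    have "sc k \<odot>\<^bsub>N\<^esub> f x \<in> q ` carrier (T c)" if "x \<in> carrier (T p)" for x
    proof -
      have "f x \<in> q ` carrier (T c)" using kf that by auto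
      then obtain y where "y \<in> carrier (T c)" "f x = q y" by auto
      then have "sc k \<odot>\<^bsub>N\<^esub> f x = q (sc k \<odot>\<^bsub>T c\<^esub> y)" "sc k \<odot>\<^bsub>T c\<^esub> y \<in> carrier (T c)"
        using qD(3) kf Tc.smult_closed by auto
      then show ?thesis by blast
    qed
    then show "k \<odot>\<^bsub>?H\<^esub> f \<in> ?Z"
      using H.smult_closed[of k f] dsD(1) kf N.smult_r_zero by auto
  qed
  have lift: "\<exists>w\<in>mod_hom E (T p') (T c). \<forall>x\<in>carrier (T p'). q (w x) = u x"
    if "u \<in> mod_hom E (T p') N" "u ` carrier (T p') \<subseteq> q ` carrier (T c)" for u p'
    by (rule projective_lift[OF proj T N q that(1)]) (use that(2) in blast)
  show ?thesis
    unfolding stable_codim_def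
  proof (rule has_codim_transfer_iff[where \<rho> = \<rho>])
    show "module K ?H" "module K ?H'" "submodule ?Z K ?H" "submodule ?Z' K ?H'" "\<zero>\<^bsub>?H'\<^esub> \<in> ?N'"
      using H.module_axioms H'.module_axioms Z stable_maps_submodule null_maps_zero by simp_all
    interpret H'': module K "hom_space E (T (p - 1)) (T c)" by (rule hom_space_module[OF T T])
    show "\<zero>\<^bsub>?H\<^esub> \<in> ?N"
      using H.M.zero_closed H''.M.zero_closed dD(1)[of _ p]
      by (auto simp: q0 intro!: bexI[of _ "\<lambda>x\<in>carrier (T (p - 1)). \<zero>\<^bsub>T c\<^esub>"])
  next
    fix x y x' y' assume "\<rho> x x'" "\<rho> y y'"
    then obtain F G where F: "F \<in> mod_hom E (T p) (T c)" "\<forall>z\<in>carrier (T p). x z = q (F z)" "\<forall>z\<in>carrier (T (p + 1)). x' z = F (d (p + 1) z)"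
      and G: "G \<in> mod_hom E (T p) (T c)" "\<forall>z\<in>carrier (T p). y z = q (G z)" "\<forall>z\<in>carrier (T (p + 1)). y' z = G (d (p + 1) z)"
      unfolding \<rho>_def by blast
    show "\<rho> (x \<oplus>\<^bsub>?H\<^esub> y) (x' \<oplus>\<^bsub>?H'\<^esub> y')"
      unfolding \<rho>_def
      by (rule bexI[OF _ mod_hom_add[OF F(1) G(1) T T]])
        (use F G qD(2) dsD(1) mod_homD(1)[OF F(1)] mod_homD(1)[OF G(1)] in auto)
  next
    fix k x x' assume k: "k \<in> carrier K" and "\<rho> x x'"
    then obtain F where F: "F \<in> mod_hom E (T p) (T c)" "\<forall>z\<in>carrier (T p). x z = q (F z)" "\<forall>z\<in>carrier (T (p + 1)). x' z = F (d (p + 1) z)"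
      unfolding \<rho>_def by blast
    interpret H'': module K "hom_space E (T p) (T c)" by (rule hom_space_module[OF T T])
    have "k \<odot>\<^bsub>hom_space E (T p) (T c)\<^esub> F \<in> mod_hom E (T p) (T c)" using H''.smult_closed[OF k] F by simp
    then show "\<rho> (k \<odot>\<^bsub>?H\<^esub> x) (k \<odot>\<^bsub>?H'\<^esub> x')"
      unfolding \<rho>_def
      by (rule bexI[rotated]) (use F k qD(3) dsD(1) mod_homD(1)[OF F(1)] in auto)
  next
    fix u assume "u \<in> ?Z"
    then have u: "u \<in> mod_hom E (T p) N" "\<And>x. x \<in> carrier (T (p + 1)) \<Longrightarrow> u (d (p + 1) x) = \<zero>\<^bsub>N\<^esub>"
      "u ` carrier (T p) \<subseteq> q ` carrier (T c)" by auto
    obtain F where F: "F \<in> mod_hom E (T p) (T c)" "\<forall>x\<in>carrier (T p). q (F x) = u x"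
      using lift[OF u(1,3)] by blast
    \<comment> \<open>Since \<open>q F d = u d = 0\<close>, the values of \<open>F d\<close> lie in
      the kernel of \<open>q\<close>, which is the image of \<open>d (c + 1)\<close> and hence the
      kernel of \<open>d c\<close>.\<close>
    let ?u' = "compose (carrier (T (p + 1))) F (d (p + 1))"
    have "?u' \<in> ?Z'"
      using mod_hom_compose[OF d_succ F(1) T] dsD(1) dsD(1)[of _ "p + 1"] dd[of _ "p + 1"] mod_hom_zero[OF F(1) T T] F u(2)
        q_iff mod_homD(1)[OF F(1)]
      by (auto simp: stable_maps_def compose_eq)
    moreover have "\<rho> u ?u'" unfolding \<rho>_def using F by (intro bexI[of _ F]) (simp_all add: compose_eq)
    ultimately show "\<exists>u'\<in>?Z'. \<rho> u u'" by blast
  next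
    fix u' assume "u' \<in> ?Z'"
    then have u': "u' \<in> mod_hom E (T (p + 1)) (T c)" "\<And>x. x \<in> carrier (T (p + 1 + 1)) \<Longrightarrow> u' (d (p + 1 + 1) x) = \<zero>\<^bsub>T c\<^esub>"
      "\<And>x. x \<in> carrier (T (p + 1)) \<Longrightarrow> d c (u' x) = \<zero>\<^bsub>T (c - 1)\<^esub>" by (auto simp: stable_maps_def)
    \<comment> \<open>Here \<open>F\<close> comes from acyclicity of the dual complex, whereas in
      the opposite direction it came from projectivity of \<open>T p\<close>.\<close>
    obtain F where F: "F \<in> mod_hom E (T p) (T c)" "\<forall>x\<in>carrier (T (p + 1)). u' x = F (d (p + 1) x)"
      using extend_succ[OF u'(1,2)] by blast
    let ?u = "compose (carrier (T p)) q F"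
    have "?u \<in> ?Z"
      using mod_hom_compose[OF F(1) q T] dsD(1) F u'(3) q_iff mod_homD(1)[OF u'(1)] mod_homD(1)[OF F(1)]
      by (auto simp: compose_eq)
    moreover have "\<rho> ?u u'" unfolding \<rho>_def using F by (intro bexI[of _ F]) (simp_all add: compose_eq)
    ultimately show "\<exists>u\<in>?Z. \<rho> u u'" by blast
  next
    fix u u' assume uZ: "u \<in> ?Z" and u'Z: "u' \<in> ?Z'" and "\<rho> u u'"
    then obtain F where F: "F \<in> mod_hom E (T p) (T c)" "\<And>x. x \<in> carrier (T p) \<Longrightarrow> u x = q (F x)"
      "\<And>x. x \<in> carrier (T (p + 1)) \<Longrightarrow> u' x = F (d (p + 1) x)"
      unfolding \<rho>_def by blast
    note FD = mod_homD[OF F(1)]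
    show "u \<in> ?N \<longleftrightarrow> u' \<in> ?N'"
    proof
      assume "u \<in> ?N"
      then obtain w where w: "w \<in> mod_hom E (T (p - 1)) (T c)" "\<And>x. x \<in> carrier (T p) \<Longrightarrow> u x = q (w (d p x))" by blast
      have wd: "compose (carrier (T p)) w (d p) \<in> mod_hom E (T p) (T c)" by (rule mod_hom_compose[OF d w(1) T])
      note wdD = mod_homD(1)[OF w(1) dD(1)]
      \<comment> \<open>Subtracting \<open>w d\<close> leaves \<open>F d\<close> unchanged and makes
        \<open>q G\<close> vanish; then \<open>G\<close> takes values in the image of
        \<open>d (c + 1)\<close> and lifts through it by projectivity of \<open>T p\<close>.\<close>
      define G where "G = (\<lambda>x\<in>carrier (T p). F x \<ominus>\<^bsub>T c\<^esub> compose (carrier (T p)) w (d p) x)"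
      have G: "G \<in> mod_hom E (T p) (T c)" unfolding G_def by (rule mod_hom_minus[OF F(1) wd T T])
      have Gx: "G x = F x \<ominus>\<^bsub>T c\<^esub> w (d p x)" if "x \<in> carrier (T p)" for x using that by (simp add: G_def compose_eq)
      have qG: "q (G x) = \<zero>\<^bsub>N\<^esub>" if "x \<in> carrier (T p)" for x
      proof -
        have "q (G x) = q (F x) \<ominus>\<^bsub>N\<^esub> q (w (d p x))"
          using Gx[OF that] mod_hom_diff[OF q T N FD(1)[OF that] wdD[OF that]] by simp
        also have "\<dots> = \<zero>\<^bsub>N\<^esub>" using F(2)[OF that] w(2)[OF that] qD(1)[OF FD(1)[OF that]] by (simp add: N.M.minus_eq N.M.r_neg)
        finally show ?thesis .
      qed
      have im: "G x \<in> d (c + 1) ` carrier (T (c + 1))" if "x \<in> carrier (T p)" for x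
        using ker[OF mod_homD(1)[OF G that]] qG[OF that] by blast
      obtain w' where w': "w' \<in> mod_hom E (T p) (T (c + 1))" "\<forall>x\<in>carrier (T p). d (c + 1) (w' x) = G x"
        using projective_lift[OF proj T T d_succ G im] by blast
      have "u' x = d (c + 1) (w' (d (p + 1) x))" if x: "x \<in> carrier (T (p + 1))" for x
      proof -
        have "w (d p (d (p + 1) x)) = \<zero>\<^bsub>T c\<^esub>" using dd[OF x] mod_hom_zero[OF w(1) T T] by simp
        then have "G (d (p + 1) x) = F (d (p + 1) x)" using Gx[OF dsD(1)[OF x]] FD(1)[OF dsD(1)[OF x]]
          by (simp add: Tc.M.minus_eq)
        then show ?thesis using w'(2) dsD(1)[OF x] F(3)[OF x] by simp
      qed
      then show "u' \<in> ?N'" using u'Z w'(1) by (auto simp: null_maps_def stable_maps_def)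
    next
      assume "u' \<in> ?N'"
      then obtain w' where w': "w' \<in> mod_hom E (T p) (T (c + 1))"
        "\<And>x. x \<in> carrier (T (p + 1)) \<Longrightarrow> u' x = d (c + 1) (w' (d (p + 1) x))" by (auto simp: null_maps_def)
      have dw: "compose (carrier (T p)) (d (c + 1)) w' \<in> mod_hom E (T p) (T c)" by (rule mod_hom_compose[OF w'(1) d_succ T])
      note dwD = dsD(1)[OF mod_homD(1)[OF w'(1)]]
      \<comment> \<open>The mirror image: subtracting \<open>d w'\<close> leaves \<open>q F\<close>
        unchanged and makes \<open>G\<close> vanish on boundaries, so that \<open>G\<close> factors
        through \<open>d p\<close>.\<close>
      define G where "G = (\<lambda>x\<in>carrier (T p). F x \<ominus>\<^bsub>T c\<^esub> compose (carrier (T p)) (d (c + 1)) w' x)"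
      have G: "G \<in> mod_hom E (T p) (T c)" unfolding G_def by (rule mod_hom_minus[OF F(1) dw T T])
      have Gx: "G x = F x \<ominus>\<^bsub>T c\<^esub> d (c + 1) (w' x)" if "x \<in> carrier (T p)" for x using that by (simp add: G_def compose_eq)
      have "G (d (p + 1) x) = \<zero>\<^bsub>T c\<^esub>" if x: "x \<in> carrier (T (p + 1))" for x
        using Gx[OF dsD(1)[OF x]] F(3)[OF x] w'(2)[OF x] dwD[OF dsD(1)[OF x]] by (simp add: Tc.M.minus_eq Tc.M.r_neg)
      then obtain w where w: "w \<in> mod_hom E (T (p - 1)) (T c)" "\<And>x. x \<in> carrier (T p) \<Longrightarrow> G x = w (d p x)"
        using extend[OF G] by blast
      have "u x = q (w (d p x))" if x: "x \<in> carrier (T p)" for x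
      proof -
        have "q (G x) = q (F x) \<ominus>\<^bsub>N\<^esub> q (d (c + 1) (w' x))"
          using Gx[OF x] mod_hom_diff[OF q T N FD(1)[OF x] dwD[OF x]] by simp
        also have "\<dots> = q (F x)" using qd[OF mod_homD(1)[OF w'(1) x]] qD(1)[OF FD(1)[OF x]] by (simp add: N.M.minus_eq)
        finally show ?thesis using F(2)[OF x] w(2)[OF x] by simp
      qed
      then show "u \<in> ?N" using uZ w(1) by auto
    qed
  qed
qed

text \<open>This is \<open>shift\<close> with \<open>N = T b\<close> and
  \<open>q = d (b + 1)\<close>. Exactness at \<open>b\<close> turns the requirement that
  \<open>u\<close> take values in the image of \<open>q\<close> into the vanishing of
  \<open>d b\<close> on the values of \<open>u\<close>.\<close>

lemma stable_codim_shift: "stable_codim p b r \<longleftrightarrow> stable_codim (p + 1) (b + 1) r"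
proof -
  have ker: "d (b + 1) x = \<zero>\<^bsub>T b\<^esub> \<longleftrightarrow> x \<in> d (b + 1 + 1) ` carrier (T (b + 1 + 1))" if "x \<in> carrier (T (b + 1))" for x
    using that exactD[of x "b + 1"] dd[of _ "b + 1"] by auto
  have im: "d b x = \<zero>\<^bsub>T (b - 1)\<^esub> \<longleftrightarrow> x \<in> d (b + 1) ` carrier (T (b + 1))" if "x \<in> carrier (T b)" for x
    using that exactD[of x b] dd[of _ b] by auto
  have "{u \<in> mod_hom E (T p) (T b). (\<forall>x\<in>carrier (T (p + 1)). u (d (p + 1) x) = \<zero>\<^bsub>T b\<^esub>) \<and>
      u ` carrier (T p) \<subseteq> d (b + 1) ` carrier (T (b + 1))} = stable_maps p b"
    unfolding stable_maps_def using im mod_homD(1)[of _ E "T p" "T b"] by (intro Collect_cong conj_cong refl) auto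
  then show ?thesis
    using shift[OF T d_succ ker, of p r] by (simp add: stable_codim_def null_maps_def)
qed

text \<open>The equivalence can be iterated both ways, so any common shift of the two degrees is
  allowed, negative ones included.\<close>

lemma stable_codim_shift_int: "stable_codim p b r \<longleftrightarrow> stable_codim (p + k) (b + k) r"
proof (induction k rule: int_induct[where k = 0])
  case base then show ?case by simp
next
  case (step1 i) then show ?case using stable_codim_shift[of "p + i" "b + i" r] by (simp add: add.assoc)
next
  case (step2 i) then show ?case using stable_codim_shift[of "p + (i - 1)" "b + (i - 1)" r] by simp
qed

end

section \<open>Cohomology and invariants of an augmented complex as stable homomorphisms\<close>

lemma (in abelian_group) eq_of_diff_zero:
  assumes "a \<in> carrier G" "b \<in> carrier G" "a \<ominus> b = \<zero>"
  shows "a = b"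
  using assms minus_equality[of a "\<ominus> b"] by (simp add: minus_eq)

text \<open>\<open>\<epsilon>\<close> presents \<open>B\<close> as the cokernel of
  \<open>d 1\<close>, which is the syzygy in degree -1. A generator \<open>b1\<close> is fixed so
  that homomorphisms out of \<open>B\<close> become elements of the target, namely their values at
  \<open>b1\<close>.\<close>

locale augmented_complex = acyclic_complex K E T d
    for K :: "('k, 'x) ring_scheme" and E :: "('k, 'e) module" and T :: "int \<Rightarrow> ('e, 'm) module" and d +
  fixes B :: "('e, 'b) module" and \<epsilon> :: "'m \<Rightarrow> 'b" and b1 :: 'b
  assumes B: "left_module E B" and \<epsilon>: "\<epsilon> \<in> mod_hom E (T 0) B" and \<epsilon>_surj: "\<epsilon> ` carrier (T 0) = carrier B"
    and \<epsilon>_ker: "{x \<in> carrier (T 0). \<epsilon> x = \<zero>\<^bsub>B\<^esub>} = d 1 ` carrier (T 1)"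
    and b1: "b1 \<in> carrier B" and cyclic: "\<And>b. b \<in> carrier B \<Longrightarrow> \<exists>e\<in>carrier E. b = e \<odot>\<^bsub>B\<^esub> b1"
begin

lemma hom_cocycles_submodule: "submodule (hom_cocycles E T d B n) K (hom_space E (T n) B)"
proof -
  interpret H: module K "hom_space E (T n) B" by (rule hom_space_module[OF T B])
  interpret B: left_module E B by (rule B)
  note dsD = mod_homD[OF d_succ]
  show ?thesis
  proof (rule H.submoduleI')
    show "hom_cocycles E T d B n \<subseteq> carrier (hom_space E (T n) B)" by (auto simp: hom_cocycles_def)
    show "\<zero>\<^bsub>hom_space E (T n) B\<^esub> \<in> hom_cocycles E T d B n"
      using H.M.zero_closed dsD(1) by (simp add: hom_cocycles_def)
  next
    fix f g assume "f \<in> hom_cocycles E T d B n" "g \<in> hom_cocycles E T d B n"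
    then show "f \<oplus>\<^bsub>hom_space E (T n) B\<^esub> g \<in> hom_cocycles E T d B n"
      using H.M.a_closed[of f g] dsD(1) by (simp add: hom_cocycles_def)
  next
    fix c f assume "c \<in> carrier K" "f \<in> hom_cocycles E T d B n"
    then show "c \<odot>\<^bsub>hom_space E (T n) B\<^esub> f \<in> hom_cocycles E T d B n"
      using H.smult_closed[of c f] dsD(1) B.smult_r_zero by (simp add: hom_cocycles_def)
  qed
qed

lemma hom_coboundaries_subset: "hom_coboundaries E T d B n \<subseteq> hom_cocycles E T d B n"
proof
  fix u assume "u \<in> hom_coboundaries E T d B n"
  then obtain g where g: "g \<in> mod_hom E (T (n - 1)) B" "u = compose (carrier (T n)) g (d n)"
    by (auto simp: hom_coboundaries_def)
  then show "u \<in> hom_cocycles E T d B n"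
    using mod_hom_compose[OF d g(1) T] mod_homD(1)[OF d_succ] dd mod_hom_zero[OF g(1) T B]
    by (auto simp: hom_cocycles_def compose_eq)
qed

text \<open>This is \<open>shift\<close> with \<open>q = \<epsilon>\<close>. As
  \<open>\<epsilon>\<close> is onto, the image condition is empty, and every homomorphism from
  \<open>T (n - 1)\<close> to \<open>B\<close> lifts to \<open>T 0\<close>, so null maps are exactly
  coboundaries. The shift replaces \<open>B\<close> in degree -1 by the syzygy in degree 0, which
  explains \<open>n + 1\<close>.\<close>

lemma hom_codim_iff:
  "has_codim K (hom_space E (T n) B) (hom_cocycles E T d B n) (hom_coboundaries E T d B n) r
    \<longleftrightarrow> stable_codim (n + 1) 0 r"
proof -
  have Z: "{u \<in> mod_hom E (T n) B. (\<forall>x\<in>carrier (T (n + 1)). u (d (n + 1) x) = \<zero>\<^bsub>B\<^esub>) \<and>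
      u ` carrier (T n) \<subseteq> \<epsilon> ` carrier (T 0)} = hom_cocycles E T d B n"
    using mod_homD(1)[of _ E "T n" B] by (auto simp: hom_cocycles_def \<epsilon>_surj)
  have N: "{u \<in> mod_hom E (T n) B. \<exists>w\<in>mod_hom E (T (n - 1)) (T 0). \<forall>x\<in>carrier (T n). u x = \<epsilon> (w (d n x))}
      = hom_coboundaries E T d B n" (is "?L = _")
  proof
    show "?L \<subseteq> hom_coboundaries E T d B n"
    proof
      fix u assume "u \<in> ?L"
      then obtain w where u: "u \<in> mod_hom E (T n) B" and w: "w \<in> mod_hom E (T (n - 1)) (T 0)"
        "\<forall>x\<in>carrier (T n). u x = \<epsilon> (w (d n x))" by auto
      let ?g = "compose (carrier (T (n - 1))) \<epsilon> w"
      have g: "?g \<in> mod_hom E (T (n - 1)) B" by (rule mod_hom_compose[OF w(1) \<epsilon> T])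
      have "u = compose (carrier (T n)) ?g (d n)"
        by (rule mod_hom_eqI[OF u mod_hom_compose[OF d g T]]) (use w(2) mod_homD(1)[OF d] in \<open>simp add: compose_eq\<close>)
      then show "u \<in> hom_coboundaries E T d B n" using g by (auto simp: hom_coboundaries_def)
    qed
    show "hom_coboundaries E T d B n \<subseteq> ?L"
    proof
      fix u assume "u \<in> hom_coboundaries E T d B n"
      then obtain g where g: "g \<in> mod_hom E (T (n - 1)) B" "u = compose (carrier (T n)) g (d n)"
        by (auto simp: hom_coboundaries_def)
      obtain w where w: "w \<in> mod_hom E (T (n - 1)) (T 0)" "\<forall>x\<in>carrier (T (n - 1)). \<epsilon> (w x) = g x"
        using projective_lift[OF proj T B \<epsilon> g(1)] mod_homD(1)[OF g(1)] by (auto simp: \<epsilon>_surj)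
      show "u \<in> ?L"
        using mod_hom_compose[OF d g(1) T] g(2) w mod_homD(1)[OF d] by (auto simp: compose_eq intro!: bexI[of _ w])
    qed
  qed
  have ker: "\<epsilon> x = \<zero>\<^bsub>B\<^esub> \<longleftrightarrow> x \<in> d (0 + 1) ` carrier (T (0 + 1))" if "x \<in> carrier (T 0)" for x
    using that \<epsilon>_ker by auto
  show ?thesis using shift[OF B \<epsilon> ker, of n r] unfolding Z N by simp
qed

text \<open>\<open>invs n\<close> is the image of $\mathrm{Hom}_E(B,T_n)$ under evaluation at the generator of \<open>B\<close>.\<close>

definition invs :: "int \<Rightarrow> 'm set"
  where "invs n = {z \<in> carrier (T n). \<forall>e\<in>carrier E. e \<odot>\<^bsub>B\<^esub> b1 = \<zero>\<^bsub>B\<^esub> \<longrightarrow> e \<odot>\<^bsub>T n\<^esub> z = \<zero>\<^bsub>T n\<^esub>}"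

definition inv_cycles :: "int \<Rightarrow> 'm set"
  where "inv_cycles n = {z \<in> invs n. d n z = \<zero>\<^bsub>T (n - 1)\<^esub>}"

lemma invs_submodule: "submodule (invs n) K (restrict_scalars E (T n))"
proof -
  interpret V: module K "restrict_scalars E (T n)" by (rule restrict_scalars_module[OF T])
  interpret T: left_module E "T n" by (rule T)
  show ?thesis
  proof (rule V.submoduleI')
    fix c x assume c: "c \<in> carrier K" and x: "x \<in> invs n"
    have "e \<odot>\<^bsub>T n\<^esub> (sc c \<odot>\<^bsub>T n\<^esub> x) = \<zero>\<^bsub>T n\<^esub>" if e: "e \<in> carrier E" "e \<odot>\<^bsub>B\<^esub> b1 = \<zero>\<^bsub>B\<^esub>" for e
    proof -
      have xc: "x \<in> carrier (T n)" using x by (simp add: invs_def)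
      have "e \<odot>\<^bsub>T n\<^esub> (sc c \<odot>\<^bsub>T n\<^esub> x) = sc c \<odot>\<^bsub>T n\<^esub> (e \<odot>\<^bsub>T n\<^esub> x)"
        using T.smult_assoc[of e "sc c" x] T.smult_assoc[of "sc c" e x] sc_central[OF c e(1)] c e xc by simp
      also have "\<dots> = \<zero>\<^bsub>T n\<^esub>" using e x c T.smult_r_zero by (simp add: invs_def)
      finally show ?thesis .
    qed
    then show "c \<odot>\<^bsub>restrict_scalars E (T n)\<^esub> x \<in> invs n"
      using x c T.smult_closed by (simp add: invs_def)
  qed (auto simp: invs_def T.smult_r_zero T.smult_r_distr)
qed

lemma d_invs:
  assumes z: "z \<in> invs (n + 1)"
  shows "d (n + 1) z \<in> invs n"
proof -
  have zc: "z \<in> carrier (T (n + 1))" using z by (simp add: invs_def)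
  have "e \<odot>\<^bsub>T n\<^esub> d (n + 1) z = \<zero>\<^bsub>T n\<^esub>" if "e \<in> carrier E" "e \<odot>\<^bsub>B\<^esub> b1 = \<zero>\<^bsub>B\<^esub>" for e
    using mod_homD(3)[OF d_succ that(1) zc] mod_hom_zero[OF d_succ T T, of n] z that by (simp add: invs_def)
  then show ?thesis using mod_homD(1)[OF d_succ zc] by (simp add: invs_def)
qed

lemma inv_cycles_submodule: "submodule (inv_cycles n) K (restrict_scalars E (T n))"
proof -
  interpret V: module K "restrict_scalars E (T n)" by (rule restrict_scalars_module[OF T])
  interpret T: left_module E "T (n - 1)" by (rule T)
  note I = V.submoduleE[OF invs_submodule] V.submodule_zero[OF invs_submodule]
  have c: "\<And>x. x \<in> invs n \<Longrightarrow> x \<in> carrier (T n)" by (simp add: invs_def)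
  show ?thesis
    by (rule V.submoduleI')
      (use I c mod_homD(2,3)[OF d] T.smult_r_zero in \<open>auto simp: inv_cycles_def d_zero\<close>)
qed

lemma inv_boundaries_submodule: "submodule (d (n + 1) ` invs (n + 1)) K (restrict_scalars E (T n))"
  and inv_boundaries_subset: "d (n + 1) ` invs (n + 1) \<subseteq> inv_cycles n"
proof -
  interpret V: module K "restrict_scalars E (T n)" by (rule restrict_scalars_module[OF T])
  interpret V': module K "restrict_scalars E (T (n + 1))" by (rule restrict_scalars_module[OF T])
  note I = V'.submoduleE[OF invs_submodule] V'.submodule_zero[OF invs_submodule]
  have c: "\<And>x. x \<in> invs (n + 1) \<Longrightarrow> x \<in> carrier (T (n + 1))" by (simp add: invs_def)
  show "d (n + 1) ` invs (n + 1) \<subseteq> inv_cycles n"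
    using d_invs dd c by (auto simp: inv_cycles_def)
  show "submodule (d (n + 1) ` invs (n + 1)) K (restrict_scalars E (T n))"
  proof (rule V.submoduleI')
    show "\<zero>\<^bsub>restrict_scalars E (T n)\<^esub> \<in> d (n + 1) ` invs (n + 1)"
      using I(7) mod_hom_zero[OF d_succ T T, of n] by force
  next
    fix a b assume "a \<in> d (n + 1) ` invs (n + 1)" "b \<in> d (n + 1) ` invs (n + 1)"
    then obtain x y where "x \<in> invs (n + 1)" "y \<in> invs (n + 1)" "a = d (n + 1) x" "b = d (n + 1) y" by auto
    then show "a \<oplus>\<^bsub>restrict_scalars E (T n)\<^esub> b \<in> d (n + 1) ` invs (n + 1)"
      using I(5)[of x y] c mod_homD(2)[OF d_succ, of x n y] by (intro image_eqI[of _ _ "x \<oplus>\<^bsub>T (n + 1)\<^esub> y"]) auto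
  next
    fix k a assume "k \<in> carrier K" "a \<in> d (n + 1) ` invs (n + 1)"
    then obtain x where "k \<in> carrier K" "x \<in> invs (n + 1)" "a = d (n + 1) x" by auto
    then show "k \<odot>\<^bsub>restrict_scalars E (T n)\<^esub> a \<in> d (n + 1) ` invs (n + 1)"
      using I(4)[of k x] c mod_homD(3)[OF d_succ, of "sc k" x n] by (intro image_eqI[of _ _ "sc k \<odot>\<^bsub>T (n + 1)\<^esub> x"]) auto
  qed (use c mod_homD(1)[OF d_succ] in auto)
qed

text \<open>\<open>z\<close> is annihilated by everything that annihilates \<open>b1\<close>, so
  \<open>e b1\<close> may be sent to \<open>e z\<close>; the resulting map out of \<open>B\<close>
  is composed with \<open>\<epsilon>\<close>.\<close>

lemma invs_hom:
  assumes z: "z \<in> invs n"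
  shows "\<exists>u\<in>mod_hom E (T 0) (T n). \<forall>x\<in>carrier (T 0). \<forall>e\<in>carrier E. \<epsilon> x = e \<odot>\<^bsub>B\<^esub> b1 \<longrightarrow> u x = e \<odot>\<^bsub>T n\<^esub> z"
proof -
  interpret T: left_module E "T n" by (rule T)
  interpret T0: left_module E "T 0" by (rule T)
  interpret B: left_module E B by (rule B)
  have zc: "z \<in> carrier (T n)" using z by (simp add: invs_def)
  have wd: "e \<odot>\<^bsub>T n\<^esub> z = e' \<odot>\<^bsub>T n\<^esub> z" if "e \<in> carrier E" "e' \<in> carrier E" "e \<odot>\<^bsub>B\<^esub> b1 = e' \<odot>\<^bsub>B\<^esub> b1" for e e'
  proof -
    have "(e \<ominus>\<^bsub>E\<^esub> e') \<odot>\<^bsub>B\<^esub> b1 = \<zero>\<^bsub>B\<^esub>"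
      using that b1 B.smult_closed by (simp add: B.smult_l_diff B.M.minus_eq B.M.r_neg)
    then have "(e \<ominus>\<^bsub>E\<^esub> e') \<odot>\<^bsub>T n\<^esub> z = \<zero>\<^bsub>T n\<^esub>" using z that by (simp add: invs_def)
    then have "e \<odot>\<^bsub>T n\<^esub> z \<ominus>\<^bsub>T n\<^esub> e' \<odot>\<^bsub>T n\<^esub> z = \<zero>\<^bsub>T n\<^esub>"
      using that zc by (simp add: T.smult_l_diff)
    then show ?thesis by (rule T.M.eq_of_diff_zero[rotated 2]) (use that zc T.smult_closed in simp_all)
  qed
  define s where "s x = (SOME e. e \<in> carrier E \<and> \<epsilon> x = e \<odot>\<^bsub>B\<^esub> b1)" for x
  have s: "s x \<in> carrier E" "\<epsilon> x = s x \<odot>\<^bsub>B\<^esub> b1" if "x \<in> carrier (T 0)" for x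
  proof -
    have "\<exists>e. e \<in> carrier E \<and> \<epsilon> x = e \<odot>\<^bsub>B\<^esub> b1" using cyclic mod_homD(1)[OF \<epsilon> that] by blast
    then have "s x \<in> carrier E \<and> \<epsilon> x = s x \<odot>\<^bsub>B\<^esub> b1" unfolding s_def by (rule someI_ex)
    then show "s x \<in> carrier E" "\<epsilon> x = s x \<odot>\<^bsub>B\<^esub> b1" by auto
  qed
  have val: "s x \<odot>\<^bsub>T n\<^esub> z = e \<odot>\<^bsub>T n\<^esub> z" if "x \<in> carrier (T 0)" "e \<in> carrier E" "\<epsilon> x = e \<odot>\<^bsub>B\<^esub> b1" for x e
    using wd[OF s(1)[OF that(1)] that(2)] s(2)[OF that(1)] that(3) by simp
  have "(\<lambda>x\<in>carrier (T 0). s x \<odot>\<^bsub>T n\<^esub> z) \<in> mod_hom E (T 0) (T n)"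
  proof (rule left_module_restrict_homI[OF T])
    fix x assume "x \<in> carrier (T 0)" then show "s x \<odot>\<^bsub>T n\<^esub> z \<in> carrier (T n)" using s zc T.smult_closed by simp
  next
    fix x y assume xy: "x \<in> carrier (T 0)" "y \<in> carrier (T 0)"
    have "s (x \<oplus>\<^bsub>T 0\<^esub> y) \<odot>\<^bsub>T n\<^esub> z = (s x \<oplus>\<^bsub>E\<^esub> s y) \<odot>\<^bsub>T n\<^esub> z"
      using xy s b1 mod_homD(2)[OF \<epsilon>] by (intro val) (simp_all add: B.smult_l_distr)
    then show "s (x \<oplus>\<^bsub>T 0\<^esub> y) \<odot>\<^bsub>T n\<^esub> z = s x \<odot>\<^bsub>T n\<^esub> z \<oplus>\<^bsub>T n\<^esub> s y \<odot>\<^bsub>T n\<^esub> z"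
      using s xy zc by (simp add: T.smult_l_distr)
  next
    fix r x assume xy: "r \<in> carrier E" "x \<in> carrier (T 0)"
    have "s (r \<odot>\<^bsub>T 0\<^esub> x) \<odot>\<^bsub>T n\<^esub> z = (r \<otimes>\<^bsub>E\<^esub> s x) \<odot>\<^bsub>T n\<^esub> z"
      using xy s b1 mod_homD(3)[OF \<epsilon>] T0.smult_closed by (intro val) (simp_all add: B.smult_assoc)
    then show "s (r \<odot>\<^bsub>T 0\<^esub> x) \<odot>\<^bsub>T n\<^esub> z = r \<odot>\<^bsub>T n\<^esub> (s x \<odot>\<^bsub>T n\<^esub> z)"
      using s xy zc by (simp add: T.smult_assoc)
  qed
  then show ?thesis using val by (intro bexI) auto
qed

text \<open>A stable map out of \<open>T 0\<close> kills the image of \<open>d 1\<close>, hence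
  factors through \<open>\<epsilon>\<close> and is determined by its value at a preimage of the
  generator. Evaluation there matches stable maps with invariant cycles and null maps with
  boundaries of invariants. The index 0 appears without a shift because the source already is the
  syzygy in degree -1.\<close>

lemma inv_codim_iff:
  "has_codim K (restrict_scalars E (T n)) (inv_cycles n) (d (n + 1) ` invs (n + 1)) r \<longleftrightarrow> stable_codim 0 n r"
proof -
  interpret V: module K "restrict_scalars E (T n)" by (rule restrict_scalars_module[OF T])
  let ?H = "hom_space E (T 0) (T n)"
  interpret H: module K ?H by (rule hom_space_module[OF T T])
  interpret Tn: left_module E "T n" by (rule T)
  interpret T0: left_module E "T 0" by (rule T)
  interpret B: left_module E B by (rule B)
  note \<epsilon>D = mod_homD[OF \<epsilon>] and dD = mod_homD[OF d] and dsD = mod_homD[OF d_succ]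
  obtain x1 where x1: "x1 \<in> carrier (T 0)" "\<epsilon> x1 = b1" using b1 \<epsilon>_surj by (metis imageE)
  have ker: "\<exists>y\<in>carrier (T 1). x = d 1 y" if "x \<in> carrier (T 0)" "\<epsilon> x = \<zero>\<^bsub>B\<^esub>" for x
    using that \<epsilon>_ker by blast
  have d1: "y \<in> carrier (T 1) \<Longrightarrow> d 1 y \<in> carrier (T 0)" "y \<in> carrier (T 1) \<Longrightarrow> \<epsilon> (d 1 y) = \<zero>\<^bsub>B\<^esub>" for y
    using \<epsilon>_ker by auto
  have kill: "u x = \<zero>\<^bsub>T k\<^esub>"
    if "\<forall>y\<in>carrier (T 1). u (d 1 y) = \<zero>\<^bsub>T k\<^esub>" "x \<in> carrier (T 0)" "\<epsilon> x = \<zero>\<^bsub>B\<^esub>" for u x k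
    using that ker by blast
  \<comment> \<open>The difference of \<open>x\<close> and \<open>e x1\<close> lies in the kernel of
    \<open>\<epsilon>\<close>, where \<open>u\<close> vanishes.\<close>
  have gen: "u x = e \<odot>\<^bsub>T k\<^esub> u x1"
    if u: "u \<in> mod_hom E (T 0) (T k)" "\<forall>y\<in>carrier (T 1). u (d 1 y) = \<zero>\<^bsub>T k\<^esub>"
      and x: "x \<in> carrier (T 0)" "e \<in> carrier E" "\<epsilon> x = e \<odot>\<^bsub>B\<^esub> b1" for u x e k
  proof -
    interpret Tk: left_module E "T k" by (rule T)
    have ex: "e \<odot>\<^bsub>T 0\<^esub> x1 \<in> carrier (T 0)" using x x1 T0.smult_closed by simp
    have "\<epsilon> (x \<ominus>\<^bsub>T 0\<^esub> e \<odot>\<^bsub>T 0\<^esub> x1) = \<zero>\<^bsub>B\<^esub>"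
      using mod_hom_diff[OF \<epsilon> T B x(1) ex] \<epsilon>D(3)[OF x(2) x1(1)] x x1 b1 B.smult_closed by (simp add: B.M.minus_eq B.M.r_neg)
    then have "u (x \<ominus>\<^bsub>T 0\<^esub> e \<odot>\<^bsub>T 0\<^esub> x1) = \<zero>\<^bsub>T k\<^esub>" using kill[OF u(2)] x ex by simp
    then have eq: "u x \<ominus>\<^bsub>T k\<^esub> e \<odot>\<^bsub>T k\<^esub> u x1 = \<zero>\<^bsub>T k\<^esub>"
      using mod_hom_diff[OF u(1) T T x(1) ex] mod_homD(3)[OF u(1) x(2) x1(1)] by simp
    have c: "u x \<in> carrier (T k)" "e \<odot>\<^bsub>T k\<^esub> u x1 \<in> carrier (T k)"
      using mod_homD(1)[OF u(1)] x x1 Tk.smult_closed by auto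
    show ?thesis by (rule Tk.M.eq_of_diff_zero[OF c eq])
  qed
  have inv: "u x1 \<in> invs k"
    if u: "u \<in> mod_hom E (T 0) (T k)" "\<forall>y\<in>carrier (T 1). u (d 1 y) = \<zero>\<^bsub>T k\<^esub>" for u k
  proof -
    have "e \<odot>\<^bsub>T k\<^esub> u x1 = \<zero>\<^bsub>T k\<^esub>" if e: "e \<in> carrier E" "e \<odot>\<^bsub>B\<^esub> b1 = \<zero>\<^bsub>B\<^esub>" for e
    proof -
      have "\<epsilon> \<zero>\<^bsub>T 0\<^esub> = e \<odot>\<^bsub>B\<^esub> b1" using mod_hom_zero[OF \<epsilon> T B] e by simp
      from gen[OF u _ e(1) this] show ?thesis using mod_hom_zero[OF u(1) T T] by simp
    qed
    then show ?thesis using mod_homD(1)[OF u(1) x1(1)] by (simp add: invs_def)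
  qed
  have stab: "u \<in> mod_hom E (T 0) (T n) \<and> (\<forall>y\<in>carrier (T 1). u (d 1 y) = \<zero>\<^bsub>T n\<^esub>) \<and>
      (\<forall>x\<in>carrier (T 0). d n (u x) = \<zero>\<^bsub>T (n - 1)\<^esub>)" if "u \<in> stable_maps 0 n" for u
    using that by (simp add: stable_maps_def)
  have hom: "\<exists>u\<in>mod_hom E (T 0) (T k). u x1 = z \<and> (\<forall>y\<in>carrier (T 1). u (d 1 y) = \<zero>\<^bsub>T k\<^esub>)"
    if z: "z \<in> invs k" for z k
  proof -
    interpret Tk: left_module E "T k" by (rule T)
    have zc: "z \<in> carrier (T k)" using z by (simp add: invs_def)
    obtain u where u: "u \<in> mod_hom E (T 0) (T k)"
      "\<And>x e. x \<in> carrier (T 0) \<Longrightarrow> e \<in> carrier E \<Longrightarrow> \<epsilon> x = e \<odot>\<^bsub>B\<^esub> b1 \<Longrightarrow> u x = e \<odot>\<^bsub>T k\<^esub> z"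
      using invs_hom[OF z] by blast
    have "u x1 = \<one>\<^bsub>E\<^esub> \<odot>\<^bsub>T k\<^esub> z" by (rule u(2)) (use x1 b1 B.smult_one in simp_all)
    moreover have "u (d 1 y) = \<zero>\<^bsub>E\<^esub> \<odot>\<^bsub>T k\<^esub> z" if "y \<in> carrier (T 1)" for y
      by (rule u(2)) (use d1[OF that] b1 B.smult_l_zero in simp_all)
    ultimately show ?thesis using u(1) zc Tk.smult_one Tk.smult_l_zero by auto
  qed
  have "stable_codim 0 n r \<longleftrightarrow> has_codim K (restrict_scalars E (T n)) (inv_cycles n) (d (n + 1) ` invs (n + 1)) r"
    unfolding stable_codim_def
  proof (rule has_codim_transfer_iff[where \<rho> = "\<lambda>u z. u x1 = z"])
    show "module K ?H" "module K (restrict_scalars E (T n))" "submodule (stable_maps 0 n) K ?H"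
      "submodule (inv_cycles n) K (restrict_scalars E (T n))" "\<zero>\<^bsub>?H\<^esub> \<in> null_maps 0 n"
      "\<zero>\<^bsub>restrict_scalars E (T n)\<^esub> \<in> d (n + 1) ` invs (n + 1)"
      by (fact H.module_axioms V.module_axioms stable_maps_submodule inv_cycles_submodule null_maps_zero
        V.submodule_zero[OF inv_boundaries_submodule])+
  next
    fix u assume "u \<in> stable_maps 0 n"
    then show "\<exists>z\<in>inv_cycles n. u x1 = z" using stab[of u] inv[of u n] x1 by (simp add: inv_cycles_def)
  next
    fix z assume z: "z \<in> inv_cycles n"
    then obtain u where u: "u \<in> mod_hom E (T 0) (T n)" "u x1 = z" "\<forall>y\<in>carrier (T 1). u (d 1 y) = \<zero>\<^bsub>T n\<^esub>"
      using hom[of z n] by (auto simp: inv_cycles_def)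
    interpret Tn1: left_module E "T (n - 1)" by (rule T)
    have "d n (u x) = \<zero>\<^bsub>T (n - 1)\<^esub>" if x: "x \<in> carrier (T 0)" for x
    proof -
      obtain e where e: "e \<in> carrier E" "\<epsilon> x = e \<odot>\<^bsub>B\<^esub> b1" using cyclic[OF \<epsilon>D(1)[OF x]] by blast
      have "d n (u x) = e \<odot>\<^bsub>T (n - 1)\<^esub> d n z"
        using gen[OF u(1,3) x e] u(2) dD(3)[OF e(1)] mod_homD(1)[OF u(1) x1(1)] by simp
      then show ?thesis using z e Tn1.smult_r_zero by (simp add: inv_cycles_def)
    qed
    then show "\<exists>u\<in>stable_maps 0 n. u x1 = z" using u by (auto simp: stable_maps_def)
  next
    fix u z assume uS: "u \<in> stable_maps 0 n" and z: "z \<in> inv_cycles n" "u x1 = z"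
    note u = stab[OF uS]
    show "u \<in> null_maps 0 n \<longleftrightarrow> z \<in> d (n + 1) ` invs (n + 1)"
    proof
      assume "u \<in> null_maps 0 n"
      then obtain w where w: "w \<in> mod_hom E (T (0 - 1)) (T (n + 1))" "\<And>x. x \<in> carrier (T 0) \<Longrightarrow> u x = d (n + 1) (w (d 0 x))"
        by (auto simp: null_maps_def)
      \<comment> \<open>After composition with \<open>d 0\<close> the map kills the image of
        \<open>d 1\<close>, so its value at \<open>x1\<close> is an invariant, and the boundary of
        that invariant is \<open>z\<close>.\<close>
      let ?w = "compose (carrier (T 0)) w (d 0)"
      have wh: "?w \<in> mod_hom E (T 0) (T (n + 1))" by (rule mod_hom_compose[OF d w(1) T])
      have "?w (d 1 y) = \<zero>\<^bsub>T (n + 1)\<^esub>" if "y \<in> carrier (T 1)" for y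
        using dd[of y 0] that d1[OF that] mod_hom_zero[OF w(1) T T] by (simp add: compose_eq)
      then have "?w x1 \<in> invs (n + 1)" using inv[OF wh] by blast
      moreover have "z = d (n + 1) (?w x1)" using z w(2)[OF x1(1)] x1 by (simp add: compose_eq)
      ultimately show "z \<in> d (n + 1) ` invs (n + 1)" by blast
    next
      assume "z \<in> d (n + 1) ` invs (n + 1)"
      then obtain z' where z': "z' \<in> invs (n + 1)" "z = d (n + 1) z'" by blast
      obtain v where v: "v \<in> mod_hom E (T 0) (T (n + 1))" "v x1 = z'" "\<forall>y\<in>carrier (T 1). v (d 1 y) = \<zero>\<^bsub>T (n + 1)\<^esub>"
        using hom[OF z'(1)] by blast
      \<comment> \<open>\<open>v\<close> vanishes on the image of \<open>d 1\<close> and therefore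
        extends along \<open>d 0\<close>; the extension is the factorization that a null map
        requires.\<close>
      obtain w where w: "w \<in> mod_hom E (T (0 - 1)) (T (n + 1))" "\<forall>x\<in>carrier (T 0). v x = w (d 0 x)"
        using extend[OF v(1)] v(3) by auto
      have "u x = d (n + 1) (w (d 0 x))" if x: "x \<in> carrier (T 0)" for x
      proof -
        obtain e where e: "e \<in> carrier E" "\<epsilon> x = e \<odot>\<^bsub>B\<^esub> b1" using cyclic[OF \<epsilon>D(1)[OF x]] by blast
        have "u x = e \<odot>\<^bsub>T n\<^esub> d (n + 1) (v x1)" using gen[OF _ _ x e, of u n] u z v(2) z'(2) by simp
        also have "\<dots> = d (n + 1) (v x)"
          using gen[OF v(1,3) x e] dsD(3)[OF e(1)] mod_homD(1)[OF v(1) x1(1)] by simp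
        finally show ?thesis using w(2) x by simp
      qed
      then show "u \<in> null_maps 0 n" using w(1) u by (auto simp: null_maps_def)
    qed
  qed (use x1 in simp_all)
  then show ?thesis by simp
qed

end

section \<open>The Casimir element of a Frobenius algebra\<close>

lemma additive_zero:
  assumes "abelian_group G" "abelian_group H" "h \<in> carrier G \<rightarrow> carrier H"
    and add: "\<And>x y. x \<in> carrier G \<Longrightarrow> y \<in> carrier G \<Longrightarrow> h (x \<oplus>\<^bsub>G\<^esub> y) = h x \<oplus>\<^bsub>H\<^esub> h y"
  shows "h \<zero>\<^bsub>G\<^esub> = \<zero>\<^bsub>H\<^esub>"
proof -
  interpret G: abelian_group G by fact
  interpret H: abelian_group H by fact
  have "h \<zero>\<^bsub>G\<^esub> = h \<zero>\<^bsub>G\<^esub> \<oplus>\<^bsub>H\<^esub> h \<zero>\<^bsub>G\<^esub>" "h \<zero>\<^bsub>G\<^esub> \<in> carrier H" using add[of "\<zero>\<^bsub>G\<^esub>" "\<zero>\<^bsub>G\<^esub>"] assms(3) by auto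
  then show ?thesis by (metis H.add.r_cancel_one')
qed

lemma additive_finsum:
  assumes G: "abelian_group G" and H: "abelian_group H" and h: "h \<in> carrier G \<rightarrow> carrier H"
    and add: "\<And>x y. x \<in> carrier G \<Longrightarrow> y \<in> carrier G \<Longrightarrow> h (x \<oplus>\<^bsub>G\<^esub> y) = h x \<oplus>\<^bsub>H\<^esub> h y"
    and "finite S" "f \<in> S \<rightarrow> carrier G"
  shows "h (finsum G f S) = finsum H (\<lambda>s. h (f s)) S"
  using assms(5,6)
proof (induction S)
  interpret G: abelian_group G by fact
  interpret H: abelian_group H by fact
  case empty
  then show ?case using additive_zero[OF G H h add] by simp
next
  interpret G: abelian_group G by fact
  interpret H: abelian_group H by fact
  case (insert s S)
  then have "f s \<in> carrier G" "f \<in> S \<rightarrow> carrier G" by auto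
  moreover then have "(\<lambda>s. h (f s)) \<in> S \<rightarrow> carrier H" "h (f s) \<in> carrier H" using h by auto
  ultimately show ?case using insert add by simp
qed

lemma (in abelian_monoid) finsum_swap:
  assumes "finite I" "finite J" "\<And>i j. i \<in> I \<Longrightarrow> j \<in> J \<Longrightarrow> f i j \<in> carrier G"
  shows "finsum G (\<lambda>i. finsum G (\<lambda>j. f i j) J) I = finsum G (\<lambda>j. finsum G (\<lambda>i. f i j) I) J"
  using assms(1,3)
proof (induction I)
  case empty then show ?case using assms(2) by simp
next
  case (insert i I)
  have c: "(\<lambda>j. f i j) \<in> J \<rightarrow> carrier G" "(\<lambda>j. finsum G (\<lambda>i. f i j) I) \<in> J \<rightarrow> carrier G"
    using insert.prems by (auto intro!: finsum_closed)
  have "finsum G (\<lambda>j. finsum G (\<lambda>i. f i j) (insert i I)) J = finsum G (\<lambda>j. f i j \<oplus> finsum G (\<lambda>i. f i j) I) J"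
    by (rule finsum_cong') (use insert c in \<open>auto intro!: finsum_insert\<close>)
  also have "\<dots> = finsum G (\<lambda>j. f i j) J \<oplus> finsum G (\<lambda>j. finsum G (\<lambda>i. f i j) I) J"
    by (rule finsum_addf[OF c])
  also have "\<dots> = finsum G (\<lambda>i. finsum G (\<lambda>j. f i j) J) (insert i I)"
    using insert c by (subst finsum_insert) (auto intro!: finsum_closed)
  finally show ?case by simp
qed

lemma (in ring) r_diff: "\<lbrakk>x \<in> carrier R; y \<in> carrier R; z \<in> carrier R\<rbrakk> \<Longrightarrow> z \<otimes> (x \<ominus> y) = z \<otimes> x \<ominus> z \<otimes> y"
  by (simp add: minus_eq r_distr r_minus)

text \<open>The isomorphism \<open>\<phi>\<close> is replaced by the form
  \<open>t = \<phi>(1)\<close>, from which it is recovered by sending \<open>a\<close> to the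
  functional \<open>t (- a)\<close>; \<open>t_rep\<close> and \<open>t_nondeg\<close> express its
  surjectivity and injectivity.\<close>

locale frobenius_form = A: k_alg K A for K :: "('k, 'x) ring_scheme" and A :: "('k, 'a) module" +
  fixes \<nu> :: "'a \<Rightarrow> 'a" and t :: "'a \<Rightarrow> 'k"
  assumes \<nu>_closed: "a \<in> carrier A \<Longrightarrow> \<nu> a \<in> carrier A"
    and \<nu>_invol: "a \<in> carrier A \<Longrightarrow> \<nu> (\<nu> a) = a"
    and t_functional: "functional_on K A (carrier A) t"
    and t_\<nu>: "\<lbrakk>x \<in> carrier A; y \<in> carrier A\<rbrakk> \<Longrightarrow> t (x \<otimes>\<^bsub>A\<^esub> y) = t (\<nu> y \<otimes>\<^bsub>A\<^esub> x)"
    and t_rep: "functional_on K A (carrier A) f \<Longrightarrow> \<exists>a\<in>carrier A. \<forall>x\<in>carrier A. f x = t (x \<otimes>\<^bsub>A\<^esub> a)"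
    and t_nondeg: "\<lbrakk>a \<in> carrier A; \<And>x. x \<in> carrier A \<Longrightarrow> t (x \<otimes>\<^bsub>A\<^esub> a) = \<zero>\<^bsub>K\<^esub>\<rbrakk> \<Longrightarrow> a = \<zero>\<^bsub>A\<^esub>"
begin

lemmas tD = functional_onD[OF t_functional]

lemma t_zero: "t \<zero>\<^bsub>A\<^esub> = \<zero>\<^bsub>K\<^esub>"
  by (rule A.EM.functional_zero[OF t_functional A.EM.carrier_is_submodule])

lemma t_eqI:
  assumes "a \<in> carrier A" "b \<in> carrier A" "\<And>x. x \<in> carrier A \<Longrightarrow> t (x \<otimes>\<^bsub>A\<^esub> a) = t (x \<otimes>\<^bsub>A\<^esub> b)"
  shows "a = b"
proof -
  have "a \<ominus>\<^bsub>A\<^esub> b = \<zero>\<^bsub>A\<^esub>"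
  proof (rule t_nondeg)
    fix x assume x: "x \<in> carrier A"
    have "t (x \<otimes>\<^bsub>A\<^esub> (a \<ominus>\<^bsub>A\<^esub> b)) = t (x \<otimes>\<^bsub>A\<^esub> a) \<ominus>\<^bsub>K\<^esub> t (x \<otimes>\<^bsub>A\<^esub> b)"
      using x assms A.EM.functional_minus[OF t_functional A.EM.carrier_is_submodule] by (simp add: A.E.r_diff)
    then show "t (x \<otimes>\<^bsub>A\<^esub> (a \<ominus>\<^bsub>A\<^esub> b)) = \<zero>\<^bsub>K\<^esub>" using assms x tD(1) by (simp add: A.K.minus_eq A.K.r_neg)
  qed (use assms in simp)
  then show ?thesis by (rule A.E.eq_of_diff_zero[OF assms(1,2)])
qed

end

text \<open>An abstract picture of the enveloping algebra: \<open>L a\<close> is a tensor 1,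
  \<open>R a\<close> is 1 tensor a and so reverses products, and \<open>\<tau>\<close> contracts the
  first factor with \<open>t\<close>. \<open>E_induct\<close> has no cases for scalars or zero,
  since pure tensors absorb both. \<open>B\<close> is the algebra as a bimodule, and
  \<open>e\<close>, \<open>e'\<close> are dual bases for \<open>t\<close>.\<close>

locale enveloping = frobenius_form K A \<nu> t + k_alg K E
    for K :: "('k, 'x) ring_scheme" and A :: "('k, 'a) module" and \<nu> t and E :: "('k, 'e) module" +
  fixes L R :: "'a \<Rightarrow> 'e" and \<tau> :: "'e \<Rightarrow> 'a" and B :: "('e, 'a) module" and e e' :: "nat \<Rightarrow> 'a" and r :: nat
  assumes L_closed: "a \<in> carrier A \<Longrightarrow> L a \<in> carrier E" and R_closed: "a \<in> carrier A \<Longrightarrow> R a \<in> carrier E"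
    and L_mult: "\<lbrakk>a \<in> carrier A; b \<in> carrier A\<rbrakk> \<Longrightarrow> L (a \<otimes>\<^bsub>A\<^esub> b) = L a \<otimes>\<^bsub>E\<^esub> L b"
    and R_mult: "\<lbrakk>a \<in> carrier A; b \<in> carrier A\<rbrakk> \<Longrightarrow> R (a \<otimes>\<^bsub>A\<^esub> b) = R b \<otimes>\<^bsub>E\<^esub> R a"
    and L_add: "\<lbrakk>a \<in> carrier A; b \<in> carrier A\<rbrakk> \<Longrightarrow> L (a \<oplus>\<^bsub>A\<^esub> b) = L a \<oplus>\<^bsub>E\<^esub> L b"
    and R_add: "\<lbrakk>a \<in> carrier A; b \<in> carrier A\<rbrakk> \<Longrightarrow> R (a \<oplus>\<^bsub>A\<^esub> b) = R a \<oplus>\<^bsub>E\<^esub> R b"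
    and L_smult: "\<lbrakk>c \<in> carrier K; a \<in> carrier A\<rbrakk> \<Longrightarrow> L (c \<odot>\<^bsub>A\<^esub> a) = c \<odot>\<^bsub>E\<^esub> L a"
    and R_smult: "\<lbrakk>c \<in> carrier K; a \<in> carrier A\<rbrakk> \<Longrightarrow> R (c \<odot>\<^bsub>A\<^esub> a) = c \<odot>\<^bsub>E\<^esub> R a"
    and L_one: "L \<one>\<^bsub>A\<^esub> = \<one>\<^bsub>E\<^esub>" and R_one: "R \<one>\<^bsub>A\<^esub> = \<one>\<^bsub>E\<^esub>"
    and LR_comm: "\<lbrakk>a \<in> carrier A; b \<in> carrier A\<rbrakk> \<Longrightarrow> R b \<otimes>\<^bsub>E\<^esub> L a = L a \<otimes>\<^bsub>E\<^esub> R b"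
    and E_induct: "\<lbrakk>u \<in> carrier E; \<And>a b. a \<in> carrier A \<Longrightarrow> b \<in> carrier A \<Longrightarrow> P (L a \<otimes>\<^bsub>E\<^esub> R b);
      \<And>u v. \<lbrakk>u \<in> carrier E; v \<in> carrier E; P u; P v\<rbrakk> \<Longrightarrow> P (u \<oplus>\<^bsub>E\<^esub> v)\<rbrakk> \<Longrightarrow> P u"
    and \<tau>_closed: "u \<in> carrier E \<Longrightarrow> \<tau> u \<in> carrier A"
    and \<tau>_add: "\<lbrakk>u \<in> carrier E; v \<in> carrier E\<rbrakk> \<Longrightarrow> \<tau> (u \<oplus>\<^bsub>E\<^esub> v) = \<tau> u \<oplus>\<^bsub>A\<^esub> \<tau> v"
    and \<tau>_LR: "\<lbrakk>a \<in> carrier A; b \<in> carrier A\<rbrakk> \<Longrightarrow> \<tau> (L a \<otimes>\<^bsub>E\<^esub> R b) = t a \<odot>\<^bsub>A\<^esub> b"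
    and B_carrier: "carrier B = carrier A" and B_add: "add B = add A" and B_zero: "\<zero>\<^bsub>B\<^esub> = \<zero>\<^bsub>A\<^esub>"
    and B_module: "left_module E B"
    and B_L: "\<lbrakk>a \<in> carrier A; x \<in> carrier A\<rbrakk> \<Longrightarrow> L a \<odot>\<^bsub>B\<^esub> x = a \<otimes>\<^bsub>A\<^esub> x"
    and B_R: "\<lbrakk>a \<in> carrier A; x \<in> carrier A\<rbrakk> \<Longrightarrow> R a \<odot>\<^bsub>B\<^esub> x = x \<otimes>\<^bsub>A\<^esub> a"
    and e_closed: "i < r \<Longrightarrow> e i \<in> carrier A" and e'_closed: "i < r \<Longrightarrow> e' i \<in> carrier A"
    and e_basis: "x \<in> carrier A \<Longrightarrow> x = finsum A (\<lambda>i. t (e' i \<otimes>\<^bsub>A\<^esub> x) \<odot>\<^bsub>A\<^esub> e i) {..<r}"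
    and e'_basis: "x \<in> carrier A \<Longrightarrow> x = finsum A (\<lambda>i. t (x \<otimes>\<^bsub>A\<^esub> e i) \<odot>\<^bsub>A\<^esub> e' i) {..<r}"
begin

lemmas E_ab = E.is_abelian_group and A_ab = A.E.is_abelian_group

lemma L_finsum: "f \<in> {..<r} \<rightarrow> carrier A \<Longrightarrow> L (finsum A f {..<r}) = finsum E (\<lambda>i. L (f i)) {..<r}"
  by (rule additive_finsum[OF A_ab E_ab]) (auto simp: L_closed L_add)

lemma R_finsum: "f \<in> {..<r} \<rightarrow> carrier A \<Longrightarrow> R (finsum A f {..<r}) = finsum E (\<lambda>i. R (f i)) {..<r}"
  by (rule additive_finsum[OF A_ab E_ab]) (auto simp: R_closed R_add)

lemma \<tau>_zero: "\<tau> \<zero>\<^bsub>E\<^esub> = \<zero>\<^bsub>A\<^esub>"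
  by (rule additive_zero[OF E_ab A_ab]) (auto simp: \<tau>_closed \<tau>_add)

lemma R_zero: "R \<zero>\<^bsub>A\<^esub> = \<zero>\<^bsub>E\<^esub>"
  by (rule additive_zero[OF A_ab E_ab]) (auto simp: R_closed R_add)

lemma coeff_closed: "a \<in> carrier A \<Longrightarrow> i < r \<Longrightarrow> t (e' i \<otimes>\<^bsub>A\<^esub> a) \<in> carrier K"
    "a \<in> carrier A \<Longrightarrow> i < r \<Longrightarrow> t (a \<otimes>\<^bsub>A\<^esub> e i) \<in> carrier K"
  using tD(1) e_closed e'_closed by auto

definition \<omega> where "\<omega> = finsum E (\<lambda>i. L (e i) \<otimes>\<^bsub>E\<^esub> R (e' i)) {..<r}"

lemma \<omega>_closed: "\<omega> \<in> carrier E"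
  unfolding \<omega>_def by (rule E.finsum_closed) (auto simp: e_closed e'_closed L_closed R_closed)

text \<open>Both sides equal the double sum of \<open>m i j\<close> times \<open>e j\<close> tensor
  \<open>e' i\<close>: a linear map on the first factor moves to its transpose on the second. The
  two commutation rules for \<open>\<omega>\<close> are the instances for left and right
  multiplication.\<close>

lemma casimir_move:
  assumes m: "\<And>i j. i < r \<Longrightarrow> j < r \<Longrightarrow> m i j \<in> carrier K"
    and x: "\<And>i. i < r \<Longrightarrow> x i = finsum A (\<lambda>j. m i j \<odot>\<^bsub>A\<^esub> e j) {..<r}"
    and y: "\<And>j. j < r \<Longrightarrow> y j = finsum A (\<lambda>i. m i j \<odot>\<^bsub>A\<^esub> e' i) {..<r}"
  shows "finsum E (\<lambda>i. L (x i) \<otimes>\<^bsub>E\<^esub> R (e' i)) {..<r} = finsum E (\<lambda>j. L (e j) \<otimes>\<^bsub>E\<^esub> R (y j)) {..<r}"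
proof -
  let ?f = "\<lambda>i j. m i j \<odot>\<^bsub>E\<^esub> (L (e j) \<otimes>\<^bsub>E\<^esub> R (e' i))"
  have f: "?f i j \<in> carrier E" if "i < r" "j < r" for i j
    using that m e_closed e'_closed L_closed R_closed by simp
  have 1: "L (x i) \<otimes>\<^bsub>E\<^esub> R (e' i) = finsum E (\<lambda>j. ?f i j) {..<r}" if i: "i < r" for i
  proof -
    have "L (x i) = finsum E (\<lambda>j. L (m i j \<odot>\<^bsub>A\<^esub> e j)) {..<r}"
      unfolding x[OF i] by (rule L_finsum) (use m i e_closed in auto)
    then have "L (x i) \<otimes>\<^bsub>E\<^esub> R (e' i) = finsum E (\<lambda>j. L (m i j \<odot>\<^bsub>A\<^esub> e j) \<otimes>\<^bsub>E\<^esub> R (e' i)) {..<r}"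
      using E.finsum_ldistr[of "{..<r}" "R (e' i)" "\<lambda>j. L (m i j \<odot>\<^bsub>A\<^esub> e j)"] i m e_closed e'_closed L_closed R_closed
      by (simp add: Pi_def)
    also have "\<dots> = finsum E (\<lambda>j. ?f i j) {..<r}"
      by (rule E.finsum_cong') (use f i m e_closed e'_closed in \<open>auto simp: L_smult smult_mult L_closed R_closed\<close>)
    finally show ?thesis .
  qed
  have 2: "L (e j) \<otimes>\<^bsub>E\<^esub> R (y j) = finsum E (\<lambda>i. ?f i j) {..<r}" if j: "j < r" for j
  proof -
    have "R (y j) = finsum E (\<lambda>i. R (m i j \<odot>\<^bsub>A\<^esub> e' i)) {..<r}"
      unfolding y[OF j] by (rule R_finsum) (use m j e'_closed in auto)
    then have "L (e j) \<otimes>\<^bsub>E\<^esub> R (y j) = finsum E (\<lambda>i. L (e j) \<otimes>\<^bsub>E\<^esub> R (m i j \<odot>\<^bsub>A\<^esub> e' i)) {..<r}"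
      using E.finsum_rdistr[of "{..<r}" "L (e j)" "\<lambda>i. R (m i j \<odot>\<^bsub>A\<^esub> e' i)"] j m e_closed e'_closed L_closed R_closed
      by (simp add: Pi_def)
    also have "\<dots> = finsum E (\<lambda>i. ?f i j) {..<r}"
      by (rule E.finsum_cong') (use f j m e_closed e'_closed in \<open>auto simp: R_smult smult_mult L_closed R_closed\<close>)
    finally show ?thesis .
  qed
  have "finsum E (\<lambda>i. L (x i) \<otimes>\<^bsub>E\<^esub> R (e' i)) {..<r} = finsum E (\<lambda>i. finsum E (\<lambda>j. ?f i j) {..<r}) {..<r}"
    by (rule E.finsum_cong') (use 1 f in \<open>auto intro!: E.finsum_closed\<close>)
  also have "\<dots> = finsum E (\<lambda>j. finsum E (\<lambda>i. ?f i j) {..<r}) {..<r}"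
    by (rule E.finsum_swap) (use f in auto)
  also have "\<dots> = finsum E (\<lambda>j. L (e j) \<otimes>\<^bsub>E\<^esub> R (y j)) {..<r}"
    by (rule E.finsum_cong') (use 2 e_closed L_closed R_closed y m e'_closed in \<open>auto intro!: E.m_closed L_closed R_closed A.E.finsum_closed\<close>)
  finally show ?thesis .
qed

text \<open>In the second factor the order is reversed: \<open>R a\<close> from the left appends
  \<open>a\<close> to \<open>e' i\<close> on the right, and \<open>R a\<close> from the right puts
  \<open>a\<close> in front.\<close>

lemma L_\<omega>:
  assumes a: "a \<in> carrier A"
  shows "L a \<otimes>\<^bsub>E\<^esub> \<omega> = finsum E (\<lambda>i. L (a \<otimes>\<^bsub>A\<^esub> e i) \<otimes>\<^bsub>E\<^esub> R (e' i)) {..<r}"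
    and "R a \<otimes>\<^bsub>E\<^esub> \<omega> = finsum E (\<lambda>i. L (e i) \<otimes>\<^bsub>E\<^esub> R (e' i \<otimes>\<^bsub>A\<^esub> a)) {..<r}"
    and "\<omega> \<otimes>\<^bsub>E\<^esub> L a = finsum E (\<lambda>i. L (e i \<otimes>\<^bsub>A\<^esub> a) \<otimes>\<^bsub>E\<^esub> R (e' i)) {..<r}"
    and "\<omega> \<otimes>\<^bsub>E\<^esub> R a = finsum E (\<lambda>i. L (e i) \<otimes>\<^bsub>E\<^esub> R (a \<otimes>\<^bsub>A\<^esub> e' i)) {..<r}"
proof -
  note c = a e_closed e'_closed L_closed R_closed
  have fc: "(\<lambda>i. L (e i) \<otimes>\<^bsub>E\<^esub> R (e' i)) \<in> {..<r} \<rightarrow> carrier E" using c by auto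
  show "L a \<otimes>\<^bsub>E\<^esub> \<omega> = finsum E (\<lambda>i. L (a \<otimes>\<^bsub>A\<^esub> e i) \<otimes>\<^bsub>E\<^esub> R (e' i)) {..<r}"
    unfolding \<omega>_def by (subst E.finsum_rdistr) (use c fc in \<open>auto intro!: E.finsum_cong' simp: L_mult E.m_assoc\<close>)
  show "\<omega> \<otimes>\<^bsub>E\<^esub> R a = finsum E (\<lambda>i. L (e i) \<otimes>\<^bsub>E\<^esub> R (a \<otimes>\<^bsub>A\<^esub> e' i)) {..<r}"
    unfolding \<omega>_def by (subst E.finsum_ldistr) (use c fc in \<open>auto intro!: E.finsum_cong' simp: R_mult E.m_assoc\<close>)
  have 1: "R a \<otimes>\<^bsub>E\<^esub> (L x \<otimes>\<^bsub>E\<^esub> R y) = L x \<otimes>\<^bsub>E\<^esub> R (y \<otimes>\<^bsub>A\<^esub> a)" if "x \<in> carrier A" "y \<in> carrier A" for x y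
    using that c LR_comm[of x a] by (simp add: R_mult flip: E.m_assoc)
  have 2: "L x \<otimes>\<^bsub>E\<^esub> R y \<otimes>\<^bsub>E\<^esub> L a = L (x \<otimes>\<^bsub>A\<^esub> a) \<otimes>\<^bsub>E\<^esub> R y" if "x \<in> carrier A" "y \<in> carrier A" for x y
    using that c LR_comm[of a y] by (simp add: L_mult E.m_assoc)
  show "R a \<otimes>\<^bsub>E\<^esub> \<omega> = finsum E (\<lambda>i. L (e i) \<otimes>\<^bsub>E\<^esub> R (e' i \<otimes>\<^bsub>A\<^esub> a)) {..<r}"
    unfolding \<omega>_def by (subst E.finsum_rdistr) (use c fc in \<open>auto intro!: E.finsum_cong' simp: 1\<close>)
  show "\<omega> \<otimes>\<^bsub>E\<^esub> L a = finsum E (\<lambda>i. L (e i \<otimes>\<^bsub>A\<^esub> a) \<otimes>\<^bsub>E\<^esub> R (e' i)) {..<r}"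
    unfolding \<omega>_def by (subst E.finsum_ldistr) (use c fc in \<open>auto intro!: E.finsum_cong' simp: 2\<close>)
qed

lemma \<omega>_left:
  assumes a: "a \<in> carrier A"
  shows "L a \<otimes>\<^bsub>E\<^esub> \<omega> = R a \<otimes>\<^bsub>E\<^esub> \<omega>"
  unfolding L_\<omega>[OF a]
\<comment> \<open>The matrix of left multiplication by \<open>a\<close> in the basis
  \<open>e\<close>. By associativity the same numbers are the coordinates of \<open>e' j a\<close>
  in the basis \<open>e'\<close>.\<close>
proof (rule casimir_move[where m = "\<lambda>i j. t (e' j \<otimes>\<^bsub>A\<^esub> (a \<otimes>\<^bsub>A\<^esub> e i))"])
  fix j assume "j < r"
  then show "e' j \<otimes>\<^bsub>A\<^esub> a = finsum A (\<lambda>i. t (e' j \<otimes>\<^bsub>A\<^esub> (a \<otimes>\<^bsub>A\<^esub> e i)) \<odot>\<^bsub>A\<^esub> e' i) {..<r}"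
    using e'_basis[of "e' j \<otimes>\<^bsub>A\<^esub> a"] a e_closed e'_closed coeff_closed
    by (simp add: A.E.m_assoc cong: A.E.finsum_cong)
qed (use e_basis coeff_closed e_closed e'_closed a in auto)

lemma \<omega>_right:
  assumes a: "a \<in> carrier A"
  shows "\<omega> \<otimes>\<^bsub>E\<^esub> L a = \<omega> \<otimes>\<^bsub>E\<^esub> R (\<nu> a)"
proof -
  \<comment> \<open>These are the entries of the matrix of right multiplication by \<open>a\<close>.
    Moving \<open>a\<close> to the front inside \<open>t\<close> costs \<open>\<nu>\<close>, and the
    result is a coordinate of \<open>\<nu>(a) e' j\<close> with respect to \<open>e'\<close>; this
    is the origin of the twist.\<close>
  have eq: "t (\<nu> a \<otimes>\<^bsub>A\<^esub> e' j \<otimes>\<^bsub>A\<^esub> e i) = t (e' j \<otimes>\<^bsub>A\<^esub> (e i \<otimes>\<^bsub>A\<^esub> a))" if "i < r" "j < r" for i j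
    using t_\<nu>[of "e' j \<otimes>\<^bsub>A\<^esub> e i" a] that a e_closed e'_closed \<nu>_closed by (simp add: A.E.m_assoc)
  show ?thesis
    unfolding L_\<omega>[OF a] L_\<omega>[OF \<nu>_closed[OF a]]
  proof (rule casimir_move[where m = "\<lambda>i j. t (e' j \<otimes>\<^bsub>A\<^esub> (e i \<otimes>\<^bsub>A\<^esub> a))"])
    fix j assume j: "j < r"
    have "\<nu> a \<otimes>\<^bsub>A\<^esub> e' j = finsum A (\<lambda>i. t (\<nu> a \<otimes>\<^bsub>A\<^esub> e' j \<otimes>\<^bsub>A\<^esub> e i) \<odot>\<^bsub>A\<^esub> e' i) {..<r}"
      by (rule e'_basis) (use a j e'_closed \<nu>_closed in simp)
    also have "\<dots> = finsum A (\<lambda>i. t (e' j \<otimes>\<^bsub>A\<^esub> (e i \<otimes>\<^bsub>A\<^esub> a)) \<odot>\<^bsub>A\<^esub> e' i) {..<r}"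
      by (rule A.E.finsum_cong') (use eq j a e_closed e'_closed coeff_closed in auto)
    finally show "\<nu> a \<otimes>\<^bsub>A\<^esub> e' j = finsum A (\<lambda>i. t (e' j \<otimes>\<^bsub>A\<^esub> (e i \<otimes>\<^bsub>A\<^esub> a)) \<odot>\<^bsub>A\<^esub> e' i) {..<r}" .
  qed (use e_basis coeff_closed e_closed e'_closed a in auto)
qed

text \<open>The coordinates of \<open>x\<close> over the second factor: \<open>x\<close> is the sum
  of the \<open>e i\<close> tensor \<open>slice i x\<close>, because \<open>t (e' i a)\<close> is
  the coefficient of \<open>e i\<close> in \<open>a\<close>.\<close>

definition slice :: "nat \<Rightarrow> 'e \<Rightarrow> 'a" where "slice i x = \<tau> (L (e' i) \<otimes>\<^bsub>E\<^esub> x)"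

lemma slice_closed: "i < r \<Longrightarrow> x \<in> carrier E \<Longrightarrow> slice i x \<in> carrier A"
  by (simp add: slice_def \<tau>_closed L_closed e'_closed)

lemma slice_zero: "i < r \<Longrightarrow> slice i \<zero>\<^bsub>E\<^esub> = \<zero>\<^bsub>A\<^esub>"
  by (simp add: slice_def L_closed e'_closed \<tau>_zero)

lemma slice_sum:
  assumes "x \<in> carrier E"
  shows "x = finsum E (\<lambda>i. L (e i) \<otimes>\<^bsub>E\<^esub> R (slice i x)) {..<r}"
  using assms
proof (rule E_induct)
  fix a b assume ab: "a \<in> carrier A" "b \<in> carrier A"
  have sl: "slice i (L a \<otimes>\<^bsub>E\<^esub> R b) = t (e' i \<otimes>\<^bsub>A\<^esub> a) \<odot>\<^bsub>A\<^esub> b" if "i < r" for i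
    using that ab e'_closed L_closed R_closed \<tau>_LR[of "e' i \<otimes>\<^bsub>A\<^esub> a" b]
    by (simp add: slice_def L_mult E.m_assoc)
  have "L a \<otimes>\<^bsub>E\<^esub> R b = finsum E (\<lambda>i. L (t (e' i \<otimes>\<^bsub>A\<^esub> a) \<odot>\<^bsub>A\<^esub> e i)) {..<r} \<otimes>\<^bsub>E\<^esub> R b"
    using e_basis[OF ab(1)] L_finsum[of "\<lambda>i. t (e' i \<otimes>\<^bsub>A\<^esub> a) \<odot>\<^bsub>A\<^esub> e i"] coeff_closed ab e_closed by (simp add: Pi_def)
  also have "\<dots> = finsum E (\<lambda>i. L (t (e' i \<otimes>\<^bsub>A\<^esub> a) \<odot>\<^bsub>A\<^esub> e i) \<otimes>\<^bsub>E\<^esub> R b) {..<r}"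
    by (rule E.finsum_ldistr) (use coeff_closed ab e_closed L_closed R_closed in auto)
  also have "\<dots> = finsum E (\<lambda>i. L (e i) \<otimes>\<^bsub>E\<^esub> R (slice i (L a \<otimes>\<^bsub>E\<^esub> R b))) {..<r}"
    by (rule E.finsum_cong')
      (use coeff_closed ab e_closed L_closed R_closed in \<open>auto simp: sl L_smult R_smult smult_mult\<close>)
  finally show "L a \<otimes>\<^bsub>E\<^esub> R b = finsum E (\<lambda>i. L (e i) \<otimes>\<^bsub>E\<^esub> R (slice i (L a \<otimes>\<^bsub>E\<^esub> R b))) {..<r}" .
next
  fix x y assume xy: "x \<in> carrier E" "y \<in> carrier E"
    and IH: "x = finsum E (\<lambda>i. L (e i) \<otimes>\<^bsub>E\<^esub> R (slice i x)) {..<r}" "y = finsum E (\<lambda>i. L (e i) \<otimes>\<^bsub>E\<^esub> R (slice i y)) {..<r}"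
  note c = L_closed R_closed e_closed e'_closed slice_closed
  have "x \<oplus>\<^bsub>E\<^esub> y = finsum E (\<lambda>i. L (e i) \<otimes>\<^bsub>E\<^esub> R (slice i x) \<oplus>\<^bsub>E\<^esub> L (e i) \<otimes>\<^bsub>E\<^esub> R (slice i y)) {..<r}"
    using IH by (subst E.finsum_addf) (use xy c in auto)
  also have "\<dots> = finsum E (\<lambda>i. L (e i) \<otimes>\<^bsub>E\<^esub> R (slice i (x \<oplus>\<^bsub>E\<^esub> y))) {..<r}"
  proof (rule E.finsum_cong')
    fix i assume "i \<in> {..<r}"
    then have "slice i (x \<oplus>\<^bsub>E\<^esub> y) = slice i x \<oplus>\<^bsub>A\<^esub> slice i y"
      using xy c by (simp add: slice_def E.r_distr \<tau>_add)
    then show "L (e i) \<otimes>\<^bsub>E\<^esub> R (slice i x) \<oplus>\<^bsub>E\<^esub> L (e i) \<otimes>\<^bsub>E\<^esub> R (slice i y) = L (e i) \<otimes>\<^bsub>E\<^esub> R (slice i (x \<oplus>\<^bsub>E\<^esub> y))"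
      using xy c \<open>i \<in> {..<r}\<close> by (simp add: R_add E.r_distr)
  qed (use xy c in auto)
  finally show "x \<oplus>\<^bsub>E\<^esub> y = finsum E (\<lambda>i. L (e i) \<otimes>\<^bsub>E\<^esub> R (slice i (x \<oplus>\<^bsub>E\<^esub> y))) {..<r}" .
qed

text \<open>Acting on a bimodule, \<open>\<kappa> a\<close> sends \<open>p\<close> to the twisted
  commutator \<open>a p - p \<nu>(a)\<close>.\<close>

definition \<kappa> :: "'a \<Rightarrow> 'e" where "\<kappa> a = L a \<ominus>\<^bsub>E\<^esub> R (\<nu> a)"

lemma \<kappa>_closed: "a \<in> carrier A \<Longrightarrow> \<kappa> a \<in> carrier E"
  by (simp add: \<kappa>_def L_closed R_closed \<nu>_closed)

lemma \<omega>_\<kappa>: "a \<in> carrier A \<Longrightarrow> \<omega> \<otimes>\<^bsub>E\<^esub> \<kappa> a = \<zero>\<^bsub>E\<^esub>"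
  using \<omega>_right[of a] by (simp add: \<kappa>_def E.minus_eq E.r_distr E.r_minus L_closed R_closed \<nu>_closed \<omega>_closed E.r_neg)

text \<open>The contraction yields \<open>c\<close> times the sum of the
  \<open>t (e i) e' i\<close>, and that sum is the expansion of 1. Hence \<open>c\<close> can be
  recovered from \<open>\<omega>\<close> times 1 tensor \<open>c\<close>.\<close>

lemma \<tau>_\<omega>_R:
  assumes c: "c \<in> carrier A"
  shows "\<tau> (\<omega> \<otimes>\<^bsub>E\<^esub> R c) = c"
proof -
  note cl = L_closed R_closed e_closed e'_closed
  have "\<tau> (\<omega> \<otimes>\<^bsub>E\<^esub> R c) = finsum A (\<lambda>i. \<tau> (L (e i) \<otimes>\<^bsub>E\<^esub> R (c \<otimes>\<^bsub>A\<^esub> e' i))) {..<r}"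
    unfolding L_\<omega>(4)[OF c] by (rule additive_finsum[OF E_ab A_ab]) (use c cl \<tau>_closed \<tau>_add in auto)
  also have "\<dots> = finsum A (\<lambda>i. c \<otimes>\<^bsub>A\<^esub> (t (\<one>\<^bsub>A\<^esub> \<otimes>\<^bsub>A\<^esub> e i) \<odot>\<^bsub>A\<^esub> e' i)) {..<r}"
    by (rule A.E.finsum_cong') (use c cl tD(1) in \<open>auto simp: \<tau>_LR A.smult_mult\<close>)
  also have "\<dots> = c \<otimes>\<^bsub>A\<^esub> finsum A (\<lambda>i. t (\<one>\<^bsub>A\<^esub> \<otimes>\<^bsub>A\<^esub> e i) \<odot>\<^bsub>A\<^esub> e' i) {..<r}"
    by (rule A.E.finsum_rdistr[symmetric]) (use c cl tD(1) in auto)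
  also have "\<dots> = c" using e'_basis[of "\<one>\<^bsub>A\<^esub>"] c by simp
  finally show ?thesis .
qed

text \<open>Modulo twisted commutators every \<open>x\<close> has the form 1 tensor
  \<open>c\<close>, since the first factor of \<open>e i\<close> tensor \<open>slice i x\<close> can
  be pushed to the other side. Twisted commutators are killed by \<open>\<omega>\<close>, so
  \<open>\<omega> x = 0\<close> says that \<open>\<omega>\<close> kills 1 tensor \<open>c\<close>,
  and then \<open>c = 0\<close>.\<close>

lemma \<omega>_kernel:
  assumes x: "x \<in> carrier E" and 0: "\<omega> \<otimes>\<^bsub>E\<^esub> x = \<zero>\<^bsub>E\<^esub>"
  shows "x = finsum E (\<lambda>i. \<kappa> (e i) \<otimes>\<^bsub>E\<^esub> R (slice i x)) {..<r}"
proof -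
  note cl = L_closed R_closed e_closed e'_closed \<nu>_closed \<kappa>_closed slice_closed x
  \<comment> \<open>What remains after the \<open>e i\<close> are moved across: replacing
    \<open>e i\<close> tensor \<open>y\<close> by \<open>\<kappa> (e i)\<close> times 1 tensor
    \<open>y\<close> costs 1 tensor \<open>y \<nu>(e i)\<close>.\<close>
  define c where "c = finsum A (\<lambda>i. slice i x \<otimes>\<^bsub>A\<^esub> \<nu> (e i)) {..<r}"
  let ?S = "finsum E (\<lambda>i. \<kappa> (e i) \<otimes>\<^bsub>E\<^esub> R (slice i x)) {..<r}"
  have c: "c \<in> carrier A" unfolding c_def using cl by (auto intro!: A.E.finsum_closed)
  have S: "?S \<in> carrier E" using cl by (auto intro!: E.finsum_closed)
  have "?S \<oplus>\<^bsub>E\<^esub> R c = finsum E (\<lambda>i. \<kappa> (e i) \<otimes>\<^bsub>E\<^esub> R (slice i x) \<oplus>\<^bsub>E\<^esub> R (slice i x \<otimes>\<^bsub>A\<^esub> \<nu> (e i))) {..<r}"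
    unfolding c_def using cl by (subst R_finsum) (auto intro!: E.finsum_addf[symmetric])
  also have "\<dots> = finsum E (\<lambda>i. L (e i) \<otimes>\<^bsub>E\<^esub> R (slice i x)) {..<r}"
    by (rule E.finsum_cong') (use cl in \<open>auto simp: \<kappa>_def E.minus_eq E.l_distr E.l_minus R_mult E.a_assoc E.l_neg\<close>)
  finally have xS: "x = ?S \<oplus>\<^bsub>E\<^esub> R c" using slice_sum[OF x] by simp
  have "\<omega> \<otimes>\<^bsub>E\<^esub> ?S = finsum E (\<lambda>i. \<omega> \<otimes>\<^bsub>E\<^esub> (\<kappa> (e i) \<otimes>\<^bsub>E\<^esub> R (slice i x))) {..<r}"
    by (rule E.finsum_rdistr) (use cl \<omega>_closed in auto)
  also have "\<dots> = finsum E (\<lambda>i. \<zero>\<^bsub>E\<^esub>) {..<r}"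
    by (rule E.finsum_cong') (use cl \<omega>_closed \<omega>_\<kappa> in \<open>auto simp flip: E.m_assoc\<close>)
  finally have "\<omega> \<otimes>\<^bsub>E\<^esub> ?S = \<zero>\<^bsub>E\<^esub>" by simp
  then have "\<omega> \<otimes>\<^bsub>E\<^esub> R c = \<zero>\<^bsub>E\<^esub>"
    using 0 xS E.r_distr[OF S R_closed[OF c] \<omega>_closed] \<omega>_closed R_closed[OF c] by simp
  then have "c = \<zero>\<^bsub>A\<^esub>" using \<tau>_\<omega>_R[OF c] \<tau>_zero by simp
  then show ?thesis using xS S R_zero by simp
qed

text \<open>By the commutation hypothesis, contracting \<open>e' i x\<close> is the same as
  contracting \<open>x e' i\<close>, so each slice of \<open>x\<close> equals
  \<open>\<tau> x\<close> times \<open>e' i\<close>. This is also the second factor belonging to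
  \<open>e i\<close> in \<open>\<omega>\<close> times 1 tensor \<open>\<tau> x\<close>.\<close>

lemma \<omega>_image:
  assumes x: "x \<in> carrier E" and comm: "\<And>a. a \<in> carrier A \<Longrightarrow> L a \<otimes>\<^bsub>E\<^esub> x = R a \<otimes>\<^bsub>E\<^esub> x"
  shows "x = \<omega> \<otimes>\<^bsub>E\<^esub> R (\<tau> x)"
proof -
  note cl = L_closed R_closed e_closed e'_closed slice_closed \<tau>_closed
  have \<tau>R: "\<tau> (R b \<otimes>\<^bsub>E\<^esub> y) = \<tau> y \<otimes>\<^bsub>A\<^esub> b" if b: "b \<in> carrier A" and "y \<in> carrier E" for b y
    using that(2)
  proof (rule E_induct)
    fix a c assume ac: "a \<in> carrier A" "c \<in> carrier A"
    have "R b \<otimes>\<^bsub>E\<^esub> (L a \<otimes>\<^bsub>E\<^esub> R c) = L a \<otimes>\<^bsub>E\<^esub> R (c \<otimes>\<^bsub>A\<^esub> b)"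
      using ac b cl LR_comm[of a b] by (simp add: R_mult flip: E.m_assoc)
    then show "\<tau> (R b \<otimes>\<^bsub>E\<^esub> (L a \<otimes>\<^bsub>E\<^esub> R c)) = \<tau> (L a \<otimes>\<^bsub>E\<^esub> R c) \<otimes>\<^bsub>A\<^esub> b"
      using ac b tD(1) by (simp add: \<tau>_LR A.smult_mult)
  next
    fix u v assume "u \<in> carrier E" "v \<in> carrier E" "\<tau> (R b \<otimes>\<^bsub>E\<^esub> u) = \<tau> u \<otimes>\<^bsub>A\<^esub> b" "\<tau> (R b \<otimes>\<^bsub>E\<^esub> v) = \<tau> v \<otimes>\<^bsub>A\<^esub> b"
    then show "\<tau> (R b \<otimes>\<^bsub>E\<^esub> (u \<oplus>\<^bsub>E\<^esub> v)) = \<tau> (u \<oplus>\<^bsub>E\<^esub> v) \<otimes>\<^bsub>A\<^esub> b"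
      using b cl by (simp add: E.r_distr \<tau>_add A.E.l_distr)
  qed
  have "\<omega> \<otimes>\<^bsub>E\<^esub> R (\<tau> x) = finsum E (\<lambda>i. L (e i) \<otimes>\<^bsub>E\<^esub> R (slice i x)) {..<r}"
    unfolding L_\<omega>(4)[OF \<tau>_closed[OF x]]
  proof (rule E.finsum_cong')
    fix i assume i: "i \<in> {..<r}"
    then have "\<tau> x \<otimes>\<^bsub>A\<^esub> e' i = slice i x" using \<tau>R[of "e' i" x] comm[of "e' i"] e'_closed x by (simp add: slice_def)
    then show "L (e i) \<otimes>\<^bsub>E\<^esub> R (\<tau> x \<otimes>\<^bsub>A\<^esub> e' i) = L (e i) \<otimes>\<^bsub>E\<^esub> R (slice i x)" by simp
  qed (use cl x in auto)
  then show ?thesis using slice_sum[OF x] by simp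
qed

text \<open>Both embeddings of the algebra multiply \<open>\<omega>\<close> from the left in the
  same way, so a tensor b acts on it like the product a b. In particular whatever annihilates 1 in
  \<open>B\<close> annihilates \<open>\<omega>\<close>, and this is how \<open>\<omega>\<close>
  produces invariants.\<close>

lemma mult_\<omega>: "x \<in> carrier E \<Longrightarrow> x \<otimes>\<^bsub>E\<^esub> \<omega> = L (x \<odot>\<^bsub>B\<^esub> \<one>\<^bsub>A\<^esub>) \<otimes>\<^bsub>E\<^esub> \<omega>"
proof (erule E_induct)
  interpret B: left_module E B by (rule B_module)
  note cl = L_closed R_closed \<omega>_closed
  fix a b assume ab: "a \<in> carrier A" "b \<in> carrier A"
  have "L a \<otimes>\<^bsub>E\<^esub> R b \<otimes>\<^bsub>E\<^esub> \<omega> = L (a \<otimes>\<^bsub>A\<^esub> b) \<otimes>\<^bsub>E\<^esub> \<omega>"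
    using ab cl \<omega>_left[of b] by (simp add: E.m_assoc L_mult)
  moreover have "(L a \<otimes>\<^bsub>E\<^esub> R b) \<odot>\<^bsub>B\<^esub> \<one>\<^bsub>A\<^esub> = a \<otimes>\<^bsub>A\<^esub> b"
    using ab cl by (simp add: B.smult_assoc B_carrier B_L B_R)
  ultimately show "L a \<otimes>\<^bsub>E\<^esub> R b \<otimes>\<^bsub>E\<^esub> \<omega> = L ((L a \<otimes>\<^bsub>E\<^esub> R b) \<odot>\<^bsub>B\<^esub> \<one>\<^bsub>A\<^esub>) \<otimes>\<^bsub>E\<^esub> \<omega>" by simp
next
  interpret B: left_module E B by (rule B_module)
  fix x y assume xy: "x \<in> carrier E" "y \<in> carrier E" "x \<otimes>\<^bsub>E\<^esub> \<omega> = L (x \<odot>\<^bsub>B\<^esub> \<one>\<^bsub>A\<^esub>) \<otimes>\<^bsub>E\<^esub> \<omega>"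
    "y \<otimes>\<^bsub>E\<^esub> \<omega> = L (y \<odot>\<^bsub>B\<^esub> \<one>\<^bsub>A\<^esub>) \<otimes>\<^bsub>E\<^esub> \<omega>"
  have c: "x \<odot>\<^bsub>B\<^esub> \<one>\<^bsub>A\<^esub> \<in> carrier A" "y \<odot>\<^bsub>B\<^esub> \<one>\<^bsub>A\<^esub> \<in> carrier A"
    using B.smult_closed[of _ "\<one>\<^bsub>A\<^esub>"] xy by (auto simp: B_carrier)
  show "(x \<oplus>\<^bsub>E\<^esub> y) \<otimes>\<^bsub>E\<^esub> \<omega> = L ((x \<oplus>\<^bsub>E\<^esub> y) \<odot>\<^bsub>B\<^esub> \<one>\<^bsub>A\<^esub>) \<otimes>\<^bsub>E\<^esub> \<omega>"
    using xy c \<omega>_closed L_closed B.smult_l_distr[of x y "\<one>\<^bsub>A\<^esub>"]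
    by (simp add: E.l_distr B_carrier B_add L_add)
qed

text \<open>The case of \<open>E\<close> is applied in each coordinate of a free module containing
  \<open>P\<close>. The elements \<open>\<kappa> (e i)\<close> are the same for all coordinates, so
  the slices assemble; finite support survives because a slice of zero is zero. Then
  \<open>\<pi>\<close> carries the result back to \<open>P\<close>.\<close>

lemma projective_\<omega>_kernel:
  fixes P :: "('e, 'm) module"
  assumes P: "projective_module E P" and p: "p \<in> carrier P" "\<omega> \<odot>\<^bsub>P\<^esub> p = \<zero>\<^bsub>P\<^esub>"
  shows "\<exists>y\<in>{..<r} \<rightarrow> carrier P. p = finsum P (\<lambda>i. \<kappa> (e i) \<odot>\<^bsub>P\<^esub> y i) {..<r}"
proof -
  obtain I :: "'m set" and \<iota> \<pi> where *: "left_module E P" "\<iota> \<in> mod_hom E P (free_module E I)"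
    "\<pi> \<in> mod_hom E (free_module E I) P" "\<And>x. x \<in> carrier P \<Longrightarrow> \<pi> (\<iota> x) = x"
    using P by (auto simp: projective_module_def)
  let ?F = "free_module E I"
  note F = free_left_module[OF E.ring_axioms, of I]
  interpret F: left_module E ?F by (rule F)
  interpret P: left_module E P by (rule *)
  define f where "f = \<iota> p"
  have f: "f \<in> carrier ?F" using mod_homD(1)[OF *(2) p(1)] by (simp add: f_def)
  have fj: "f j \<in> carrier E" for j by (rule E.free_module_carrierD[OF f])
  have "\<omega> \<odot>\<^bsub>?F\<^esub> f = \<zero>\<^bsub>?F\<^esub>"
    using mod_homD(3)[OF *(2) \<omega>_closed p(1)] p(2) mod_hom_zero[OF *(2,1) F] by (simp add: f_def)
  then have 0: "\<omega> \<otimes>\<^bsub>E\<^esub> f j = \<zero>\<^bsub>E\<^esub>" for j by (auto simp: free_module_simps dest: fun_cong)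
  define y where "y i = (\<lambda>j. R (slice i (f j)))" for i
  have y: "y i \<in> carrier ?F" if i: "i < r" for i
  proof -
    have "{j. y i j \<noteq> \<zero>\<^bsub>E\<^esub>} \<subseteq> {j. f j \<noteq> \<zero>\<^bsub>E\<^esub>}" using i slice_zero R_zero by (auto simp: y_def)
    moreover have "finite {j. f j \<noteq> \<zero>\<^bsub>E\<^esub>}" using f by (simp add: free_module_simps)
    ultimately have "finite {j. y i j \<noteq> \<zero>\<^bsub>E\<^esub>}" by (rule finite_subset)
    then show ?thesis using f i slice_zero R_zero R_closed slice_closed fj by (auto simp: free_module_simps y_def)
  qed
  have fc: "(\<lambda>i. \<kappa> (e i) \<odot>\<^bsub>?F\<^esub> y i) \<in> {..<r} \<rightarrow> carrier ?F" using y \<kappa>_closed e_closed F.smult_closed by auto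
  have "f = finsum ?F (\<lambda>i. \<kappa> (e i) \<odot>\<^bsub>?F\<^esub> y i) {..<r}"
  proof
    fix j
    have "finsum ?F (\<lambda>i. \<kappa> (e i) \<odot>\<^bsub>?F\<^esub> y i) {..<r} j = finsum E (\<lambda>i. (\<kappa> (e i) \<odot>\<^bsub>?F\<^esub> y i) j) {..<r}"
      by (rule additive_finsum[OF F.M.abelian_group_axioms E_ab, where h = "\<lambda>g. g j"])
        (use fc E.free_module_carrierD[of _ I] in \<open>auto simp: free_module_simps(3)\<close>)
    also have "\<dots> = f j" using \<omega>_kernel[OF fj 0] by (simp add: free_module_simps(4) y_def)
    finally show "f j = finsum ?F (\<lambda>i. \<kappa> (e i) \<odot>\<^bsub>?F\<^esub> y i) {..<r} j" by simp
  qed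
  then have "p = \<pi> (finsum ?F (\<lambda>i. \<kappa> (e i) \<odot>\<^bsub>?F\<^esub> y i) {..<r})" using *(4)[OF p(1)] by (simp add: f_def)
  also have "\<dots> = finsum P (\<lambda>i. \<pi> (\<kappa> (e i) \<odot>\<^bsub>?F\<^esub> y i)) {..<r}"
    by (rule mod_hom_finsum[OF *(3) F *(1) _ fc]) simp
  also have "\<dots> = finsum P (\<lambda>i. \<kappa> (e i) \<odot>\<^bsub>P\<^esub> \<pi> (y i)) {..<r}"
    by (rule P.M.finsum_cong')
      (use y mod_homD(1,3)[OF *(3)] \<kappa>_closed e_closed P.smult_closed in auto)
  finally show ?thesis using y mod_homD(1)[OF *(3)] by (intro bexI[of _ "\<lambda>i. \<pi> (y i)"]) auto
qed

text \<open>Again coordinatewise: the preimage 1 tensor \<open>\<tau> (f j)\<close> is zero wherever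
  \<open>f j\<close> is, so the coordinates form an element of the free module.\<close>

lemma projective_\<omega>_image:
  fixes P :: "('e, 'm) module"
  assumes P: "projective_module E P" and p: "p \<in> carrier P" "\<And>a. a \<in> carrier A \<Longrightarrow> L a \<odot>\<^bsub>P\<^esub> p = R a \<odot>\<^bsub>P\<^esub> p"
  shows "\<exists>q\<in>carrier P. p = \<omega> \<odot>\<^bsub>P\<^esub> q"
proof -
  obtain I :: "'m set" and \<iota> \<pi> where *: "left_module E P" "\<iota> \<in> mod_hom E P (free_module E I)"
    "\<pi> \<in> mod_hom E (free_module E I) P" "\<And>x. x \<in> carrier P \<Longrightarrow> \<pi> (\<iota> x) = x"
    using P by (auto simp: projective_module_def)
  let ?F = "free_module E I"
  note F = free_left_module[OF E.ring_axioms, of I]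
  interpret F: left_module E ?F by (rule F)
  define f where "f = \<iota> p"
  have f: "f \<in> carrier ?F" using mod_homD(1)[OF *(2) p(1)] by (simp add: f_def)
  have fj: "f j \<in> carrier E" for j by (rule E.free_module_carrierD[OF f])
  have "L a \<odot>\<^bsub>?F\<^esub> f = R a \<odot>\<^bsub>?F\<^esub> f" if "a \<in> carrier A" for a
    using mod_homD(3)[OF *(2) _ p(1)] p(2)[OF that] L_closed R_closed that by (simp add: f_def flip: mod_homD(3)[OF *(2) _ p(1)])
  then have comm: "L a \<otimes>\<^bsub>E\<^esub> f j = R a \<otimes>\<^bsub>E\<^esub> f j" if "a \<in> carrier A" for a j
    using that by (auto simp: free_module_simps dest: fun_cong)
  define y where "y = (\<lambda>j. R (\<tau> (f j)))"
  have y: "y \<in> carrier ?F"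
  proof -
    have "{j. y j \<noteq> \<zero>\<^bsub>E\<^esub>} \<subseteq> {j. f j \<noteq> \<zero>\<^bsub>E\<^esub>}" using \<tau>_zero R_zero by (auto simp: y_def)
    moreover have "finite {j. f j \<noteq> \<zero>\<^bsub>E\<^esub>}" using f by (simp add: free_module_simps)
    ultimately have "finite {j. y j \<noteq> \<zero>\<^bsub>E\<^esub>}" by (rule finite_subset)
    then show ?thesis using f \<tau>_zero R_zero R_closed \<tau>_closed fj by (auto simp: free_module_simps y_def)
  qed
  have "f = \<omega> \<odot>\<^bsub>?F\<^esub> y" using \<omega>_image[OF fj comm] by (auto simp: free_module_simps(4) y_def)
  then have "p = \<omega> \<odot>\<^bsub>P\<^esub> \<pi> y" using *(4)[OF p(1)] mod_homD(3)[OF *(3) \<omega>_closed y] by (simp add: f_def)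
  then show ?thesis using mod_homD(1)[OF *(3) y] by blast
qed

end

section \<open>Duality\<close>

text \<open>\<open>f\<close> descends to the image of \<open>D\<close> and is extended from there to
  \<open>W\<close>. This is exactness of dualization: a functional that kills a kernel comes from a
  functional on the target.\<close>

lemma functional_factor:
  fixes K :: "('k, 'x) ring_scheme" and V :: "('k, 'v, 'y) module_scheme" and W :: "('k, 'w) module"
  assumes V: "module K V" and W: "vspace K W" "fin_spanned K W" and Z: "submodule Z K V"
    and D: "\<And>z. z \<in> Z \<Longrightarrow> D z \<in> carrier W" "\<And>x y. x \<in> Z \<Longrightarrow> y \<in> Z \<Longrightarrow> D (x \<oplus>\<^bsub>V\<^esub> y) = D x \<oplus>\<^bsub>W\<^esub> D y"
      "\<And>c x. c \<in> carrier K \<Longrightarrow> x \<in> Z \<Longrightarrow> D (c \<odot>\<^bsub>V\<^esub> x) = c \<odot>\<^bsub>W\<^esub> D x"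
    and f: "functional_on K V Z f" and ker: "\<And>z. z \<in> Z \<Longrightarrow> D z = \<zero>\<^bsub>W\<^esub> \<Longrightarrow> f z = \<zero>\<^bsub>K\<^esub>"
  shows "\<exists>h. functional_on K W (carrier W) h \<and> (\<forall>z\<in>Z. h (D z) = f z)"
proof -
  interpret V: module K V by fact
  interpret W: vspace K W by fact
  note Zs = V.submoduleE(4,5)[OF Z] V.submodule_zero[OF Z] V.submodule_minus[OF Z]
  have ZC: "Z \<subseteq> carrier V" using Z V.submoduleE(1) by blast
  note fD = functional_onD[OF f]
  have D_minus: "D (x \<ominus>\<^bsub>V\<^esub> y) = D x \<ominus>\<^bsub>W\<^esub> D y" if "x \<in> Z" "y \<in> Z" for x y
  proof -
    have "x \<ominus>\<^bsub>V\<^esub> y = x \<oplus>\<^bsub>V\<^esub> (\<ominus>\<^bsub>K\<^esub> \<one>\<^bsub>K\<^esub>) \<odot>\<^bsub>V\<^esub> y" using that ZC V.minus_smult[of y] by (auto simp: V.M.minus_eq)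
    then show ?thesis using that D Zs(1) W.minus_smult[of "D y"] by (simp add: W.M.minus_eq)
  qed
  have wd: "f x = f y" if "x \<in> Z" "y \<in> Z" "D x = D y" for x y
  proof -
    have "D (x \<ominus>\<^bsub>V\<^esub> y) = \<zero>\<^bsub>W\<^esub>" using D_minus that D(1) by (simp add: W.M.minus_eq W.M.r_neg)
    then have "f (x \<ominus>\<^bsub>V\<^esub> y) = \<zero>\<^bsub>K\<^esub>" using ker Zs(4) that by blast
    then have "f x \<ominus>\<^bsub>K\<^esub> f y = \<zero>\<^bsub>K\<^esub>" using that V.functional_minus[OF f Z] by simp
    then show ?thesis by (rule V.R.eq_of_diff_zero[rotated 2]) (use fD(1) that in auto)
  qed
  define g where "g y = f (SOME z. z \<in> Z \<and> D z = y)" for y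
  have g: "g (D z) = f z" if z: "z \<in> Z" for z
  proof -
    have "\<exists>w. w \<in> Z \<and> D w = D z" using z by blast
    then have "(SOME w. w \<in> Z \<and> D w = D z) \<in> Z \<and> D (SOME w. w \<in> Z \<and> D w = D z) = D z" by (rule someI_ex)
    then show ?thesis unfolding g_def by (intro wd) (use z in auto)
  qed
  have DZ: "submodule (D ` Z) K W"
  proof (rule W.submoduleI')
    show "D ` Z \<subseteq> carrier W" using D(1) by auto
    have "D (\<zero>\<^bsub>V\<^esub> \<ominus>\<^bsub>V\<^esub> \<zero>\<^bsub>V\<^esub>) = \<zero>\<^bsub>W\<^esub>" using D_minus[OF Zs(3) Zs(3)] D(1)[OF Zs(3)] by (simp add: W.M.minus_eq W.M.r_neg)
    then show "\<zero>\<^bsub>W\<^esub> \<in> D ` Z" using Zs(4)[OF Zs(3) Zs(3)] by (metis imageI)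
  next
    fix a b assume "a \<in> D ` Z" "b \<in> D ` Z"
    then show "a \<oplus>\<^bsub>W\<^esub> b \<in> D ` Z" using D(2) Zs(2) by (auto simp flip: D(2))
  next
    fix c a assume "c \<in> carrier K" "a \<in> D ` Z"
    then show "c \<odot>\<^bsub>W\<^esub> a \<in> D ` Z" using D(3) Zs(1) by (auto simp flip: D(3))
  qed
  have "functional_on K W (D ` Z) g"
    unfolding functional_on_def
  proof (intro conjI ballI)
    show "g \<in> D ` Z \<rightarrow> carrier K" using g fD(1) by auto
  next
    fix a b assume "a \<in> D ` Z" "b \<in> D ` Z"
    then obtain x y where xy: "x \<in> Z" "y \<in> Z" "a = D x" "b = D y" by auto
    then show "g (a \<oplus>\<^bsub>W\<^esub> b) = g a \<oplus>\<^bsub>K\<^esub> g b" using g[of "x \<oplus>\<^bsub>V\<^esub> y"] g D(2) Zs(2) fD(2) by simp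
  next
    fix c a assume "c \<in> carrier K" "a \<in> D ` Z"
    then obtain x where xy: "c \<in> carrier K" "x \<in> Z" "a = D x" by auto
    then show "g (c \<odot>\<^bsub>W\<^esub> a) = c \<otimes>\<^bsub>K\<^esub> g a" using g[of "c \<odot>\<^bsub>V\<^esub> x"] g D(3) Zs(1) fD(3) by simp
  qed
  from W.functional_extend[OF W(2) DZ this] obtain h where
    h: "functional_on K W (carrier W) h" "\<forall>y\<in>D ` Z. h y = g y" by blast
  then show ?thesis using g by auto
qed

lemma (in module) functional_finsum:
  assumes Z: "submodule Z R M" and "finite I" "\<And>i. i \<in> I \<Longrightarrow> c i \<in> carrier R" "\<And>i. i \<in> I \<Longrightarrow> functional_on R M Z (f i)"
  shows "functional_on R M Z (\<lambda>z. finsum R (\<lambda>i. c i \<otimes> f i z) I)"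
  unfolding functional_on_def
proof (intro conjI ballI)
  have cl: "(\<lambda>i. c i \<otimes> f i z) \<in> I \<rightarrow> carrier R" if "z \<in> Z" for z
    using assms(3) functional_onD(1)[OF assms(4)] that by auto
  show "(\<lambda>z. finsum R (\<lambda>i. c i \<otimes> f i z) I) \<in> Z \<rightarrow> carrier R" using cl by (auto intro!: R.finsum_closed)
  show "finsum R (\<lambda>i. c i \<otimes> f i (x \<oplus>\<^bsub>M\<^esub> y)) I = finsum R (\<lambda>i. c i \<otimes> f i x) I \<oplus> finsum R (\<lambda>i. c i \<otimes> f i y) I"
    if "x \<in> Z" "y \<in> Z" for x y
    unfolding R.finsum_addf[OF cl[OF that(1)] cl[OF that(2)], symmetric]
    by (rule R.finsum_cong') (use that assms(3) functional_onD(1,2)[OF assms(4)] in \<open>auto simp: R.r_distr\<close>)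
  show "finsum R (\<lambda>i. c i \<otimes> f i (k \<odot>\<^bsub>M\<^esub> x)) I = k \<otimes> finsum R (\<lambda>i. c i \<otimes> f i x) I"
    if "k \<in> carrier R" "x \<in> Z" for k x
    unfolding R.finsum_rdistr[OF assms(2) that(1) cl[OF that(2)]]
    by (rule R.finsum_cong') (use that assms(3) functional_onD(1,3)[OF assms(4)] in \<open>auto simp: R.m_lcomm\<close>)
qed

context enveloping
begin

lemma B_plus: "x \<oplus>\<^bsub>B\<^esub> y = x \<oplus>\<^bsub>A\<^esub> y"
  by (simp add: B_add)

lemma sc_L: "c \<in> carrier K \<Longrightarrow> sc c = L (c \<odot>\<^bsub>A\<^esub> \<one>\<^bsub>A\<^esub>)"
  by (simp add: L_smult L_one)

lemma B_sc: "c \<in> carrier K \<Longrightarrow> x \<in> carrier A \<Longrightarrow> sc c \<odot>\<^bsub>B\<^esub> x = c \<odot>\<^bsub>A\<^esub> x"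
  by (simp add: sc_L B_L A.sc_smult)

lemma hom_functional:
  assumes P: "left_module E P" and g: "g \<in> mod_hom E P B"
  shows "functional_on K (restrict_scalars E P) (carrier P) (\<lambda>p. t (g p))"
  using mod_homD(1-3)[OF g] tD sc_closed
  by (auto simp: functional_on_def B_carrier B_plus B_sc)

text \<open>The kernel of \<open>\<omega>\<close> consists of sums of twisted commutators
  \<open>a y - y \<nu>(a)\<close>, and \<open>t\<close> vanishes on their images
  \<open>a x - x \<nu>(a)\<close>. So the composite of \<open>t\<close> and \<open>g\<close> depends
  on \<open>p\<close> only through \<open>\<omega> p\<close>.\<close>

lemma hom_\<omega>_kernel:
  fixes P :: "('e, 'm) module"
  assumes P: "projective_module E P" and g: "g \<in> mod_hom E P B" and p: "p \<in> carrier P" "\<omega> \<odot>\<^bsub>P\<^esub> p = \<zero>\<^bsub>P\<^esub>"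
  shows "t (g p) = \<zero>\<^bsub>K\<^esub>"
proof -
  have PM: "left_module E P" using P by (simp add: projective_module_def)
  interpret P: left_module E P by (rule PM)
  interpret V: module K "restrict_scalars E P" by (rule restrict_scalars_module[OF PM])
  interpret B: left_module E B by (rule B_module)
  obtain y where y: "y \<in> {..<r} \<rightarrow> carrier P" "p = finsum P (\<lambda>i. \<kappa> (e i) \<odot>\<^bsub>P\<^esub> y i) {..<r}"
    using projective_\<omega>_kernel[OF P p] by blast
  have yc: "i < r \<Longrightarrow> y i \<in> carrier P" for i using y(1) by auto
  note gD = mod_homD[OF g, unfolded B_carrier]
  show ?thesis unfolding y(2)
  proof (rule P.M.finsum_induct)
    show "(\<lambda>i. \<kappa> (e i) \<odot>\<^bsub>P\<^esub> y i) \<in> {..<r} \<rightarrow> carrier P" using yc \<kappa>_closed e_closed P.smult_closed by auto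
    show "t (g \<zero>\<^bsub>P\<^esub>) = \<zero>\<^bsub>K\<^esub>" using mod_hom_zero[OF g PM B_module] t_zero B_zero by simp
    show "t (g (a \<oplus>\<^bsub>P\<^esub> b)) = \<zero>\<^bsub>K\<^esub>" if "a \<in> carrier P" "b \<in> carrier P" "t (g a) = \<zero>\<^bsub>K\<^esub>" "t (g b) = \<zero>\<^bsub>K\<^esub>" for a b
      using that gD tD by (simp add: B_plus)
  next
    fix i assume i: "i \<in> {..<r}"
    let ?a = "e i" and ?x = "g (y i)"
    have c: "?a \<in> carrier A" "y i \<in> carrier P" "?x \<in> carrier A" using i e_closed y gD(1) by auto
    have "g (\<kappa> ?a \<odot>\<^bsub>P\<^esub> y i) = \<kappa> ?a \<odot>\<^bsub>B\<^esub> ?x" using gD(3) \<kappa>_closed c by simp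
    also have "\<dots> = ?a \<otimes>\<^bsub>A\<^esub> ?x \<ominus>\<^bsub>B\<^esub> ?x \<otimes>\<^bsub>A\<^esub> \<nu> ?a"
      using c L_closed R_closed \<nu>_closed by (simp add: \<kappa>_def B.smult_l_diff B_carrier B_L B_R)
    also have "\<dots> = ?a \<otimes>\<^bsub>A\<^esub> ?x \<ominus>\<^bsub>A\<^esub> ?x \<otimes>\<^bsub>A\<^esub> \<nu> ?a"
      using B_add by (simp add: a_minus_def a_inv_def m_inv_def B_zero B_carrier)
    finally have "t (g (\<kappa> ?a \<odot>\<^bsub>P\<^esub> y i)) = t (?a \<otimes>\<^bsub>A\<^esub> ?x) \<ominus>\<^bsub>K\<^esub> t (?x \<otimes>\<^bsub>A\<^esub> \<nu> ?a)"
      using c \<nu>_closed A.EM.functional_minus[OF t_functional A.EM.carrier_is_submodule] by simp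
    \<comment> \<open>The rule for \<open>t\<close> brings \<open>\<nu>(a)\<close> to the front as
      \<open>\<nu>(\<nu>(a))\<close>, which the involution hypothesis turns into
      \<open>a\<close>.\<close>
    also have "t (?x \<otimes>\<^bsub>A\<^esub> \<nu> ?a) = t (?a \<otimes>\<^bsub>A\<^esub> ?x)" using t_\<nu>[of ?x "\<nu> ?a"] c \<nu>_closed \<nu>_invol by simp
    finally show "t (g (\<kappa> ?a \<odot>\<^bsub>P\<^esub> y i)) = \<zero>\<^bsub>K\<^esub>" using c tD(1) by (simp add: A.K.minus_eq A.K.r_neg)
  qed simp
qed

text \<open>For fixed \<open>p\<close> the form sending \<open>x\<close> to \<open>l (x p)\<close>
  is represented by a unique \<open>g p\<close> in the algebra. Compatibility with the left action
  is built into this; compatibility with the right action combines the twisted invariance of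
  \<open>l\<close> with the rule for \<open>t\<close>.\<close>

lemma hom_of_functional:
  assumes P: "left_module E P" and l: "functional_on K (restrict_scalars E P) (carrier P) l"
    and tw: "\<And>a p. a \<in> carrier A \<Longrightarrow> p \<in> carrier P \<Longrightarrow> l (L a \<odot>\<^bsub>P\<^esub> p) = l (R (\<nu> a) \<odot>\<^bsub>P\<^esub> p)"
  shows "\<exists>g\<in>mod_hom E P B. \<forall>p\<in>carrier P. t (g p) = l p"
proof -
  interpret P: left_module E P by (rule P)
  interpret B: left_module E B by (rule B_module)
  note lD = functional_onD[OF l, simplified]
  note cl = L_closed R_closed P.smult_closed
  have ex: "\<exists>a\<in>carrier A. \<forall>x\<in>carrier A. l (L x \<odot>\<^bsub>P\<^esub> p) = t (x \<otimes>\<^bsub>A\<^esub> a)" if p: "p \<in> carrier P" for p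
  proof (rule t_rep)
    show "functional_on K A (carrier A) (\<lambda>x. l (L x \<odot>\<^bsub>P\<^esub> p))"
      unfolding functional_on_def
    proof (intro conjI ballI)
      fix c x assume "c \<in> carrier K" "x \<in> carrier A"
      then have "L (c \<odot>\<^bsub>A\<^esub> x) \<odot>\<^bsub>P\<^esub> p = sc c \<odot>\<^bsub>P\<^esub> (L x \<odot>\<^bsub>P\<^esub> p)"
        using p cl by (simp add: L_smult sc_smult flip: P.smult_assoc)
      then show "l (L (c \<odot>\<^bsub>A\<^esub> x) \<odot>\<^bsub>P\<^esub> p) = c \<otimes>\<^bsub>K\<^esub> l (L x \<odot>\<^bsub>P\<^esub> p)"
        using lD(3) \<open>c \<in> carrier K\<close> \<open>x \<in> carrier A\<close> p cl by simp
    qed (use lD(1,2) p cl in \<open>auto simp: L_add P.smult_l_distr\<close>)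
  qed
  then obtain g where g: "\<And>p. p \<in> carrier P \<Longrightarrow> g p \<in> carrier A"
    "\<And>p x. p \<in> carrier P \<Longrightarrow> x \<in> carrier A \<Longrightarrow> l (L x \<odot>\<^bsub>P\<^esub> p) = t (x \<otimes>\<^bsub>A\<^esub> g p)" by metis
  have uniq: "g p = a" if "p \<in> carrier P" "a \<in> carrier A" "\<And>x. x \<in> carrier A \<Longrightarrow> l (L x \<odot>\<^bsub>P\<^esub> p) = t (x \<otimes>\<^bsub>A\<^esub> a)" for p a
    by (rule t_eqI) (use that g in auto)
  have Bc: "x \<in> carrier E \<Longrightarrow> a \<in> carrier A \<Longrightarrow> x \<odot>\<^bsub>B\<^esub> a \<in> carrier A" for x a
    using B.smult_closed[of x a] by (simp add: B_carrier)
  have gadd: "g (p \<oplus>\<^bsub>P\<^esub> q) = g p \<oplus>\<^bsub>A\<^esub> g q" if "p \<in> carrier P" "q \<in> carrier P" for p q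
    by (rule uniq) (use that g lD(2) tD(2) cl in \<open>auto simp: P.smult_r_distr A.E.r_distr\<close>)
  have gsm: "g (x \<odot>\<^bsub>P\<^esub> p) = x \<odot>\<^bsub>B\<^esub> g p" if "x \<in> carrier E" and p: "p \<in> carrier P" for x p
    using that(1)
  proof (rule E_induct)
    fix a b assume ab: "a \<in> carrier A" "b \<in> carrier A"
    have eq: "(L a \<otimes>\<^bsub>E\<^esub> R b) \<odot>\<^bsub>B\<^esub> g p = a \<otimes>\<^bsub>A\<^esub> g p \<otimes>\<^bsub>A\<^esub> b"
      using ab g p cl by (simp add: B.smult_assoc B_carrier B_L B_R A.E.m_assoc)
    show "g ((L a \<otimes>\<^bsub>E\<^esub> R b) \<odot>\<^bsub>P\<^esub> p) = (L a \<otimes>\<^bsub>E\<^esub> R b) \<odot>\<^bsub>B\<^esub> g p"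
      unfolding eq
    proof (rule uniq)
      fix x assume x: "x \<in> carrier A"
      let ?q = "L (x \<otimes>\<^bsub>A\<^esub> a) \<odot>\<^bsub>P\<^esub> p"
      have q: "?q \<in> carrier P" using x ab p cl by simp
      have "L x \<otimes>\<^bsub>E\<^esub> (L a \<otimes>\<^bsub>E\<^esub> R b) = R b \<otimes>\<^bsub>E\<^esub> L (x \<otimes>\<^bsub>A\<^esub> a)"
        using x ab cl LR_comm[of "x \<otimes>\<^bsub>A\<^esub> a" b] by (simp add: L_mult E.m_assoc)
      then have "L x \<odot>\<^bsub>P\<^esub> ((L a \<otimes>\<^bsub>E\<^esub> R b) \<odot>\<^bsub>P\<^esub> p) = R b \<odot>\<^bsub>P\<^esub> ?q"
        using x ab p cl P.smult_assoc[of "L x" "L a \<otimes>\<^bsub>E\<^esub> R b" p] P.smult_assoc[of "R b" "L (x \<otimes>\<^bsub>A\<^esub> a)" p] by simp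
      \<comment> \<open>\<open>tw\<close> is read at \<open>\<nu>(b)\<close>: the action of
        \<open>b\<close> from the right is traded for that of \<open>\<nu>(b)\<close> from the left
        because \<open>\<nu>(\<nu>(b)) = b\<close>. The rule for \<open>t\<close> undoes the trade
        below.\<close>
      then have "l (L x \<odot>\<^bsub>P\<^esub> ((L a \<otimes>\<^bsub>E\<^esub> R b) \<odot>\<^bsub>P\<^esub> p)) = l (L (\<nu> b) \<odot>\<^bsub>P\<^esub> ?q)"
        using tw[OF \<nu>_closed[OF ab(2)] q] \<nu>_invol ab by simp
      also have "L (\<nu> b) \<odot>\<^bsub>P\<^esub> ?q = L (\<nu> b \<otimes>\<^bsub>A\<^esub> (x \<otimes>\<^bsub>A\<^esub> a)) \<odot>\<^bsub>P\<^esub> p"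
        using x ab p cl \<nu>_closed L_mult[of "\<nu> b" "x \<otimes>\<^bsub>A\<^esub> a"] by (simp add: P.smult_assoc)
      also have "l \<dots> = t (\<nu> b \<otimes>\<^bsub>A\<^esub> (x \<otimes>\<^bsub>A\<^esub> a \<otimes>\<^bsub>A\<^esub> g p))"
        using g(2)[OF p, of "\<nu> b \<otimes>\<^bsub>A\<^esub> (x \<otimes>\<^bsub>A\<^esub> a)"] x ab \<nu>_closed g(1)[OF p] by (simp add: A.E.m_assoc)
      also have "\<dots> = t (x \<otimes>\<^bsub>A\<^esub> (a \<otimes>\<^bsub>A\<^esub> g p \<otimes>\<^bsub>A\<^esub> b))"
        using t_\<nu>[of "x \<otimes>\<^bsub>A\<^esub> a \<otimes>\<^bsub>A\<^esub> g p" b] x ab g(1)[OF p] by (simp add: A.E.m_assoc)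
      finally show "l (L x \<odot>\<^bsub>P\<^esub> ((L a \<otimes>\<^bsub>E\<^esub> R b) \<odot>\<^bsub>P\<^esub> p)) = t (x \<otimes>\<^bsub>A\<^esub> (a \<otimes>\<^bsub>A\<^esub> g p \<otimes>\<^bsub>A\<^esub> b))" .
    qed (use ab p g cl in auto)
  next
    fix u v assume "u \<in> carrier E" "v \<in> carrier E" "g (u \<odot>\<^bsub>P\<^esub> p) = u \<odot>\<^bsub>B\<^esub> g p" "g (v \<odot>\<^bsub>P\<^esub> p) = v \<odot>\<^bsub>B\<^esub> g p"
    then show "g ((u \<oplus>\<^bsub>E\<^esub> v) \<odot>\<^bsub>P\<^esub> p) = (u \<oplus>\<^bsub>E\<^esub> v) \<odot>\<^bsub>B\<^esub> g p"
      using p g(1)[OF p] P.smult_closed by (simp add: P.smult_l_distr B.smult_l_distr gadd B_carrier B_plus)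
  qed
  have "(\<lambda>p\<in>carrier P. g p) \<in> mod_hom E P B"
    by (rule left_module_restrict_homI[OF P]) (use g(1) gadd gsm in \<open>auto simp: B_carrier B_plus\<close>)
  moreover have "t (g p) = l p" if "p \<in> carrier P" for p
    using g(2)[OF that A.E.one_closed] g(1)[OF that] that by (simp add: L_one P.smult_one)
  ultimately show ?thesis by (intro bexI) auto
qed

text \<open>By left linearity \<open>t (x g(p))\<close> is the value of the composite with
  \<open>t\<close> at \<open>x p\<close>, so this composite determines \<open>g\<close> by
  nondegeneracy.\<close>

lemma hom_zeroI:
  assumes P: "left_module E P" and g: "g \<in> mod_hom E P B" "g' \<in> mod_hom E P B"
    and 0: "\<And>p. p \<in> carrier P \<Longrightarrow> t (g p) = t (g' p)" and p: "p \<in> carrier P"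
  shows "g p = g' p"
proof (rule t_eqI)
  interpret P: left_module E P by (rule P)
  show "g p \<in> carrier A" "g' p \<in> carrier A" using mod_homD(1)[OF g(1) p] mod_homD(1)[OF g(2) p] by (simp_all add: B_carrier)
  fix x assume x: "x \<in> carrier A"
  have "L x \<odot>\<^bsub>P\<^esub> p \<in> carrier P" using x p L_closed P.smult_closed by simp
  then show "t (x \<otimes>\<^bsub>A\<^esub> g p) = t (x \<otimes>\<^bsub>A\<^esub> g' p)"
    using 0[of "L x \<odot>\<^bsub>P\<^esub> p"] mod_homD(3)[OF g(1) L_closed[OF x] p] mod_homD(3)[OF g(2) L_closed[OF x] p]
      B_L[OF x] \<open>g p \<in> carrier A\<close> \<open>g' p \<in> carrier A\<close> by simp
qed

text \<open>\<open>E\<close> is spanned by the finitely many \<open>e i\<close> tensor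
  \<open>e j\<close>; applied to generators of \<open>P\<close> over \<open>E\<close> they span
  \<open>P\<close> over \<open>K\<close>.\<close>

lemma fin_spanned_restrict_scalars:
  assumes P: "left_module E P" and fg: "fin_gen E P"
  shows "fin_spanned K (restrict_scalars E P)"
proof -
  interpret P: left_module E P by (rule P)
  interpret V: module K "restrict_scalars E P" by (rule restrict_scalars_module[OF P])
  obtain S where S: "finite S" "S \<subseteq> carrier P" "\<forall>x\<in>carrier P. \<exists>c\<in>S \<rightarrow> carrier E. x = finsum P (\<lambda>s. c s \<odot>\<^bsub>P\<^esub> s) S"
    using fg by (auto simp: fin_gen_def)
  note cl = L_closed R_closed e_closed P.smult_closed
  define S' where "S' = (\<lambda>(i, j, s). L (e i) \<odot>\<^bsub>P\<^esub> (R (e j) \<odot>\<^bsub>P\<^esub> s)) ` ({..<r} \<times> {..<r} \<times> S)"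
  have "finite S'" using S(1) by (simp add: S'_def)
  moreover have "S' \<subseteq> carrier P" using S(2) cl by (auto simp: S'_def)
  moreover have "U = carrier P" if U: "submodule U K (restrict_scalars E P)" and SU: "S' \<subseteq> U" for U
  proof
    note Us = V.submoduleE[OF U, simplified] V.submodule_zero[OF U, simplified]
    show "U \<subseteq> carrier P" by (rule Us)
    \<comment> \<open>Stated for a general \<open>H\<close> so that it serves twice, with
      \<open>L\<close> for the first factor and with \<open>R\<close> for the second.\<close>
    have span: "H a \<odot>\<^bsub>P\<^esub> p \<in> U"
      if H: "\<And>a. a \<in> carrier A \<Longrightarrow> H a \<in> carrier E" "\<And>f. f \<in> {..<r} \<rightarrow> carrier A \<Longrightarrow> H (finsum A f {..<r}) = finsum E (\<lambda>i. H (f i)) {..<r}"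
        "\<And>c a. c \<in> carrier K \<Longrightarrow> a \<in> carrier A \<Longrightarrow> H (c \<odot>\<^bsub>A\<^esub> a) = c \<odot>\<^bsub>E\<^esub> H a"
        and p: "p \<in> carrier P" and gen: "\<And>i. i < r \<Longrightarrow> H (e i) \<odot>\<^bsub>P\<^esub> p \<in> U" and a: "a \<in> carrier A" for H a p
    proof -
      define c where "c i = t (e' i \<otimes>\<^bsub>A\<^esub> a)" for i
      have c: "i < r \<Longrightarrow> c i \<in> carrier K" for i using coeff_closed(1)[OF a] by (simp add: c_def)
      have "a = finsum A (\<lambda>i. c i \<odot>\<^bsub>A\<^esub> e i) {..<r}" unfolding c_def by (rule e_basis[OF a])
      then have "H a = finsum E (\<lambda>i. H (c i \<odot>\<^bsub>A\<^esub> e i)) {..<r}" using H(2)[of "\<lambda>i. c i \<odot>\<^bsub>A\<^esub> e i"] c e_closed by (simp add: Pi_def)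
      then have "H a \<odot>\<^bsub>P\<^esub> p = finsum P (\<lambda>i. H (c i \<odot>\<^bsub>A\<^esub> e i) \<odot>\<^bsub>P\<^esub> p) {..<r}"
        using P.finsum_smult_l[of "{..<r}" "\<lambda>i. H (c i \<odot>\<^bsub>A\<^esub> e i)" p] p c e_closed H(1) by (simp add: Pi_def)
      also have "\<dots> \<in> U"
      proof (rule P.M.finsum_induct)
        fix i assume "i \<in> {..<r}"
        then have "H (c i \<odot>\<^bsub>A\<^esub> e i) \<odot>\<^bsub>P\<^esub> p = sc (c i) \<odot>\<^bsub>P\<^esub> (H (e i) \<odot>\<^bsub>P\<^esub> p)"
          using c e_closed H p by (simp add: sc_smult flip: P.smult_assoc)
        then show "H (c i \<odot>\<^bsub>A\<^esub> e i) \<odot>\<^bsub>P\<^esub> p \<in> U" using Us(4)[OF c gen] \<open>i \<in> {..<r}\<close> by simp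
      qed (use H c e_closed p cl Us(5,7) in auto)
      finally show ?thesis .
    qed
    have gen: "x \<odot>\<^bsub>P\<^esub> s \<in> U" if "x \<in> carrier E" "s \<in> S" for x s
      using that(1)
    proof (rule E_induct)
      fix a b assume ab: "a \<in> carrier A" "b \<in> carrier A"
      have s: "s \<in> carrier P" using that S by auto
      have gen0: "L (e i) \<odot>\<^bsub>P\<^esub> (R (e j) \<odot>\<^bsub>P\<^esub> s) \<in> U" if "i < r" "j < r" for i j
        using SU \<open>s \<in> S\<close> that by (auto simp: S'_def image_subset_iff)
      have gen1: "L a \<odot>\<^bsub>P\<^esub> (R (e j) \<odot>\<^bsub>P\<^esub> s) \<in> U" if "j < r" for j
        by (rule span[of L]) (use that ab s cl L_finsum L_smult gen0 in auto)
      \<comment> \<open>The two actions commute, so the result about \<open>L a\<close> can be fed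
        into \<open>span\<close> once more, now with \<open>L a\<close> applied to \<open>s\<close>
        as the base vector.\<close>
      have gen2: "R (e j) \<odot>\<^bsub>P\<^esub> (L a \<odot>\<^bsub>P\<^esub> s) \<in> U" if j: "j < r" for j
      proof -
        have "R (e j) \<odot>\<^bsub>P\<^esub> (L a \<odot>\<^bsub>P\<^esub> s) = (R (e j) \<otimes>\<^bsub>E\<^esub> L a) \<odot>\<^bsub>P\<^esub> s" using j ab s cl by (simp add: P.smult_assoc)
        also have "\<dots> = L a \<odot>\<^bsub>P\<^esub> (R (e j) \<odot>\<^bsub>P\<^esub> s)" using j ab s cl by (simp add: LR_comm P.smult_assoc)
        finally show ?thesis using gen1[OF j] by (simp only:)
      qed
      have "R b \<odot>\<^bsub>P\<^esub> (L a \<odot>\<^bsub>P\<^esub> s) \<in> U"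
        by (rule span[of R]) (use ab s cl R_finsum R_smult gen2 in auto)
      then show "(L a \<otimes>\<^bsub>E\<^esub> R b) \<odot>\<^bsub>P\<^esub> s \<in> U"
        using ab s cl LR_comm[of a b] P.smult_assoc[of "R b" "L a" s] by simp
    next
      fix u v assume "u \<in> carrier E" "v \<in> carrier E" "u \<odot>\<^bsub>P\<^esub> s \<in> U" "v \<odot>\<^bsub>P\<^esub> s \<in> U"
      then show "(u \<oplus>\<^bsub>E\<^esub> v) \<odot>\<^bsub>P\<^esub> s \<in> U" using Us(5) that S by (auto simp: P.smult_l_distr)
    qed
    show "carrier P \<subseteq> U"
    proof
      fix x assume "x \<in> carrier P"
      then obtain c where c: "c \<in> S \<rightarrow> carrier E" "x = finsum P (\<lambda>s. c s \<odot>\<^bsub>P\<^esub> s) S" using S(3) by blast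
      have cs: "s \<in> S \<Longrightarrow> c s \<in> carrier E \<and> s \<in> carrier P" for s using c(1) S(2) by auto
      show "x \<in> U" unfolding c(2)
        by (rule P.M.finsum_induct[OF S(1)]) (use cs cl gen Us(5,7) in auto)
    qed
  qed
  ultimately show ?thesis unfolding fin_spanned_def by auto
qed

end

section \<open>The pairing of homomorphisms into the algebra with invariants\<close>

locale enveloping_complex = enveloping K A \<nu> t E L R \<tau> B e e' r + augmented_complex K E T d B \<epsilon> "\<one>\<^bsub>A\<^esub>"
    for K :: "('k, 'x) ring_scheme" and A :: "('k, 'a) module" and \<nu> t and E :: "('k, 'e) module"
    and L R \<tau> B e e' r and T :: "int \<Rightarrow> ('e, 'm) module" and d \<epsilon>
begin

text \<open>The differences of a tensor 1 and 1 tensor a annihilate 1, so invariants lie in the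
  centralizer, which is the image of \<open>\<omega>\<close> by projectivity. The reverse inclusion
  comes from \<open>mult_\<omega>\<close>.\<close>

lemma invs_eq: "invs n = (\<lambda>q. \<omega> \<odot>\<^bsub>T n\<^esub> q) ` carrier (T n)"
proof
  interpret T: left_module E "T n" by (rule T)
  interpret B: left_module E B by (rule B_module)
  show "invs n \<subseteq> (\<lambda>q. \<omega> \<odot>\<^bsub>T n\<^esub> q) ` carrier (T n)"
  proof
    fix z assume z: "z \<in> invs n"
    then have zc: "z \<in> carrier (T n)" by (simp add: invs_def)
    have "L a \<odot>\<^bsub>T n\<^esub> z = R a \<odot>\<^bsub>T n\<^esub> z" if a: "a \<in> carrier A" for a
    proof -
      have "(L a \<ominus>\<^bsub>E\<^esub> R a) \<odot>\<^bsub>B\<^esub> \<one>\<^bsub>A\<^esub> = \<zero>\<^bsub>B\<^esub>"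
        using a L_closed R_closed B.M.r_neg[of a] by (simp add: B.smult_l_diff B_carrier B_L B_R B.M.minus_eq)
      then have "(L a \<ominus>\<^bsub>E\<^esub> R a) \<odot>\<^bsub>T n\<^esub> z = \<zero>\<^bsub>T n\<^esub>" using z a L_closed R_closed by (simp add: invs_def)
      then have "L a \<odot>\<^bsub>T n\<^esub> z \<ominus>\<^bsub>T n\<^esub> R a \<odot>\<^bsub>T n\<^esub> z = \<zero>\<^bsub>T n\<^esub>" using a zc L_closed R_closed by (simp add: T.smult_l_diff)
      then show ?thesis by (rule T.M.eq_of_diff_zero[rotated 2]) (use a zc L_closed R_closed T.smult_closed in auto)
    qed
    then show "z \<in> (\<lambda>q. \<omega> \<odot>\<^bsub>T n\<^esub> q) ` carrier (T n)" using projective_\<omega>_image[OF proj zc] by blast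
  qed
  show "(\<lambda>q. \<omega> \<odot>\<^bsub>T n\<^esub> q) ` carrier (T n) \<subseteq> invs n"
  proof clarify
    fix q assume q: "q \<in> carrier (T n)"
    have "x \<odot>\<^bsub>T n\<^esub> (\<omega> \<odot>\<^bsub>T n\<^esub> q) = \<zero>\<^bsub>T n\<^esub>" if x: "x \<in> carrier E" "x \<odot>\<^bsub>B\<^esub> \<one>\<^bsub>A\<^esub> = \<zero>\<^bsub>B\<^esub>" for x
    proof -
      have "L \<zero>\<^bsub>A\<^esub> = \<zero>\<^bsub>E\<^esub>" by (rule additive_zero[OF A_ab E_ab]) (auto simp: L_closed L_add)
      then have "x \<otimes>\<^bsub>E\<^esub> \<omega> = \<zero>\<^bsub>E\<^esub>" using mult_\<omega>[OF x(1)] x(2) \<omega>_closed by (simp add: B_zero)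
      then show ?thesis using T.smult_assoc[OF x(1) \<omega>_closed q] T.smult_l_zero[OF q] by simp
    qed
    then show "\<omega> \<odot>\<^bsub>T n\<^esub> q \<in> invs n" using q \<omega>_closed T.smult_closed by (simp add: invs_def)
  qed
qed

lemma T_vspace: "vspace K (restrict_scalars E (T n))"
  using k_algebra by (intro vspace.intro restrict_scalars_module T) (simp add: k_algebra_def)

lemma T_fin_spanned: "fin_spanned K (restrict_scalars E (T n))"
  by (rule fin_spanned_restrict_scalars[OF T fg])

text \<open>Composing with \<open>\<omega>\<close> makes any functional invariant under the twist,
  because multiplication by \<open>\<omega>\<close> identifies a tensor 1 with 1 tensor
  \<open>\<nu>(a)\<close> acting first.\<close>

lemma hom_of_inv_functional:
  assumes f: "functional_on K (restrict_scalars E (T n)) (invs n) f"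
  shows "\<exists>g\<in>mod_hom E (T n) B. \<forall>p\<in>carrier (T n). t (g p) = f (\<omega> \<odot>\<^bsub>T n\<^esub> p)"
proof (rule hom_of_functional[OF T])
  interpret T: left_module E "T n" by (rule T)
  note fD = functional_onD[OF f, simplified]
  have inv: "p \<in> carrier (T n) \<Longrightarrow> \<omega> \<odot>\<^bsub>T n\<^esub> p \<in> invs n" for p by (simp add: invs_eq)
  show "functional_on K (restrict_scalars E (T n)) (carrier (T n)) (\<lambda>p. f (\<omega> \<odot>\<^bsub>T n\<^esub> p))"
    unfolding functional_on_def
  proof (intro conjI ballI)
    fix c p assume cp: "c \<in> carrier K" "p \<in> carrier (T n)"
    have "\<omega> \<odot>\<^bsub>T n\<^esub> (sc c \<odot>\<^bsub>T n\<^esub> p) = sc c \<odot>\<^bsub>T n\<^esub> (\<omega> \<odot>\<^bsub>T n\<^esub> p)"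
      using T.smult_assoc[OF \<omega>_closed sc_closed[OF cp(1)] cp(2)] T.smult_assoc[OF sc_closed[OF cp(1)] \<omega>_closed cp(2)]
        sc_central[OF cp(1) \<omega>_closed] by simp
    then show "f (\<omega> \<odot>\<^bsub>T n\<^esub> (c \<odot>\<^bsub>restrict_scalars E (T n)\<^esub> p)) = c \<otimes>\<^bsub>K\<^esub> f (\<omega> \<odot>\<^bsub>T n\<^esub> p)"
      using fD(3)[OF cp(1) inv[OF cp(2)]] by simp
  qed (use fD(1,2) inv \<omega>_closed in \<open>auto simp: T.smult_r_distr\<close>)
  fix a p assume ap: "a \<in> carrier A" "p \<in> carrier (T n)"
  then show "f (\<omega> \<odot>\<^bsub>T n\<^esub> (L a \<odot>\<^bsub>T n\<^esub> p)) = f (\<omega> \<odot>\<^bsub>T n\<^esub> (R (\<nu> a) \<odot>\<^bsub>T n\<^esub> p))"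
    using T.smult_assoc[OF \<omega>_closed L_closed[OF ap(1)] ap(2)] \<omega>_right[OF ap(1)]
      T.smult_assoc[OF \<omega>_closed R_closed[OF \<nu>_closed[OF ap(1)]] ap(2)] by simp
qed

text \<open>The functional on invariants with which a homomorphism pairs: \<open>\<omega> p\<close> is sent to \<open>t (g p)\<close>.\<close>

definition inv_pairing :: "int \<Rightarrow> ('m \<Rightarrow> 'a) \<Rightarrow> 'm \<Rightarrow> 'k"
  where "inv_pairing n g z = t (g (SOME p. p \<in> carrier (T n) \<and> \<omega> \<odot>\<^bsub>T n\<^esub> p = z))"

text \<open>The chosen preimage does not matter: two preimages differ by an element of the kernel of
  \<open>\<omega>\<close>, where the composite of \<open>t\<close> and \<open>g\<close>
  vanishes.\<close>

lemma inv_pairing: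
  assumes g: "g \<in> mod_hom E (T n) B" and p: "p \<in> carrier (T n)"
  shows "inv_pairing n g (\<omega> \<odot>\<^bsub>T n\<^esub> p) = t (g p)"
proof -
  interpret T: left_module E "T n" by (rule T)
  interpret V: module K "restrict_scalars E (T n)" by (rule restrict_scalars_module[OF T])
  define q where "q = (SOME q. q \<in> carrier (T n) \<and> \<omega> \<odot>\<^bsub>T n\<^esub> q = \<omega> \<odot>\<^bsub>T n\<^esub> p)"
  have "\<exists>q. q \<in> carrier (T n) \<and> \<omega> \<odot>\<^bsub>T n\<^esub> q = \<omega> \<odot>\<^bsub>T n\<^esub> p" using p by blast
  then have q: "q \<in> carrier (T n) \<and> \<omega> \<odot>\<^bsub>T n\<^esub> q = \<omega> \<odot>\<^bsub>T n\<^esub> p" unfolding q_def by (rule someI_ex)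
  have "\<omega> \<odot>\<^bsub>T n\<^esub> (q \<ominus>\<^bsub>T n\<^esub> p) = \<zero>\<^bsub>T n\<^esub>"
    using q p \<omega>_closed T.smult_closed by (simp add: T.M.minus_eq T.smult_r_distr T.smult_r_neg T.M.r_neg)
  then have 0: "t (g (q \<ominus>\<^bsub>T n\<^esub> p)) = \<zero>\<^bsub>K\<^esub>" using hom_\<omega>_kernel[OF proj g] q p by simp
  note f = hom_functional[OF T g]
  have "q = (q \<ominus>\<^bsub>T n\<^esub> p) \<oplus>\<^bsub>T n\<^esub> p" using q p by (simp add: T.M.minus_eq T.M.a_assoc T.M.l_neg)
  then have "t (g q) = t (g (q \<ominus>\<^bsub>T n\<^esub> p)) \<oplus>\<^bsub>K\<^esub> t (g p)"
    using functional_onD(2)[OF f, of "q \<ominus>\<^bsub>T n\<^esub> p" p] q p by simp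
  then show ?thesis using 0 functional_onD(1)[OF f p] by (simp add: inv_pairing_def q_def)
qed

lemma inv_pairing_functional:
  assumes g: "g \<in> mod_hom E (T n) B"
  shows "functional_on K (restrict_scalars E (T n)) (invs n) (inv_pairing n g)"
  unfolding functional_on_def invs_eq
proof (intro conjI ballI)
  interpret T: left_module E "T n" by (rule T)
  note f = functional_onD[OF hom_functional[OF T g], simplified]
  show "inv_pairing n g \<in> (\<lambda>q. \<omega> \<odot>\<^bsub>T n\<^esub> q) ` carrier (T n) \<rightarrow> carrier K" using inv_pairing[OF g] f(1) by auto
  fix x assume "x \<in> (\<lambda>q. \<omega> \<odot>\<^bsub>T n\<^esub> q) ` carrier (T n)"
  then obtain p where p: "p \<in> carrier (T n)" "x = \<omega> \<odot>\<^bsub>T n\<^esub> p" by blast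
  show "inv_pairing n g (x \<oplus>\<^bsub>restrict_scalars E (T n)\<^esub> y) = inv_pairing n g x \<oplus>\<^bsub>K\<^esub> inv_pairing n g y"
    if y: "y \<in> (\<lambda>q. \<omega> \<odot>\<^bsub>T n\<^esub> q) ` carrier (T n)" for y
  proof -
    obtain q where q: "y = \<omega> \<odot>\<^bsub>T n\<^esub> q" "q \<in> carrier (T n)" using y by (rule imageE)
    have "x \<oplus>\<^bsub>T n\<^esub> y = \<omega> \<odot>\<^bsub>T n\<^esub> (p \<oplus>\<^bsub>T n\<^esub> q)" using p q \<omega>_closed by (simp add: T.smult_r_distr)
    then show ?thesis using inv_pairing[OF g, of "p \<oplus>\<^bsub>T n\<^esub> q"] inv_pairing[OF g] p q f(2) by simp
  qed
  show "inv_pairing n g (c \<odot>\<^bsub>restrict_scalars E (T n)\<^esub> x) = c \<otimes>\<^bsub>K\<^esub> inv_pairing n g x" if c: "c \<in> carrier K" for c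
  proof -
    have "sc c \<odot>\<^bsub>T n\<^esub> x = \<omega> \<odot>\<^bsub>T n\<^esub> (sc c \<odot>\<^bsub>T n\<^esub> p)"
      using T.smult_assoc[OF \<omega>_closed sc_closed[OF c] p(1)] T.smult_assoc[OF sc_closed[OF c] \<omega>_closed p(1)]
        sc_central[OF c \<omega>_closed] p(2) by simp
    then show ?thesis using inv_pairing[OF g, of "sc c \<odot>\<^bsub>T n\<^esub> p"] inv_pairing[OF g] p f(3)[OF c p(1)] T.smult_closed c by simp
  qed
qed

text \<open>The coordinates on cohomology are the pairings with representatives \<open>v i\<close>
  of a basis of the homology of invariants; that they are coordinates says that the pairing is
  perfect.\<close>

lemma hom_codim_dual:
  assumes codim: "has_codim K (restrict_scalars E (T n)) (inv_cycles n) (d (n + 1) ` invs (n + 1)) s"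
  shows "has_codim K (hom_space E (T n) B) (hom_cocycles E T d B n) (hom_coboundaries E T d B n) s"
proof -
  let ?V = "restrict_scalars E (T n)" and ?W = "restrict_scalars E (T (n - 1))"
  interpret V: vspace K ?V by (rule T_vspace)
  interpret T: left_module E "T n" by (rule T)
  interpret B: left_module E B by (rule B_module)
  note Z = inv_cycles_submodule[of n] and N = inv_boundaries_subset[of n]
  obtain v \<chi> where v: "v \<in> {..<s} \<rightarrow> inv_cycles n" and \<chi>: "\<forall>i<s. functional_on K ?V (inv_cycles n) (\<chi> i)"
    and dual: "\<forall>i<s. \<forall>j<s. \<chi> i (v j) = (if i = j then \<one>\<^bsub>K\<^esub> else \<zero>\<^bsub>K\<^esub>)"
    and \<chi>0: "\<forall>i<s. \<forall>z\<in>d (n + 1) ` invs (n + 1). \<chi> i z = \<zero>\<^bsub>K\<^esub>"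
    and rep: "\<forall>z\<in>inv_cycles n. \<exists>b\<in>d (n + 1) ` invs (n + 1). z = b \<oplus>\<^bsub>?V\<^esub> finsum ?V (\<lambda>i. \<chi> i z \<odot>\<^bsub>?V\<^esub> v i) {..<s}"
    using V.has_codim_basis[OF Z N codim] by (elim exE conjE) (rule that)
  have vi: "v i \<in> inv_cycles n" if "i < s" for i using v that by auto
  have cyc_inv: "z \<in> inv_cycles n \<Longrightarrow> z \<in> invs n" for z by (simp add: inv_cycles_def)
  have inv_rep: "\<exists>p\<in>carrier (T m). z = \<omega> \<odot>\<^bsub>T m\<^esub> p" if "z \<in> invs m" for z m using that by (auto simp: invs_eq)
  have d\<omega>: "d m (\<omega> \<odot>\<^bsub>T m\<^esub> p) = \<omega> \<odot>\<^bsub>T (m - 1)\<^esub> d m p" if "p \<in> carrier (T m)" for m p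
    by (rule mod_homD(3)[OF d \<omega>_closed that])
  have ds\<omega>: "d (m + 1) (\<omega> \<odot>\<^bsub>T (m + 1)\<^esub> p) = \<omega> \<odot>\<^bsub>T m\<^esub> d (m + 1) p" if "p \<in> carrier (T (m + 1))" for m p
    by (rule mod_homD(3)[OF d_succ \<omega>_closed that])
  have coc: "g \<in> mod_hom E (T n) B" if "g \<in> hom_cocycles E T d B n" for g using that by (simp add: hom_cocycles_def)
  have "coordinates K (hom_space E (T n) B) (hom_cocycles E T d B n) (hom_coboundaries E T d B n) s
    (\<lambda>i g. inv_pairing n g (v i))"
    unfolding coordinates_def
  proof (intro conjI allI impI ballI)
    fix i assume i: "i < s"
    obtain p where p: "p \<in> carrier (T n)" "v i = \<omega> \<odot>\<^bsub>T n\<^esub> p" using inv_rep[OF cyc_inv[OF vi[OF i]]] by blast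
    have val: "inv_pairing n g (v i) = t (g p)" if "g \<in> mod_hom E (T n) B" for g using inv_pairing[OF that p(1)] p(2) by simp
    interpret H: module K "hom_space E (T n) B" by (rule hom_space_module[OF T B_module])
    show "functional_on K (hom_space E (T n) B) (hom_cocycles E T d B n) (\<lambda>g. inv_pairing n g (v i))"
      unfolding functional_on_def
    proof (intro conjI ballI)
      show "(\<lambda>g. inv_pairing n g (v i)) \<in> hom_cocycles E T d B n \<rightarrow> carrier K"
        using val coc tD(1) mod_homD(1)[OF coc p(1)] by (auto simp: B_carrier)
    next
      fix g g' assume gg: "g \<in> hom_cocycles E T d B n" "g' \<in> hom_cocycles E T d B n"
      have "g \<oplus>\<^bsub>hom_space E (T n) B\<^esub> g' \<in> mod_hom E (T n) B" using H.M.a_closed[of g g'] coc gg by simp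
      from val[OF this] show "inv_pairing n (g \<oplus>\<^bsub>hom_space E (T n) B\<^esub> g') (v i) = inv_pairing n g (v i) \<oplus>\<^bsub>K\<^esub> inv_pairing n g' (v i)"
        using val coc gg tD(2) mod_homD(1)[OF coc p(1)] p(1) by (simp add: B_carrier B_plus)
    next
      fix c g assume gg: "c \<in> carrier K" "g \<in> hom_cocycles E T d B n"
      have "c \<odot>\<^bsub>hom_space E (T n) B\<^esub> g \<in> mod_hom E (T n) B" using H.smult_closed[of c g] coc gg by simp
      from val[OF this] show "inv_pairing n (c \<odot>\<^bsub>hom_space E (T n) B\<^esub> g) (v i) = c \<otimes>\<^bsub>K\<^esub> inv_pairing n g (v i)"
        using val coc gg tD(3) mod_homD(1)[OF coc p(1)] p(1) by (simp add: B_carrier B_sc)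
    qed
  next
    fix c assume c: "\<forall>i<s. c i \<in> carrier K"
    \<comment> \<open>The functional on cycles with the prescribed values at the \<open>v i\<close>
      that vanishes on boundaries. An extension to \<open>T n\<close> yields a homomorphism
      \<open>g\<close> with these pairings, and vanishing on boundaries makes \<open>g\<close> a
      cocycle.\<close>
    define \<theta> where "\<theta> z = finsum K (\<lambda>i. c i \<otimes>\<^bsub>K\<^esub> \<chi> i z) {..<s}" for z
    have \<theta>: "functional_on K ?V (inv_cycles n) \<theta>"
      unfolding \<theta>_def by (rule V.functional_finsum[OF Z]) (use c \<chi> in auto)
    have \<theta>0: "\<theta> b = \<zero>\<^bsub>K\<^esub>" if "b \<in> d (n + 1) ` invs (n + 1)" for b
    proof -
      have "\<theta> b = finsum K (\<lambda>i. \<zero>\<^bsub>K\<^esub>) {..<s}" unfolding \<theta>_def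
        by (rule A.K.finsum_cong') (use c \<chi>0 that in auto)
      then show ?thesis by simp
    qed
    have \<theta>v: "\<theta> (v i) = c i" if i: "i < s" for i
    proof -
      have "\<theta> (v i) = finsum K (\<lambda>j. if i = j then c j else \<zero>\<^bsub>K\<^esub>) {..<s}" unfolding \<theta>_def
        by (rule A.K.finsum_cong') (use c dual i in auto)
      also have "\<dots> = c i" by (rule A.K.finsum_singleton) (use c i in auto)
      finally show ?thesis .
    qed
    obtain \<Theta> where \<Theta>: "functional_on K ?V (carrier ?V) \<Theta>" "\<forall>z\<in>inv_cycles n. \<Theta> z = \<theta> z"
      using V.functional_extend[OF T_fin_spanned Z \<theta>] by blast
    have "functional_on K ?V (invs n) \<Theta>" by (rule functional_on_subset[OF \<Theta>(1)]) (auto simp: invs_def)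
    then obtain g where g: "g \<in> mod_hom E (T n) B" "\<And>p. p \<in> carrier (T n) \<Longrightarrow> t (g p) = \<Theta> (\<omega> \<odot>\<^bsub>T n\<^esub> p)"
      using hom_of_inv_functional by blast
    have gd: "compose (carrier (T (n + 1))) g (d (n + 1)) \<in> mod_hom E (T (n + 1)) B"
      by (rule mod_hom_compose[OF d_succ g(1) T])
    have zero: "(\<lambda>x\<in>carrier (T (n + 1)). \<zero>\<^bsub>B\<^esub>) \<in> mod_hom E (T (n + 1)) B"
      by (rule left_module_restrict_homI[OF T]) (auto simp: B.smult_r_zero)
    have "g (d (n + 1) x) = \<zero>\<^bsub>B\<^esub>" if x: "x \<in> carrier (T (n + 1))" for x
    proof -
      have "compose (carrier (T (n + 1))) g (d (n + 1)) x = (\<lambda>x\<in>carrier (T (n + 1)). \<zero>\<^bsub>B\<^esub>) x"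
      proof (rule hom_zeroI[OF T gd zero _ x])
        fix y assume y: "y \<in> carrier (T (n + 1))"
        have "d (n + 1) (\<omega> \<odot>\<^bsub>T (n + 1)\<^esub> y) \<in> d (n + 1) ` invs (n + 1)" using y by (auto simp: invs_eq)
        then have "\<Theta> (\<omega> \<odot>\<^bsub>T n\<^esub> d (n + 1) y) = \<zero>\<^bsub>K\<^esub>" using \<Theta>(2) \<theta>0 N ds\<omega>[OF y] by auto
        then show "t (compose (carrier (T (n + 1))) g (d (n + 1)) y) = t ((\<lambda>x\<in>carrier (T (n + 1)). \<zero>\<^bsub>B\<^esub>) y)"
          using g(2)[OF mod_homD(1)[OF d_succ y]] y t_zero by (simp add: compose_eq B_zero)
      qed
      then show ?thesis using x by (simp add: compose_eq)
    qed
    then have gZ: "g \<in> hom_cocycles E T d B n" using g(1) by (simp add: hom_cocycles_def)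
    have "inv_pairing n g (v i) = c i" if i: "i < s" for i
    proof -
      obtain p where p: "p \<in> carrier (T n)" "v i = \<omega> \<odot>\<^bsub>T n\<^esub> p" using inv_rep[OF cyc_inv[OF vi[OF i]]] by blast
      then show ?thesis using inv_pairing[OF g(1) p(1)] g(2)[OF p(1)] \<Theta>(2) vi[OF i] \<theta>v[OF i] by simp
    qed
    then show "\<exists>g\<in>hom_cocycles E T d B n. \<forall>i<s. inv_pairing n g (v i) = c i" using gZ by blast
  next
    fix g assume gZ: "g \<in> hom_cocycles E T d B n"
    note g = coc[OF gZ]
    note pf = inv_pairing_functional[OF g]
    show "g \<in> hom_coboundaries E T d B n \<longleftrightarrow> (\<forall>i<s. inv_pairing n g (v i) = \<zero>\<^bsub>K\<^esub>)"
    proof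
      assume "g \<in> hom_coboundaries E T d B n"
      then obtain w where w: "w \<in> mod_hom E (T (n - 1)) B" "g = compose (carrier (T n)) w (d n)"
        by (auto simp: hom_coboundaries_def)
      show "\<forall>i<s. inv_pairing n g (v i) = \<zero>\<^bsub>K\<^esub>"
      proof (intro allI impI)
        fix i assume i: "i < s"
        obtain p where p: "p \<in> carrier (T n)" "v i = \<omega> \<odot>\<^bsub>T n\<^esub> p" using inv_rep[OF cyc_inv[OF vi[OF i]]] by blast
        \<comment> \<open>Because \<open>v i\<close> is a cycle, \<open>d n p\<close> lies in the
          kernel of \<open>\<omega>\<close>, where the composite of \<open>t\<close> and
          \<open>w\<close> vanishes.\<close>
        have "\<omega> \<odot>\<^bsub>T (n - 1)\<^esub> d n p = \<zero>\<^bsub>T (n - 1)\<^esub>" using d\<omega>[OF p(1)] p(2) vi[OF i] by (simp add: inv_cycles_def)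
        then have "t (w (d n p)) = \<zero>\<^bsub>K\<^esub>" by (rule hom_\<omega>_kernel[OF proj w(1) mod_homD(1)[OF d p(1)]])
        then show "inv_pairing n g (v i) = \<zero>\<^bsub>K\<^esub>" using inv_pairing[OF g p(1)] p w(2) by (simp add: compose_eq)
      qed
    next
      assume van: "\<forall>i<s. inv_pairing n g (v i) = \<zero>\<^bsub>K\<^esub>"
      have pf': "functional_on K ?V (inv_cycles n) (inv_pairing n g)" by (rule functional_on_subset[OF pf]) (use cyc_inv in auto)
      note pD' = functional_onD[OF pf']
      note Zs = V.submoduleE[OF Z] V.submodule_zero[OF Z]
      \<comment> \<open>The \<open>v i\<close> span the invariant cycles modulo boundaries, and a
        cocycle pairs to zero with every boundary.\<close>
      have van_cyc: "inv_pairing n g z = \<zero>\<^bsub>K\<^esub>" if z: "z \<in> inv_cycles n" for z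
      proof -
        let ?S = "finsum ?V (\<lambda>i. \<chi> i z \<odot>\<^bsub>?V\<^esub> v i) {..<s}"
        obtain b where b: "b \<in> d (n + 1) ` invs (n + 1)" "z = b \<oplus>\<^bsub>?V\<^esub> ?S" using rep z by blast
        obtain y where y: "y \<in> carrier (T (n + 1))" "b = \<omega> \<odot>\<^bsub>T n\<^esub> d (n + 1) y" using b(1) ds\<omega> by (auto simp: invs_eq)
        have "inv_pairing n g b = t (g (d (n + 1) y))" using inv_pairing[OF g mod_homD(1)[OF d_succ y(1)]] y(2) by simp
        also have "\<dots> = \<zero>\<^bsub>K\<^esub>" using gZ y t_zero by (simp add: hom_cocycles_def B_zero)
        finally have b0: "inv_pairing n g b = \<zero>\<^bsub>K\<^esub>" .
        have ck: "\<chi> i z \<in> carrier K" if "i < s" for i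
          using functional_onD(1)[OF _ z, of K ?V "\<chi> i"] \<chi> that by simp
        have "?S \<in> inv_cycles n \<and> inv_pairing n g ?S = \<zero>\<^bsub>K\<^esub>"
        proof (rule V.M.finsum_induct)
          show "(\<lambda>i. \<chi> i z \<odot>\<^bsub>?V\<^esub> v i) \<in> {..<s} \<rightarrow> carrier ?V" using vi Zs(1) ck by (auto simp del: restrict_scalars_simps)
          show "\<zero>\<^bsub>?V\<^esub> \<in> inv_cycles n \<and> inv_pairing n g \<zero>\<^bsub>?V\<^esub> = \<zero>\<^bsub>K\<^esub>" using Zs(7) V.functional_zero[OF pf' Z] by simp
          show "x \<oplus>\<^bsub>?V\<^esub> y \<in> inv_cycles n \<and> inv_pairing n g (x \<oplus>\<^bsub>?V\<^esub> y) = \<zero>\<^bsub>K\<^esub>"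
            if "x \<in> inv_cycles n \<and> inv_pairing n g x = \<zero>\<^bsub>K\<^esub>" "y \<in> inv_cycles n \<and> inv_pairing n g y = \<zero>\<^bsub>K\<^esub>" for x y
            using that Zs(5) pD'(2) by (simp del: restrict_scalars_simps)
          show "\<chi> i z \<odot>\<^bsub>?V\<^esub> v i \<in> inv_cycles n \<and> inv_pairing n g (\<chi> i z \<odot>\<^bsub>?V\<^esub> v i) = \<zero>\<^bsub>K\<^esub>" if "i \<in> {..<s}" for i
            using that van vi Zs(4) ck pD'(3) by (simp del: restrict_scalars_simps)
        qed simp
        moreover have "b \<in> inv_cycles n" using b(1) N by blast
        ultimately show ?thesis using b(2) b0 pD'(2)[of b ?S] by simp
      qed
      \<comment> \<open>Since the pairing with \<open>g\<close> kills all invariant cycles, it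
        factors through \<open>d n\<close>. Restricted to the invariants of
        \<open>T (n - 1)\<close>, the functional \<open>h\<close> is converted into the homomorphism
        whose coboundary is \<open>g\<close>.\<close>
      obtain h where h: "functional_on K ?W (carrier ?W) h" "\<And>z. z \<in> invs n \<Longrightarrow> h (d n z) = inv_pairing n g z"
      proof -
        have c: "z \<in> invs n \<Longrightarrow> z \<in> carrier (T n)" for z by (simp add: invs_def)
        have "\<exists>h. functional_on K ?W (carrier ?W) h \<and> (\<forall>z\<in>invs n. h (d n z) = inv_pairing n g z)"
          by (rule functional_factor[OF V.module_axioms T_vspace T_fin_spanned invs_submodule _ _ _ pf])
            (use c mod_homD(1-3)[OF d] van_cyc in \<open>auto simp: inv_cycles_def\<close>)
        then show ?thesis using that by blast
      qed
      have "functional_on K ?W (invs (n - 1)) h" by (rule functional_on_subset[OF h(1)]) (auto simp: invs_def)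
      then obtain w where w: "w \<in> mod_hom E (T (n - 1)) B" "\<And>p. p \<in> carrier (T (n - 1)) \<Longrightarrow> t (w p) = h (\<omega> \<odot>\<^bsub>T (n - 1)\<^esub> p)"
        using hom_of_inv_functional by blast
      have wd: "compose (carrier (T n)) w (d n) \<in> mod_hom E (T n) B" by (rule mod_hom_compose[OF d w(1) T])
      have "g = compose (carrier (T n)) w (d n)"
      proof (rule mod_hom_eqI[OF g wd], rule hom_zeroI[OF T g wd])
        fix p assume p: "p \<in> carrier (T n)"
        have "t (w (d n p)) = h (d n (\<omega> \<odot>\<^bsub>T n\<^esub> p))" using w(2)[OF mod_homD(1)[OF d p]] d\<omega>[OF p] by simp
        also have "\<dots> = t (g p)" using h(2)[of "\<omega> \<odot>\<^bsub>T n\<^esub> p"] inv_pairing[OF g p] p by (simp add: invs_eq)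
        finally show "t (g p) = t (compose (carrier (T n)) w (d n) p)" using p by (simp add: compose_eq)
      qed
      then show "g \<in> hom_coboundaries E T d B n" using w(1) by (auto simp: hom_coboundaries_def)
    qed
  qed
  then show ?thesis by (auto simp: has_codim_def)
qed

text \<open>Let \<open>s\<close> be the dimension of the homology of invariants in degree
  \<open>n\<close>. Duality makes it the dimension of cohomology in degree \<open>n\<close>. It also
  belongs to stable maps of degrees 0 and \<open>n\<close>, hence after a shift by \<open>-n\<close>
  to those of degrees \<open>-n\<close> and 0, which compute cohomology in degree
  \<open>-(n + 1)\<close>.\<close>

theorem cohomology_mod_iso:
  "\<exists>h. h \<in> mod_iso K (hom_cohomology E T d B n) (hom_cohomology E T d B (- (n + 1)))"
proof -
  interpret V: vspace K "restrict_scalars E (T n)" by (rule T_vspace)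
  obtain s where s: "has_codim K (restrict_scalars E (T n)) (inv_cycles n) (d (n + 1) ` invs (n + 1)) s"
    using V.has_codim_exists[OF T_fin_spanned inv_boundaries_submodule inv_cycles_submodule inv_boundaries_subset] by blast
  have 1: "has_codim K (hom_space E (T n) B) (hom_cocycles E T d B n) (hom_coboundaries E T d B n) s"
    by (rule hom_codim_dual[OF s])
  have "stable_codim 0 n s" using s inv_codim_iff by blast
  then have "stable_codim (- (n + 1) + 1) 0 s" using stable_codim_shift_int[of 0 n s "- n"] by simp
  then have 2: "has_codim K (hom_space E (T (- (n + 1))) B) (hom_cocycles E T d B (- (n + 1))) (hom_coboundaries E T d B (- (n + 1))) s"
    using hom_codim_iff by blast
  show ?thesis
    unfolding hom_cohomology_def
    by (rule mod_iso_quot_module[OF hom_space_module[OF T B_module] hom_space_module[OF T B_module]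
          hom_cocycles_submodule hom_coboundaries_subset 1 hom_cocycles_submodule hom_coboundaries_subset 2])
qed

end

section \<open>The Frobenius form of a Nakayama automorphism and its dual bases\<close>

lemma fin_gen_fin_spanned:
  assumes "module K V" "fin_gen K V"
  shows "fin_spanned K V"
proof -
  interpret V: module K V by fact
  obtain S where S: "finite S" "S \<subseteq> carrier V" "\<forall>x\<in>carrier V. \<exists>c\<in>S \<rightarrow> carrier K. x = finsum V (\<lambda>s. c s \<odot>\<^bsub>V\<^esub> s) S"
    using assms(2) by (auto simp: fin_gen_def)
  have "carrier V \<subseteq> U" if U: "submodule U K V" "S \<subseteq> U" for U
  proof
    fix x assume "x \<in> carrier V"
    then obtain c where c: "c \<in> S \<rightarrow> carrier K" "x = finsum V (\<lambda>s. c s \<odot>\<^bsub>V\<^esub> s) S" using S(3) by blast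
    have cs: "s \<in> S \<Longrightarrow> c s \<in> carrier K \<and> s \<in> carrier V" for s using c(1) S(2) by auto
    show "x \<in> U" unfolding c(2)
      by (rule V.M.finsum_induct[OF S(1)])
        (use cs V.submoduleE(4,5)[OF U(1)] V.submodule_zero[OF U(1)] U(2) in auto)
  qed
  then show ?thesis using S V.submoduleE(1) unfolding fin_spanned_def by (metis subset_antisym)
qed

text \<open>Start from any basis \<open>v\<close> with its coordinate functionals. Each of these is
  \<open>t (- a i)\<close> for some \<open>a i\<close>, and moving \<open>a i\<close> to the left
  turns it into \<open>t (e' i -)\<close> with \<open>e' i = \<nu>(a i)\<close>. The second
  expansion is the transpose of the first and is checked by testing against
  \<open>t\<close>.\<close>

lemma (in frobenius_form) dual_bases:
  assumes "fin_gen K A"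
  shows "\<exists>(r::nat) e e'. (\<forall>i<r. e i \<in> carrier A \<and> e' i \<in> carrier A) \<and>
    (\<forall>x\<in>carrier A. x = finsum A (\<lambda>i. t (e' i \<otimes>\<^bsub>A\<^esub> x) \<odot>\<^bsub>A\<^esub> e i) {..<r}) \<and>
    (\<forall>x\<in>carrier A. x = finsum A (\<lambda>i. t (x \<otimes>\<^bsub>A\<^esub> e i) \<odot>\<^bsub>A\<^esub> e' i) {..<r})"
proof -
  interpret V: vspace K A
    using A.k_algebra by (intro vspace.intro) (simp_all add: k_algebra_def)
  note C = A.EM.carrier_is_submodule
  have N: "submodule {\<zero>\<^bsub>A\<^esub>} K A" by (rule A.EM.submoduleI') auto
  obtain r where r: "has_codim K A (carrier A) {\<zero>\<^bsub>A\<^esub>} r"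
    using V.has_codim_exists[OF fin_gen_fin_spanned[OF A.EM.module_axioms assms] N C] by auto
  obtain v \<chi> where v: "v \<in> {..<r} \<rightarrow> carrier A" and \<chi>: "\<forall>i<r. functional_on K A (carrier A) (\<chi> i)"
    and rep: "\<forall>z\<in>carrier A. \<exists>n\<in>{\<zero>\<^bsub>A\<^esub>}. z = n \<oplus>\<^bsub>A\<^esub> finsum A (\<lambda>i. \<chi> i z \<odot>\<^bsub>A\<^esub> v i) {..<r}"
    using V.has_codim_basis[OF C _ r] by auto
  have vc: "i < r \<Longrightarrow> v i \<in> carrier A" for i using v by auto
  have "\<exists>a\<in>carrier A. \<forall>x\<in>carrier A. \<chi> i x = t (x \<otimes>\<^bsub>A\<^esub> a)" if "i < r" for i
    using t_rep \<chi> that by blast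
  then obtain a where a: "\<And>i. i < r \<Longrightarrow> a i \<in> carrier A" "\<And>i x. i < r \<Longrightarrow> x \<in> carrier A \<Longrightarrow> \<chi> i x = t (x \<otimes>\<^bsub>A\<^esub> a i)"
    by metis
  define e' where "e' i = \<nu> (a i)" for i
  have e'c: "i < r \<Longrightarrow> e' i \<in> carrier A" for i using a \<nu>_closed by (simp add: e'_def)
  have \<chi>_eq: "\<chi> i x = t (e' i \<otimes>\<^bsub>A\<^esub> x)" if "i < r" "x \<in> carrier A" for i x
    using a that t_\<nu>[of x "a i"] by (simp add: e'_def)
  have ck: "t (e' i \<otimes>\<^bsub>A\<^esub> x) \<in> carrier K" "t (x \<otimes>\<^bsub>A\<^esub> v i) \<in> carrier K" if "i < r" "x \<in> carrier A" for i x
    using that e'c vc tD(1) by auto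
  have 1: "x = finsum A (\<lambda>i. t (e' i \<otimes>\<^bsub>A\<^esub> x) \<odot>\<^bsub>A\<^esub> v i) {..<r}" if x: "x \<in> carrier A" for x
  proof -
    have "finsum A (\<lambda>i. \<chi> i x \<odot>\<^bsub>A\<^esub> v i) {..<r} = finsum A (\<lambda>i. t (e' i \<otimes>\<^bsub>A\<^esub> x) \<odot>\<^bsub>A\<^esub> v i) {..<r}"
      by (rule A.E.finsum_cong') (use x vc ck \<chi>_eq in auto)
    moreover have "finsum A (\<lambda>i. t (e' i \<otimes>\<^bsub>A\<^esub> x) \<odot>\<^bsub>A\<^esub> v i) {..<r} \<in> carrier A"
      using x vc ck by (auto intro!: A.E.finsum_closed)
    ultimately show ?thesis using rep x by auto
  qed
  have tsum: "t (finsum A f {..<r}) = finsum K (\<lambda>i. t (f i)) {..<r}" if "f \<in> {..<r} \<rightarrow> carrier A" for f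
    by (rule additive_finsum[OF A.E.is_abelian_group A.K.is_abelian_group]) (use tD that in auto)
  have 2: "x = finsum A (\<lambda>i. t (x \<otimes>\<^bsub>A\<^esub> v i) \<odot>\<^bsub>A\<^esub> e' i) {..<r}" (is "_ = ?y") if x: "x \<in> carrier A" for x
  proof (rule t_eqI[OF x])
    show yc: "?y \<in> carrier A" using x e'c ck by (auto intro!: A.E.finsum_closed)
    fix z assume z: "z \<in> carrier A"
    \<comment> \<open>The test \<open>t (z -)\<close> is rewritten as \<open>t (- \<nu>(z))\<close>,
      so that the first expansion can be inserted for \<open>\<nu>(z)\<close>.\<close>
    have mv: "t (z \<otimes>\<^bsub>A\<^esub> u) = t (u \<otimes>\<^bsub>A\<^esub> \<nu> z)" if "u \<in> carrier A" for u
      using t_\<nu>[of u "\<nu> z"] that z \<nu>_closed \<nu>_invol by simp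
    define w where "w = \<nu> z"
    have w: "w \<in> carrier A" using z \<nu>_closed by (simp add: w_def)
    have "?y \<otimes>\<^bsub>A\<^esub> w = finsum A (\<lambda>i. (t (x \<otimes>\<^bsub>A\<^esub> v i) \<odot>\<^bsub>A\<^esub> e' i) \<otimes>\<^bsub>A\<^esub> w) {..<r}"
      by (rule A.E.finsum_ldistr) (use x e'c ck w in auto)
    then have "t (?y \<otimes>\<^bsub>A\<^esub> w) = finsum K (\<lambda>i. t ((t (x \<otimes>\<^bsub>A\<^esub> v i) \<odot>\<^bsub>A\<^esub> e' i) \<otimes>\<^bsub>A\<^esub> w)) {..<r}"
      using tsum[of "\<lambda>i. (t (x \<otimes>\<^bsub>A\<^esub> v i) \<odot>\<^bsub>A\<^esub> e' i) \<otimes>\<^bsub>A\<^esub> w"] x e'c ck w by (simp add: Pi_def)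
    also have "\<dots> = finsum K (\<lambda>i. t (x \<otimes>\<^bsub>A\<^esub> (t (e' i \<otimes>\<^bsub>A\<^esub> w) \<odot>\<^bsub>A\<^esub> v i))) {..<r}"
      by (rule A.K.finsum_cong') (use x e'c ck w vc tD in \<open>auto simp: A.smult_mult A.K.m_comm\<close>)
    also have "\<dots> = t (finsum A (\<lambda>i. x \<otimes>\<^bsub>A\<^esub> (t (e' i \<otimes>\<^bsub>A\<^esub> w) \<odot>\<^bsub>A\<^esub> v i)) {..<r})"
      by (rule tsum[symmetric]) (use x ck w vc in auto)
    also have "finsum A (\<lambda>i. x \<otimes>\<^bsub>A\<^esub> (t (e' i \<otimes>\<^bsub>A\<^esub> w) \<odot>\<^bsub>A\<^esub> v i)) {..<r} = x \<otimes>\<^bsub>A\<^esub> finsum A (\<lambda>i. t (e' i \<otimes>\<^bsub>A\<^esub> w) \<odot>\<^bsub>A\<^esub> v i) {..<r}"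
      by (rule A.E.finsum_rdistr[symmetric]) (use x ck w vc in auto)
    also have "finsum A (\<lambda>i. t (e' i \<otimes>\<^bsub>A\<^esub> w) \<odot>\<^bsub>A\<^esub> v i) {..<r} = w" using 1[OF w] by simp
    finally show "t (z \<otimes>\<^bsub>A\<^esub> x) = t (z \<otimes>\<^bsub>A\<^esub> ?y)" using mv[OF x] mv[OF yc] by (simp add: w_def)
  qed
  show ?thesis
    by (rule exI[of _ r], rule exI[of _ v], rule exI[of _ e']) (use 1 2 vc e'c in blast)
qed

text \<open>Left linearity gives \<open>\<phi>(a)(x) = t (x a)\<close> with
  \<open>t = \<phi>(1)\<close>, so bijectivity of \<open>\<phi>\<close> becomes representability and
  nondegeneracy.\<close>

lemma nakayama_frobenius_form:
  assumes A: "k_algebra K A" and nak: "nakayama_automorphism K A \<nu>" and inv: "\<forall>x\<in>carrier A. \<nu> (\<nu> x) = x"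
  shows "\<exists>t. frobenius_form K A \<nu> t"
proof -
  interpret A: k_alg K A by (rule k_alg.intro[OF A])
  obtain \<phi> where \<nu>: "\<nu> \<in> ring_iso A A" and \<phi>: "\<phi> \<in> mod_iso A (regular_module A) (dual_module K A)"
    and tw: "\<forall>l\<in>carrier A. \<forall>x\<in>carrier A. \<phi> \<one>\<^bsub>A\<^esub> (l \<otimes>\<^bsub>A\<^esub> x) = \<phi> \<one>\<^bsub>A\<^esub> (\<nu> x \<otimes>\<^bsub>A\<^esub> l)"
    using nak unfolding nakayama_automorphism_def by blast
  define t where "t = \<phi> \<one>\<^bsub>A\<^esub>"
  have h: "\<phi> \<in> mod_hom A (regular_module A) (dual_module K A)" and bij: "bij_betw \<phi> (carrier A) (carrier (dual_module K A))"
    using \<phi> by (simp_all add: mod_iso_def)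
  have func: "functional_on K A (carrier A) f" if "f \<in> carrier (dual_module K A)" for f
    using mod_homD(1-3)[of f K A "regular_module K"] that by (simp add: dual_module_def functional_on_def)
  have val: "\<phi> a x = t (x \<otimes>\<^bsub>A\<^esub> a)" if "a \<in> carrier A" "x \<in> carrier A" for a x
    using mod_homD(3)[OF h, of a "\<one>\<^bsub>A\<^esub>"] that by (simp add: dual_module_def t_def)
  have tf: "functional_on K A (carrier A) t" unfolding t_def by (rule func) (use mod_homD(1)[OF h] in simp)
  have "frobenius_form K A \<nu> t"
  proof (unfold_locales)
    fix a assume "a \<in> carrier A"
    then show "\<nu> a \<in> carrier A" using \<nu> by (auto simp: ring_iso_def ring_hom_def)
  next
    fix f assume f: "functional_on K A (carrier A) f"
    note fD = functional_onD[OF f]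
    have "restrict f (carrier A) \<in> mod_hom K A (regular_module K)"
      by (rule mod_homI) (use fD in auto)
    then have "restrict f (carrier A) \<in> carrier (dual_module K A)" by (simp add: dual_module_def)
    then obtain a where a: "a \<in> carrier A" "\<phi> a = restrict f (carrier A)" using bij by (metis bij_betwE bij_betw_imp_surj_on imageE)
    have "f x = t (x \<otimes>\<^bsub>A\<^esub> a)" if "x \<in> carrier A" for x using val[OF a(1) that] a(2) that by simp
    then show "\<exists>a\<in>carrier A. \<forall>x\<in>carrier A. f x = t (x \<otimes>\<^bsub>A\<^esub> a)" using a(1) by blast
  next
    fix a assume a: "a \<in> carrier A" and 0: "\<And>x. x \<in> carrier A \<Longrightarrow> t (x \<otimes>\<^bsub>A\<^esub> a) = \<zero>\<^bsub>K\<^esub>"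
    have t0: "t \<zero>\<^bsub>A\<^esub> = \<zero>\<^bsub>K\<^esub>" by (rule A.EM.functional_zero[OF tf A.EM.carrier_is_submodule])
    have ext: "\<phi> b \<in> extensional (carrier A)" if "b \<in> carrier A" for b
      using mod_homD(1)[OF h, of b] mod_homD(4)[of "\<phi> b" K A "regular_module K"] that by (simp add: dual_module_def)
    have "\<phi> a = \<phi> \<zero>\<^bsub>A\<^esub>"
      by (rule extensionalityI[OF ext ext]) (use a 0 t0 val in simp_all)
    then show "a = \<zero>\<^bsub>A\<^esub>" using bij a by (auto simp: bij_betw_def inj_on_def)
  qed (use inv tw tf in \<open>simp_all add: t_def\<close>)
  then show ?thesis by blast
qed

section \<open>The enveloping algebra\<close>

text \<open>The algebras below are records that agree with known structures only in some fields;
  this rule and its analogues compare exactly the fields that the axioms mention.\<close>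

lemma abelian_group_cong:
  assumes eq: "carrier H = carrier G" "add H = add G" "\<zero>\<^bsub>H\<^esub> = \<zero>\<^bsub>G\<^esub>" and G: "abelian_group G"
  shows "abelian_group H"
proof -
  interpret G: abelian_group G by (rule G)
  show ?thesis
    by (rule abelian_groupI) (auto simp: eq G.a_ac intro: G.add.l_inv_ex)
qed

lemma ring_cong:
  assumes eq: "carrier H = carrier G" "add H = add G" "\<zero>\<^bsub>H\<^esub> = \<zero>\<^bsub>G\<^esub>" "mult H = mult G" "\<one>\<^bsub>H\<^esub> = \<one>\<^bsub>G\<^esub>"
    and G: "ring G"
  shows "ring H"
proof -
  interpret G: ring G by (rule G)
  have "Group.monoid H" by (rule monoidI) (simp_all add: eq G.m_assoc)
  then show ?thesis
    by (intro ringI abelian_group_cong[OF eq(1-3) G.is_abelian_group]) (simp_all add: eq G.l_distr G.r_distr)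
qed

lemma left_module_cong:
  assumes "carrier N = carrier M" "add N = add M" "\<zero>\<^bsub>N\<^esub> = \<zero>\<^bsub>M\<^esub>" "smult N = smult M" "left_module R M"
  shows "left_module R N"
  using assms abelian_group_cong[of N M] by (simp add: left_module_def left_module_axioms_def)

lemma module_left_module: "module K V \<Longrightarrow> left_module K V"
proof -
  assume "module K V"
  then interpret V: module K V .
  show ?thesis
    by unfold_locales (simp_all add: V.smult_l_distr V.smult_r_distr V.smult_assoc1)
qed

text \<open>The linear extension of \<open>\<beta>\<close> from basis vectors. The sum in the action
  on \<open>enveloping_self\<close> is an instance of it.\<close>

definition lin :: "('k, 'x) ring_scheme \<Rightarrow> ('k, 'v) module \<Rightarrow> ('i \<Rightarrow> 'v) \<Rightarrow> ('i \<Rightarrow> 'k) \<Rightarrow> 'v"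
  where "lin K V \<beta> f = finsum V (\<lambda>p. f p \<odot>\<^bsub>V\<^esub> \<beta> p) {p. f p \<noteq> \<zero>\<^bsub>K\<^esub>}"

lemma lin_hom:
  assumes K: "ring K" and V: "left_module K V" and \<beta>: "\<And>i. i \<in> I \<Longrightarrow> \<beta> i \<in> carrier V"
  shows "(\<lambda>f\<in>carrier (free_module K I). lin K V \<beta> f) \<in> mod_hom K (free_module K I) V"
    and "i \<in> I \<Longrightarrow> lin K V \<beta> (basis_vector K i) = \<beta> i"
proof -
  obtain h where h: "h \<in> mod_hom K (free_module K I) V" "\<forall>i\<in>I. h (basis_vector K i) = \<beta> i"
    "\<forall>f\<in>carrier (free_module K I). h f = lin K V \<beta> f"
    using free_module_hom_exists[OF K V, of I \<beta>] \<beta> by (auto simp: lin_def)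
  have "h = (\<lambda>f\<in>carrier (free_module K I). lin K V \<beta> f)"
    by (rule extensionalityI[OF mod_homD(4)[OF h(1)]]) (use h(3) in auto)
  then show "(\<lambda>f\<in>carrier (free_module K I). lin K V \<beta> f) \<in> mod_hom K (free_module K I) V" using h(1) by simp
  show "i \<in> I \<Longrightarrow> lin K V \<beta> (basis_vector K i) = \<beta> i" using h(2,3) basis_vector_closed[OF K] by metis
qed

text \<open>For maps given as plain functions, not cut down to the carrier; products with a fixed
  factor occur in this form.\<close>

lemma free_linear_eq:
  assumes K: "ring K" and V: "left_module K V"
    and "\<And>f. f \<in> carrier (free_module K I) \<Longrightarrow> \<Phi> f \<in> carrier V"
    and "\<And>f g. f \<in> carrier (free_module K I) \<Longrightarrow> g \<in> carrier (free_module K I) \<Longrightarrow> \<Phi> (f \<oplus>\<^bsub>free_module K I\<^esub> g) = \<Phi> f \<oplus>\<^bsub>V\<^esub> \<Phi> g"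
    and "\<And>c f. c \<in> carrier K \<Longrightarrow> f \<in> carrier (free_module K I) \<Longrightarrow> \<Phi> (c \<odot>\<^bsub>free_module K I\<^esub> f) = c \<odot>\<^bsub>V\<^esub> \<Phi> f"
    and "\<And>f. f \<in> carrier (free_module K I) \<Longrightarrow> \<Psi> f \<in> carrier V"
    and "\<And>f g. f \<in> carrier (free_module K I) \<Longrightarrow> g \<in> carrier (free_module K I) \<Longrightarrow> \<Psi> (f \<oplus>\<^bsub>free_module K I\<^esub> g) = \<Psi> f \<oplus>\<^bsub>V\<^esub> \<Psi> g"
    and "\<And>c f. c \<in> carrier K \<Longrightarrow> f \<in> carrier (free_module K I) \<Longrightarrow> \<Psi> (c \<odot>\<^bsub>free_module K I\<^esub> f) = c \<odot>\<^bsub>V\<^esub> \<Psi> f"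
    and eq: "\<And>i. i \<in> I \<Longrightarrow> \<Phi> (basis_vector K i) = \<Psi> (basis_vector K i)"
    and f: "f \<in> carrier (free_module K I)"
  shows "\<Phi> f = \<Psi> f"
proof -
  have "(\<lambda>f\<in>carrier (free_module K I). \<Phi> f) \<in> mod_hom K (free_module K I) V"
    by (rule left_module_restrict_homI[OF free_left_module[OF K]]) (simp_all add: assms(3-5))
  moreover have "(\<lambda>f\<in>carrier (free_module K I). \<Psi> f) \<in> mod_hom K (free_module K I) V"
    by (rule left_module_restrict_homI[OF free_left_module[OF K]]) (simp_all add: assms(6-8))
  ultimately have "(\<lambda>f\<in>carrier (free_module K I). \<Phi> f) = (\<lambda>f\<in>carrier (free_module K I). \<Psi> f)"
    by (rule free_module_hom_eq[OF K V]) (use eq basis_vector_closed[OF K, of _ I] in auto)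
  then show ?thesis using f by (metis restrict_apply')
qed

section \<open>The tensor product of two algebras as a quotient\<close>

locale tensor = A: k_alg K A + B: k_alg K B
  for K :: "('k, 'x) ring_scheme" and A :: "('k, 'a) module" and B :: "('k, 'b) module"
begin

abbreviation "M \<equiv> carrier A \<times> carrier B"
abbreviation "FM \<equiv> free_module K M"
abbreviation "F \<equiv> free_product_algebra K A B"
abbreviation "bv \<equiv> basis_vector K"
abbreviation pm where "pm p q \<equiv> (fst p \<otimes>\<^bsub>A\<^esub> fst q, snd p \<otimes>\<^bsub>B\<^esub> snd q)"

lemmas K_ring = A.K.is_ring

lemma F_simps:
  "carrier F = carrier FM" "add F = add FM" "\<zero>\<^bsub>F\<^esub> = \<zero>\<^bsub>FM\<^esub>" "smult F = smult FM" "\<one>\<^bsub>F\<^esub> = bv (\<one>\<^bsub>A\<^esub>, \<one>\<^bsub>B\<^esub>)"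
  "(f \<otimes>\<^bsub>F\<^esub> g) r = finsum K (\<lambda>(p, q). f p \<otimes>\<^bsub>K\<^esub> g q) {(p, q). f p \<noteq> \<zero>\<^bsub>K\<^esub> \<and> g q \<noteq> \<zero>\<^bsub>K\<^esub> \<and> r = pm p q}"
  by (simp_all add: free_product_algebra_def)

lemma FM: "left_module K FM" by (rule free_left_module[OF K_ring])

lemma F_module: "left_module K F"
  by (rule left_module_cong[OF _ _ _ _ FM]) (simp_all add: F_simps)

sublocale F: left_module K F by (rule F_module)

lemma bv_closed: "p \<in> M \<Longrightarrow> bv p \<in> carrier F"
  using basis_vector_closed[OF K_ring] by (simp add: F_simps)

lemma FD: "f \<in> carrier F \<Longrightarrow> f p \<in> carrier K" "f \<in> carrier F \<Longrightarrow> finite {p. f p \<noteq> \<zero>\<^bsub>K\<^esub>}"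
    "f \<in> carrier F \<Longrightarrow> f p \<noteq> \<zero>\<^bsub>K\<^esub> \<Longrightarrow> p \<in> M"
proof -
  show "f \<in> carrier F \<Longrightarrow> f p \<in> carrier K" "f \<in> carrier F \<Longrightarrow> finite {p. f p \<noteq> \<zero>\<^bsub>K\<^esub>}"
    using A.K.free_module_carrierD[of f M p] by (simp_all add: F_simps free_module_simps)
  show "f \<in> carrier F \<Longrightarrow> f p \<noteq> \<zero>\<^bsub>K\<^esub> \<Longrightarrow> p \<in> M"
    unfolding F_simps(1) free_module_simps(1) by blast
qed

lemma F_pointwise: "(f \<oplus>\<^bsub>F\<^esub> g) p = f p \<oplus>\<^bsub>K\<^esub> g p" "(c \<odot>\<^bsub>F\<^esub> f) p = c \<otimes>\<^bsub>K\<^esub> f p" "\<zero>\<^bsub>F\<^esub> p = \<zero>\<^bsub>K\<^esub>"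
  by (simp_all add: F_simps free_module_simps)

text \<open>The defining sum runs over supports, which change with the factors. Enlarging it to a
  rectangle that contains them lets products of \<open>f\<close>, \<open>g\<close> and their sum be
  compared over one index set.\<close>

lemma mult_eq:
  assumes f: "f \<in> carrier F" and g: "g \<in> carrier F" and S: "finite S" "{p. f p \<noteq> \<zero>\<^bsub>K\<^esub>} \<subseteq> S" and T: "finite T" "{p. g p \<noteq> \<zero>\<^bsub>K\<^esub>} \<subseteq> T"
  shows "(f \<otimes>\<^bsub>F\<^esub> g) r = finsum K (\<lambda>z. f (fst z) \<otimes>\<^bsub>K\<^esub> g (snd z)) {z \<in> S \<times> T. r = pm (fst z) (snd z)}"
proof -
  have "finite {z \<in> S \<times> T. r = pm (fst z) (snd z)}" using S T by simp
  then show ?thesis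
    unfolding F_simps case_prod_beta
    by (intro A.K.add.finprod_mono_neutral_cong_left) (use S T FD(1)[OF f] FD(1)[OF g] in auto)
qed

lemma F_mult_closed:
  assumes f: "f \<in> carrier F" and g: "g \<in> carrier F"
  shows "f \<otimes>\<^bsub>F\<^esub> g \<in> carrier F"
proof -
  let ?S = "{p. f p \<noteq> \<zero>\<^bsub>K\<^esub>}" and ?T = "{p. g p \<noteq> \<zero>\<^bsub>K\<^esub>}"
  have supp: "{r. (f \<otimes>\<^bsub>F\<^esub> g) r \<noteq> \<zero>\<^bsub>K\<^esub>} \<subseteq> (\<lambda>z. pm (fst z) (snd z)) ` (?S \<times> ?T)"
  proof
    fix r assume "r \<in> {r. (f \<otimes>\<^bsub>F\<^esub> g) r \<noteq> \<zero>\<^bsub>K\<^esub>}"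
    then have "finsum K (\<lambda>z. f (fst z) \<otimes>\<^bsub>K\<^esub> g (snd z)) {z \<in> ?S \<times> ?T. r = pm (fst z) (snd z)} \<noteq> \<zero>\<^bsub>K\<^esub>"
      using mult_eq[OF f g FD(2)[OF f] subset_refl FD(2)[OF g] subset_refl] by simp
    then have "{z \<in> ?S \<times> ?T. r = pm (fst z) (snd z)} \<noteq> {}" by (metis A.K.finsum_empty)
    then show "r \<in> (\<lambda>z. pm (fst z) (snd z)) ` (?S \<times> ?T)" by blast
  qed
  have "(\<lambda>z. pm (fst z) (snd z)) ` (?S \<times> ?T) \<subseteq> M" using FD(3)[OF f] FD(3)[OF g] by auto
  then have "r \<notin> M \<Longrightarrow> (f \<otimes>\<^bsub>F\<^esub> g) r = \<zero>\<^bsub>K\<^esub>" for r using supp by blast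
  moreover have "(f \<otimes>\<^bsub>F\<^esub> g) r \<in> carrier K" for r
    unfolding mult_eq[OF f g FD(2)[OF f] subset_refl FD(2)[OF g] subset_refl]
    by (rule A.K.finsum_closed) (use FD(1)[OF f] FD(1)[OF g] in auto)
  moreover have "finite {r. (f \<otimes>\<^bsub>F\<^esub> g) r \<noteq> \<zero>\<^bsub>K\<^esub>}" by (rule finite_subset[OF supp]) (use FD(2)[OF f] FD(2)[OF g] in simp)
  ultimately show ?thesis unfolding F_simps(1) free_module_simps(1) by blast
qed

lemma F_mult_linear_aux:
  assumes f: "f \<in> carrier F" and g: "g \<in> carrier F" and h: "h \<in> carrier F" and c: "c \<in> carrier K"
  shows "(f \<oplus>\<^bsub>F\<^esub> g) \<otimes>\<^bsub>F\<^esub> h = f \<otimes>\<^bsub>F\<^esub> h \<oplus>\<^bsub>F\<^esub> g \<otimes>\<^bsub>F\<^esub> h"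
    and "h \<otimes>\<^bsub>F\<^esub> (f \<oplus>\<^bsub>F\<^esub> g) = h \<otimes>\<^bsub>F\<^esub> f \<oplus>\<^bsub>F\<^esub> h \<otimes>\<^bsub>F\<^esub> g"
    and "(c \<odot>\<^bsub>F\<^esub> f) \<otimes>\<^bsub>F\<^esub> h = c \<odot>\<^bsub>F\<^esub> (f \<otimes>\<^bsub>F\<^esub> h)"
    and "h \<otimes>\<^bsub>F\<^esub> (c \<odot>\<^bsub>F\<^esub> f) = c \<odot>\<^bsub>F\<^esub> (h \<otimes>\<^bsub>F\<^esub> f)"
proof -
  let ?S = "{p. f p \<noteq> \<zero>\<^bsub>K\<^esub>} \<union> {p. g p \<noteq> \<zero>\<^bsub>K\<^esub>}" and ?T = "{p. h p \<noteq> \<zero>\<^bsub>K\<^esub>}"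
  have S: "finite ?S" "finite ?T" using FD(2) assms by auto
  have fg: "f \<oplus>\<^bsub>F\<^esub> g \<in> carrier F" "c \<odot>\<^bsub>F\<^esub> f \<in> carrier F" using assms F.smult_closed by auto
  note FD1 = FD(1)[OF f] FD(1)[OF g] FD(1)[OF h]
  have supp: "{p. (f \<oplus>\<^bsub>F\<^esub> g) p \<noteq> \<zero>\<^bsub>K\<^esub>} \<subseteq> ?S" "{p. (c \<odot>\<^bsub>F\<^esub> f) p \<noteq> \<zero>\<^bsub>K\<^esub>} \<subseteq> ?S"
    "{p. f p \<noteq> \<zero>\<^bsub>K\<^esub>} \<subseteq> ?S" "{p. g p \<noteq> \<zero>\<^bsub>K\<^esub>} \<subseteq> ?S" using c by (auto simp: F_pointwise)
  note ml = mult_eq[OF _ h S(1) _ S(2) subset_refl] and mr = mult_eq[OF h _ S(2) subset_refl S(1)]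
  show "(f \<oplus>\<^bsub>F\<^esub> g) \<otimes>\<^bsub>F\<^esub> h = f \<otimes>\<^bsub>F\<^esub> h \<oplus>\<^bsub>F\<^esub> g \<otimes>\<^bsub>F\<^esub> h"
  proof
    fix r
    let ?Z = "{z \<in> ?S \<times> ?T. r = pm (fst z) (snd z)}"
    have "((f \<oplus>\<^bsub>F\<^esub> g) \<otimes>\<^bsub>F\<^esub> h) r = finsum K (\<lambda>z. f (fst z) \<otimes>\<^bsub>K\<^esub> h (snd z) \<oplus>\<^bsub>K\<^esub> g (fst z) \<otimes>\<^bsub>K\<^esub> h (snd z)) ?Z"
      unfolding ml[OF fg(1) supp(1)]
      by (rule A.K.finsum_cong') (use FD1 in \<open>auto simp: F_pointwise A.K.l_distr\<close>)
    also have "\<dots> = (f \<otimes>\<^bsub>F\<^esub> h \<oplus>\<^bsub>F\<^esub> g \<otimes>\<^bsub>F\<^esub> h) r"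
      unfolding F_pointwise ml[OF f supp(3)] ml[OF g supp(4)] by (rule A.K.finsum_addf) (use FD1 in auto)
    finally show "((f \<oplus>\<^bsub>F\<^esub> g) \<otimes>\<^bsub>F\<^esub> h) r = (f \<otimes>\<^bsub>F\<^esub> h \<oplus>\<^bsub>F\<^esub> g \<otimes>\<^bsub>F\<^esub> h) r" .
  qed
  show "h \<otimes>\<^bsub>F\<^esub> (f \<oplus>\<^bsub>F\<^esub> g) = h \<otimes>\<^bsub>F\<^esub> f \<oplus>\<^bsub>F\<^esub> h \<otimes>\<^bsub>F\<^esub> g"
  proof
    fix r
    let ?Z = "{z \<in> ?T \<times> ?S. r = pm (fst z) (snd z)}"
    have "(h \<otimes>\<^bsub>F\<^esub> (f \<oplus>\<^bsub>F\<^esub> g)) r = finsum K (\<lambda>z. h (fst z) \<otimes>\<^bsub>K\<^esub> f (snd z) \<oplus>\<^bsub>K\<^esub> h (fst z) \<otimes>\<^bsub>K\<^esub> g (snd z)) ?Z"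
      unfolding mr[OF fg(1) supp(1)]
      by (rule A.K.finsum_cong') (use FD1 in \<open>auto simp: F_pointwise A.K.r_distr\<close>)
    also have "\<dots> = (h \<otimes>\<^bsub>F\<^esub> f \<oplus>\<^bsub>F\<^esub> h \<otimes>\<^bsub>F\<^esub> g) r"
      unfolding F_pointwise mr[OF f supp(3)] mr[OF g supp(4)] by (rule A.K.finsum_addf) (use FD1 in auto)
    finally show "(h \<otimes>\<^bsub>F\<^esub> (f \<oplus>\<^bsub>F\<^esub> g)) r = (h \<otimes>\<^bsub>F\<^esub> f \<oplus>\<^bsub>F\<^esub> h \<otimes>\<^bsub>F\<^esub> g) r" .
  qed
  show "(c \<odot>\<^bsub>F\<^esub> f) \<otimes>\<^bsub>F\<^esub> h = c \<odot>\<^bsub>F\<^esub> (f \<otimes>\<^bsub>F\<^esub> h)"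
  proof
    fix r
    let ?Z = "{z \<in> ?S \<times> ?T. r = pm (fst z) (snd z)}"
    have fin: "finite ?Z" using S by simp
    have "((c \<odot>\<^bsub>F\<^esub> f) \<otimes>\<^bsub>F\<^esub> h) r = finsum K (\<lambda>z. c \<otimes>\<^bsub>K\<^esub> (f (fst z) \<otimes>\<^bsub>K\<^esub> h (snd z))) ?Z"
      unfolding ml[OF fg(2) supp(2)]
      by (rule A.K.finsum_cong') (use FD1 c in \<open>auto simp: F_pointwise A.K.m_assoc\<close>)
    also have "\<dots> = (c \<odot>\<^bsub>F\<^esub> (f \<otimes>\<^bsub>F\<^esub> h)) r"
      unfolding F_pointwise ml[OF f supp(3)] by (rule A.K.finsum_rdistr[OF fin c, symmetric]) (use FD1 in auto)
    finally show "((c \<odot>\<^bsub>F\<^esub> f) \<otimes>\<^bsub>F\<^esub> h) r = (c \<odot>\<^bsub>F\<^esub> (f \<otimes>\<^bsub>F\<^esub> h)) r" .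
  qed
  show "h \<otimes>\<^bsub>F\<^esub> (c \<odot>\<^bsub>F\<^esub> f) = c \<odot>\<^bsub>F\<^esub> (h \<otimes>\<^bsub>F\<^esub> f)"
  proof
    fix r
    let ?Z = "{z \<in> ?T \<times> ?S. r = pm (fst z) (snd z)}"
    have fin: "finite ?Z" using S by simp
    have "(h \<otimes>\<^bsub>F\<^esub> (c \<odot>\<^bsub>F\<^esub> f)) r = finsum K (\<lambda>z. c \<otimes>\<^bsub>K\<^esub> (h (fst z) \<otimes>\<^bsub>K\<^esub> f (snd z))) ?Z"
      unfolding mr[OF fg(2) supp(2)]
      by (rule A.K.finsum_cong') (use FD1 c in \<open>auto simp: F_pointwise A.K.m_lcomm\<close>)
    also have "\<dots> = (c \<odot>\<^bsub>F\<^esub> (h \<otimes>\<^bsub>F\<^esub> f)) r"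
      unfolding F_pointwise mr[OF f supp(3)] by (rule A.K.finsum_rdistr[OF fin c, symmetric]) (use FD1 in auto)
    finally show "(h \<otimes>\<^bsub>F\<^esub> (c \<odot>\<^bsub>F\<^esub> f)) r = (c \<odot>\<^bsub>F\<^esub> (h \<otimes>\<^bsub>F\<^esub> f)) r" .
  qed
qed

lemma F_mult_linear:
  "\<lbrakk>f \<in> carrier F; g \<in> carrier F; h \<in> carrier F\<rbrakk> \<Longrightarrow> (f \<oplus>\<^bsub>F\<^esub> g) \<otimes>\<^bsub>F\<^esub> h = f \<otimes>\<^bsub>F\<^esub> h \<oplus>\<^bsub>F\<^esub> g \<otimes>\<^bsub>F\<^esub> h"
  "\<lbrakk>f \<in> carrier F; g \<in> carrier F; h \<in> carrier F\<rbrakk> \<Longrightarrow> h \<otimes>\<^bsub>F\<^esub> (f \<oplus>\<^bsub>F\<^esub> g) = h \<otimes>\<^bsub>F\<^esub> f \<oplus>\<^bsub>F\<^esub> h \<otimes>\<^bsub>F\<^esub> g"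
  "\<lbrakk>f \<in> carrier F; h \<in> carrier F; c \<in> carrier K\<rbrakk> \<Longrightarrow> (c \<odot>\<^bsub>F\<^esub> f) \<otimes>\<^bsub>F\<^esub> h = c \<odot>\<^bsub>F\<^esub> (f \<otimes>\<^bsub>F\<^esub> h)"
  "\<lbrakk>f \<in> carrier F; h \<in> carrier F; c \<in> carrier K\<rbrakk> \<Longrightarrow> h \<otimes>\<^bsub>F\<^esub> (c \<odot>\<^bsub>F\<^esub> f) = c \<odot>\<^bsub>F\<^esub> (h \<otimes>\<^bsub>F\<^esub> f)"
  using F_mult_linear_aux[of f g h "\<zero>\<^bsub>K\<^esub>"] F_mult_linear_aux[of f f h c] by simp_all

lemma pm_closed: "p \<in> M \<Longrightarrow> q \<in> M \<Longrightarrow> pm p q \<in> M" by auto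

lemma bv_mult:
  assumes "p \<in> M" "q \<in> M"
  shows "bv p \<otimes>\<^bsub>F\<^esub> bv q = bv (pm p q)"
proof
  fix r
  have "(bv p \<otimes>\<^bsub>F\<^esub> bv q) r = finsum K (\<lambda>z. bv p (fst z) \<otimes>\<^bsub>K\<^esub> bv q (snd z)) {z \<in> {p} \<times> {q}. r = pm (fst z) (snd z)}"
    by (rule mult_eq) (use assms bv_closed in \<open>auto simp: basis_vector_def\<close>)
  also have "{z \<in> {p} \<times> {q}. r = pm (fst z) (snd z)} = (if r = pm p q then {(p, q)} else {})" by auto
  also have "finsum K (\<lambda>z. bv p (fst z) \<otimes>\<^bsub>K\<^esub> bv q (snd z)) \<dots> = bv (pm p q) r"
    by (simp add: basis_vector_def)
  finally show "(bv p \<otimes>\<^bsub>F\<^esub> bv q) r = bv (pm p q) r" .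
qed

lemma F_linear_eq:
  assumes "left_module K V"
    and "\<And>f. f \<in> carrier F \<Longrightarrow> \<Phi> f \<in> carrier V"
    and "\<And>f g. f \<in> carrier F \<Longrightarrow> g \<in> carrier F \<Longrightarrow> \<Phi> (f \<oplus>\<^bsub>F\<^esub> g) = \<Phi> f \<oplus>\<^bsub>V\<^esub> \<Phi> g"
    and "\<And>c f. c \<in> carrier K \<Longrightarrow> f \<in> carrier F \<Longrightarrow> \<Phi> (c \<odot>\<^bsub>F\<^esub> f) = c \<odot>\<^bsub>V\<^esub> \<Phi> f"
    and "\<And>f. f \<in> carrier F \<Longrightarrow> \<Psi> f \<in> carrier V"
    and "\<And>f g. f \<in> carrier F \<Longrightarrow> g \<in> carrier F \<Longrightarrow> \<Psi> (f \<oplus>\<^bsub>F\<^esub> g) = \<Psi> f \<oplus>\<^bsub>V\<^esub> \<Psi> g"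
    and "\<And>c f. c \<in> carrier K \<Longrightarrow> f \<in> carrier F \<Longrightarrow> \<Psi> (c \<odot>\<^bsub>F\<^esub> f) = c \<odot>\<^bsub>V\<^esub> \<Psi> f"
    and "\<And>p. p \<in> M \<Longrightarrow> \<Phi> (bv p) = \<Psi> (bv p)"
    and "f \<in> carrier F"
  shows "\<Phi> f = \<Psi> f"
  by (rule free_linear_eq[OF K_ring assms(1), of M \<Phi> \<Psi> f]) (use assms(2-9) in \<open>simp_all add: F_simps(1-4)\<close>)

text \<open>Both sides are linear in each argument. From three basis vectors, where the identity is
  associativity in \<open>A\<close> and in \<open>B\<close>, first the third, then the second, then
  the first argument is made arbitrary.\<close>

lemma F_assoc:
  assumes fgh: "f \<in> carrier F" "g \<in> carrier F" "h \<in> carrier F"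
  shows "f \<otimes>\<^bsub>F\<^esub> g \<otimes>\<^bsub>F\<^esub> h = f \<otimes>\<^bsub>F\<^esub> (g \<otimes>\<^bsub>F\<^esub> h)"
proof -
  note L = F_mult_linear F_mult_closed F.smult_closed
  have 1: "bv p \<otimes>\<^bsub>F\<^esub> bv q \<otimes>\<^bsub>F\<^esub> h = bv p \<otimes>\<^bsub>F\<^esub> (bv q \<otimes>\<^bsub>F\<^esub> h)" if pq: "p \<in> M" "q \<in> M" and h: "h \<in> carrier F" for p q h
  proof (rule F_linear_eq[OF F_module _ _ _ _ _ _ _ h])
    fix r assume r: "r \<in> M"
    have "pm (pm p q) r = pm p (pm q r)" using pq r by (auto simp: A.E.m_assoc B.E.m_assoc)
    then show "bv p \<otimes>\<^bsub>F\<^esub> bv q \<otimes>\<^bsub>F\<^esub> bv r = bv p \<otimes>\<^bsub>F\<^esub> (bv q \<otimes>\<^bsub>F\<^esub> bv r)"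
      using pq r bv_mult[OF pq] bv_mult[OF pq(2) r] bv_mult[OF pm_closed[OF pq] r] bv_mult[OF pq(1) pm_closed[OF pq(2) r]] by simp
  qed (use pq bv_closed L in simp_all)
  have 2: "bv p \<otimes>\<^bsub>F\<^esub> g \<otimes>\<^bsub>F\<^esub> h = bv p \<otimes>\<^bsub>F\<^esub> (g \<otimes>\<^bsub>F\<^esub> h)" if p: "p \<in> M" and g: "g \<in> carrier F" and h: "h \<in> carrier F" for p g h
    by (rule F_linear_eq[OF F_module _ _ _ _ _ _ _ g]) (use p h bv_closed L 1 in simp_all)
  show ?thesis
    by (rule F_linear_eq[OF F_module _ _ _ _ _ _ _ fgh(1)]) (use fgh L 2 in simp_all)
qed

lemma F_ring: "ring F"
proof (rule ringI)
  show "abelian_group F" by (rule F.M.abelian_group_axioms)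
  have one: "\<one>\<^bsub>F\<^esub> \<in> carrier F" unfolding F_simps(5) by (rule bv_closed) simp
  note L = F_mult_linear F_mult_closed F.smult_closed
  show "Group.monoid F"
  proof (rule monoidI)
    fix f assume f: "f \<in> carrier F"
    show "\<one>\<^bsub>F\<^esub> \<otimes>\<^bsub>F\<^esub> f = f"
      by (rule F_linear_eq[OF F_module _ _ _ _ _ _ _ f, of "\<lambda>f. \<one>\<^bsub>F\<^esub> \<otimes>\<^bsub>F\<^esub> f" "\<lambda>f. f"])
        (use one L F_simps(5) in \<open>auto simp: bv_mult\<close>)
    show "f \<otimes>\<^bsub>F\<^esub> \<one>\<^bsub>F\<^esub> = f"
      by (rule F_linear_eq[OF F_module _ _ _ _ _ _ _ f, of "\<lambda>f. f \<otimes>\<^bsub>F\<^esub> \<one>\<^bsub>F\<^esub>" "\<lambda>f. f"])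
        (use one L F_simps(5) in \<open>auto simp: bv_mult\<close>)
  qed (use one F_assoc F_mult_closed in auto)
qed (use F_mult_linear A.K.one_closed in blast)+

sublocale FR: ring F by (rule F_ring)

definition bilinear :: "('k, 'v) module \<Rightarrow> ('a \<times> 'b \<Rightarrow> 'v) \<Rightarrow> bool"
  where "bilinear V \<beta> \<longleftrightarrow> (\<forall>a\<in>carrier A. \<forall>b\<in>carrier B. \<beta> (a, b) \<in> carrier V) \<and>
    (\<forall>a\<in>carrier A. \<forall>a'\<in>carrier A. \<forall>b\<in>carrier B. \<beta> (a \<oplus>\<^bsub>A\<^esub> a', b) = \<beta> (a, b) \<oplus>\<^bsub>V\<^esub> \<beta> (a', b)) \<and>
    (\<forall>a\<in>carrier A. \<forall>b\<in>carrier B. \<forall>b'\<in>carrier B. \<beta> (a, b \<oplus>\<^bsub>B\<^esub> b') = \<beta> (a, b) \<oplus>\<^bsub>V\<^esub> \<beta> (a, b')) \<and>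
    (\<forall>c\<in>carrier K. \<forall>a\<in>carrier A. \<forall>b\<in>carrier B. \<beta> (c \<odot>\<^bsub>A\<^esub> a, b) = c \<odot>\<^bsub>V\<^esub> \<beta> (a, b)) \<and>
    (\<forall>c\<in>carrier K. \<forall>a\<in>carrier A. \<forall>b\<in>carrier B. \<beta> (a, c \<odot>\<^bsub>B\<^esub> b) = c \<odot>\<^bsub>V\<^esub> \<beta> (a, b))"

lemma lin_F:
  assumes V: "left_module K V" and \<beta>: "bilinear V \<beta>"
  shows "(\<lambda>f\<in>carrier F. lin K V \<beta> f) \<in> mod_hom K F V"
    and "p \<in> M \<Longrightarrow> lin K V \<beta> (bv p) = \<beta> p"
proof -
  have c: "p \<in> M \<Longrightarrow> \<beta> p \<in> carrier V" for p using \<beta> by (auto simp: bilinear_def)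
  show "p \<in> M \<Longrightarrow> lin K V \<beta> (bv p) = \<beta> p" by (rule lin_hom(2)[OF K_ring V, of M]) (simp_all add: c)
  have "(\<lambda>f\<in>carrier FM. lin K V \<beta> f) \<in> mod_hom K FM V" by (rule lin_hom(1)[OF K_ring V]) (rule c)
  moreover have "mod_hom K F V = mod_hom K FM V" by (simp add: mod_hom_def F_simps(1-4))
  ultimately show "(\<lambda>f\<in>carrier F. lin K V \<beta> f) \<in> mod_hom K F V" by (simp add: F_simps(1))
qed

lemma lin_FD:
  assumes V: "left_module K V" and \<beta>: "bilinear V \<beta>"
  shows "f \<in> carrier F \<Longrightarrow> lin K V \<beta> f \<in> carrier V"
    and "f \<in> carrier F \<Longrightarrow> g \<in> carrier F \<Longrightarrow> lin K V \<beta> (f \<oplus>\<^bsub>F\<^esub> g) = lin K V \<beta> f \<oplus>\<^bsub>V\<^esub> lin K V \<beta> g"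
    and "c \<in> carrier K \<Longrightarrow> f \<in> carrier F \<Longrightarrow> lin K V \<beta> (c \<odot>\<^bsub>F\<^esub> f) = c \<odot>\<^bsub>V\<^esub> lin K V \<beta> f"
    and "f \<in> carrier F \<Longrightarrow> g \<in> carrier F \<Longrightarrow> lin K V \<beta> (f \<ominus>\<^bsub>F\<^esub> g) = lin K V \<beta> f \<ominus>\<^bsub>V\<^esub> lin K V \<beta> g"
  using mod_homD(1-3)[OF lin_F(1)[OF assms]] mod_hom_diff[OF lin_F(1)[OF assms] F_module V] F.smult_closed
  by (auto simp: F.M.minus_closed)

abbreviation "I \<equiv> Idl\<^bsub>F\<^esub> (bilinear_relations K A B)"

lemma relations_closed: "bilinear_relations K A B \<subseteq> carrier F"
  by (auto simp: bilinear_relations_def Let_def intro!: F.M.minus_closed F.M.a_closed bv_closed F.smult_closed)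

sublocale I: ideal I F by (rule FR.genideal_ideal[OF relations_closed])

text \<open>Multiplying the argument by a fixed pair gives another bilinear map. The elements killed
  by all bilinear maps are therefore closed under multiplication by basis vectors, as those killed
  by a single one need not be.\<close>

lemma bilinear_shift:
  assumes \<beta>: "bilinear V \<beta>" and p: "p \<in> M"
  shows "bilinear V (\<lambda>q. \<beta> (pm p q))" "bilinear V (\<lambda>q. \<beta> (pm q p))"
  using assms by (auto simp: bilinear_def A.E.r_distr A.E.l_distr B.E.r_distr B.E.l_distr A.smult_mult B.smult_mult)

text \<open>Elements killed by every bilinear map into \<open>V\<close> form an ideal containing the relations.\<close>

lemma lin_I:
  assumes V: "left_module K V" and \<beta>: "bilinear V \<beta>" and f: "f \<in> I"
  shows "lin K V \<beta> f = \<zero>\<^bsub>V\<^esub>"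
proof -
  interpret V: left_module K V by (rule V)
  define J where "J = {f \<in> carrier F. \<forall>\<beta>. bilinear V \<beta> \<longrightarrow> lin K V \<beta> f = \<zero>\<^bsub>V\<^esub>}"
  note D = lin_FD[OF V]
  have mult: "lin K V \<beta> (bv p \<otimes>\<^bsub>F\<^esub> f) = lin K V (\<lambda>q. \<beta> (pm p q)) f" "lin K V \<beta> (f \<otimes>\<^bsub>F\<^esub> bv p) = lin K V (\<lambda>q. \<beta> (pm q p)) f"
    if b: "bilinear V \<beta>" and p: "p \<in> M" and f: "f \<in> carrier F" for p f \<beta>
  proof -
    note sh = bilinear_shift[OF b p]
    show "lin K V \<beta> (bv p \<otimes>\<^bsub>F\<^esub> f) = lin K V (\<lambda>q. \<beta> (pm p q)) f"
      by (rule F_linear_eq[OF V _ _ _ _ _ _ _ f])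
        (use b p sh D F_mult_linear F_mult_closed bv_closed bv_mult pm_closed F.smult_closed lin_F(2)[OF V] in simp_all)
    show "lin K V \<beta> (f \<otimes>\<^bsub>F\<^esub> bv p) = lin K V (\<lambda>q. \<beta> (pm q p)) f"
      by (rule F_linear_eq[OF V _ _ _ _ _ _ _ f])
        (use b p sh D F_mult_linear F_mult_closed bv_closed bv_mult pm_closed F.smult_closed lin_F(2)[OF V] in simp_all)
  qed
  have "ideal J F"
  proof (rule idealI[OF F_ring])
    show "subgroup J (add_monoid F)"
    proof (rule group.subgroupI[OF F.M.a_group])
      show "J \<noteq> {}" using mod_hom_zero[OF lin_F(1)[OF V] F_module V] by (auto simp: J_def)
      show "inv\<^bsub>add_monoid F\<^esub> a \<in> J" if "a \<in> J" for a
        using mod_hom_neg[OF lin_F(1)[OF V] F_module V, of _ a] that by (auto simp: J_def simp flip: a_inv_def)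
    qed (auto simp: J_def D)
  next
    fix f x assume f: "f \<in> J" and x: "x \<in> carrier F"
    have fc: "f \<in> carrier F" using f by (simp add: J_def)
    have "lin K V \<beta> (x \<otimes>\<^bsub>F\<^esub> f) = \<zero>\<^bsub>V\<^esub>" if b: "bilinear V \<beta>" for \<beta>
    proof (rule F_linear_eq[OF V _ _ _ _ _ _ _ x, of "\<lambda>x. lin K V \<beta> (x \<otimes>\<^bsub>F\<^esub> f)" "\<lambda>_. \<zero>\<^bsub>V\<^esub>"])
      fix p assume p: "p \<in> M"
      show "lin K V \<beta> (bv p \<otimes>\<^bsub>F\<^esub> f) = \<zero>\<^bsub>V\<^esub>" using mult(1)[OF b p fc] bilinear_shift(1)[OF b p] f by (simp add: J_def)
    qed (use b fc D F_mult_linear F_mult_closed F.smult_closed V.smult_r_zero in simp_all)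
    then show "x \<otimes>\<^bsub>F\<^esub> f \<in> J" using fc x F_mult_closed by (simp add: J_def)
    have "lin K V \<beta> (f \<otimes>\<^bsub>F\<^esub> x) = \<zero>\<^bsub>V\<^esub>" if b: "bilinear V \<beta>" for \<beta>
    proof (rule F_linear_eq[OF V _ _ _ _ _ _ _ x, of "\<lambda>x. lin K V \<beta> (f \<otimes>\<^bsub>F\<^esub> x)" "\<lambda>_. \<zero>\<^bsub>V\<^esub>"])
      fix p assume p: "p \<in> M"
      show "lin K V \<beta> (f \<otimes>\<^bsub>F\<^esub> bv p) = \<zero>\<^bsub>V\<^esub>" using mult(2)[OF b p fc] bilinear_shift(2)[OF b p] f by (simp add: J_def)
    qed (use b fc D F_mult_linear F_mult_closed F.smult_closed V.smult_r_zero in simp_all)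
    then show "f \<otimes>\<^bsub>F\<^esub> x \<in> J" using fc x F_mult_closed by (simp add: J_def)
  qed
  moreover have "bilinear_relations K A B \<subseteq> J"
  proof
    fix x assume x: "x \<in> bilinear_relations K A B"
    have "lin K V \<beta> x = \<zero>\<^bsub>V\<^esub>" if b: "bilinear V \<beta>" for \<beta>
      using x b bv_closed F.smult_closed
      by (auto simp: bilinear_relations_def Let_def D[OF b] lin_F(2)[OF V b] bilinear_def V.M.minus_eq V.M.r_neg V.smult_closed)
    then show "x \<in> J" using x relations_closed by (auto simp: J_def)
  qed
  ultimately have "I \<subseteq> J" by (rule FR.genideal_minimal)
  then show ?thesis using f \<beta> by (auto simp: J_def)
qed

abbreviation "TP \<equiv> tensor_algebra_of K A B"
abbreviation "cls f \<equiv> I +>\<^bsub>F\<^esub> f"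

lemma TP_eq: "TP = quot_module F I"
  by (simp add: tensor_algebra_of_def Let_def)

lemma TP_carrier: "carrier TP = cls ` carrier F"
  by (auto simp: TP_eq quot_module_def FactRing_def A_RCOSETS_def RCOSETS_def a_r_coset_def)

lemma cls_closed: "f \<in> carrier F \<Longrightarrow> cls f \<in> carrier TP"
  by (simp add: TP_carrier)

lemma cls_add: "f \<in> carrier F \<Longrightarrow> g \<in> carrier F \<Longrightarrow> cls f \<oplus>\<^bsub>TP\<^esub> cls g = cls (f \<oplus>\<^bsub>F\<^esub> g)"
  by (simp add: TP_eq quot_module_def FactRing_def I.a_rcos_sum)

lemma cls_mult: "f \<in> carrier F \<Longrightarrow> g \<in> carrier F \<Longrightarrow> cls f \<otimes>\<^bsub>TP\<^esub> cls g = cls (f \<otimes>\<^bsub>F\<^esub> g)"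
  by (simp add: TP_eq quot_module_def FactRing_def I.rcoset_mult_add)

lemma cls_one: "\<one>\<^bsub>TP\<^esub> = cls \<one>\<^bsub>F\<^esub>"
  by (simp add: TP_eq quot_module_def FactRing_def)

lemma cls_eqI: "f \<in> carrier F \<Longrightarrow> g \<in> carrier F \<Longrightarrow> f \<ominus>\<^bsub>F\<^esub> g \<in> I \<Longrightarrow> cls f = cls g"
  using I.a_rcos_module_minus[OF F_ring, of g f] I.a_repr_independence'[of f g] by auto

text \<open>The scalar action on cosets is a union over representatives. It is constant on a coset
  because scaling by \<open>c\<close> is multiplication by the class of \<open>c\<close> times 1 in
  the quotient ring.\<close>

lemma cls_smult:
  assumes c: "c \<in> carrier K" and f: "f \<in> carrier F"
  shows "c \<odot>\<^bsub>TP\<^esub> cls f = cls (c \<odot>\<^bsub>F\<^esub> f)"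
proof -
  have one: "c \<odot>\<^bsub>F\<^esub> \<one>\<^bsub>F\<^esub> \<in> carrier F" using c F.smult_closed by simp
  have const: "cls (c \<odot>\<^bsub>F\<^esub> x) = cls (c \<odot>\<^bsub>F\<^esub> f)" if x: "x \<in> cls f" for x
  proof -
    have xc: "x \<in> carrier F" using I.a_elemrcos_carrier[OF f x] .
    have "cls x = cls f" using I.a_repr_independence'[OF x f] by simp
    then have "cls (c \<odot>\<^bsub>F\<^esub> \<one>\<^bsub>F\<^esub>) \<otimes>\<^bsub>TP\<^esub> cls x = cls (c \<odot>\<^bsub>F\<^esub> \<one>\<^bsub>F\<^esub>) \<otimes>\<^bsub>TP\<^esub> cls f" by simp
    then show ?thesis using cls_mult[OF one xc] cls_mult[OF one f] F_mult_linear(3)[OF FR.one_closed xc c] F_mult_linear(3)[OF FR.one_closed f c] xc f by simp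
  qed
  have "c \<odot>\<^bsub>TP\<^esub> cls f = (\<Union>x\<in>cls f. cls (c \<odot>\<^bsub>F\<^esub> x))" by (simp add: TP_eq quot_module_def)
  also have "\<dots> = (\<Union>x\<in>cls f. cls (c \<odot>\<^bsub>F\<^esub> f))" by (rule SUP_cong[OF refl const])
  also have "\<dots> = cls (c \<odot>\<^bsub>F\<^esub> f)" by (rule UN_constant_eq[OF I.a_rcos_self[OF f]]) simp
  finally show ?thesis .
qed

lemma TP_zero: "\<zero>\<^bsub>TP\<^esub> = cls \<zero>\<^bsub>F\<^esub>"
  using F.M.a_coset_add_zero[OF I.a_subset] by (simp add: TP_eq quot_module_def FactRing_def)

lemma TP_k_algebra: "k_algebra K TP"
proof -
  have R: "ring TP"
    by (rule ring_cong[OF _ _ _ _ _ I.quotient_is_ring]) (simp_all add: TP_eq quot_module_def)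
  interpret R: ring TP by (rule R)
  note S = cls_add cls_mult cls_smult F.smult_closed F_mult_closed F_mult_linear cls_closed
  have "module K TP"
    by (rule moduleI[OF A.K.is_cring R.is_abelian_group])
      (auto simp: TP_carrier S F.smult_l_distr F.smult_r_distr F.smult_assoc F.smult_one)
  then show ?thesis
    unfolding k_algebra_def using A.k_algebra R
    by (auto simp: TP_carrier S k_algebra_def)
qed

definition pure where "pure a b = cls (bv (a, b))"

lemma pure_closed: "a \<in> carrier A \<Longrightarrow> b \<in> carrier B \<Longrightarrow> pure a b \<in> carrier TP"
  by (simp add: pure_def cls_closed bv_closed)

lemma pure_mult:
  "\<lbrakk>a \<in> carrier A; b \<in> carrier B; a' \<in> carrier A; b' \<in> carrier B\<rbrakk> \<Longrightarrow>
    pure a b \<otimes>\<^bsub>TP\<^esub> pure a' b' = pure (a \<otimes>\<^bsub>A\<^esub> a') (b \<otimes>\<^bsub>B\<^esub> b')"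
  by (simp add: pure_def cls_mult bv_closed bv_mult)

lemma pure_one: "pure \<one>\<^bsub>A\<^esub> \<one>\<^bsub>B\<^esub> = \<one>\<^bsub>TP\<^esub>"
  by (simp add: pure_def cls_one F_simps)

lemma relation_mem: "x \<in> bilinear_relations K A B \<Longrightarrow> x \<in> I"
  using FR.genideal_self[OF relations_closed] by blast

lemma pure_bilinear:
  assumes "a \<in> carrier A" "a' \<in> carrier A" "b \<in> carrier B" "b' \<in> carrier B" "c \<in> carrier K"
  shows "pure (a \<oplus>\<^bsub>A\<^esub> a') b = pure a b \<oplus>\<^bsub>TP\<^esub> pure a' b" "pure a (b \<oplus>\<^bsub>B\<^esub> b') = pure a b \<oplus>\<^bsub>TP\<^esub> pure a b'"
    "pure (c \<odot>\<^bsub>A\<^esub> a) b = c \<odot>\<^bsub>TP\<^esub> pure a b" "pure a (c \<odot>\<^bsub>B\<^esub> b) = c \<odot>\<^bsub>TP\<^esub> pure a b"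
proof -
  note S = cls_add cls_smult F.smult_closed bv_closed
  have "bv (a \<oplus>\<^bsub>A\<^esub> a', b) \<ominus>\<^bsub>F\<^esub> (bv (a, b) \<oplus>\<^bsub>F\<^esub> bv (a', b)) \<in> I"
    by (rule relation_mem) (use assms in \<open>unfold bilinear_relations_def Let_def, blast\<close>)
  then show "pure (a \<oplus>\<^bsub>A\<^esub> a') b = pure a b \<oplus>\<^bsub>TP\<^esub> pure a' b"
    unfolding pure_def using assms by (simp add: S cls_eqI)
  have "bv (a, b \<oplus>\<^bsub>B\<^esub> b') \<ominus>\<^bsub>F\<^esub> (bv (a, b) \<oplus>\<^bsub>F\<^esub> bv (a, b')) \<in> I"
    by (rule relation_mem) (use assms in \<open>unfold bilinear_relations_def Let_def, blast\<close>)
  then show "pure a (b \<oplus>\<^bsub>B\<^esub> b') = pure a b \<oplus>\<^bsub>TP\<^esub> pure a b'"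
    unfolding pure_def using assms by (simp add: S cls_eqI)
  have "bv (c \<odot>\<^bsub>A\<^esub> a, b) \<ominus>\<^bsub>F\<^esub> c \<odot>\<^bsub>F\<^esub> bv (a, b) \<in> I"
    by (rule relation_mem) (use assms in \<open>unfold bilinear_relations_def Let_def, blast\<close>)
  then show "pure (c \<odot>\<^bsub>A\<^esub> a) b = c \<odot>\<^bsub>TP\<^esub> pure a b"
    unfolding pure_def using assms by (simp add: S cls_eqI)
  have "bv (a, c \<odot>\<^bsub>B\<^esub> b) \<ominus>\<^bsub>F\<^esub> c \<odot>\<^bsub>F\<^esub> bv (a, b) \<in> I"
    by (rule relation_mem) (use assms in \<open>unfold bilinear_relations_def Let_def, blast\<close>)
  then show "pure a (c \<odot>\<^bsub>B\<^esub> b) = c \<odot>\<^bsub>TP\<^esub> pure a b"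
    unfolding pure_def using assms by (simp add: S cls_eqI)
qed

text \<open>Scalars are absorbed into the first factor, so every class is a sum of pure
  tensors.\<close>

lemma TP_induct:
  assumes X: "X \<in> carrier TP" and pure: "\<And>a b. a \<in> carrier A \<Longrightarrow> b \<in> carrier B \<Longrightarrow> P (pure a b)"
    and add: "\<And>X Y. \<lbrakk>X \<in> carrier TP; Y \<in> carrier TP; P X; P Y\<rbrakk> \<Longrightarrow> P (X \<oplus>\<^bsub>TP\<^esub> Y)"
  shows "P X"
proof -
  interpret TP: k_alg K TP by (rule k_alg.intro[OF TP_k_algebra])
  obtain f where f: "f \<in> carrier FM" "X = cls f" using X by (auto simp: TP_carrier F_simps)
  have "P (cls f)" using K_ring f(1)
  proof (rule free_module_induct)
    \<comment> \<open>The zero class is itself a pure tensor, so the empty sum needs no case of its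
      own.\<close>
    have "pure (\<zero>\<^bsub>K\<^esub> \<odot>\<^bsub>A\<^esub> \<zero>\<^bsub>A\<^esub>) \<zero>\<^bsub>B\<^esub> = \<zero>\<^bsub>K\<^esub> \<odot>\<^bsub>TP\<^esub> pure \<zero>\<^bsub>A\<^esub> \<zero>\<^bsub>B\<^esub>"
      by (rule pure_bilinear(3)[of _ "\<zero>\<^bsub>A\<^esub>" _ "\<zero>\<^bsub>B\<^esub>"]) simp_all
    also have "\<dots> = cls \<zero>\<^bsub>F\<^esub>" using pure_closed by (simp add: TP_zero)
    finally have "P (cls \<zero>\<^bsub>F\<^esub>)" using pure[of "\<zero>\<^bsub>K\<^esub> \<odot>\<^bsub>A\<^esub> \<zero>\<^bsub>A\<^esub>" "\<zero>\<^bsub>B\<^esub>"] by simp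
    then show "P (cls (\<lambda>i. \<zero>\<^bsub>K\<^esub>))" by (simp add: F_simps free_module_simps)
  next
    fix p c g assume p: "p \<in> M" and c: "c \<in> carrier K" and g: "g \<in> carrier FM" "P (cls g)"
    obtain a b where ab: "p = (a, b)" "a \<in> carrier A" "b \<in> carrier B" using p by auto
    have gF: "g \<in> carrier F" using g by (simp add: F_simps)
    have "cls (c \<odot>\<^bsub>F\<^esub> bv p \<oplus>\<^bsub>F\<^esub> g) = pure (c \<odot>\<^bsub>A\<^esub> a) b \<oplus>\<^bsub>TP\<^esub> cls g"
      using ab c gF p bv_closed F.smult_closed pure_bilinear(3)[OF ab(2) ab(2) ab(3) ab(3) c]
      by (simp add: pure_def cls_smult cls_add)
    then have "P (cls (c \<odot>\<^bsub>F\<^esub> bv p \<oplus>\<^bsub>F\<^esub> g))"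
      using add pure pure_closed cls_closed gF g(2) ab c by simp
    then show "P (cls (c \<odot>\<^bsub>FM\<^esub> bv p \<oplus>\<^bsub>FM\<^esub> g))" by (simp add: F_simps)
  qed
  then show ?thesis using f by simp
qed

text \<open>A bilinear map has one value on all representatives, so the image of a coset is a
  singleton; \<open>the_elem\<close> agrees with the way the action on
  \<open>enveloping_self\<close> is written.\<close>

definition tlift :: "('k, 'v) module \<Rightarrow> ('a \<times> 'b \<Rightarrow> 'v) \<Rightarrow> ('a \<times> 'b \<Rightarrow> 'k) set \<Rightarrow> 'v"
  where "tlift V \<beta> X = the_elem (lin K V \<beta> ` X)"

lemma tlift_cls:
  assumes V: "left_module K V" and \<beta>: "bilinear V \<beta>" and f: "f \<in> carrier F"
  shows "tlift V \<beta> (cls f) = lin K V \<beta> f"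
proof -
  interpret V: left_module K V by (rule V)
  have const: "lin K V \<beta> x = lin K V \<beta> f" if x: "x \<in> cls f" for x
  proof -
    obtain i where i: "i \<in> I" "x = i \<oplus>\<^bsub>F\<^esub> f" using x by (auto simp: a_r_coset_def r_coset_def)
    have ic: "i \<in> carrier F" using i(1) I.a_Hcarr by blast
    show ?thesis using lin_FD(2)[OF V \<beta> ic f] lin_I[OF V \<beta> i(1)] lin_FD(1)[OF V \<beta> f] i(2) by simp
  qed
  have "lin K V \<beta> ` cls f = (\<lambda>_. lin K V \<beta> f) ` cls f" by (rule image_cong[OF refl const])
  also have "\<dots> = {lin K V \<beta> f}" by (rule image_constant[OF I.a_rcos_self[OF f]])
  finally have "lin K V \<beta> ` cls f = {lin K V \<beta> f}" .
  then show ?thesis by (simp add: tlift_def)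
qed

lemma tlift:
  assumes V: "left_module K V" and \<beta>: "bilinear V \<beta>"
  shows "X \<in> carrier TP \<Longrightarrow> tlift V \<beta> X \<in> carrier V"
    and "X \<in> carrier TP \<Longrightarrow> Y \<in> carrier TP \<Longrightarrow> tlift V \<beta> (X \<oplus>\<^bsub>TP\<^esub> Y) = tlift V \<beta> X \<oplus>\<^bsub>V\<^esub> tlift V \<beta> Y"
    and "a \<in> carrier A \<Longrightarrow> b \<in> carrier B \<Longrightarrow> tlift V \<beta> (pure a b) = \<beta> (a, b)"
proof -
  note D = lin_FD[OF V \<beta>] tlift_cls[OF V \<beta>]
  show "X \<in> carrier TP \<Longrightarrow> tlift V \<beta> X \<in> carrier V" using D by (auto simp: TP_carrier)
  show "X \<in> carrier TP \<Longrightarrow> Y \<in> carrier TP \<Longrightarrow> tlift V \<beta> (X \<oplus>\<^bsub>TP\<^esub> Y) = tlift V \<beta> X \<oplus>\<^bsub>V\<^esub> tlift V \<beta> Y"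
    using D by (auto simp: TP_carrier cls_add)
  show "a \<in> carrier A \<Longrightarrow> b \<in> carrier B \<Longrightarrow> tlift V \<beta> (pure a b) = \<beta> (a, b)"
    using D lin_F(2)[OF V \<beta>, of "(a, b)"] bv_closed by (simp add: pure_def)
qed

end

lemma opposite_algebra_simps [simp]:
  "carrier (opposite_algebra A) = carrier A" "zero (opposite_algebra A) = \<zero>\<^bsub>A\<^esub>" "one (opposite_algebra A) = \<one>\<^bsub>A\<^esub>"
  "add (opposite_algebra A) = add A" "smult (opposite_algebra A) = smult A"
  "x \<otimes>\<^bsub>opposite_algebra A\<^esub> y = y \<otimes>\<^bsub>A\<^esub> x"
  by (simp_all add: opposite_algebra_def)

lemma opposite_k_algebra:
  assumes "k_algebra K A"
  shows "k_algebra K (opposite_algebra A)"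
proof -
  interpret A: k_alg K A by (rule k_alg.intro[OF assms])
  have ag: "abelian_group (opposite_algebra A)"
    by (rule abelian_group_cong[OF _ _ _ A.E.is_abelian_group]) simp_all
  have mon: "Group.monoid (opposite_algebra A)" by (rule monoidI) (simp_all add: A.E.m_assoc)
  have "ring (opposite_algebra A)"
    by (rule ringI[OF ag mon]) (simp_all add: A.E.l_distr A.E.r_distr)
  moreover have "module K (opposite_algebra A)"
    by (rule moduleI[OF A.K.is_cring ag])
      (simp_all add: A.EM.smult_l_distr A.EM.smult_r_distr A.EM.smult_assoc1)
  ultimately show ?thesis
    using assms A.smult_mult by (simp add: k_algebra_def)
qed

section \<open>The enveloping algebra and its action on the algebra\<close>

locale env_algebra = k_alg K A for K :: "('k, 'x) ring_scheme" and A :: "('k, 'a) module"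
begin

sublocale tensor K A "opposite_algebra A"
  by (intro tensor.intro k_alg.intro k_algebra opposite_k_algebra)

abbreviation "Env \<equiv> enveloping_algebra K A"
abbreviation "Self \<equiv> enveloping_self K A"

lemma Env_eq: "Env = TP"
  by (simp add: enveloping_algebra_def)

lemma A_left_module: "left_module K A"
  by (rule module_left_module) (rule EM.module_axioms)

text \<open>Seen as the lift of the bilinear map sending \<open>(a, a')\<close> to
  \<open>a b a'\<close>, the action inherits independence of representatives and additivity from
  \<open>tlift\<close>.\<close>

lemma Self_simps:
  "carrier Self = carrier A" "add Self = add A" "\<zero>\<^bsub>Self\<^esub> = \<zero>\<^bsub>A\<^esub>"
  "X \<odot>\<^bsub>Self\<^esub> b = tlift A (\<lambda>p. fst p \<otimes>\<^bsub>A\<^esub> b \<otimes>\<^bsub>A\<^esub> snd p) X"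
  by (simp_all add: enveloping_self_def tlift_def lin_def)

lemma act_bilinear: "b \<in> carrier A \<Longrightarrow> bilinear A (\<lambda>p. fst p \<otimes>\<^bsub>A\<^esub> b \<otimes>\<^bsub>A\<^esub> snd p)"
  by (simp add: bilinear_def E.l_distr E.r_distr smult_mult)

lemmas act = tlift[OF A_left_module act_bilinear, folded Self_simps(4)]

text \<open>Distributivity over sums in the algebra and associativity are additive in elements of
  the enveloping algebra and so are checked on pure tensors, for associativity in the left factor
  first and then in the right one.\<close>

lemma Self_left_module: "left_module Env Self"
proof -
  interpret TP: k_alg K TP by (rule k_alg.intro[OF TP_k_algebra])
  have ag: "abelian_group Self" by (rule abelian_group_cong[OF _ _ _ E.is_abelian_group]) (simp_all add: Self_simps)
  have plus: "x \<oplus>\<^bsub>Self\<^esub> y = x \<oplus>\<^bsub>A\<^esub> y" for x y by (simp add: Self_simps)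
  have r_distr: "X \<odot>\<^bsub>Self\<^esub> (x \<oplus>\<^bsub>A\<^esub> y) = X \<odot>\<^bsub>Self\<^esub> x \<oplus>\<^bsub>A\<^esub> X \<odot>\<^bsub>Self\<^esub> y"
    if "X \<in> carrier TP" and xy: "x \<in> carrier A" "y \<in> carrier A" for X x y
    using that(1)
    by (rule TP_induct) (use xy in \<open>simp_all add: act E.l_distr E.r_distr E.add.m_ac\<close>)
  have assoc: "(X \<otimes>\<^bsub>TP\<^esub> Y) \<odot>\<^bsub>Self\<^esub> x = X \<odot>\<^bsub>Self\<^esub> (Y \<odot>\<^bsub>Self\<^esub> x)"
    if X: "X \<in> carrier TP" and Y: "Y \<in> carrier TP" and x: "x \<in> carrier A" for X Y x
    using X
  proof (rule TP_induct)
    fix a b assume "a \<in> carrier A" "b \<in> carrier (opposite_algebra A)"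
    then have ab: "a \<in> carrier A" "b \<in> carrier A" by simp_all
    then have p: "pure a b \<in> carrier TP" using pure_closed by simp
    show "(pure a b \<otimes>\<^bsub>TP\<^esub> Y) \<odot>\<^bsub>Self\<^esub> x = pure a b \<odot>\<^bsub>Self\<^esub> (Y \<odot>\<^bsub>Self\<^esub> x)"
      using Y
    proof (rule TP_induct)
      fix a' b' assume "a' \<in> carrier A" "b' \<in> carrier (opposite_algebra A)"
      then show "(pure a b \<otimes>\<^bsub>TP\<^esub> pure a' b') \<odot>\<^bsub>Self\<^esub> x = pure a b \<odot>\<^bsub>Self\<^esub> (pure a' b' \<odot>\<^bsub>Self\<^esub> x)"
        using ab x by (simp add: pure_mult act E.m_assoc)
    next
      fix Y Y' assume "Y \<in> carrier TP" "Y' \<in> carrier TP"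
        "(pure a b \<otimes>\<^bsub>TP\<^esub> Y) \<odot>\<^bsub>Self\<^esub> x = pure a b \<odot>\<^bsub>Self\<^esub> (Y \<odot>\<^bsub>Self\<^esub> x)"
        "(pure a b \<otimes>\<^bsub>TP\<^esub> Y') \<odot>\<^bsub>Self\<^esub> x = pure a b \<odot>\<^bsub>Self\<^esub> (Y' \<odot>\<^bsub>Self\<^esub> x)"
      then show "(pure a b \<otimes>\<^bsub>TP\<^esub> (Y \<oplus>\<^bsub>TP\<^esub> Y')) \<odot>\<^bsub>Self\<^esub> x = pure a b \<odot>\<^bsub>Self\<^esub> ((Y \<oplus>\<^bsub>TP\<^esub> Y') \<odot>\<^bsub>Self\<^esub> x)"
        using p x r_distr[OF p] act(1,2)[OF x] by (simp add: TP.E.r_distr)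
    qed
  next
    fix X X' assume "X \<in> carrier TP" "X' \<in> carrier TP"
      "(X \<otimes>\<^bsub>TP\<^esub> Y) \<odot>\<^bsub>Self\<^esub> x = X \<odot>\<^bsub>Self\<^esub> (Y \<odot>\<^bsub>Self\<^esub> x)" "(X' \<otimes>\<^bsub>TP\<^esub> Y) \<odot>\<^bsub>Self\<^esub> x = X' \<odot>\<^bsub>Self\<^esub> (Y \<odot>\<^bsub>Self\<^esub> x)"
    then show "((X \<oplus>\<^bsub>TP\<^esub> X') \<otimes>\<^bsub>TP\<^esub> Y) \<odot>\<^bsub>Self\<^esub> x = (X \<oplus>\<^bsub>TP\<^esub> X') \<odot>\<^bsub>Self\<^esub> (Y \<odot>\<^bsub>Self\<^esub> x)"
      using Y x act(1,2)[OF x] act(1,2)[OF act(1)[OF x Y]] by (simp add: TP.E.l_distr)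
  qed
  have one: "\<one>\<^bsub>TP\<^esub> \<odot>\<^bsub>Self\<^esub> x = x" if "x \<in> carrier A" for x
    using act(3)[OF that, of "\<one>\<^bsub>A\<^esub>" "\<one>\<^bsub>A\<^esub>"] that pure_one by simp
  have "left_module TP Self"
    by (intro left_module.intro left_module_axioms.intro TP.E.ring_axioms ag)
      (simp_all add: Self_simps(1) plus act(1,2) r_distr assoc one)
  then show ?thesis by (simp add: Env_eq)
qed

text \<open>Connects the coset model with the interface on which the Casimir calculations rest; the
  Frobenius form enters through the contraction \<open>\<tau>\<close> and the dual bases.\<close>

lemma enveloping_exists:
  assumes form: "frobenius_form K A \<nu> t" and fg: "fin_gen K A"
  shows "\<exists>L R \<tau> e e' r. enveloping K A \<nu> t Env L R \<tau> Self e e' r"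
proof -
  interpret fr: frobenius_form K A \<nu> t by (rule form)
  interpret TP: k_alg K TP by (rule k_alg.intro[OF TP_k_algebra])
  obtain r :: nat and e e' where e: "\<forall>i<r. e i \<in> carrier A \<and> e' i \<in> carrier A"
    "\<forall>x\<in>carrier A. x = finsum A (\<lambda>i. t (e' i \<otimes>\<^bsub>A\<^esub> x) \<odot>\<^bsub>A\<^esub> e i) {..<r}"
    "\<forall>x\<in>carrier A. x = finsum A (\<lambda>i. t (x \<otimes>\<^bsub>A\<^esub> e i) \<odot>\<^bsub>A\<^esub> e' i) {..<r}"
    using fr.dual_bases[OF fg] by (elim exE conjE) (rule that)
  define L where "L a = pure a \<one>\<^bsub>A\<^esub>" for a
  define R where "R b = pure \<one>\<^bsub>A\<^esub> b" for b
  define \<tau> where "\<tau> = tlift A (\<lambda>p. t (fst p) \<odot>\<^bsub>A\<^esub> snd p)"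
  have bil: "bilinear A (\<lambda>p. t (fst p) \<odot>\<^bsub>A\<^esub> snd p)"
    using fr.tD by (simp add: bilinear_def EM.smult_l_distr EM.smult_r_distr EM.smult_assoc1 K.m_comm flip: EM.smult_assoc1)
  note \<tau> = tlift[OF A_left_module bil, folded \<tau>_def]
  have pc: "a \<in> carrier A \<Longrightarrow> b \<in> carrier A \<Longrightarrow> pure a b \<in> carrier TP" for a b using pure_closed by simp
  have pm: "\<lbrakk>a \<in> carrier A; b \<in> carrier A; a' \<in> carrier A; b' \<in> carrier A\<rbrakk> \<Longrightarrow>
    pure a b \<otimes>\<^bsub>TP\<^esub> pure a' b' = pure (a \<otimes>\<^bsub>A\<^esub> a') (b' \<otimes>\<^bsub>A\<^esub> b)" for a b a' b'
    using pure_mult[of a b a' b'] by simp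
  have LR: "a \<in> carrier A \<Longrightarrow> b \<in> carrier A \<Longrightarrow> L a \<otimes>\<^bsub>TP\<^esub> R b = pure a b" for a b
    by (simp add: L_def R_def pm)
  have "enveloping K A \<nu> t TP L R \<tau> Self e e' r"
  proof (intro enveloping.intro form k_alg.intro TP_k_algebra enveloping_axioms.intro)
    fix u P assume u: "u \<in> carrier TP" and pr: "\<And>a b. a \<in> carrier A \<Longrightarrow> b \<in> carrier A \<Longrightarrow> P (L a \<otimes>\<^bsub>TP\<^esub> R b)"
      and ad: "\<And>u v. \<lbrakk>u \<in> carrier TP; v \<in> carrier TP; P u; P v\<rbrakk> \<Longrightarrow> P (u \<oplus>\<^bsub>TP\<^esub> v)"
    from u show "P u" by (rule TP_induct) (use pr ad LR in auto)
  next
    show "left_module TP Self" using Self_left_module by (simp add: Env_eq)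
  next
    fix x assume "x \<in> carrier A"
    then show "x = finsum A (\<lambda>i. t (e' i \<otimes>\<^bsub>A\<^esub> x) \<odot>\<^bsub>A\<^esub> e i) {..<r}"
      "x = finsum A (\<lambda>i. t (x \<otimes>\<^bsub>A\<^esub> e i) \<odot>\<^bsub>A\<^esub> e' i) {..<r}" using e(2,3) by blast+
  next
    fix a b assume ab: "a \<in> carrier A" "b \<in> carrier A"
    show "L (a \<oplus>\<^bsub>A\<^esub> b) = L a \<oplus>\<^bsub>TP\<^esub> L b" unfolding L_def
      by (rule pure_bilinear(1)[of _ _ _ "\<one>\<^bsub>A\<^esub>" "\<zero>\<^bsub>K\<^esub>"]) (use ab in simp_all)
    show "R (a \<oplus>\<^bsub>A\<^esub> b) = R a \<oplus>\<^bsub>TP\<^esub> R b" unfolding R_def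
      using pure_bilinear(2)[of "\<one>\<^bsub>A\<^esub>" "\<one>\<^bsub>A\<^esub>" a b "\<zero>\<^bsub>K\<^esub>"] ab by simp
  next
    fix c a assume ca: "c \<in> carrier K" "a \<in> carrier A"
    show "L (c \<odot>\<^bsub>A\<^esub> a) = c \<odot>\<^bsub>TP\<^esub> L a" unfolding L_def
      by (rule pure_bilinear(3)[of _ a _ "\<one>\<^bsub>A\<^esub>"]) (use ca in simp_all)
    show "R (c \<odot>\<^bsub>A\<^esub> a) = c \<odot>\<^bsub>TP\<^esub> R a" unfolding R_def
      using pure_bilinear(4)[of "\<one>\<^bsub>A\<^esub>" "\<one>\<^bsub>A\<^esub>" a a c] ca by simp
  next
    fix a x assume ax: "a \<in> carrier A" "x \<in> carrier A"
    show "L a \<odot>\<^bsub>Self\<^esub> x = a \<otimes>\<^bsub>A\<^esub> x" "R a \<odot>\<^bsub>Self\<^esub> x = x \<otimes>\<^bsub>A\<^esub> a"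
      using ax act(3)[OF ax(2)] by (simp_all add: L_def R_def)
  next
    fix a b assume ab: "a \<in> carrier A" "b \<in> carrier A"
    then show "\<tau> (L a \<otimes>\<^bsub>TP\<^esub> R b) = t a \<odot>\<^bsub>A\<^esub> b" using \<tau>(3)[of a b] LR by simp
    show "L (a \<otimes>\<^bsub>A\<^esub> b) = L a \<otimes>\<^bsub>TP\<^esub> L b" "R (a \<otimes>\<^bsub>A\<^esub> b) = R b \<otimes>\<^bsub>TP\<^esub> R a" "R b \<otimes>\<^bsub>TP\<^esub> L a = L a \<otimes>\<^bsub>TP\<^esub> R b"
      using ab by (simp_all add: L_def R_def pm)
    show "L a \<in> carrier TP" "R a \<in> carrier TP" using ab pc by (simp_all add: L_def R_def)
  qed (use e(1) \<tau>(1,2) pure_one in \<open>simp_all add: L_def R_def Self_simps\<close>)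
  then show ?thesis unfolding Env_eq by (intro exI)
qed

end

theorem corollary3p8:
  fixes K :: "('k, 'x) ring_scheme"
    and A :: "('k, 'a) module"
    and \<nu> :: "'a \<Rightarrow> 'a"
    and T :: "int \<Rightarrow> (('a \<times> 'a \<Rightarrow> 'k) set, 'm) module"
    and d :: "int \<Rightarrow> 'm \<Rightarrow> 'm"
  assumes "field K"
    and "frobenius_algebra K A"
    and "nakayama_automorphism K A \<nu>"
    and "\<forall>x\<in>carrier A. \<nu> (\<nu> x) = x"
    and "complete_resolution (enveloping_algebra K A) (enveloping_self K A) T d"
  shows "\<forall>n::int. \<exists>h. h \<in> mod_iso K
    (tate_hochschild K A T d (enveloping_self K A) n)
    (tate_hochschild K A T d (enveloping_self K A) (- (n + 1)))"
proof -
  have A: "k_algebra K A" and fgA: "fin_gen K A" using assms(2) by (simp_all add: frobenius_algebra_def)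
  interpret env_algebra K A by (intro env_algebra.intro k_alg.intro A)
  obtain t where t: "frobenius_form K A \<nu> t" using nakayama_frobenius_form[OF A assms(3,4)] by blast
  obtain L R \<tau> e e' r where env: "enveloping K A \<nu> t Env L R \<tau> Self e e' r"
    using enveloping_exists[OF t fgA] by blast
  interpret env: enveloping K A \<nu> t Env L R \<tau> Self e e' r by (rule env)
  have cpx: "chain_complex Env T d" and ex: "\<And>n. exact_at T d n" and fgT: "\<And>n. fin_gen Env (T n)"
    and pT: "\<And>n. projective_module Env (T n)"
    and hT: "\<And>n. hom_cocycles Env T d (regular_module Env) n = hom_coboundaries Env T d (regular_module Env) n"
    using assms(5) by (simp_all add: complete_resolution_def)
  interpret C: acyclic_complex K Env T d
    by (intro acyclic_complex.intro acyclic_complex_axioms.intro k_alg.intro env.k_algebra cpx ex fgT pT hT)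
  obtain P :: "int \<Rightarrow> (('a \<times> 'a \<Rightarrow> 'k) set, 'm) module" and \<delta> f where
    P: "projective_resolution Env Self P \<delta>" "chain_map Env T d P \<delta> f" "\<And>n. n \<ge> 0 \<Longrightarrow> bij_betw (f n) (carrier (T n)) (carrier (P n))"
    using assms(5) by (auto simp: complete_resolution_def)
  obtain \<epsilon> where \<epsilon>: "\<epsilon> \<in> mod_hom Env (P 0) Self" "\<epsilon> ` carrier (P 0) = carrier Self"
    "{x \<in> carrier (P 0). \<epsilon> x = \<zero>\<^bsub>Self\<^esub>} = \<delta> 1 ` carrier (P 1)"
    using P(1) unfolding projective_resolution_def by (elim conjE bexE) (rule that)
  have f: "f n \<in> mod_hom Env (T n) (P n)" "\<And>x. x \<in> carrier (T n) \<Longrightarrow> \<delta> n (f n x) = f (n - 1) (d n x)" for n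
    using P(2) by (simp_all add: chain_map_def)
  \<comment> \<open>The augmentation of the projective resolution is transported to
    \<open>T\<close>. Bijectivity of \<open>f\<close> in degrees 0 and 1 identifies the two
    presentations of the algebra as a cokernel.\<close>
  let ?\<epsilon> = "compose (carrier (T 0)) \<epsilon> (f 0)"
  note b0 = P(3)[of 0, simplified] and b1 = P(3)[of 1, simplified]
  have ker: "{x \<in> carrier (T 0). ?\<epsilon> x = \<zero>\<^bsub>Self\<^esub>} = d 1 ` carrier (T 1)"
  proof -
    have d1: "y \<in> carrier (T 1) \<Longrightarrow> d 1 y \<in> carrier (T 0)" for y using mod_homD(1)[OF C.d[of 1]] by simp
    have "?\<epsilon> x = \<zero>\<^bsub>Self\<^esub> \<longleftrightarrow> x \<in> d 1 ` carrier (T 1)" if x: "x \<in> carrier (T 0)" for x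
    proof -
      have "?\<epsilon> x = \<zero>\<^bsub>Self\<^esub> \<longleftrightarrow> f 0 x \<in> \<delta> 1 ` carrier (P 1)"
        using x \<epsilon>(3) mod_homD(1)[OF f(1) x] by (auto simp: compose_eq)
      also have "\<delta> 1 ` carrier (P 1) = \<delta> 1 ` f 1 ` carrier (T 1)" using b1 by (simp add: bij_betw_def)
      also have "\<dots> = f 0 ` d 1 ` carrier (T 1)" unfolding image_image
        by (rule image_cong[OF refl]) (use f(2)[of _ 1] in simp)
      also have "f 0 x \<in> f 0 ` d 1 ` carrier (T 1) \<longleftrightarrow> x \<in> d 1 ` carrier (T 1)"
        by (rule inj_on_image_mem_iff[OF bij_betw_imp_inj_on[OF b0] x]) (use d1 in auto)
      finally show ?thesis .
    qed
    then show ?thesis using d1 by blast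
  qed
  have surj: "?\<epsilon> ` carrier (T 0) = carrier Self"
  proof -
    have "?\<epsilon> ` carrier (T 0) = \<epsilon> ` f 0 ` carrier (T 0)" by (simp add: compose_def image_image)
    then show ?thesis using b0 \<epsilon>(2) by (simp add: bij_betw_def)
  qed
  have "augmented_complex K Env T d Self ?\<epsilon> \<one>\<^bsub>A\<^esub>"
  proof (intro augmented_complex.intro augmented_complex_axioms.intro C.acyclic_complex_axioms
      env.B_module mod_hom_compose[OF f(1) \<epsilon>(1) C.T] surj ker)
    show "\<one>\<^bsub>A\<^esub> \<in> carrier Self" by (simp add: Self_simps)
    \<comment> \<open>The algebra is cyclic over its enveloping algebra: b is the result of b tensor
      1 acting on 1.\<close>
    show "\<exists>x\<in>carrier Env. b = x \<odot>\<^bsub>Self\<^esub> \<one>\<^bsub>A\<^esub>" if "b \<in> carrier Self" for b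
      using that env.B_L[of b "\<one>\<^bsub>A\<^esub>"] env.L_closed[of b] by (auto simp: Self_simps(1) intro!: bexI[of _ "L b"])
  qed
  then interpret X: enveloping_complex K A \<nu> t Env L R \<tau> Self e e' r T d ?\<epsilon>
    by (intro enveloping_complex.intro env)
  show ?thesis using X.cohomology_mod_iso by (simp add: tate_hochschild_def)
qed

end
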